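(* Let $\bar\delta>0$, $\bar\nu\in i\mathbb{R}\setminus\{0\}$, and let $U(\cdot\,;k,M,p)$, $c(k,M,p)$ be the three-parameter family of Korteweg-de Vries periodic waves described in the context. Fix $(k_\star,M_\star,p_\star)$ with $\langle(U_\star')^2\rangle=k_\star^2\langle(U_\star'')^2\rangle$ (subscript $\star$ = evaluation there). Let $U^\delta_\star=U_\star+\delta\tilde U_{1,\star}+\delta^2\tilde U_{2,\star}+O(\delta^3)$ and $c^\delta_\star=c_\star+\delta^2\tilde c_{2,\star}+O(\delta^3)$ be the associated $1$-periodic travelling wave of the generalized Kuramoto-Sivashinsky equation, as described in the context. Consider, with $\nu=\varepsilon\bar\nu$ and $\varepsilon\to0$, eigenvalues $\lambda$ and $1$-periodic eigenfunctions $\hat u$ of $$\lambda\hat u+k_\star(\tfrac{d}{dx}+\nu)\big((6U^{\varepsilon\bar\delta}_\star-c^{\varepsilon\bar\delta}_\star)\hat u\big)+k_\star^3(\tfrac{d}{dx}+\nu)^3\hat u+\varepsilon\bar\delta\Big(k_\star^2(\tfrac{d}{dx}+\nu)^2\hat u+k_\star^4(\tfrac{d}{dx}+\nu)^4\hat u\Big)=0$$ that expand as $\lambda=\varepsilon\bar\nu\lambda_0+(\varepsilon\bar\nu)^2\lambda_1+O(\varepsilon^3)$ and $\hat u=\hat u_0+\varepsilon\hat u_1+\varepsilon^2\hat u_2+O(\varepsilon^3)$, and set $\tilde\lambda_0=\lambda_0/k_\star$. Then $\hat u_0=k_1U_\star'$ for some constant $k_1$. With $M_1=\langle\hat u_1\rangle$,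 there are constants $p_1,k_2$ such that $$\hat u_1=\bar\nu k_\star\,\mathrm{d}U_\star(k_1,M_1,p_1)+k_1\bar\delta\,\tilde U_{1,\star}'+k_2U_\star'$$ and $$\tilde\lambda_0k_1+k_\star\,\mathrm{d}c_\star(k_1,M_1,p_1)=0,\qquad(\tilde\lambda_0-c_\star)M_1+\mathrm{d}\langle3U^2\rangle_\star(k_1,M_1,p_1)=0,$$ $$\begin{aligned}0=\ &\bar\nu k_\star\Big[(\tilde\lambda_0-c_\star)\,\mathrm{d}\big\langle\tfrac12U^2\big\rangle_\star+\mathrm{d}\big\langle2U^3-\tfrac32k^2(U')^2\big\rangle_\star\Big](k_1,M_1,p_1)\\&-\bar\delta\ \mathrm{d}\big\langle k^2(U')^2-k^4(U'')^2\big\rangle_\star(k_1,M_1,p_1)\\&-6k_\star\bar\delta\,\big\langle\tilde U_{1,\star}U_\star'\,\mathrm{d}U_\star(k_1,M_1,p_1)\big\rangle\\&+k_1\bar\delta\Big((\tilde\lambda_0-c_\star)\langle\tilde U_{1,\star}'U_\star\rangle-\big\langle(3k_\star^2\tilde U_{1,\star}''+6\tilde U_{1,\star}U_\star)U_\star'\big\rangle\Big).\end{aligned}$$ These three relations form a full spectral problem for the eigenvalue $\tilde\lambda_0$ and eigenvector $(k_1,M_1,p_1)$, so that $\tilde\lambda_0$ must satisfy a dispersion relation $E(\tilde\lambda_0)=0$ with $E$ a polynomial of degree $3$. Moreover, searching, in the co-moving frame of speed $c_\star$, for plane-wave solutions (proportional to $e^{\bar\nu k_\star(X-c_\star T+\tilde\lambda_0T)}$)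 of the following linear system leads exactly to this spectral problem: $$\partial_Tk_1+\mathrm{d}[kc]_\star\,\partial_X(k_1,M_1,p_1)=0,\qquad\partial_TM_1+\mathrm{d}\langle3U^2\rangle_\star\,\partial_X(k_1,M_1,p_1)=0,$$ $$\begin{aligned}0=\ &\mathrm{d}\big\langle\tfrac12U^2\big\rangle_\star\partial_T(k_1,M_1,p_1)+\mathrm{d}\big\langle2U^3-\tfrac32k^2(U')^2\big\rangle_\star\partial_X(k_1,M_1,p_1)\\&-\bar\delta\ \mathrm{d}\big\langle k^2(U')^2-k^4(U'')^2\big\rangle_\star(k_1,M_1,p_1)\\&-6\bar\delta\,\big\langle\tilde U_{1,\star}U_\star'\,\mathrm{d}[kU]_\star(k_1,M_1,p_1)\big\rangle\\&-3k_1\bar\delta k_\star^2\langle\tilde U_{1,\star}''U_\star'\rangle-\bar\delta\,\langle\tilde U_{1,\star}'U_\star\rangle\,\mathrm{d}[kc]_\star(k_1,M_1,p_1).\end{aligned}$$ This system governs the first corrections $(k_1,M_1,p_1)$ in the modulation expansion of $\partial_Tu+6u\,\partial_Xu+\varepsilon^2\partial_X^3u+\bar\delta(\varepsilon^2\partial_X^2u+\varepsilon^4\partial_X^4u)=0$ when the leading-order parameters are the constants $(k_\star,M_\star,p_\star)$.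
   Context: $\langle f\rangle=\int_0^1 f(y)\,dy$ for $1$-periodic $f$. Primes denote derivatives with respect to the periodic variable. The symbol $\mathrm{d}$ denotes the differential with respect to the parameters $(k,M,p)$, so $\mathrm{d}F_\star(a,b,e)=a\,\partial_kF_\star+b\,\partial_MF_\star+e\,\partial_pF_\star$. KdV family: for $k>0$, $M\in\mathbb{R}$, $p\in(0,1)$, $U(y;k,M,p)=M+\tilde U(y;k,p)$ and $c(k,M,p)=6M+\tilde c(k,p)$ with $$\tilde U(y;k,p)=8K(p)^2k^2\Big(\mathrm{dn}^2(2K(p)y)-\tfrac{E(p)}{K(p)}\Big),\qquad\tilde c(k,p)=16K(p)^2k^2\Big(2-p^2-3\tfrac{E(p)}{K(p)}\Big),$$ where $K(p),E(p)$ are the complete elliptic integrals of first and second kind and $\mathrm{dn}$ is Jacobi's delta function, all of modulus $p$ (this $E(p)$ is unrelated to the dispersion polynomial $E(\tilde\lambda_0)$). These satisfy $-kcU'+6kUU'+k^3U'''=0$ and $\langle U\rangle=M$. On $1$-periodic functions the operator $f\mapsto k_\star((6U_\star-c_\star)f)'+k_\star^3f'''$ is Fredholm of index $0$. Its kernel is spanned by $U_\star'$ and $1-6(\partial_pc_\star)^{-1}\partial_pU_\star$, and the kernel of its adjoint is spanned by $1$ and $U_\star$. Generalized Kuramoto-Sivashinsky profiles for small $\delta>0$: $U^\delta_\star$ is $1$-periodic with $\langle U^\delta_\star\rangle=M_\star$ and solves $-k_\star c^\delta_\star U'+6k_\star UU'+k_\star^3U'''+\delta(k_\star^2U''+k_\star^4U'''')=0$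 (travelling waves of $\partial_tu+6u\,\partial_xu+\partial_x^3u+\delta(\partial_x^2u+\partial_x^4u)=0$). It has the displayed expansions as $\delta\to0$, with $\tilde U_{1,\star}$ odd, $\tilde U_{2,\star}$ even, and, with $\tilde U_\star=U_\star-M_\star$ and $\tilde c_\star=c_\star-6M_\star$, $$k_\star^3\tilde U_{1,\star}'''+k_\star\big((6\tilde U_\star-\tilde c_\star)\tilde U_{1,\star}\big)'+k_\star^2\tilde U_\star''+k_\star^4\tilde U_\star''''=0,$$ $$k_\star^3\tilde U_{2,\star}'''+k_\star\big((6\tilde U_\star-\tilde c_\star)\tilde U_{2,\star}+3\tilde U_{1,\star}^2-\tilde c_{2,\star}\tilde U_\star\big)'+k_\star^2\tilde U_{1,\star}''+k_\star^4\tilde U_{1,\star}''''=0 .$$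
   Formalization: Two formulas are corrected: M_1 is ⟨û_1⟩/(ν̄k_⋆) in place of ⟨û_1⟩, and in the third relation and third modulation equation the term d⟨k²(U')²−k⁴(U'')²⟩ is replaced by d⟨k²U_⋆'U'−k⁴U_⋆''U''⟩ with U_⋆ held fixed under d. *)

theory Defs
  imports "HOL-Analysis.Analysis" "HOL-Computational_Algebra.Polynomial"
begin

section \<open>Calculus conventions\<close>

text \<open>Iterated derivatives are written \<open>(D ^^ n) f\<close>.\<close>

definition D :: "(real \<Rightarrow> 'a::real_normed_vector) \<Rightarrow> real \<Rightarrow> 'a" where
  "D f = (\<lambda>y. vector_derivative f (at y))"

primrec Ck :: "nat \<Rightarrow> ('a::real_normed_vector \<Rightarrow> 'b::real_normed_vector) \<Rightarrow> bool" where
  "Ck 0 f = continuous_on UNIV f"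
| "Ck (Suc n) f = ((\<forall>x. f differentiable (at x)) \<and>
     (\<forall>v. Ck n (\<lambda>x. frechet_derivative f (at x) v)))"

definition one_periodic :: "(real \<Rightarrow> 'a) \<Rightarrow> bool" where
  "one_periodic f \<longleftrightarrow> (\<forall>y. f (y + 1) = f y)"

definition avg :: "(real \<Rightarrow> 'a::real_normed_vector) \<Rightarrow> 'a" where
  "avg f = integral {0..1} f"

text \<open>The differential with respect to the parameters \<open>(k, M, p)\<close>, at the base point \<open>(k, M, p)\<close>
  and applied to \<open>(a, b, e)\<close>.  The direction may be real or complex.\<close>

definition dpar :: "(real \<Rightarrow> real \<Rightarrow> real \<Rightarrow> real) \<Rightarrow> real \<Rightarrow> real \<Rightarrow> real \<Rightarrow>
    'a \<Rightarrow> 'a \<Rightarrow> 'a \<Rightarrow> 'a::real_normed_vector" where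
  "dpar F k M p a b e =
     deriv (\<lambda>s. F s M p) k *\<^sub>R a + deriv (\<lambda>s. F k s p) M *\<^sub>R b + deriv (\<lambda>s. F k M s) p *\<^sub>R e"

section \<open>Elliptic functions of modulus \<open>p\<close> and the KdV periodic waves\<close>

definition ellF :: "real \<Rightarrow> real \<Rightarrow> real" where
  "ellF \<phi> p = (if 0 \<le> \<phi> then integral {0..\<phi>} (\<lambda>t. 1 / sqrt (1 - p\<^sup>2 * (sin t)\<^sup>2))
               else - integral {\<phi>..0} (\<lambda>t. 1 / sqrt (1 - p\<^sup>2 * (sin t)\<^sup>2)))"

definition ellK :: "real \<Rightarrow> real" where
  "ellK p = ellF (pi / 2) p"

definition ellE :: "real \<Rightarrow> real" where
  "ellE p = integral {0..pi / 2} (\<lambda>t. sqrt (1 - p\<^sup>2 * (sin t)\<^sup>2))"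

text \<open>Jacobi's amplitude inverts the incomplete integral of the first kind, a bijection of the
  real line for \<open>0 < p < 1\<close>.\<close>

definition jacobi_am :: "real \<Rightarrow> real \<Rightarrow> real" where
  "jacobi_am u p = (THE \<phi>. ellF \<phi> p = u)"

definition jacobi_dn :: "real \<Rightarrow> real \<Rightarrow> real" where
  "jacobi_dn u p = sqrt (1 - p\<^sup>2 * (sin (jacobi_am u p))\<^sup>2)"

definition kdv_Ut :: "real \<Rightarrow> real \<Rightarrow> real \<Rightarrow> real" where
  "kdv_Ut k p y = 8 * (ellK p)\<^sup>2 * k\<^sup>2 * ((jacobi_dn (2 * ellK p * y) p)\<^sup>2 - ellE p / ellK p)"

definition kdv_ct :: "real \<Rightarrow> real \<Rightarrow> real" where
  "kdv_ct k p = 16 * (ellK p)\<^sup>2 * k\<^sup>2 * (2 - p\<^sup>2 - 3 * ellE p / ellK p)"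

definition kdv_U :: "real \<Rightarrow> real \<Rightarrow> real \<Rightarrow> real \<Rightarrow> real" where
  "kdv_U k M p y = M + kdv_Ut k p y"

definition kdv_c :: "real \<Rightarrow> real \<Rightarrow> real \<Rightarrow> real" where
  "kdv_c k M p = 6 * M + kdv_ct k p"

section \<open>Expansions and generalized Kuramoto-Sivashinsky profiles\<close>

text \<open>\<open>F \<epsilon> = f0 + \<epsilon> f1 + \<epsilon>\<^sup>2 f2 + O(\<epsilon>\<^sup>3)\<close> as \<open>\<epsilon> \<rightarrow> 0+\<close>: for functions in the norm
  of \<open>C\<^sup>4\<close> (four is the order of the equations), and for scalars.\<close>

definition expands_C4 :: "(real \<Rightarrow> real \<Rightarrow> 'a::real_normed_vector) \<Rightarrow>
    (real \<Rightarrow> 'a) \<Rightarrow> (real \<Rightarrow> 'a) \<Rightarrow> (real \<Rightarrow> 'a) \<Rightarrow> bool" where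
  "expands_C4 F f0 f1 f2 \<longleftrightarrow>
     (\<exists>C. \<forall>\<^sub>F \<epsilon> in at_right 0. \<forall>j\<le>4. \<forall>y.
        norm ((D ^^ j) (\<lambda>z. F \<epsilon> z - (f0 z + \<epsilon> *\<^sub>R f1 z + \<epsilon>\<^sup>2 *\<^sub>R f2 z)) y) \<le> C * \<epsilon> ^ 3)"

definition expands :: "(real \<Rightarrow> 'a::real_normed_vector) \<Rightarrow> 'a \<Rightarrow> 'a \<Rightarrow> 'a \<Rightarrow> bool" where
  "expands f a0 a1 a2 \<longleftrightarrow>
     (\<exists>C. \<forall>\<^sub>F \<epsilon> in at_right 0. norm (f \<epsilon> - (a0 + \<epsilon> *\<^sub>R a1 + \<epsilon>\<^sup>2 *\<^sub>R a2)) \<le> C * \<epsilon> ^ 3)"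

definition gks_profiles :: "real \<Rightarrow> real \<Rightarrow> real \<Rightarrow> (real \<Rightarrow> real \<Rightarrow> real) \<Rightarrow> (real \<Rightarrow> real) \<Rightarrow>
    (real \<Rightarrow> real) \<Rightarrow> (real \<Rightarrow> real) \<Rightarrow> real \<Rightarrow> bool" where
  "gks_profiles k M p Ud cd U1 U2 c2 \<longleftrightarrow>
     (\<forall>\<^sub>F \<delta> in at_right 0. Ck 4 (Ud \<delta>) \<and> one_periodic (Ud \<delta>) \<and> avg (Ud \<delta>) = M \<and>
        (\<forall>y. - k * cd \<delta> * D (Ud \<delta>) y + 6 * k * Ud \<delta> y * D (Ud \<delta>) y + k ^ 3 * (D ^^ 3) (Ud \<delta>) y
             + \<delta> * (k\<^sup>2 * (D ^^ 2) (Ud \<delta>) y + k ^ 4 * (D ^^ 4) (Ud \<delta>) y) = 0)) \<and>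
     expands_C4 Ud (kdv_U k M p) U1 U2 \<and>
     expands cd (kdv_c k M p) 0 c2 \<and>
     Ck 4 U1 \<and> one_periodic U1 \<and> (\<forall>y. U1 (- y) = - U1 y) \<and>
     Ck 4 U2 \<and> one_periodic U2 \<and> (\<forall>y. U2 (- y) = U2 y) \<and>
     (\<forall>y. k ^ 3 * (D ^^ 3) U1 y
          + k * D (\<lambda>z. (6 * kdv_Ut k p z - kdv_ct k p) * U1 z) y
          + k\<^sup>2 * (D ^^ 2) (kdv_Ut k p) y + k ^ 4 * (D ^^ 4) (kdv_Ut k p) y = 0) \<and>
     (\<forall>y. k ^ 3 * (D ^^ 3) U2 y
          + k * D (\<lambda>z. (6 * kdv_Ut k p z - kdv_ct k p) * U2 z + 3 * (U1 z)\<^sup>2 - c2 * kdv_Ut k p z) y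
          + k\<^sup>2 * (D ^^ 2) U1 y + k ^ 4 * (D ^^ 4) U1 y = 0)"

section \<open>The Bloch eigenvalue problem\<close>

definition D\<nu> :: "complex \<Rightarrow> (real \<Rightarrow> complex) \<Rightarrow> real \<Rightarrow> complex" where
  "D\<nu> \<nu> f = (\<lambda>x. D f x + \<nu> * f x)"

definition bloch_eigenpair :: "real \<Rightarrow> real \<Rightarrow> (real \<Rightarrow> real) \<Rightarrow> real \<Rightarrow> complex \<Rightarrow>
    complex \<Rightarrow> (real \<Rightarrow> complex) \<Rightarrow> bool" where
  "bloch_eigenpair k \<delta> V c \<nu> lam u \<longleftrightarrow>
     Ck 4 u \<and> one_periodic u \<and> (\<exists>x. u x \<noteq> 0) \<and>
     (\<forall>x. lam * u x
        + of_real k * D\<nu> \<nu> (\<lambda>z. of_real (6 * V z - c) * u z) x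
        + of_real (k ^ 3) * (D\<nu> \<nu> ^^ 3) u x
        + of_real \<delta> * (of_real (k\<^sup>2) * (D\<nu> \<nu> ^^ 2) u x + of_real (k ^ 4) * (D\<nu> \<nu> ^^ 4) u x) = 0)"

definition bloch_expansion :: "real \<Rightarrow> real \<Rightarrow> (real \<Rightarrow> real \<Rightarrow> real) \<Rightarrow> (real \<Rightarrow> real) \<Rightarrow> complex \<Rightarrow>
    complex \<Rightarrow> complex \<Rightarrow> (real \<Rightarrow> complex) \<Rightarrow> (real \<Rightarrow> complex) \<Rightarrow> (real \<Rightarrow> complex) \<Rightarrow> bool" where
  "bloch_expansion k \<delta>b Ud cd \<nu>b lam0 lam1 u0 u1 u2 \<longleftrightarrow>
     Ck 4 u0 \<and> Ck 4 u1 \<and> Ck 4 u2 \<and> one_periodic u0 \<and> one_periodic u1 \<and> one_periodic u2 \<and>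
     (\<exists>lam u. (\<forall>\<^sub>F \<epsilon> in at_right 0.
               bloch_eigenpair k (\<epsilon> * \<delta>b) (Ud (\<epsilon> * \<delta>b)) (cd (\<epsilon> * \<delta>b)) (of_real \<epsilon> * \<nu>b) (lam \<epsilon>) (u \<epsilon>)) \<and>
            expands lam 0 (\<nu>b * lam0) (\<nu>b\<^sup>2 * lam1) \<and>
            expands_C4 u u0 u1 u2)"

section \<open>Averaged quantities and the spectral problem\<close>

definition av_3U2 :: "real \<Rightarrow> real \<Rightarrow> real \<Rightarrow> real" where
  "av_3U2 k M p = avg (\<lambda>y. 3 * (kdv_U k M p y)\<^sup>2)"

definition av_half_U2 :: "real \<Rightarrow> real \<Rightarrow> real \<Rightarrow> real" where
  "av_half_U2 k M p = avg (\<lambda>y. (kdv_U k M p y)\<^sup>2 / 2)"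

definition av_flux :: "real \<Rightarrow> real \<Rightarrow> real \<Rightarrow> real" where
  "av_flux k M p = avg (\<lambda>y. 2 * (kdv_U k M p y) ^ 3 - 3 / 2 * k\<^sup>2 * (D (kdv_U k M p) y)\<^sup>2)"

text \<open>The dissipation \<open>\<langle>k\<^sup>2 (U')\<^sup>2 - k\<^sup>4 (U'')\<^sup>2\<rangle>\<close> with one of the two factors frozen at
  \<open>V\<close>.  It is to be differentiated with \<open>V\<close> fixed at the base wave, which gives
  \<open>- \<langle>V d[k\<^sup>2 U'' + k\<^sup>4 U'''']\<rangle>\<close>.  The full differential, of both factors, must not be used
  next to the terms in \<open>U1\<close> below: once the first relation holds, these terms sum to
  \<open>\<delta>b \<langle>(k\<^sup>2 V'' + k\<^sup>4 V'''') dU\<rangle>\<close>, which is exactly the contribution of the second factor.\<close>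

definition av_dissip :: "(real \<Rightarrow> real) \<Rightarrow> real \<Rightarrow> real \<Rightarrow> real \<Rightarrow> real" where
  "av_dissip V k M p =
     avg (\<lambda>y. k\<^sup>2 * (D V y * D (kdv_U k M p) y) - k ^ 4 * ((D ^^ 2) V y * (D ^^ 2) (kdv_U k M p) y))"

text \<open>Left-hand sides of the three relations for the eigenvalue \<open>l\<close> and the vector
  \<open>(k1, M1, p1)\<close>.\<close>

definition spectral_k :: "real \<Rightarrow> real \<Rightarrow> real \<Rightarrow> complex \<Rightarrow> complex \<Rightarrow> complex \<Rightarrow> complex \<Rightarrow> complex" where
  "spectral_k k M p l k1 M1 p1 = l * k1 + of_real k * dpar kdv_c k M p k1 M1 p1"

definition spectral_M :: "real \<Rightarrow> real \<Rightarrow> real \<Rightarrow> complex \<Rightarrow> complex \<Rightarrow> complex \<Rightarrow> complex \<Rightarrow> complex" where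
  "spectral_M k M p l k1 M1 p1 = (l - of_real (kdv_c k M p)) * M1 + dpar av_3U2 k M p k1 M1 p1"

definition spectral_p :: "real \<Rightarrow> real \<Rightarrow> real \<Rightarrow> real \<Rightarrow> complex \<Rightarrow> (real \<Rightarrow> real) \<Rightarrow>
    complex \<Rightarrow> complex \<Rightarrow> complex \<Rightarrow> complex \<Rightarrow> complex" where
  "spectral_p k M p \<delta>b \<nu>b U1 l k1 M1 p1 =
     (let U = kdv_U k M p; c = kdv_c k M p in
       \<nu>b * of_real k * ((l - of_real c) * dpar av_half_U2 k M p k1 M1 p1 + dpar av_flux k M p k1 M1 p1)
       - of_real \<delta>b * dpar (av_dissip U) k M p k1 M1 p1
       - 6 * of_real k * of_real \<delta>b *
           avg (\<lambda>y. of_real (U1 y * D U y) * dpar (\<lambda>k M p. kdv_U k M p y) k M p k1 M1 p1)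
       + k1 * of_real \<delta>b *
           ((l - of_real c) * of_real (avg (\<lambda>y. D U1 y * U y))
            - of_real (avg (\<lambda>y. (3 * k\<^sup>2 * (D ^^ 2) U1 y + 6 * U1 y * U y) * D U y))))"

definition spectral_map :: "real \<Rightarrow> real \<Rightarrow> real \<Rightarrow> real \<Rightarrow> complex \<Rightarrow> (real \<Rightarrow> real) \<Rightarrow>
    complex \<Rightarrow> complex ^ 3 \<Rightarrow> complex ^ 3" where
  "spectral_map k M p \<delta>b \<nu>b U1 l v =
     vector [spectral_k k M p l (v $ 1) (v $ 2) (v $ 3),
             spectral_M k M p l (v $ 1) (v $ 2) (v $ 3),
             spectral_p k M p \<delta>b \<nu>b U1 l (v $ 1) (v $ 2) (v $ 3)]"

section \<open>The linear modulation system\<close>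

definition dX :: "(real \<Rightarrow> real \<Rightarrow> 'a::real_normed_vector) \<Rightarrow> real \<Rightarrow> real \<Rightarrow> 'a" where
  "dX f X T = D (\<lambda>x. f x T) X"

definition dT :: "(real \<Rightarrow> real \<Rightarrow> 'a::real_normed_vector) \<Rightarrow> real \<Rightarrow> real \<Rightarrow> 'a" where
  "dT f X T = D (\<lambda>t. f X t) T"

definition modulation_system :: "real \<Rightarrow> real \<Rightarrow> real \<Rightarrow> real \<Rightarrow> (real \<Rightarrow> real) \<Rightarrow>
    (real \<Rightarrow> real \<Rightarrow> 'a::real_normed_vector) \<Rightarrow> (real \<Rightarrow> real \<Rightarrow> 'a) \<Rightarrow> (real \<Rightarrow> real \<Rightarrow> 'a) \<Rightarrow> bool" where
  "modulation_system k M p \<delta>b U1 k1 M1 p1 \<longleftrightarrow>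
     (let U = kdv_U k M p; kc = (\<lambda>k M p. k * kdv_c k M p) in
      \<forall>X T.
        dT k1 X T + dpar kc k M p (dX k1 X T) (dX M1 X T) (dX p1 X T) = 0 \<and>
        dT M1 X T + dpar av_3U2 k M p (dX k1 X T) (dX M1 X T) (dX p1 X T) = 0 \<and>
        dpar av_half_U2 k M p (dT k1 X T) (dT M1 X T) (dT p1 X T)
        + dpar av_flux k M p (dX k1 X T) (dX M1 X T) (dX p1 X T)
        - \<delta>b *\<^sub>R dpar (av_dissip U) k M p (k1 X T) (M1 X T) (p1 X T)
        - (6 * \<delta>b) *\<^sub>R avg (\<lambda>y. (U1 y * D U y) *\<^sub>R
              dpar (\<lambda>k M p. k * kdv_U k M p y) k M p (k1 X T) (M1 X T) (p1 X T))
        - (3 * \<delta>b * k\<^sup>2 * avg (\<lambda>y. (D ^^ 2) U1 y * D U y)) *\<^sub>R k1 X T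
        - (\<delta>b * avg (\<lambda>y. D U1 y * U y)) *\<^sub>R dpar kc k M p (k1 X T) (M1 X T) (p1 X T) = 0)"

section \<open>The modulation expansion\<close>

text \<open>Functions \<open>F \<theta> X T\<close> of the fast phase and the slow variables.  If
  \<open>u(X, T) = F (\<phi>(X, T) / \<epsilon>) X T\<close> then \<open>\<partial>\<^sub>X u\<close> and \<open>\<partial>\<^sub>T u\<close> are
  represented by \<open>msX \<epsilon> \<phi> F\<close> and \<open>msT \<epsilon> \<phi> F\<close>.\<close>

type_synonym twoscale = "real \<Rightarrow> real \<Rightarrow> real \<Rightarrow> real"

definition msX :: "real \<Rightarrow> (real \<Rightarrow> real \<Rightarrow> real) \<Rightarrow> twoscale \<Rightarrow> twoscale" where
  "msX \<epsilon> \<phi> F = (\<lambda>\<theta> X T. dX \<phi> X T / \<epsilon> * D (\<lambda>s. F s X T) \<theta> + dX (F \<theta>) X T)"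

definition msT :: "real \<Rightarrow> (real \<Rightarrow> real \<Rightarrow> real) \<Rightarrow> twoscale \<Rightarrow> twoscale" where
  "msT \<epsilon> \<phi> F = (\<lambda>\<theta> X T. dT \<phi> X T / \<epsilon> * D (\<lambda>s. F s X T) \<theta> + dT (F \<theta>) X T)"

definition ms_residual :: "real \<Rightarrow> real \<Rightarrow> (real \<Rightarrow> real \<Rightarrow> real) \<Rightarrow> twoscale \<Rightarrow> twoscale" where
  "ms_residual \<delta>b \<epsilon> \<phi> F = (\<lambda>\<theta> X T.
     msT \<epsilon> \<phi> F \<theta> X T + 6 * F \<theta> X T * msX \<epsilon> \<phi> F \<theta> X T + \<epsilon>\<^sup>2 * (msX \<epsilon> \<phi> ^^ 3) F \<theta> X T
     + \<delta>b * (\<epsilon>\<^sup>2 * (msX \<epsilon> \<phi> ^^ 2) F \<theta> X T + \<epsilon> ^ 4 * (msX \<epsilon> \<phi> ^^ 4) F \<theta> X T))"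

text \<open>Expansion about the constant parameters \<open>(k, M, p)\<close>: the phase is
  \<open>k (X - c T) + \<epsilon> \<phi>1 + \<epsilon>\<^sup>2 \<phi>2\<close>, the profile is \<open>U + \<epsilon> W1 + \<epsilon>\<^sup>2 W2\<close>, and the equation holds
  at the orders \<open>\<epsilon>\<^sup>-\<^sup>1\<close>, \<open>1\<close> and \<open>\<epsilon>\<close>.\<close>

definition modulation_expansion :: "real \<Rightarrow> real \<Rightarrow> real \<Rightarrow> real \<Rightarrow>
    (real \<Rightarrow> real \<Rightarrow> real) \<Rightarrow> (real \<Rightarrow> real \<Rightarrow> real) \<Rightarrow> twoscale \<Rightarrow> twoscale \<Rightarrow> bool" where
  "modulation_expansion k M p \<delta>b \<phi>1 \<phi>2 W1 W2 \<longleftrightarrow>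
     (\<forall>n. Ck n (\<lambda>(X, T). \<phi>1 X T)) \<and> (\<forall>n. Ck n (\<lambda>(X, T). \<phi>2 X T)) \<and>
     (\<forall>n. Ck n (\<lambda>(\<theta>, X, T). W1 \<theta> X T)) \<and> (\<forall>n. Ck n (\<lambda>(\<theta>, X, T). W2 \<theta> X T)) \<and>
     (\<forall>X T. one_periodic (\<lambda>\<theta>. W1 \<theta> X T) \<and> one_periodic (\<lambda>\<theta>. W2 \<theta> X T)) \<and>
     (\<forall>\<theta> X T. \<exists>C. \<forall>\<^sub>F \<epsilon> in at_right 0.
        \<bar>ms_residual \<delta>b \<epsilon>
           (\<lambda>X T. k * (X - kdv_c k M p * T) + \<epsilon> * \<phi>1 X T + \<epsilon>\<^sup>2 * \<phi>2 X T)
           (\<lambda>\<theta> X T. kdv_U k M p \<theta> + \<epsilon> * W1 \<theta> X T + \<epsilon>\<^sup>2 * W2 \<theta> X T) \<theta> X T\<bar> \<le> C * \<epsilon>\<^sup>2)"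

end

theory Submission
  imports Defs
begin

text \<open>Write \<open>U = M + V\<close> for the KdV wave, \<open>X\<close> and \<open>Y\<close> for the first two correctors of the dissipative
wave, and \<open>L f = k ((6 U - c) f)' + k\<^sup>3 f'''\<close> for the linearization.  Both the Bloch problem and the
modulation problem are expanded in \<open>\<epsilon>\<close>, and both give a chain of equations \<open>L f\<^sub>j = g\<^sub>j\<close>.  A right-hand
side is admissible only if it is orthogonal to the kernel of the adjoint, spanned by \<open>1\<close> and \<open>U\<close>; a
solution is determined up to the kernel of \<open>L\<close>, spanned by \<open>U'\<close> and \<open>\<phi> = 1 - 6 \<partial>\<^sub>pU / \<partial>\<^sub>pc\<close>.

For the KdV family, differentiation in the modulus goes through the inverse function theorem for the
incomplete integral of the first kind.  The wave solves \<open>k\<^sup>2 V'' = b + c V - 3 V\<^sup>2\<close>, with \<open>c\<close> the speed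
for mean zero and an integration constant \<open>b\<close>, both explicit in \<open>E(p)\<close> and \<open>K(p)\<close>.  Three facts
about them are needed, and all come from the bounds
\<open>(1 - p\<^sup>2) K\<^sup>2 \<le> E\<^sup>2\<close> and \<open>2 E \<le> (2 - p\<^sup>2) K\<close>: \<open>\<partial>\<^sub>pc > 0\<close>, \<open>\<partial>\<^sub>pb > 0\<close>, and
\<open>4 b + 3 c s - 6 s\<^sup>2 < 0\<close> for \<open>s = - \<partial>\<^sub>pb / \<partial>\<^sub>pc\<close> (lemmas \<open>kdv_ct_p_pos\<close>, \<open>kdv_b_p_pos\<close>,
\<open>kdv_not_resonant\<close>).  The first one gives the kernel of \<open>L\<close> (\<open>linearized_kernel\<close>), by integration
by parts and uniqueness for a second-order linear equation.

For Bloch waves the leading order is \<open>L u\<^sub>0 = 0\<close>, so \<open>u\<^sub>0 = \<beta> \<phi> + \<alpha> U'\<close>.  Solvability of the next order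
against \<open>1\<close> fixes the eigenvalue if \<open>\<beta> \<noteq> 0\<close>; then solvability against \<open>V\<close> reads \<open>\<nu> A + \<delta> B = 0\<close> with
real \<open>A\<close>, \<open>B\<close>, where \<open>A\<close> is \<open>k\<close> times the third quantity above.  As \<open>\<nu>\<close> is imaginary and \<open>A \<noteq> 0\<close>, it
follows that \<open>\<beta> = 0\<close> (\<open>bloch_leading\<close>).  At order \<open>\<epsilon>\<close> the parameter derivatives of the travelling
wave equation and the \<open>x\<close>-derivative of the equation for \<open>X\<close> give \<open>u\<^sub>1\<close> up to the kernel, and the
first relation is the choice of the component along \<open>\<phi>\<close>.  The two other relations are the
solvability conditions at order \<open>\<epsilon>\<^sup>2\<close> (\<open>bloch_relations\<close>): what is not in them is an exact
derivative, or odd.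

Each relation is affine in the eigenvalue \<open>l\<close>, and in the determinant of the
system \<open>l\<^sup>3\<close> has the coefficient \<open>\<nu> k \<partial>\<^sub>pb / 6\<close>, as \<open>\<langle>U \<partial>\<^sub>pU\<rangle> = \<partial>\<^sub>pb / 6\<close> (\<open>dispersion_polynomial\<close>).
On plane waves the modulation system becomes the three relations, up to invertible row operations
(\<open>plane_waves\<close>).

The residual of the modulation expansion is a polynomial in \<open>\<epsilon>\<close> whose first coefficients
must vanish.  The coefficient of order \<open>1\<close> yields the profile \<open>W\<^sub>1\<close> as above, and the coefficient of
order \<open>\<epsilon>\<close>, averaged against \<open>1\<close> and \<open>U\<close>, yields the second and third equations; the first one
says that the derivatives of the phase commute (\<open>modulation_equations\<close>).\<close>

section \<open>Integrals with a parameter\<close>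

text \<open>Oriented integrals from \<open>0\<close>, so that a primitive is differentiable on the whole line without a case
distinction at \<open>0\<close>.\<close>

definition signed_integral :: "(real \<Rightarrow> real) \<Rightarrow> real \<Rightarrow> real" where
  "signed_integral h x = (if 0 \<le> x then integral {0..x} h else - integral {x..0} h)"

lemma signed_integral_0 [simp]: "signed_integral h 0 = 0"
  by (simp add: signed_integral_def)

lemma signed_integral_deriv:
  assumes "continuous_on UNIV h"
  shows "(signed_integral h has_real_derivative h x) (at x)"
proof -
  define a where "a = - \<bar>x\<bar> - 1"
  define b where "b = \<bar>x\<bar> + 1"
  have ab: "a < x" "x < b" "a < 0" by (auto simp: a_def b_def)
  have c: "continuous_on S h" for S using assms continuous_on_subset by blast
  have int: "h integrable_on {u..v}" for u v by (rule integrable_continuous_real) (rule c)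
  have "((\<lambda>z. integral {a..z} h) has_real_derivative h x) (at x within {a..b})"
    by (rule integral_has_real_derivative) (use ab in \<open>auto intro: c\<close>)
  then have "((\<lambda>z. integral {a..z} h) has_real_derivative h x) (at x)"
    using ab by (simp add: at_within_Icc_at)
  then have d: "((\<lambda>z. integral {a..z} h - integral {a..0} h) has_real_derivative h x) (at x)"
    by (auto intro!: derivative_eq_intros)
  have eq: "integral {a..z} h - integral {a..0} h = signed_integral h z" if "z \<in> {a<..}" for z
  proof (cases "0 \<le> z")
    case True
    have "integral {a..0} h + integral {0..z} h = integral {a..z} h"
      by (rule Henstock_Kurzweil_Integration.integral_combine) (use ab True in \<open>auto intro: int\<close>)
    then show ?thesis using True by (simp add: signed_integral_def)
  next
    case False
    have "integral {a..z} h + integral {z..0} h = integral {a..0} h"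
      by (rule Henstock_Kurzweil_Integration.integral_combine) (use ab False that in \<open>auto intro: int\<close>)
    then show ?thesis using False by (simp add: signed_integral_def)
  qed
  show ?thesis
    by (rule has_field_derivative_transform_within_open[OF d, of "{a<..}"]) (use ab eq in auto)
qed

text \<open>Moving the endpoint into the integrand reduces dependence on the endpoint to dependence on a
parameter, over the fixed interval \<open>[0, 1]\<close>.\<close>

lemma signed_integral_scale:
  assumes "continuous_on UNIV h"
  shows "signed_integral h x = x * integral {0..1} (\<lambda>s. h (x * s))"
proof -
  have "((\<lambda>s. x * h (x * s)) has_integral signed_integral h (x * 1) - signed_integral h (x * 0)) {0..1}"
  proof (rule fundamental_theorem_of_calculus)
    fix s :: real
    have "((\<lambda>s. signed_integral h (x * s)) has_real_derivative h (x * s) * x) (at s)"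
      by (rule DERIV_chain2[OF signed_integral_deriv[OF assms]]) (auto intro!: derivative_eq_intros)
    then show "((\<lambda>s. signed_integral h (x * s)) has_vector_derivative x * h (x * s)) (at s within {0..1})"
      by (simp add: has_real_derivative_iff_has_vector_derivative mult.commute has_vector_derivative_at_within)
  qed simp
  then have "integral {0..1} (\<lambda>s. x * h (x * s)) = signed_integral h x"
    by (auto dest: integral_unique simp del: integral_mult_right)
  then show ?thesis by simp
qed

lemma deriv_integral_param:
  fixes f :: "real \<Rightarrow> real \<Rightarrow> real"
  assumes S: "open S" "convex S" "x \<in> S"
    and d: "\<And>x t. x \<in> S \<Longrightarrow> t \<in> {0..1} \<Longrightarrow> ((\<lambda>x. f x t) has_real_derivative f' x t) (at x)"
    and c: "\<And>x. x \<in> S \<Longrightarrow> continuous_on {0..1} (f x)"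
    and c': "continuous_on (S \<times> {0..1}) (\<lambda>(x, t). f' x t)"
  shows "((\<lambda>x. integral {0..1} (f x)) has_real_derivative integral {0..1} (f' x)) (at x)"
proof -
  have "((\<lambda>x. integral (cbox 0 1) (f x)) has_real_derivative integral (cbox 0 1) (f' x)) (at x within S)"
    by (rule leibniz_rule_field_derivative)
      (use S d c c' in \<open>auto intro: has_field_derivative_at_within integrable_continuous_real\<close>)
  then show ?thesis using S at_within_open[of x S] by simp
qed

lemma deriv_signed_integral_param:
  fixes h :: "real \<Rightarrow> real \<Rightarrow> real"
  assumes S: "open S" "convex S" "p \<in> S"
    and d: "\<And>t p. p \<in> S \<Longrightarrow> ((\<lambda>p. h t p) has_real_derivative h' t p) (at p)"
    and c: "continuous_on (UNIV \<times> S) (\<lambda>(t, p). h t p)"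
    and c': "continuous_on (UNIV \<times> S) (\<lambda>(t, p). h' t p)"
  shows "((\<lambda>p. signed_integral (\<lambda>t. h t p) x) has_real_derivative signed_integral (\<lambda>t. h' t p) x) (at p)"
proof -
  have c1: "continuous_on A (\<lambda>t. h t q)" if "q \<in> S" for q A
    by (rule continuous_on_compose2[OF c, of A "\<lambda>t. (t, q)", simplified]) (use that in \<open>auto intro!: continuous_intros\<close>)
  have c1': "continuous_on A (\<lambda>t. h' t q)" if "q \<in> S" for q A
    by (rule continuous_on_compose2[OF c', of A "\<lambda>t. (t, q)", simplified]) (use that in \<open>auto intro!: continuous_intros\<close>)
  have "((\<lambda>p. integral {0..1} (\<lambda>s. h (x * s) p)) has_real_derivative integral {0..1} (\<lambda>s. h' (x * s) p)) (at p)"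
  proof (rule deriv_integral_param[OF S])
    show "continuous_on {0..1} (\<lambda>s. h (x * s) q)" if "q \<in> S" for q
      by (rule continuous_on_compose2[OF c1[of q UNIV]]) (use that in \<open>auto intro!: continuous_intros\<close>)
    show "continuous_on (S \<times> {0..1}) (\<lambda>(q, s). h' (x * s) q)"
    proof -
      have "continuous_on (S \<times> {0..1}) (\<lambda>z. (\<lambda>(t, p). h' t p) (x * snd z, fst z))"
        by (rule continuous_on_compose2[OF c']) (auto intro!: continuous_intros)
      then show ?thesis by (simp add: split_beta)
    qed
  qed (rule d)
  then have "((\<lambda>p. x * integral {0..1} (\<lambda>s. h (x * s) p)) has_real_derivative x * integral {0..1} (\<lambda>s. h' (x * s) p)) (at p)"
    by (rule DERIV_cmult)
  then show ?thesis unfolding signed_integral_scale[OF c1'[OF S(3)]]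
    by (rule has_field_derivative_transform_within_open[of _ _ _ S]) (use S signed_integral_scale[OF c1] in auto)
qed

lemma continuous_on_signed_integral_param:
  fixes h :: "real \<Rightarrow> real \<Rightarrow> real"
  assumes c: "continuous_on (UNIV \<times> S) (\<lambda>(t, p). h t p)"
  shows "continuous_on (UNIV \<times> S) (\<lambda>(x, p). signed_integral (\<lambda>t. h t p) x)"
proof -
  have c1: "continuous_on A (\<lambda>t. h t q)" if "q \<in> S" for q A
    by (rule continuous_on_compose2[OF c, of A "\<lambda>t. (t, q)", simplified]) (use that in \<open>auto intro!: continuous_intros\<close>)
  have "continuous_on ((UNIV \<times> S) \<times> {0..1}) (\<lambda>z. (\<lambda>(t, p). h t p) (fst (fst z) * snd z, snd (fst z)))"
    by (rule continuous_on_compose2[OF c]) (auto intro!: continuous_intros)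
  then have "continuous_on (UNIV \<times> S) (\<lambda>z. integral (cbox 0 1) (\<lambda>s. h (fst z * s) (snd z)))"
    by (intro integral_continuous_on_param) (simp add: split_beta)
  then have "continuous_on (UNIV \<times> S) (\<lambda>z. fst z * integral {0..1} (\<lambda>s. h (fst z * s) (snd z)))"
    by (intro continuous_intros) simp
  then show ?thesis
    by (rule continuous_on_eq) (use signed_integral_scale[OF c1] in auto)
qed

lemma signed_integral_minus:
  assumes "continuous_on UNIV h" "\<And>t. h (- t) = h t"
  shows "signed_integral h (- x) = - signed_integral h x"
  using assms by (simp add: signed_integral_scale)

lemma signed_integral_shift:
  assumes c: "continuous_on UNIV h" and per: "\<And>t. h (t + pi) = h t"
  shows "signed_integral h (x + pi) = signed_integral h x + signed_integral h pi"
proof -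
  have "((\<lambda>x. signed_integral h (x + pi) - signed_integral h x) has_real_derivative 0) (at x)" for x
    by (auto intro!: derivative_eq_intros DERIV_chain2[OF signed_integral_deriv[OF c]] signed_integral_deriv[OF c]
        simp: per)
  then have "signed_integral h (x + pi) - signed_integral h x = signed_integral h (0 + pi) - signed_integral h 0"
    by (rule DERIV_isconst_all[rule_format]) 
  then show ?thesis by simp
qed

lemma signed_integral_pi:
  assumes c: "continuous_on UNIV h" and per: "\<And>t. h (pi - t) = h t"
  shows "signed_integral h pi = 2 * signed_integral h (pi / 2)"
proof -
  have "((\<lambda>x. signed_integral h (pi - x) + signed_integral h x) has_real_derivative 0) (at x)" for x
    by (auto intro!: derivative_eq_intros DERIV_chain2[OF signed_integral_deriv[OF c]] signed_integral_deriv[OF c]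
        simp: per)
  then have "signed_integral h (pi - 0) + signed_integral h 0 = signed_integral h (pi - pi/2) + signed_integral h (pi/2)"
    by (rule DERIV_isconst_all[rule_format]) 
  then show ?thesis by simp
qed

section \<open>Complete elliptic integrals\<close>

definition ell_delta :: "real \<Rightarrow> real \<Rightarrow> real" where
  "ell_delta t p = sqrt (1 - p\<^sup>2 * (sin t)\<^sup>2)"

lemma ell_delta_radicand_pos: "0 < p \<Longrightarrow> p < 1 \<Longrightarrow> 0 < 1 - p\<^sup>2 * (sin t)\<^sup>2" for p :: real
proof -
  assume p: "0 < p" "p < 1"
  have "(sin t)\<^sup>2 \<le> 1" by (simp add: abs_square_le_1)
  then have "p\<^sup>2 * (sin t)\<^sup>2 \<le> p\<^sup>2 * 1" by (intro mult_left_mono) auto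
  moreover have "p\<^sup>2 < 1" using p by (simp add: abs_square_less_1)
  ultimately show ?thesis by linarith
qed

lemma ell_delta_pos: "0 < p \<Longrightarrow> p < 1 \<Longrightarrow> 0 < ell_delta t p"
  unfolding ell_delta_def using ell_delta_radicand_pos by (rule real_sqrt_gt_zero)

lemma ell_delta_sq: "0 < p \<Longrightarrow> p < 1 \<Longrightarrow> (ell_delta t p)\<^sup>2 = 1 - p\<^sup>2 * (sin t)\<^sup>2"
  using ell_delta_radicand_pos[of p t] by (simp add: ell_delta_def)

lemma ell_delta_nz: "0 < p \<Longrightarrow> p < 1 \<Longrightarrow> ell_delta t p \<noteq> 0"
  using ell_delta_pos[of p t] by simp

lemma continuous_on_ell_delta: "continuous_on S (\<lambda>z. ell_delta (f z) (g z))"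
  if "continuous_on S f" "continuous_on S g" for f g :: "'a::t2_space \<Rightarrow> real"
  unfolding ell_delta_def using that
  by (intro continuous_intros)

lemma ell_delta_deriv_t:
  assumes "0 < p" "p < 1"
  shows "((\<lambda>t. ell_delta t p) has_real_derivative - p\<^sup>2 * sin t * cos t / ell_delta t p) (at t)"
  unfolding ell_delta_def
  by (rule derivative_eq_intros refl | use ell_delta_radicand_pos[OF assms, of t] in \<open>simp add: field_simps\<close>)+

lemma ell_delta_deriv_p:
  assumes "0 < p" "p < 1"
  shows "((\<lambda>p. ell_delta t p) has_real_derivative - p * (sin t)\<^sup>2 / ell_delta t p) (at p)"
  unfolding ell_delta_def
  by (rule derivative_eq_intros refl | use ell_delta_radicand_pos[OF assms, of t] in \<open>simp add: field_simps\<close>)+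

definition ellF_p :: "real \<Rightarrow> real \<Rightarrow> real" where
  "ellF_p x p = signed_integral (\<lambda>t. p * (sin t)\<^sup>2 / (ell_delta t p) ^ 3) x"

lemma ellF_signed_integral: "ellF x p = signed_integral (\<lambda>t. 1 / ell_delta t p) x"
  by (simp add: ellF_def signed_integral_def ell_delta_def)

lemma ellE_signed_integral: "ellE p = signed_integral (\<lambda>t. ell_delta t p) (pi / 2)"
  by (simp add: ellE_def signed_integral_def ell_delta_def)

lemma ellF_deriv_x:
  assumes "0 < p" "p < 1"
  shows "((\<lambda>x. ellF x p) has_real_derivative 1 / ell_delta x p) (at x)"
  unfolding ellF_signed_integral
  by (rule signed_integral_deriv) (intro continuous_intros continuous_on_ell_delta ballI ell_delta_nz[OF assms])

lemma ellF_deriv_p: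
  assumes "0 < p" "p < 1"
  shows "((\<lambda>p. ellF x p) has_real_derivative ellF_p x p) (at p)"
  unfolding ellF_signed_integral ellF_p_def
proof (rule deriv_signed_integral_param[where S = "{0<..<1}"])
  fix t p :: real assume p: "p \<in> {0<..<1}"
  note nz = ell_delta_nz[of p t]
  show "((\<lambda>p. 1 / ell_delta t p) has_real_derivative p * (sin t)\<^sup>2 / ell_delta t p ^ 3) (at p)"
    by (rule derivative_eq_intros ell_delta_deriv_p refl | use p nz in \<open>simp add: field_simps power2_eq_square power3_eq_cube\<close>)+
qed (use assms in \<open>auto intro!: continuous_intros continuous_on_ell_delta simp: split_beta ell_delta_nz\<close>)

lemma continuous_on_ellF: "continuous_on (UNIV \<times> {0<..<1}) (\<lambda>(x, p). ellF x p)"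
  unfolding ellF_signed_integral
  by (rule continuous_on_signed_integral_param)
    (auto intro!: continuous_intros continuous_on_ell_delta simp: split_beta ell_delta_nz)

lemma continuous_on_ellF_p: "continuous_on (UNIV \<times> {0<..<1}) (\<lambda>(x, p). ellF_p x p)"
  unfolding ellF_p_def
  by (rule continuous_on_signed_integral_param)
    (auto intro!: continuous_intros continuous_on_ell_delta simp: split_beta ell_delta_nz)

context
  fixes p :: real
  assumes p: "0 < p" "p < 1"
begin

private lemma has_integral_delta: "((\<lambda>t. ell_delta t p) has_integral ellE p) {0..pi/2}"
  unfolding ellE_def ell_delta_def[symmetric]
  by (intro integrable_integral integrable_continuous_real continuous_on_ell_delta continuous_intros)

private lemma has_integral_inverse_delta: "((\<lambda>t. 1 / ell_delta t p) has_integral ellK p) {0..pi/2}"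
proof -
  have "ellK p = integral {0..pi/2} (\<lambda>t. 1 / ell_delta t p)"
    by (simp add: ellK_def ellF_signed_integral signed_integral_def)
  then show ?thesis
    by (auto intro!: integrable_integral integrable_continuous_real continuous_on_ell_delta continuous_intros
        simp: ell_delta_nz[OF p])
qed

private lemma modulus_compl: "0 < 1 - p\<^sup>2" using p by (simp add: abs_square_less_1)

text \<open>\<open>p\<^sup>2 sin t cos t / \<Delta>\<close> is an antiderivative of \<open>\<Delta> - (1 - p\<^sup>2) / \<Delta>\<^sup>3\<close>
  that vanishes at both ends.\<close>

private lemma has_integral_inverse_delta_cubed:
  "((\<lambda>t. 1 / (ell_delta t p) ^ 3) has_integral ellE p / (1 - p\<^sup>2)) {0..pi/2}"
proof -
  have "((\<lambda>t. ell_delta t p - (1 - p\<^sup>2) / (ell_delta t p) ^ 3) has_integral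
      p\<^sup>2 * sin (pi/2) * cos (pi/2) / ell_delta (pi/2) p - p\<^sup>2 * sin 0 * cos 0 / ell_delta 0 p) {0..pi/2}"
  proof (rule fundamental_theorem_of_calculus)
    fix t :: real
    note nz = ell_delta_nz[OF p, of t]
    define S where "S = (sin t)\<^sup>2"
    have D2: "(ell_delta t p)\<^sup>2 = 1 - p\<^sup>2 * S" using ell_delta_sq[OF p] by (simp add: S_def)
    have C2: "(cos t)\<^sup>2 = 1 - S" by (simp add: S_def cos_squared_eq)
    have "((\<lambda>t. p\<^sup>2 * sin t * cos t / ell_delta t p) has_real_derivative
      ((p\<^sup>2 * (cos t)\<^sup>2 - p\<^sup>2 * S) * (ell_delta t p)\<^sup>2 + p\<^sup>2 * p\<^sup>2 * S * (cos t)\<^sup>2) / (ell_delta t p) ^ 3) (at t)"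
      by (rule derivative_eq_intros ell_delta_deriv_t p refl nz | use nz in \<open>simp add: S_def field_simps eval_nat_numeral\<close>)+
    also have "((p\<^sup>2 * (cos t)\<^sup>2 - p\<^sup>2 * S) * (ell_delta t p)\<^sup>2 + p\<^sup>2 * p\<^sup>2 * S * (cos t)\<^sup>2) / (ell_delta t p) ^ 3
       = (((ell_delta t p)\<^sup>2)\<^sup>2 - (1 - p\<^sup>2)) / (ell_delta t p) ^ 3"
      unfolding D2 C2 by (simp add: algebra_simps power2_eq_square)
    also have "\<dots> = ell_delta t p - (1 - p\<^sup>2) / (ell_delta t p) ^ 3"
      using nz by (simp add: field_simps eval_nat_numeral)
    finally show "((\<lambda>t. p\<^sup>2 * sin t * cos t / ell_delta t p) has_vector_derivative
      ell_delta t p - (1 - p\<^sup>2) / (ell_delta t p) ^ 3) (at t within {0..pi/2})"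
      by (simp add: has_real_derivative_iff_has_vector_derivative has_vector_derivative_at_within)
  qed simp
  from has_integral_diff[OF has_integral_delta this]
  have "((\<lambda>t. (1 - p\<^sup>2) / (ell_delta t p) ^ 3) has_integral ellE p) {0..pi/2}" by simp
  from has_integral_divide[OF this, of "1 - p\<^sup>2"] show ?thesis
    using modulus_compl by simp
qed

lemma ellK_deriv: "(ellK has_real_derivative (ellE p / (1 - p\<^sup>2) - ellK p) / p) (at p)"
proof -
  have "((\<lambda>t. (1 / (ell_delta t p) ^ 3 - 1 / ell_delta t p) / p) has_integral (ellE p / (1 - p\<^sup>2) - ellK p) / p) {0..pi/2}"
    by (intro has_integral_divide has_integral_diff has_integral_inverse_delta has_integral_inverse_delta_cubed)
  moreover have "(1 / (ell_delta t p) ^ 3 - 1 / ell_delta t p) / p = p * (sin t)\<^sup>2 / (ell_delta t p) ^ 3" for t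
  proof -
    have "(1 / (ell_delta t p) ^ 3 - 1 / ell_delta t p) / p = (1 - (ell_delta t p)\<^sup>2) / (p * (ell_delta t p) ^ 3)"
      using ell_delta_nz[OF p, of t] p by (simp add: field_simps eval_nat_numeral)
    also have "\<dots> = p * (sin t)\<^sup>2 / (ell_delta t p) ^ 3"
      unfolding ell_delta_sq[OF p] using p by (simp add: power2_eq_square)
    finally show ?thesis .
  qed
  ultimately have "ellF_p (pi / 2) p = (ellE p / (1 - p\<^sup>2) - ellK p) / p"
    by (simp add: ellF_p_def signed_integral_def integral_unique)
  then show ?thesis using ellF_deriv_p[OF p, of "pi/2"] unfolding ellK_def[abs_def] by simp
qed

lemma ellE_deriv: "(ellE has_real_derivative (ellE p - ellK p) / p) (at p)"
proof -
  have 1: "((\<lambda>p. signed_integral (\<lambda>t. ell_delta t p) (pi/2)) has_real_derivative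
      signed_integral (\<lambda>t. - p * (sin t)\<^sup>2 / ell_delta t p) (pi/2)) (at p)"
  proof (rule deriv_signed_integral_param[where S = "{0<..<1}"])
    fix t p :: real assume p: "p \<in> {0<..<1}"
    then show "((\<lambda>p. ell_delta t p) has_real_derivative - p * (sin t)\<^sup>2 / ell_delta t p) (at p)"
      by (intro ell_delta_deriv_p) auto
  qed (use p in \<open>auto intro!: continuous_intros continuous_on_ell_delta simp: split_beta ell_delta_nz\<close>)
  have 2: "((\<lambda>t. (ell_delta t p - 1 / ell_delta t p) / p) has_integral (ellE p - ellK p) / p) {0..pi/2}"
    by (intro has_integral_divide has_integral_diff has_integral_inverse_delta has_integral_delta)
  have 3: "(ell_delta t p - 1 / ell_delta t p) / p = - p * (sin t)\<^sup>2 / ell_delta t p" for t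
  proof -
    have "(ell_delta t p - 1 / ell_delta t p) / p = ((ell_delta t p)\<^sup>2 - 1) / (p * ell_delta t p)"
      using ell_delta_nz[OF p, of t] p by (simp add: field_simps eval_nat_numeral)
    also have "\<dots> = - p * (sin t)\<^sup>2 / ell_delta t p"
      unfolding ell_delta_sq[OF p] using p by (simp add: power2_eq_square)
    finally show ?thesis .
  qed
  have "signed_integral (\<lambda>t. - p * (sin t)\<^sup>2 / ell_delta t p) (pi/2) = (ellE p - ellK p) / p"
    using integral_unique[OF 2[unfolded 3]] by (simp add: signed_integral_def del: integral_minus Henstock_Kurzweil_Integration.integral_neg)
  with 1 show ?thesis
    by (simp add: ellE_signed_integral[abs_def])
qed

lemma ellK_pos: "0 < ellK p"
proof -
  have "((\<lambda>t. 1) has_integral (1::real) * (pi/2 - 0)) {0..pi/2}"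
    using has_integral_const_real[of "1::real" 0 "pi/2"] by simp
  then have "1 * (pi/2 - 0) \<le> ellK p"
  proof (rule has_integral_le[OF _ has_integral_inverse_delta])
    fix t
    have "ell_delta t p \<le> 1" unfolding ell_delta_def by simp
    then show "1 \<le> 1 / ell_delta t p" using ell_delta_pos[OF p, of t] by simp
  qed
  then show ?thesis using pi_gt_zero by (simp; linarith)
qed

text \<open>With \<open>r\<^sup>2 = 1 - p\<^sup>2\<close>, the integral of the nonnegative function
\<open>(\<Delta>\<^sup>2 - r)\<^sup>2 / \<Delta>\<^sup>3 = \<Delta> - 2 r / \<Delta> + r\<^sup>2 / \<Delta>\<^sup>3\<close> is \<open>2 E - 2 r K\<close>.\<close>

lemma ellE_lower: "(1 - p\<^sup>2) * (ellK p)\<^sup>2 \<le> (ellE p)\<^sup>2"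
proof -
  define r where "r = sqrt (1 - p\<^sup>2)"
  have r: "r\<^sup>2 = 1 - p\<^sup>2" "0 \<le> r" using modulus_compl by (auto simp: r_def)
  have "((\<lambda>t. ell_delta t p + (1 - p\<^sup>2) * (1 / (ell_delta t p) ^ 3) - 2 * r * (1 / ell_delta t p)) has_integral
     ellE p + (1 - p\<^sup>2) * (ellE p / (1 - p\<^sup>2)) - 2 * r * ellK p) {0..pi/2}"
    by (intro has_integral_add has_integral_diff has_integral_mult_right
        has_integral_inverse_delta has_integral_delta has_integral_inverse_delta_cubed)
  moreover have "0 \<le> ell_delta t p + (1 - p\<^sup>2) * (1 / (ell_delta t p) ^ 3) - 2 * r * (1 / ell_delta t p)" for t
  proof -
    have "ell_delta t p + (1 - p\<^sup>2) * (1 / (ell_delta t p) ^ 3) - 2 * r * (1 / ell_delta t p)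
      = ((ell_delta t p)\<^sup>2 - r)\<^sup>2 / (ell_delta t p) ^ 3"
      unfolding r(1)[symmetric] using ell_delta_nz[OF p, of t]
      by (simp add: field_simps eval_nat_numeral)
    then show ?thesis using ell_delta_pos[OF p, of t] by simp
  qed
  ultimately have "0 \<le> ellE p + (1 - p\<^sup>2) * (ellE p / (1 - p\<^sup>2)) - 2 * r * ellK p"
    by (rule has_integral_nonneg)
  then have "r * ellK p \<le> ellE p" using modulus_compl by simp
  then have "(r * ellK p)\<^sup>2 \<le> (ellE p)\<^sup>2" by (rule power_mono) (use r ellK_pos in simp)
  then show ?thesis by (simp add: power_mult_distrib r)
qed

text \<open>The exact derivative of \<open>- p\<^sup>2 sin t cos t / \<Delta>\<close> lies below the integrand of \<open>(2 - p\<^sup>2) K - 2 E\<close>; they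
differ by a square over \<open>\<Delta>\<^sup>3\<close>.\<close>

lemma ellE_upper: "2 * ellE p \<le> (2 - p\<^sup>2) * ellK p"
proof -
  have "((\<lambda>t. - p\<^sup>2 * (1 - 2 * (sin t)\<^sup>2) / ell_delta t p - (p\<^sup>2 * sin t * cos t)\<^sup>2 / (ell_delta t p) ^ 3) has_integral
      - p\<^sup>2 * sin (pi/2) * cos (pi/2) / ell_delta (pi/2) p - - p\<^sup>2 * sin 0 * cos 0 / ell_delta 0 p) {0..pi/2}"
  proof (rule fundamental_theorem_of_calculus)
    fix t :: real
    note nz = ell_delta_nz[OF p, of t]
    have "((\<lambda>t. - p\<^sup>2 * sin t * cos t / ell_delta t p) has_real_derivative
       - p\<^sup>2 * ((cos t)\<^sup>2 - (sin t)\<^sup>2) / ell_delta t p - (p\<^sup>2 * sin t * cos t)\<^sup>2 / (ell_delta t p) ^ 3) (at t)"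
      by (rule derivative_eq_intros ell_delta_deriv_t p refl nz | use nz in \<open>simp add: field_simps eval_nat_numeral\<close>)+
    then show "((\<lambda>t. - p\<^sup>2 * sin t * cos t / ell_delta t p) has_vector_derivative
      - p\<^sup>2 * (1 - 2 * (sin t)\<^sup>2) / ell_delta t p - (p\<^sup>2 * sin t * cos t)\<^sup>2 / (ell_delta t p) ^ 3) (at t within {0..pi/2})"
      by (simp add: has_real_derivative_iff_has_vector_derivative has_vector_derivative_at_within cos_squared_eq)
  qed simp
  then have 1: "((\<lambda>t. - p\<^sup>2 * (1 - 2 * (sin t)\<^sup>2) / ell_delta t p - (p\<^sup>2 * sin t * cos t)\<^sup>2 / (ell_delta t p) ^ 3) has_integral 0) {0..pi/2}"
    by simp
  have 2: "((\<lambda>t. (2 - p\<^sup>2) * (1 / ell_delta t p) - 2 * ell_delta t p) has_integral (2 - p\<^sup>2) * ellK p - 2 * ellE p) {0..pi/2}"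
    by (intro has_integral_diff has_integral_mult_right has_integral_inverse_delta has_integral_delta)
  have "0 \<le> (2 - p\<^sup>2) * ellK p - 2 * ellE p"
  proof (rule has_integral_le[OF 1 2])
    fix t
    note nz = ell_delta_nz[OF p, of t]
    have "(2 - p\<^sup>2) * (1 / ell_delta t p) - 2 * ell_delta t p = (2 - p\<^sup>2 - 2 * (ell_delta t p)\<^sup>2) / ell_delta t p"
      using nz by (simp add: field_simps eval_nat_numeral)
    also have "\<dots> = - p\<^sup>2 * (1 - 2 * (sin t)\<^sup>2) / ell_delta t p"
      unfolding ell_delta_sq[OF p] by (simp add: algebra_simps)
    finally show "- p\<^sup>2 * (1 - 2 * (sin t)\<^sup>2) / ell_delta t p - (p\<^sup>2 * sin t * cos t)\<^sup>2 / (ell_delta t p) ^ 3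
      \<le> (2 - p\<^sup>2) * (1 / ell_delta t p) - 2 * ell_delta t p"
      using ell_delta_pos[OF p, of t] by simp
  qed
  then show ?thesis by simp
qed

lemma ellE_pos: "0 < ellE p"
proof -
  have "0 \<le> ellE p" by (rule has_integral_nonneg[OF has_integral_delta]) (simp add: ell_delta_pos[OF p] less_imp_le)
  moreover have "0 < (1 - p\<^sup>2) * (ellK p)\<^sup>2" using modulus_compl ellK_pos by simp
  ultimately show ?thesis using ellE_lower by (cases "ellE p = 0") auto
qed

end

lemma has_derivative_from_partials:
  fixes f :: "real \<Rightarrow> real \<Rightarrow> real"
  assumes S: "open S" "convex S" "y \<in> S"
    and fx: "((\<lambda>x. f x y) has_real_derivative fx) (at x)"
    and fy: "\<And>x y. y \<in> S \<Longrightarrow> ((\<lambda>y. f x y) has_real_derivative fy x y) (at y)"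
    and c: "continuous_on (UNIV \<times> S) (\<lambda>(x, y). fy x y)"
  shows "((\<lambda>(x, y). f x y) has_derivative (\<lambda>(a, b). fx * a + fy x y * b)) (at (x, y))"
proof -
  have "((\<lambda>(x, y). f x y) has_derivative (\<lambda>(tx, ty). (*) fx tx + blinfun_apply (blinfun_mult_right (fy x y)) ty))
      (at (x, y) within UNIV \<times> S)"
  proof (rule has_derivative_partialsI)
    show "((\<lambda>x. f x y) has_derivative (*) fx) (at x within UNIV)"
      using fx by (simp add: has_field_derivative_def)
    show "((\<lambda>y. f x y) has_derivative blinfun_apply (blinfun_mult_right (fy x y))) (at y within S)"
      if "y \<in> S" for x y
      using fy[OF that, of x] by (auto simp: has_field_derivative_def intro: has_derivative_at_withinI)
    have "continuous_on (UNIV \<times> S) (\<lambda>z. blinfun_mult_right (case z of (x, y) \<Rightarrow> fy x y))"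
      by (rule bounded_linear.continuous_on[OF bounded_linear_blinfun_mult_right c])
    then have "continuous (at (x, y) within UNIV \<times> S) (\<lambda>z. blinfun_mult_right (case z of (x, y) \<Rightarrow> fy x y))"
      using S(3) unfolding continuous_on_eq_continuous_within by blast
    then show "continuous (at (x, y) within UNIV \<times> S) (\<lambda>(x, y). blinfun_mult_right (fy x y))"
      by (simp add: split_beta')
  qed (use S in auto)
  moreover have "at (x, y) within UNIV \<times> S = at (x, y)"
    using S by (intro at_within_open open_Times) auto
  ultimately show ?thesis by simp
qed

text \<open>Symmetry of second derivatives, with the differentiability of \<open>\<partial>\<^sub>p g\<close> in \<open>y\<close> as part of the
conclusion.  Writing \<open>g(y, p) = g(0, p) + \<integral> \<partial>\<^sub>y g\<close> and differentiating under the integral in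
\<open>p\<close> exhibits \<open>\<partial>\<^sub>p g\<close> as a primitive.\<close>

lemma mixed_partials:
  fixes g h :: "real \<Rightarrow> real \<Rightarrow> real"
  assumes S: "open S" "convex S" "p \<in> S"
    and gy: "\<And>y p. p \<in> S \<Longrightarrow> ((\<lambda>y. g y p) has_real_derivative h y p) (at y)"
    and gp: "\<And>y. ((\<lambda>p. g y p) has_real_derivative gp y) (at p)"
    and hp: "\<And>y p. p \<in> S \<Longrightarrow> ((\<lambda>p. h y p) has_real_derivative hp y p) (at p)"
    and c: "continuous_on (UNIV \<times> S) (\<lambda>(y, p). h y p)"
    and c': "continuous_on (UNIV \<times> S) (\<lambda>(y, p). hp y p)"
  shows "(gp has_real_derivative hp y p) (at y)"
proof -
  have c1: "continuous_on UNIV (\<lambda>y. h y q)" if "q \<in> S" for q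
    by (rule continuous_on_compose2[OF c, of UNIV "\<lambda>t. (t, q)", simplified]) (use that in \<open>auto intro!: continuous_intros\<close>)
  have c1': "continuous_on UNIV (\<lambda>y. hp y q)" if "q \<in> S" for q
    by (rule continuous_on_compose2[OF c', of UNIV "\<lambda>t. (t, q)", simplified]) (use that in \<open>auto intro!: continuous_intros\<close>)
  have rep: "g 0 q + signed_integral (\<lambda>t. h t q) y = g y q" if "q \<in> S" for y q
  proof -
    have "((\<lambda>y. g y q - signed_integral (\<lambda>t. h t q) y) has_real_derivative 0) (at y)" for y
      using gy[OF that, of y] signed_integral_deriv[OF c1[OF that], of y]
      by (auto intro!: derivative_eq_intros)
    then have "g y q - signed_integral (\<lambda>t. h t q) y = g 0 q - signed_integral (\<lambda>t. h t q) 0"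
      by (rule DERIV_isconst_all[rule_format])
    then show ?thesis by simp
  qed
  have "gp y = gp 0 + signed_integral (\<lambda>t. hp t p) y" for y
  proof (rule DERIV_unique[OF gp])
    have "((\<lambda>q. g 0 q + signed_integral (\<lambda>t. h t q) y) has_real_derivative
        gp 0 + signed_integral (\<lambda>t. hp t p) y) (at p)"
      by (intro DERIV_add gp deriv_signed_integral_param[OF S hp c c'])
    then show "((\<lambda>q. g y q) has_real_derivative gp 0 + signed_integral (\<lambda>t. hp t p) y) (at p)"
      by (rule has_field_derivative_transform_within_open[of _ _ _ S]) (use S rep in auto)
  qed
  then have "(\<lambda>y. gp 0 + signed_integral (\<lambda>t. hp t p) y) = gp" by (intro ext) (rule sym)
  moreover have "((\<lambda>y. gp 0 + signed_integral (\<lambda>t. hp t p) y) has_real_derivative hp y p) (at y)"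
    using signed_integral_deriv[OF c1'[OF S(3)], of y] by (auto intro!: derivative_eq_intros)
  ultimately show ?thesis by (rule subst[where P = "\<lambda>f. (f has_real_derivative hp y p) (at y)"])
qed

section \<open>Jacobi's amplitude\<close>

context
  fixes p :: real
  assumes p: "0 < p" "p < 1"
begin

lemma ellF_strict_mono: "x < y \<Longrightarrow> ellF x p < ellF y p"
  by (rule DERIV_pos_imp_increasing) (use ellF_deriv_x[OF p] ell_delta_pos[OF p] in \<open>auto intro!: exI\<close>)

lemma ellF_surj: "\<exists>x. ellF x p = u"
proof -
  have d: "((\<lambda>x. ellF x p - x) has_real_derivative 1 / ell_delta x p - 1) (at x)" for x
    by (intro derivative_intros ellF_deriv_x[OF p])
  have "0 \<le> 1 / ell_delta x p - 1" for x
  proof -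
    have "ell_delta x p \<le> 1" unfolding ell_delta_def by simp
    then show ?thesis using ell_delta_pos[OF p, of x] by simp
  qed
  then have mono: "x \<le> y \<Longrightarrow> ellF x p - x \<le> ellF y p - y" for x y
    by (rule_tac DERIV_nonneg_imp_nondecreasing) (use d in \<open>auto intro!: exI\<close>)
  have [simp]: "ellF 0 p = 0" by (simp add: ellF_signed_integral)
  have "continuous_on {- \<bar>u\<bar>..\<bar>u\<bar>} (\<lambda>x. ellF x p)"
    by (rule DERIV_continuous_on) (rule has_field_derivative_at_within[OF ellF_deriv_x[OF p]])
  moreover have "ellF (- \<bar>u\<bar>) p \<le> u" "u \<le> ellF \<bar>u\<bar> p"
    using mono[of 0 "\<bar>u\<bar>"] mono[of "- \<bar>u\<bar>" 0] by auto
  ultimately show ?thesis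
    using IVT'[of "\<lambda>x. ellF x p" "- \<bar>u\<bar>" u "\<bar>u\<bar>"] by auto
qed

lemma ellF_inj: "ellF x p = ellF y p \<longleftrightarrow> x = y"
  using ellF_strict_mono[of x y] ellF_strict_mono[of y x] by (metis linorder_neqE_linordered_idom order_less_irrefl)

lemma jacobi_am_ellF: "jacobi_am (ellF x p) p = x"
  unfolding jacobi_am_def ellF_inj by simp

lemma ellF_jacobi_am: "ellF (jacobi_am u p) p = u"
  using ellF_surj[of u] jacobi_am_ellF by metis

end

text \<open>The map \<open>(x, p) \<mapsto> (F(x, p), p)\<close> is inverted by \<open>(u, p) \<mapsto> (am(u, p), p)\<close>; the inverse function theorem
differentiates the amplitude in both arguments at once.\<close>

lemma jacobi_am_has_derivative:
  assumes p: "0 < p" "p < 1"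
  shows "((\<lambda>(u, p). jacobi_am u p) has_derivative
     (\<lambda>(h, e). ell_delta (jacobi_am u p) p * (h - ellF_p (jacobi_am u p) p * e))) (at (u, p))"
proof -
  define x where "x = jacobi_am u p"
  have u: "u = ellF x p" by (simp add: x_def ellF_jacobi_am[OF p])
  define f where "f = (\<lambda>z::real \<times> real. (ellF (fst z) (snd z), snd z))"
  define g where "g = (\<lambda>z::real \<times> real. (jacobi_am (fst z) (snd z), snd z))"
  define f' where "f' = (\<lambda>z::real \<times> real. (1 / ell_delta x p * fst z + ellF_p x p * snd z, snd z))"
  define g' where "g' = (\<lambda>z::real \<times> real. (ell_delta x p * (fst z - ellF_p x p * snd z), snd z))"
  have "(g has_derivative g') (at (f (x, p)))"
  proof (rule has_derivative_inverse_strong[where S = "UNIV \<times> {0<..<1}" and x = "(x, p)" and f = f])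
    show "open (UNIV \<times> {0<..<1::real} :: (real \<times> real) set)" by (intro open_Times) auto
    show "(x, p) \<in> UNIV \<times> {0<..<1}" using p by auto
    show "continuous_on (UNIV \<times> {0<..<1}) f"
      unfolding f_def using continuous_on_ellF by (auto intro!: continuous_intros simp: split_beta)
    show "g (f z) = z" if "z \<in> UNIV \<times> {0<..<1}" for z
      using that by (auto simp: f_def g_def jacobi_am_ellF)
    have "((\<lambda>(x, y). ellF x y) has_derivative (\<lambda>(a, b). 1 / ell_delta x p * a + ellF_p x p * b)) (at (x, p))"
      by (rule has_derivative_from_partials[of "{0<..<1}"])
        (use p ellF_deriv_x ellF_deriv_p continuous_on_ellF_p in auto)
    then show "(f has_derivative f') (at (x, p))"
      unfolding f_def f'_def by (intro derivative_intros) (simp add: split_beta')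
    show "f' \<circ> g' = id"
      using ell_delta_nz[OF p, of x] by (auto simp: f'_def g'_def fun_eq_iff)
  qed
  then have "((\<lambda>z. fst (g z)) has_derivative (\<lambda>z. fst (g' z))) (at (u, p))"
    by (intro has_derivative_fst) (simp add: f_def u)
  then show ?thesis by (simp add: g_def g'_def split_beta' x_def)
qed

lemma jacobi_am_deriv_u:
  assumes p: "0 < p" "p < 1"
  shows "((\<lambda>u. jacobi_am u p) has_real_derivative ell_delta (jacobi_am u p) p) (at u)"
proof -
  have "((\<lambda>u. (\<lambda>(u, p). jacobi_am u p) (u, p)) has_derivative
     (\<lambda>h. (\<lambda>(h, e). ell_delta (jacobi_am u p) p * (h - ellF_p (jacobi_am u p) p * e)) (h, 0))) (at u)"
    by (rule has_derivative_compose[of "\<lambda>u. (u, p)" "\<lambda>h. (h, 0)", OF _ jacobi_am_has_derivative[OF p]])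
      (auto intro!: derivative_eq_intros)
  then show ?thesis by (simp add: has_field_derivative_def)
qed

definition wave_am :: "real \<Rightarrow> real \<Rightarrow> real" where
  "wave_am y p = jacobi_am (2 * ellK p * y) p"

definition wave_am_p :: "real \<Rightarrow> real \<Rightarrow> real" where
  "wave_am_p y p = ell_delta (wave_am y p) p *
     (2 * ((ellE p / (1 - p\<^sup>2) - ellK p) / p) * y - ellF_p (wave_am y p) p)"

lemma wave_am_deriv_y:
  assumes "0 < p" "p < 1"
  shows "((\<lambda>y. wave_am y p) has_real_derivative 2 * ellK p * ell_delta (wave_am y p) p) (at y)"
  unfolding wave_am_def
  by (rule DERIV_cong, rule DERIV_chain2[OF jacobi_am_deriv_u[OF assms]]) (auto intro!: derivative_eq_intros)

lemma wave_am_deriv_p: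
  assumes p: "0 < p" "p < 1"
  shows "((\<lambda>p. wave_am y p) has_real_derivative wave_am_p y p) (at p)"
proof -
  let ?k = "(ellE p / (1 - p\<^sup>2) - ellK p) / p"
  have "((\<lambda>p. 2 * ellK p * y) has_real_derivative 2 * ?k * y) (at p)"
    by (intro DERIV_cmult DERIV_cmult_right ellK_deriv p)
  then have "((\<lambda>p. (2 * ellK p * y, p)) has_derivative (\<lambda>e. (2 * ?k * y * e, e))) (at p)"
    unfolding has_field_derivative_def by (intro has_derivative_Pair has_derivative_ident)
  then have "((\<lambda>q. (\<lambda>(u, p). jacobi_am u p) (2 * ellK q * y, q)) has_derivative
     (\<lambda>e. (\<lambda>(h, e). ell_delta (wave_am y p) p * (h - ellF_p (wave_am y p) p * e)) (2 * ?k * y * e, e))) (at p)"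
    using jacobi_am_has_derivative[OF p, of "2 * ellK p * y"] unfolding wave_am_def
    by (rule has_derivative_compose)
  moreover have "(\<lambda>e. (\<lambda>(h, e). ell_delta (wave_am y p) p * (h - ellF_p (wave_am y p) p * e)) (2 * ?k * y * e, e))
      = (*) (wave_am_p y p)"
    by (auto simp: fun_eq_iff wave_am_p_def algebra_simps)
  ultimately show ?thesis
    by (simp only: has_field_derivative_def wave_am_def[abs_def] prod.case)
qed

lemma continuous_on_ellK: "continuous_on {0<..<1} ellK"
  by (rule DERIV_continuous_on) (auto intro: has_field_derivative_at_within ellK_deriv)

lemma continuous_on_ellE: "continuous_on {0<..<1} ellE"
  by (rule DERIV_continuous_on) (auto intro: has_field_derivative_at_within ellE_deriv)

lemma continuous_on_wave_am: "continuous_on (UNIV \<times> {0<..<1}) (\<lambda>(y, p). wave_am y p)"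
proof -
  have c: "continuous_on (UNIV \<times> {0<..<1}) (\<lambda>(u, p). jacobi_am u p)"
    using jacobi_am_has_derivative
    by (intro continuous_at_imp_continuous_on ballI) (auto simp del: split_paired_All intro!: has_derivative_continuous)
  have "continuous_on (UNIV \<times> {0<..<1}) (\<lambda>z. (\<lambda>(u, p). jacobi_am u p) (2 * ellK (snd z) * fst z, snd z))"
    by (rule continuous_on_compose2[OF c])
      (auto intro!: continuous_intros continuous_on_compose2[OF continuous_on_ellK])
  then show ?thesis by (simp add: split_beta wave_am_def)
qed

lemma continuous_on_wave_am_p: "continuous_on (UNIV \<times> {0<..<1}) (\<lambda>(y, p). wave_am_p y p)"
proof -
  note a = continuous_on_wave_am[unfolded split_beta]
  have f: "continuous_on (UNIV \<times> {0<..<1}) (\<lambda>z. (\<lambda>(x, p). ellF_p x p) (wave_am (fst z) (snd z), snd z))"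
    by (rule continuous_on_compose2[OF continuous_on_ellF_p]) (auto intro!: continuous_intros a)
  have "p\<^sup>2 \<noteq> 1" if "0 < p" "p < 1" for p :: real
    using that by (simp add: power2_eq_1_iff)
  then show ?thesis unfolding wave_am_p_def split_beta
    using f by (auto intro!: continuous_intros a continuous_on_ell_delta
      continuous_on_compose2[OF continuous_on_ellK] continuous_on_compose2[OF continuous_on_ellE])
qed

lemma wave_am_shift:
  assumes p: "0 < p" "p < 1"
  shows "wave_am (y + 1) p = wave_am y p + pi"
proof -
  have c: "continuous_on UNIV (\<lambda>t. 1 / ell_delta t p)"
    by (intro continuous_intros continuous_on_ell_delta ballI ell_delta_nz[OF p])
  have "ellF pi p = 2 * ellK p"
    unfolding ellK_def ellF_signed_integral
    by (rule signed_integral_pi[OF c]) (simp add: ell_delta_def)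
  moreover have "ellF (wave_am y p + pi) p = ellF (wave_am y p) p + ellF pi p"
    unfolding ellF_signed_integral
    by (rule signed_integral_shift[OF c]) (simp add: ell_delta_def)
  ultimately have "ellF (wave_am y p + pi) p = ellF (wave_am (y + 1) p) p"
    by (simp add: wave_am_def ellF_jacobi_am[OF p] algebra_simps)
  then show ?thesis by (simp add: ellF_inj[OF p])
qed

lemma wave_am_minus:
  assumes p: "0 < p" "p < 1"
  shows "wave_am (- y) p = - wave_am y p"
proof -
  have c: "continuous_on UNIV (\<lambda>t. 1 / ell_delta t p)"
    by (intro continuous_intros continuous_on_ell_delta ballI ell_delta_nz[OF p])
  have "ellF (- wave_am y p) p = - ellF (wave_am y p) p"
    unfolding ellF_signed_integral
    by (rule signed_integral_minus[OF c]) (simp add: ell_delta_def)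
  then have "ellF (- wave_am y p) p = ellF (wave_am (- y) p) p"
    by (simp add: wave_am_def ellF_jacobi_am[OF p])
  then show ?thesis by (simp add: ellF_inj[OF p])
qed

section \<open>The KdV periodic waves\<close>

text \<open>\<open>kdv_b\<close> is the integration constant \<open>b\<close> in \<open>k\<^sup>2 V'' = b + c V - 3 V\<^sup>2\<close>; \<open>kdv_ct_p\<close> and \<open>kdv_b_p\<close> are
derivatives in the modulus, rewritten as products or quadratic forms in \<open>E\<close> and \<open>K\<close> whose signs can
be read off.  The subscripts \<open>y\<close> and \<open>p\<close> below denote partial derivatives of the mean-zero wave.\<close>

definition kdv_b :: "real \<Rightarrow> real \<Rightarrow> real" where
  "kdv_b k p = 64 * k ^ 4 * (2 * (2 - p\<^sup>2) * ellE p * ellK p ^ 3 - (1 - p\<^sup>2) * ellK p ^ 4 - 3 * (ellE p)\<^sup>2 * (ellK p)\<^sup>2)"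

definition kdv_ct_p :: "real \<Rightarrow> real \<Rightarrow> real" where
  "kdv_ct_p k p = 16 * k\<^sup>2 * (2 * (2 - p\<^sup>2) * ellE p * ellK p - (1 - p\<^sup>2) * (ellK p)\<^sup>2 - 3 * (ellE p)\<^sup>2) / (p * (1 - p\<^sup>2))"

definition kdv_b_p :: "real \<Rightarrow> real \<Rightarrow> real" where
  "kdv_b_p k p = 384 * k ^ 4 * ellE p * ellK p * (ellE p - (1 - p\<^sup>2) * ellK p) * (ellK p - ellE p) / (p * (1 - p\<^sup>2))"

definition kdv_Uy :: "real \<Rightarrow> real \<Rightarrow> real \<Rightarrow> real" where
  "kdv_Uy k p y = - 32 * k\<^sup>2 * ellK p ^ 3 * p\<^sup>2 * sin (wave_am y p) * cos (wave_am y p) * ell_delta (wave_am y p) p"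

definition ellK_p :: "real \<Rightarrow> real" where
  "ellK_p p = (ellE p / (1 - p\<^sup>2) - ellK p) / p"

definition kdv_Up :: "real \<Rightarrow> real \<Rightarrow> real \<Rightarrow> real" where
  "kdv_Up k p y = (let s = sin (wave_am y p); c = cos (wave_am y p) in
     8 * k\<^sup>2 * (2 * ellK p * ellK_p p * (1 - p\<^sup>2 * s\<^sup>2)
       - (ellK p)\<^sup>2 * (2 * p * s\<^sup>2 + 2 * p\<^sup>2 * s * c * wave_am_p y p)
       - ((ellE p - ellK p) / p * ellK p + ellE p * ellK_p p)))"

definition kdv_Uyp :: "real \<Rightarrow> real \<Rightarrow> real \<Rightarrow> real" where
  "kdv_Uyp k p y = (let s = sin (wave_am y p); c = cos (wave_am y p); d = ell_delta (wave_am y p) p; r = wave_am_p y p in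
     - 32 * k\<^sup>2 * ((3 * (ellK p)\<^sup>2 * ellK_p p * p\<^sup>2 + 2 * p * ellK p ^ 3) * s * c * d
       + ellK p ^ 3 * p\<^sup>2 * ((c\<^sup>2 - s\<^sup>2) * r * d - s * c * (p * s\<^sup>2 + p\<^sup>2 * s * c * r) / d)))"

context
  fixes p :: real
  assumes p: "0 < p" "p < 1"
begin

private lemma p2: "p\<^sup>2 < 1" "0 < p\<^sup>2" "p\<^sup>2 \<noteq> 1" using p by (auto simp: abs_square_less_1 power2_eq_1_iff)

private lemma K: "0 < ellK p" "ellK p \<noteq> 0" using ellK_pos[OF p] by auto

lemma kdv_Ut_eq: "kdv_Ut k p y = 8 * k\<^sup>2 * ((ellK p)\<^sup>2 * (1 - p\<^sup>2 * (sin (wave_am y p))\<^sup>2) - ellE p * ellK p)"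
proof -
  have "(jacobi_dn (2 * ellK p * y) p)\<^sup>2 = 1 - p\<^sup>2 * (sin (wave_am y p))\<^sup>2"
    unfolding jacobi_dn_def wave_am_def[symmetric] ell_delta_def[symmetric] by (rule ell_delta_sq[OF p])
  then show ?thesis unfolding kdv_Ut_def by (simp only:) (use K in \<open>simp add: field_simps power2_eq_square\<close>)
qed

lemma kdv_ct_eq: "kdv_ct k p = 16 * k\<^sup>2 * ((2 - p\<^sup>2) * (ellK p)\<^sup>2 - 3 * ellE p * ellK p)"
  using K by (simp add: kdv_ct_def field_simps power2_eq_square)

lemma kdv_Ut_deriv_y: "((\<lambda>y. kdv_Ut k p y) has_real_derivative kdv_Uy k p y) (at y)"
  unfolding kdv_Ut_eq kdv_Uy_def
  by (rule derivative_eq_intros wave_am_deriv_y p refl | simp)+ (simp add: algebra_simps eval_nat_numeral)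

lemma kdv_Uy_deriv_y:
  assumes k: "k \<noteq> 0"
  shows "((\<lambda>y. kdv_Uy k p y) has_real_derivative (kdv_b k p + kdv_ct k p * kdv_Ut k p y - 3 * (kdv_Ut k p y)\<^sup>2) / k\<^sup>2) (at y)"
proof -
  define a where "a = wave_am y p"
  define d where "d = ell_delta a p"
  define S where "S = (sin a)\<^sup>2"
  have nz: "d \<noteq> 0" using ell_delta_nz[OF p] by (simp add: d_def)
  have D2: "d\<^sup>2 = 1 - p\<^sup>2 * S" using ell_delta_sq[OF p] by (simp add: S_def d_def)
  have C2: "(cos a)\<^sup>2 = 1 - S" by (simp add: S_def cos_squared_eq)
  have "((\<lambda>y. kdv_Uy k p y) has_real_derivative
      - 32 * k\<^sup>2 * ellK p ^ 3 * p\<^sup>2 * (2 * ellK p) * (((cos a)\<^sup>2 - S) * d\<^sup>2 - p\<^sup>2 * S * (cos a)\<^sup>2)) (at y)"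
    unfolding kdv_Uy_def
    by (rule derivative_eq_intros wave_am_deriv_y p refl DERIV_chain2[OF ell_delta_deriv_t] | simp)+
      (use nz in \<open>simp add: a_def[symmetric] d_def[symmetric] S_def field_simps eval_nat_numeral\<close>)
  moreover have "- 32 * k\<^sup>2 * ellK p ^ 3 * p\<^sup>2 * (2 * ellK p) * (((cos a)\<^sup>2 - S) * d\<^sup>2 - p\<^sup>2 * S * (cos a)\<^sup>2)
      = (kdv_b k p + kdv_ct k p * kdv_Ut k p y - 3 * (kdv_Ut k p y)\<^sup>2) / k\<^sup>2"
    unfolding kdv_b_def kdv_ct_eq kdv_Ut_eq a_def[symmetric] S_def[symmetric] D2 C2
    using k by (simp add: field_simps eval_nat_numeral)
  ultimately show ?thesis by simp
qed

lemma ellK_deriv': "(ellK has_real_derivative ellK_p p) (at p)"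
  using ellK_deriv[OF p] by (simp add: ellK_p_def)

lemma kdv_b_deriv_p: "((\<lambda>p. kdv_b k p) has_real_derivative kdv_b_p k p) (at p)"
proof -
  define e K' E' where "e = ellE p" and "K' = (ellE p / (1 - p\<^sup>2) - ellK p) / p" and "E' = (ellE p - ellK p) / p"
  define q where "q = ellK p"
  let ?D = "64 * k ^ 4 * (- 4 * p * e * q ^ 3 + 2 * (2 - p\<^sup>2) * (E' * q ^ 3 + 3 * e * q\<^sup>2 * K')
      + 2 * p * q ^ 4 - 4 * (1 - p\<^sup>2) * q ^ 3 * K' - 6 * e * E' * q\<^sup>2 - 6 * e\<^sup>2 * q * K')"
  have d: "((\<lambda>p. kdv_b k p) has_real_derivative ?D) (at p)"
    unfolding kdv_b_def
    by (rule derivative_eq_intros ellK_deriv[OF p, folded K'_def] ellE_deriv[OF p, folded E'_def] refl)+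
      (simp add: e_def[symmetric] q_def[symmetric] algebra_simps)
  have x: "p * (1 - p\<^sup>2) * K' = e - (1 - p\<^sup>2) * q" and y: "p * E' = e - q"
    using p p2 by (auto simp: K'_def E'_def e_def q_def field_simps)
  have "p * (1 - p\<^sup>2) * ?D = 64 * k ^ 4 * (- 4 * p\<^sup>2 * (1 - p\<^sup>2) * e * q ^ 3
      + 2 * (2 - p\<^sup>2) * ((1 - p\<^sup>2) * (p * E') * q ^ 3 + 3 * e * q\<^sup>2 * (p * (1 - p\<^sup>2) * K'))
      + 2 * p\<^sup>2 * (1 - p\<^sup>2) * q ^ 4 - 4 * (1 - p\<^sup>2) * q ^ 3 * (p * (1 - p\<^sup>2) * K')
      - 6 * e * (1 - p\<^sup>2) * (p * E') * q\<^sup>2 - 6 * e\<^sup>2 * q * (p * (1 - p\<^sup>2) * K'))"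
    by algebra
  also have "\<dots> = 384 * k ^ 4 * e * q * (e - (1 - p\<^sup>2) * q) * (q - e)"
    unfolding x y by algebra
  finally have "?D = kdv_b_p k p"
    using p p2 by (simp add: kdv_b_p_def e_def[symmetric] q_def[symmetric] nonzero_eq_divide_eq mult.commute)
  then show ?thesis using d by simp
qed

lemma kdv_Uy_deriv_p: "((\<lambda>p. kdv_Uy k p y) has_real_derivative kdv_Uyp k p y) (at p)"
proof -
  define r where "r = wave_am_p y p"
  define T where "T = p * (sin (wave_am y p))\<^sup>2 + p\<^sup>2 * sin (wave_am y p) * cos (wave_am y p) * r"
  define x where "x = - (T / ell_delta (wave_am y p) p)"
  note dr = wave_am_deriv_p[OF p, of y, folded r_def]
  have d: "((\<lambda>p. ell_delta (wave_am y p) p) has_real_derivative x) (at p)"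
    unfolding ell_delta_def x_def T_def
    by (rule derivative_eq_intros dr refl | use ell_delta_radicand_pos[OF p, of "wave_am y p"] in \<open>simp add: field_simps power2_eq_square\<close>)+
  have eq: "kdv_Uyp k p y = - 32 * k\<^sup>2 * ((3 * (ellK p)\<^sup>2 * ellK_p p * p\<^sup>2 + 2 * p * ellK p ^ 3)
        * sin (wave_am y p) * cos (wave_am y p) * ell_delta (wave_am y p) p
       + ellK p ^ 3 * p\<^sup>2 * (((cos (wave_am y p))\<^sup>2 - (sin (wave_am y p))\<^sup>2) * r * ell_delta (wave_am y p) p
           + sin (wave_am y p) * cos (wave_am y p) * x))"
    by (simp add: kdv_Uyp_def Let_def x_def r_def T_def)
  show ?thesis
    unfolding kdv_Uy_def eq
    by (rule derivative_eq_intros dr refl d ellK_deriv')+ (simp add: algebra_simps eval_nat_numeral)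
qed

lemma wave_am_eq_shift: "sin (wave_am (y + 1) p) = - sin (wave_am y p)" "cos (wave_am (y + 1) p) = - cos (wave_am y p)"
  by (simp_all add: wave_am_shift[OF p])

lemma kdv_Ut_shift: "kdv_Ut k p (y + 1) = kdv_Ut k p y"
  by (simp add: kdv_Ut_eq wave_am_eq_shift)

lemma kdv_Ut_minus: "kdv_Ut k p (- y) = kdv_Ut k p y"
  by (simp add: kdv_Ut_eq wave_am_minus[OF p])

text \<open>In the variable \<open>am(2Ky)\<close>, which grows by \<open>\<pi>\<close> over a period, the integral of \<open>dn\<^sup>2\<close> becomes a complete
integral of the second kind.\<close>

lemma kdv_Ut_mean: "avg (kdv_Ut k p) = 0"
proof -
  have c: "continuous_on UNIV (\<lambda>t. ell_delta t p)"
    by (rule continuous_on_ell_delta[OF continuous_on_id continuous_on_const])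
  let ?G = "\<lambda>y. 8 * k\<^sup>2 * ellK p * (signed_integral (\<lambda>t. ell_delta t p) (wave_am y p) / 2 - ellE p * y)"
  have 0: "wave_am 0 p = 0" using wave_am_minus[OF p, of 0] by simp
  have 1: "wave_am 1 p = pi" using wave_am_shift[OF p, of 0] 0 by simp
  have "(kdv_Ut k p has_integral ?G 1 - ?G 0) {0..1}"
  proof (rule fundamental_theorem_of_calculus)
    fix y :: real
    have "(?G has_real_derivative 8 * k\<^sup>2 * ellK p * (ellK p * (ell_delta (wave_am y p) p)\<^sup>2 - ellE p)) (at y)"
      by (rule derivative_eq_intros wave_am_deriv_y p refl DERIV_chain2[OF signed_integral_deriv[OF c]] | simp)+
        (simp add: power2_eq_square)
    then show "(?G has_vector_derivative kdv_Ut k p y) (at y within {0..1})"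
      unfolding ell_delta_sq[OF p] kdv_Ut_eq
      by (simp add: has_real_derivative_iff_has_vector_derivative has_vector_derivative_at_within algebra_simps power2_eq_square)
  qed simp
  moreover have "signed_integral (\<lambda>t. ell_delta t p) pi = 2 * ellE p"
    unfolding ellE_signed_integral by (rule signed_integral_pi[OF c]) (simp add: ell_delta_def)
  ultimately show ?thesis by (simp add: avg_def integral_unique 0 1)
qed

private lemma EK: "(1 - p\<^sup>2) * ellK p < ellE p" "ellE p < ellK p"
proof -
  have m1: "0 < 1 - p\<^sup>2" "1 - p\<^sup>2 < 1" using p2 by auto
  show "(1 - p\<^sup>2) * ellK p < ellE p"
  proof (rule power2_less_imp_less)
    have "((1 - p\<^sup>2) * ellK p)\<^sup>2 = (1 - p\<^sup>2) * ((1 - p\<^sup>2) * (ellK p)\<^sup>2)" by (simp add: power2_eq_square)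
    also have "\<dots> < 1 * ((1 - p\<^sup>2) * (ellK p)\<^sup>2)" using m1 K by (intro mult_strict_right_mono) auto
    finally show "((1 - p\<^sup>2) * ellK p)\<^sup>2 < (ellE p)\<^sup>2" using ellE_lower[OF p] by simp
  qed (use ellE_pos[OF p] in simp)
  have "2 * ellE p < 2 * ellK p"
  proof -
    have "(2 - p\<^sup>2) * ellK p < 2 * ellK p" using p2 K by (intro mult_strict_right_mono) auto
    then show ?thesis using ellE_upper[OF p] by linarith
  qed
  then show "ellE p < ellK p" by simp
qed

private lemma speed_form_pos: "0 < 2 * (2 - p\<^sup>2) * ellE p * ellK p - (1 - p\<^sup>2) * (ellK p)\<^sup>2 - 3 * (ellE p)\<^sup>2"
proof -
  define a where "a = ellE p - (1 - p\<^sup>2) * ellK p"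
  define b where "b = (2 - p\<^sup>2) * ellK p / 2 - ellE p"
  have "0 < a" using EK(1) unfolding a_def by linarith
  moreover have "0 \<le> b" using ellE_upper[OF p] unfolding b_def by linarith
  ultimately have "0 < 3 * (a * b) + 2 * ((1 - p\<^sup>2) * ellK p * b) + p\<^sup>2 * ellK p * a / 2"
    using p2 K by (intro add_nonneg_pos add_nonneg_nonneg) auto
  also have "\<dots> = 2 * (2 - p\<^sup>2) * ellE p * ellK p - (1 - p\<^sup>2) * (ellK p)\<^sup>2 - 3 * (ellE p)\<^sup>2"
    unfolding a_def b_def by (simp add: field_simps power2_eq_square)
  finally show ?thesis .
qed

lemma kdv_ct_p_pos: "k \<noteq> 0 \<Longrightarrow> 0 < kdv_ct_p k p"
  unfolding kdv_ct_p_def using speed_form_pos p p2 by (intro divide_pos_pos mult_pos_pos) auto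

lemma kdv_b_p_pos: "k \<noteq> 0 \<Longrightarrow> 0 < kdv_b_p k p"
  unfolding kdv_b_p_def using EK K ellE_pos[OF p] p p2 by (intro divide_pos_pos mult_pos_pos) auto

text \<open>The sign of the quantity that decides whether the mean-one kernel element can occur at leading order
of a Bloch wave.  Multiplied by the square of the quadratic form in \<open>kdv_ct_p\<close>, it factors into
\<open>E\<close>-\<open>K\<close> forms of known sign.\<close>

lemma kdv_not_resonant:
  assumes k: "k \<noteq> 0"
  defines "s \<equiv> - kdv_b_p k p / kdv_ct_p k p"
  shows "4 * kdv_b k p + 3 * kdv_ct k p * s - 6 * s\<^sup>2 < 0"
proof -
  define e q n where "e = ellE p" and "q = ellK p" and "n = 1 - p\<^sup>2"
  have n: "0 < n" "n < 1" using p2 by (auto simp: n_def)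
  have q: "0 < q" using K by (simp add: q_def)
  have eq: "n * q < e" "e < q" using EK by (auto simp: n_def e_def q_def)
  have e: "0 < e" using ellE_pos[OF p] by (simp add: e_def)
  \<comment> \<open>the forms behind \<open>\<partial>\<^sub>pc\<close> and \<open>\<partial>\<^sub>pb\<close>, so that \<open>s\<close> is a multiple of \<open>q f / Q\<close>\<close>
  define Q where "Q = 2 * (1 + n) * e * q - n * q\<^sup>2 - 3 * e\<^sup>2"
  define f where "f = e * (e - n * q) * (q - e)"
  define D where "D = p * n"
  define v where "v = - 3 * (q * f) / Q"
  have Q0: "2 * (2 - p\<^sup>2) * e * q - n * q\<^sup>2 - 3 * e\<^sup>2 = Q" by (simp add: Q_def n_def)
  have Q: "0 < Q" using speed_form_pos unfolding e_def[symmetric] q_def[symmetric] n_def[symmetric] Q0 .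
  have vQ: "Q * v = - 3 * (q * f)" using Q by (simp add: v_def)
  have s: "s = 8 * k\<^sup>2 * v"
  proof -
    have "kdv_b_p k p = 384 * k ^ 4 * (q * f) / D" "kdv_ct_p k p = 16 * k\<^sup>2 * Q / D"
      unfolding kdv_b_p_def kdv_ct_p_def e_def[symmetric] q_def[symmetric] n_def[symmetric] Q0
      by (simp_all add: f_def D_def mult_ac)
    moreover have "8 * k\<^sup>2 * v * (16 * k\<^sup>2 * Q / D) = 128 * k ^ 4 * (Q * v) / D"
      by (simp add: eval_nat_numeral)
    ultimately have "8 * k\<^sup>2 * v * kdv_ct_p k p = - kdv_b_p k p" by (simp add: vQ)
    moreover have "kdv_ct_p k p \<noteq> 0" using kdv_ct_p_pos[OF k] by simp
    ultimately show ?thesis unfolding s_def by (metis nonzero_eq_divide_eq)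
  qed
  have pn: "p\<^sup>2 = 1 - n" by (simp add: n_def)
  have "Q\<^sup>2 * (4 * kdv_b k p + 3 * kdv_ct k p * s - 6 * s\<^sup>2)
      = 64 * k ^ 4 * (4 * q\<^sup>2 * Q ^ 3 + 3 * q * (2 * (1 + n) * q - 6 * e) * Q * (Q * v) - 6 * (Q * v)\<^sup>2)"
    unfolding kdv_b_def kdv_ct_eq s e_def[symmetric] q_def[symmetric] pn Q_def by algebra
  also have "\<dots> = - 128 * k ^ 4 * q ^ 5 * (((1 + n) * e - 2 * n * q) * (e + n * q - 2 * n * e) * ((2 - n) * e - n * q))"
    unfolding vQ unfolding Q_def f_def by algebra
  also have "\<dots> < 0"
  proof -
    have "2 * n * q < (1 + n) * e"
    proof (rule power2_less_imp_less)
      have "(2 * n * q)\<^sup>2 = 4 * n * (n * q\<^sup>2)" by algebra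
      also have "\<dots> < (1 + n)\<^sup>2 * (n * q\<^sup>2)"
      proof (rule mult_strict_right_mono)
        have "(1 + n)\<^sup>2 - 4 * n = (1 - n)\<^sup>2" by algebra
        moreover have "0 < (1 - n)\<^sup>2" using n by simp
        ultimately show "4 * n < (1 + n)\<^sup>2" by linarith
      qed (use n q in simp)
      also have "\<dots> \<le> (1 + n)\<^sup>2 * e\<^sup>2"
        using ellE_lower[OF p] by (intro mult_left_mono) (auto simp: e_def q_def n_def)
      finally show "(2 * n * q)\<^sup>2 < ((1 + n) * e)\<^sup>2" by (simp add: power_mult_distrib)
    qed (use n e in simp)
    moreover have "0 < e + n * q - 2 * n * e"
    proof -
      have "0 < (1 - n) * e + n * (q - e)" using n e eq by (intro add_pos_pos mult_pos_pos) auto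
      then show ?thesis by (simp add: algebra_simps)
    qed
    moreover have "0 < (2 - n) * e - n * q"
    proof -
      have "n * q + (1 - n) * e < e + (1 - n) * e" using eq by simp
      moreover have "0 < (1 - n) * e" using n e by simp
      ultimately show ?thesis by (simp add: algebra_simps)
    qed
    ultimately have "0 < 128 * k ^ 4 * q ^ 5 * (((1 + n) * e - 2 * n * q) * (e + n * q - 2 * n * e) * ((2 - n) * e - n * q))"
      using k q by (intro mult_pos_pos) auto
    then show ?thesis by simp
  qed
  finally show ?thesis using Q by (simp add: mult_less_0_iff)
qed

text \<open>Nondegeneracy of the crest, where \<open>am = 0\<close>.\<close>

lemma kdv_Uyy_0_neg: "k \<noteq> 0 \<Longrightarrow> (kdv_b k p + kdv_ct k p * kdv_Ut k p 0 - 3 * (kdv_Ut k p 0)\<^sup>2) / k\<^sup>2 < 0"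
proof -
  assume k: "k \<noteq> 0"
  have 0: "wave_am 0 p = 0" using wave_am_minus[OF p, of 0] by simp
  have "kdv_b k p + kdv_ct k p * kdv_Ut k p 0 - 3 * (kdv_Ut k p 0)\<^sup>2 = - 64 * k ^ 4 * ellK p ^ 4 * p\<^sup>2"
    unfolding kdv_b_def kdv_ct_eq kdv_Ut_eq 0 by (simp add: algebra_simps eval_nat_numeral)
  then show ?thesis using k K p by (simp add: divide_neg_pos)
qed

end

lemma kdv_ct_deriv_p:
  assumes p: "0 < p" "p < 1"
  shows "((\<lambda>p. kdv_ct k p) has_real_derivative kdv_ct_p k p) (at p)"
proof -
  have p2: "p\<^sup>2 \<noteq> 1" using p by (auto simp: power2_eq_1_iff)
  define e K' E' where "e = ellE p" and "K' = (ellE p / (1 - p\<^sup>2) - ellK p) / p" and "E' = (ellE p - ellK p) / p"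
  define q where "q = ellK p"
  let ?D = "16 * k\<^sup>2 * (- 2 * p * q\<^sup>2 + 2 * (2 - p\<^sup>2) * q * K' - 3 * E' * q - 3 * e * K')"
  have d: "((\<lambda>p. 16 * k\<^sup>2 * ((2 - p\<^sup>2) * (ellK p)\<^sup>2 - 3 * ellE p * ellK p)) has_real_derivative ?D) (at p)"
    by (rule derivative_eq_intros ellK_deriv[OF p, folded K'_def] ellE_deriv[OF p, folded E'_def] refl)+
      (simp add: e_def[symmetric] q_def[symmetric] algebra_simps)
  have x: "p * (1 - p\<^sup>2) * K' = e - (1 - p\<^sup>2) * q" and y: "p * E' = e - q"
    using p p2 by (auto simp: K'_def E'_def e_def q_def field_simps)
  have "p * (1 - p\<^sup>2) * ?D = 16 * k\<^sup>2 * (- 2 * p\<^sup>2 * (1 - p\<^sup>2) * q\<^sup>2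
      + 2 * (2 - p\<^sup>2) * q * (p * (1 - p\<^sup>2) * K') - 3 * (1 - p\<^sup>2) * (p * E') * q - 3 * e * (p * (1 - p\<^sup>2) * K'))"
    by algebra
  also have "\<dots> = 16 * k\<^sup>2 * (2 * (2 - p\<^sup>2) * e * q - (1 - p\<^sup>2) * q\<^sup>2 - 3 * e\<^sup>2)"
    unfolding x y by algebra
  finally have "?D = kdv_ct_p k p"
    using p p2 by (simp add: kdv_ct_p_def e_def[symmetric] q_def[symmetric] nonzero_eq_divide_eq mult.commute)
  with d have "((\<lambda>p. 16 * k\<^sup>2 * ((2 - p\<^sup>2) * (ellK p)\<^sup>2 - 3 * ellE p * ellK p)) has_real_derivative kdv_ct_p k p) (at p)"
    by (simp only:)
  then show ?thesis
    by (rule has_field_derivative_transform_within_open[of _ _ _ "{0<..<1}"])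
      (use p in \<open>simp_all add: kdv_ct_eq\<close>)
qed

lemma kdv_Ut_deriv_p:
  assumes p: "0 < p" "p < 1"
  shows "((\<lambda>p. kdv_Ut k p y) has_real_derivative kdv_Up k p y) (at p)"
proof -
  have "((\<lambda>p. 8 * k\<^sup>2 * ((ellK p)\<^sup>2 * (1 - p\<^sup>2 * (sin (wave_am y p))\<^sup>2) - ellE p * ellK p)) has_real_derivative kdv_Up k p y) (at p)"
    by (rule derivative_eq_intros wave_am_deriv_p p refl ellK_deriv' ellE_deriv | simp)+
      (simp add: kdv_Up_def Let_def algebra_simps power2_eq_square)
  then show ?thesis
    by (rule has_field_derivative_transform_within_open[of _ _ _ "{0<..<1}"])
      (use p in \<open>auto simp: kdv_Ut_eq\<close>)
qed

lemma continuous_on_kdv_Ut: "continuous_on (UNIV \<times> {0<..<1}) (\<lambda>(y, p). kdv_Ut k p y)"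
proof -
  note a = continuous_on_wave_am[unfolded split_beta]
  have "continuous_on (UNIV \<times> {0<..<1})
     (\<lambda>z. 8 * k\<^sup>2 * ((ellK (snd z))\<^sup>2 * (1 - (snd z)\<^sup>2 * (sin (wave_am (fst z) (snd z)))\<^sup>2) - ellE (snd z) * ellK (snd z)))"
    by (auto intro!: continuous_intros a continuous_on_compose2[OF continuous_on_ellK] continuous_on_compose2[OF continuous_on_ellE])
  then show ?thesis by (rule continuous_on_eq) (auto simp: kdv_Ut_eq)
qed

lemma continuous_on_kdv_Uy: "continuous_on (UNIV \<times> {0<..<1}) (\<lambda>(y, p). kdv_Uy k p y)"
  unfolding kdv_Uy_def split_beta
  by (auto intro!: continuous_intros continuous_on_wave_am[unfolded split_beta] continuous_on_ell_delta
    continuous_on_compose2[OF continuous_on_ellK] continuous_on_compose2[OF continuous_on_ellE])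

lemma continuous_on_ellK_p: "continuous_on {0<..<1} ellK_p"
proof -
  have "q\<^sup>2 \<noteq> 1" if "0 < q" "q < 1" for q :: real
    using that by (simp add: power2_eq_1_iff)
  then show ?thesis unfolding ellK_p_def
    by (auto intro!: continuous_intros continuous_on_ellK continuous_on_ellE)
qed

lemma continuous_on_kdv_Up: "continuous_on (UNIV \<times> {0<..<1}) (\<lambda>(y, p). kdv_Up k p y)"
  unfolding kdv_Up_def split_beta Let_def
  by (auto intro!: continuous_intros continuous_on_wave_am[unfolded split_beta] continuous_on_wave_am_p[unfolded split_beta]
    continuous_on_compose2[OF continuous_on_ellK] continuous_on_compose2[OF continuous_on_ellE]
    continuous_on_compose2[OF continuous_on_ellK_p])

lemma continuous_on_kdv_Uyp: "continuous_on (UNIV \<times> {0<..<1}) (\<lambda>(y, p). kdv_Uyp k p y)"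
  unfolding kdv_Uyp_def split_beta Let_def
  by (auto intro!: continuous_intros continuous_on_wave_am[unfolded split_beta] continuous_on_wave_am_p[unfolded split_beta]
    continuous_on_compose2[OF continuous_on_ellK] continuous_on_compose2[OF continuous_on_ellE] continuous_on_ell_delta
    continuous_on_compose2[OF continuous_on_ellK_p] simp: ell_delta_nz)

lemma kdv_Up_deriv_y:
  assumes p: "0 < p" "p < 1"
  shows "((\<lambda>y. kdv_Up k p y) has_real_derivative kdv_Uyp k p y) (at y)"
  by (rule mixed_partials[where S = "{0<..<1}" and g = "\<lambda>y p. kdv_Ut k p y" and h = "\<lambda>y p. kdv_Uy k p y"])
    (use p in \<open>auto intro: kdv_Ut_deriv_y kdv_Ut_deriv_p kdv_Uy_deriv_p continuous_on_kdv_Uy continuous_on_kdv_Uyp\<close>)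

text \<open>The profile equation differentiated in the modulus.\<close>

lemma kdv_Uyp_deriv_y:
  assumes p: "0 < p" "p < 1" and k: "k \<noteq> 0"
  shows "((\<lambda>y. kdv_Uyp k p y) has_real_derivative
    (kdv_b_p k p + kdv_ct_p k p * kdv_Ut k p y + kdv_ct k p * kdv_Up k p y - 6 * kdv_Ut k p y * kdv_Up k p y) / k\<^sup>2) (at y)"
proof (rule mixed_partials[where S = "{0<..<1}" and g = "\<lambda>y p. kdv_Uy k p y" and
      h = "\<lambda>y p. (kdv_b k p + kdv_ct k p * kdv_Ut k p y - 3 * (kdv_Ut k p y)\<^sup>2) / k\<^sup>2" and
      hp = "\<lambda>y p. (kdv_b_p k p + kdv_ct_p k p * kdv_Ut k p y + kdv_ct k p * kdv_Up k p y - 6 * kdv_Ut k p y * kdv_Up k p y) / k\<^sup>2"])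
  have cb: "continuous_on {0<..<1} (\<lambda>p. kdv_b k p)"
    by (rule DERIV_continuous_on) (auto intro: has_field_derivative_at_within kdv_b_deriv_p)
  have cc: "continuous_on {0<..<1} (\<lambda>p. kdv_ct k p)"
    by (rule DERIV_continuous_on) (auto intro: has_field_derivative_at_within kdv_ct_deriv_p)
  have e: "q\<^sup>2 \<noteq> 1" if "0 < q" "q < 1" for q :: real
    using that by (simp add: power2_eq_1_iff)
  have cb': "continuous_on {0<..<1} (\<lambda>p. kdv_b_p k p)" unfolding kdv_b_p_def
    using e by (auto intro!: continuous_intros continuous_on_ellK continuous_on_ellE)
  have cc': "continuous_on {0<..<1} (\<lambda>p. kdv_ct_p k p)" unfolding kdv_ct_p_def
    using e by (auto intro!: continuous_intros continuous_on_ellK continuous_on_ellE)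
  note c = continuous_on_compose2[OF cb] continuous_on_compose2[OF cc] continuous_on_compose2[OF cb'] continuous_on_compose2[OF cc']
    continuous_on_kdv_Ut[unfolded split_beta] continuous_on_kdv_Up[unfolded split_beta]
  show "continuous_on (UNIV \<times> {0<..<1}) (\<lambda>(y, p). (kdv_b k p + kdv_ct k p * kdv_Ut k p y - 3 * (kdv_Ut k p y)\<^sup>2) / k\<^sup>2)"
    unfolding split_beta using k by (auto intro!: continuous_intros c)
  show "continuous_on (UNIV \<times> {0<..<1}) (\<lambda>(y, p). (kdv_b_p k p + kdv_ct_p k p * kdv_Ut k p y + kdv_ct k p * kdv_Up k p y - 6 * kdv_Ut k p y * kdv_Up k p y) / k\<^sup>2)"
    unfolding split_beta using k by (auto intro!: continuous_intros c)
  fix y q :: real assume "q \<in> {0<..<1}"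
  then have q: "0 < q" "q < 1" by auto
  show "((\<lambda>p. (kdv_b k p + kdv_ct k p * kdv_Ut k p y - 3 * (kdv_Ut k p y)\<^sup>2) / k\<^sup>2) has_real_derivative
    (kdv_b_p k q + kdv_ct_p k q * kdv_Ut k q y + kdv_ct k q * kdv_Up k q y - 6 * kdv_Ut k q y * kdv_Up k q y) / k\<^sup>2) (at q)"
    by (rule derivative_eq_intros kdv_b_deriv_p kdv_ct_deriv_p kdv_Ut_deriv_p q refl | simp)+ (use k in \<open>simp_all add: field_simps\<close>)
qed (use p k in \<open>auto intro: kdv_Uy_deriv_y kdv_Uy_deriv_p\<close>)

section \<open>Smooth functions\<close>

lemma Ck_const: "Ck n (\<lambda>x. c)"
  by (induction n arbitrary: c) (auto simp: frechet_derivative_const)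

lemma Ck_Suc_imp: "Ck (Suc n) f \<Longrightarrow> Ck n f"
proof (induction n arbitrary: f)
  case 0
  then show ?case
    by (auto simp: continuous_on_eq_continuous_at intro!: continuous_at_imp_continuous_on differentiable_imp_continuous_within)
next
  case (Suc n)
  then show ?case by (auto simp del: Ck.simps(2) simp: Ck.simps(2)[of "Suc n"] Ck.simps(2)[of n])
qed

lemma Ck_le: "Ck m f \<Longrightarrow> n \<le> m \<Longrightarrow> Ck n f"
  by (induction m) (auto simp: le_Suc_eq intro: Ck_Suc_imp simp del: Ck.simps)

lemma Ck_imp_continuous: "Ck n f \<Longrightarrow> continuous_on UNIV f"
  using Ck_le[of n f 0] by simp

lemma Ck_SucI:
  assumes "\<And>x. (f has_derivative f' x) (at x)" "\<And>v. Ck n (\<lambda>x. f' x v)"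
  shows "Ck (Suc n) f"
proof -
  have "frechet_derivative f (at x) = f' x" for x
    using frechet_derivative_at[OF assms(1)] by simp
  then show ?thesis using assms by (auto simp: differentiable_def)
qed

lemma Ck_SucD:
  assumes "Ck (Suc n) f"
  shows "(f has_derivative frechet_derivative f (at x)) (at x)" "Ck n (\<lambda>x. frechet_derivative f (at x) v)"
  using assms by (auto simp: frechet_derivative_works)

lemma Ck_add: "Ck n f \<Longrightarrow> Ck n g \<Longrightarrow> Ck n (\<lambda>x. f x + g x)"
proof (induction n arbitrary: f g)
  case 0
  then show ?case by (auto intro: continuous_intros)
next
  case (Suc n)
  note f = Ck_SucD[OF Suc.prems(1)] and g = Ck_SucD[OF Suc.prems(2)]
  show ?case
    by (rule Ck_SucI) (rule has_derivative_add[OF f(1) g(1)], rule Suc.IH[OF f(2) g(2)])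
qed

lemma Ck_linear: "bounded_linear L \<Longrightarrow> Ck n f \<Longrightarrow> Ck n (\<lambda>x. L (f x))"
proof (induction n arbitrary: f)
  case 0
  then show ?case by (auto intro: bounded_linear.continuous_on)
next
  case (Suc n)
  note f = Ck_SucD[OF Suc.prems(2)]
  show ?case
    by (rule Ck_SucI) (rule bounded_linear.has_derivative[OF Suc.prems(1) f(1)], rule Suc.IH[OF Suc.prems(1) f(2)])
qed

lemma Ck_compose_linear: "bounded_linear L \<Longrightarrow> Ck n f \<Longrightarrow> Ck n (\<lambda>x. f (L x))"
proof (induction n arbitrary: f)
  case 0
  then show ?case
    by (auto intro: continuous_on_compose2[of UNIV f] simp: linear_continuous_on)
next
  case (Suc n)
  note f = Ck_SucD[OF Suc.prems(2)]
  show ?case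
  proof (rule Ck_SucI)
    show "((\<lambda>x. f (L x)) has_derivative (\<lambda>v. frechet_derivative f (at (L x)) (L v))) (at x)" for x
      by (rule has_derivative_compose[OF bounded_linear_imp_has_derivative[OF Suc.prems(1)] f(1)])
  qed (rule Suc.IH[OF Suc.prems(1) f(2)])
qed

lemma Ck_mult:
  fixes f g :: "'a::real_normed_vector \<Rightarrow> real"
  shows "Ck n f \<Longrightarrow> Ck n g \<Longrightarrow> Ck n (\<lambda>x. f x * g x)"
proof (induction n arbitrary: f g)
  case 0
  then show ?case by (auto intro: continuous_intros)
next
  case (Suc n)
  note f = Ck_SucD[OF Suc.prems(1)] and g = Ck_SucD[OF Suc.prems(2)]
  show ?case
    by (rule Ck_SucI) (rule has_derivative_mult[OF f(1) g(1)],
      intro Ck_add Suc.IH f(2) g(2) Ck_Suc_imp[OF Suc.prems(1)] Ck_Suc_imp[OF Suc.prems(2)])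
qed

lemma Ck_cmult: "Ck n f \<Longrightarrow> Ck n (\<lambda>x. c * f x)" for f :: "'a::real_normed_vector \<Rightarrow> real"
  by (rule Ck_mult[OF Ck_const])

lemma Ck_diff: "Ck n f \<Longrightarrow> Ck n g \<Longrightarrow> Ck n (\<lambda>x. f x - g x)"
  using Ck_add[of n f "\<lambda>x. - g x"] Ck_linear[OF bounded_linear_minus[OF bounded_linear_ident], of n g] by simp

text \<open>Functions of one real variable.\<close>

lemma D_eqI: "(f has_vector_derivative f') (at y) \<Longrightarrow> D f y = f'"
  by (simp add: D_def vector_derivative_at)

lemma D_eqI_real: "(f has_real_derivative f') (at y) \<Longrightarrow> D f y = f'"
  by (rule D_eqI) (simp add: has_real_derivative_iff_has_vector_derivative)

lemma D_funI: "(\<And>y. (f has_real_derivative f' y) (at y)) \<Longrightarrow> D f = f'"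
  by (rule ext) (rule D_eqI_real)

lemma Ck_Suc_D:
  assumes "Ck (Suc n) f"
  shows "(f has_vector_derivative D f y) (at y)" "Ck n (D f)"
proof -
  have d: "(f has_vector_derivative D f y) (at y)" for y
    using assms by (simp add: D_def vector_derivative_works[symmetric])
  have e: "D f = (\<lambda>y. frechet_derivative f (at y) 1)"
  proof
    fix y
    have "(\<lambda>v. v *\<^sub>R D f y) = frechet_derivative f (at y)"
      using d[of y] unfolding has_vector_derivative_def by (rule frechet_derivative_at)
    from fun_cong[OF this, of 1] show "D f y = frechet_derivative f (at y) 1" by simp
  qed
  show "(f has_vector_derivative D f y) (at y)" by (rule d)
  show "Ck n (D f)" unfolding e by (rule Ck_SucD(2)[OF assms])
qed

lemma Ck_SucI_real:
  assumes "\<And>y. (f has_vector_derivative f' y) (at y)" "Ck n f'"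
  shows "Ck (Suc n) f"
proof (rule Ck_SucI)
  show "(f has_derivative (\<lambda>v. v *\<^sub>R f' y)) (at y)" for y
    using assms(1) by (simp add: has_vector_derivative_def)
  show "Ck n (\<lambda>x. v *\<^sub>R f' x)" for v
    by (rule Ck_linear[OF bounded_linear_scaleR_right assms(2)])
qed

lemma Ck_funpow_D: "Ck n f \<Longrightarrow> j \<le> n \<Longrightarrow> Ck (n - j) ((D ^^ j) f)"
proof (induction j)
  case (Suc j)
  then have "Ck (Suc (n - Suc j)) ((D ^^ j) f)" by (simp del: Ck.simps add: Suc_diff_Suc)
  then show ?case by (simp del: Ck.simps add: Ck_Suc_D(2))
qed simp

lemma Ck_funpow_D_deriv:
  assumes "Ck n f" "j < n"
  shows "((D ^^ j) f has_vector_derivative (D ^^ Suc j) f y) (at y)"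
proof -
  have "Ck (Suc (n - Suc j)) ((D ^^ j) f)"
    using Ck_funpow_D[OF assms(1), of j] assms(2) by (simp del: Ck.simps add: Suc_diff_Suc)
  then show ?thesis using Ck_Suc_D(1)[of "n - Suc j" "(D ^^ j) f" y] by simp
qed

lemma Ck_funpow_D_continuous: "Ck n f \<Longrightarrow> j \<le> n \<Longrightarrow> continuous_on UNIV ((D ^^ j) f)"
  by (rule Ck_imp_continuous[OF Ck_funpow_D])

lemma periodic_deriv:
  fixes y :: real
  assumes "\<And>y. (f has_vector_derivative f' y) (at y)" "\<And>y. f (y + 1) = f y"
  shows "f' (y + 1) = f' y"
proof -
  have "((\<lambda>y. f (y + 1)) has_vector_derivative f' (y + 1)) (at y)"
  proof -
    have "((\<lambda>y::real. y + 1) has_vector_derivative 1) (at y)"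
      unfolding has_real_derivative_iff_has_vector_derivative[symmetric] by (auto intro!: derivative_eq_intros)
    from vector_diff_chain_at[OF this assms(1)] show ?thesis by (simp add: o_def)
  qed
  then have "(f has_vector_derivative f' (y + 1)) (at y)" by (simp add: assms(2))
  then show ?thesis using assms(1) vector_derivative_unique_at by blast
qed

lemma one_periodic_D: "Ck (Suc n) f \<Longrightarrow> one_periodic f \<Longrightarrow> one_periodic (D f)"
  unfolding one_periodic_def using periodic_deriv[of f "D f"] Ck_Suc_D(1) by blast

lemma one_periodic_funpow_D: "Ck n f \<Longrightarrow> one_periodic f \<Longrightarrow> j \<le> n \<Longrightarrow> one_periodic ((D ^^ j) f)"
proof (induction j)
  case (Suc j)
  then have "Ck (Suc (n - Suc j)) ((D ^^ j) f)"
    using Ck_funpow_D[of n f j] by (simp del: Ck.simps add: Suc_diff_Suc)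
  with Suc show ?case by (simp del: Ck.simps add: one_periodic_D)
qed simp

section \<open>Averages\<close>

lemma has_integral_avg: "continuous_on UNIV f \<Longrightarrow> (f has_integral avg f) {0..1}" for f :: "real \<Rightarrow> 'a::banach"
  unfolding avg_def by (rule integrable_integral[OF integrable_continuous_real[OF continuous_on_subset]]) auto

lemma avg_eqI: "(f has_integral i) {0..1} \<Longrightarrow> avg f = i"
  by (simp add: avg_def integral_unique)

lemma avg_add: "continuous_on UNIV f \<Longrightarrow> continuous_on UNIV g \<Longrightarrow> avg (\<lambda>y. f y + g y) = avg f + avg g"
  for f :: "real \<Rightarrow> 'a::banach"
  by (intro avg_eqI has_integral_add has_integral_avg)

lemma avg_diff: "continuous_on UNIV f \<Longrightarrow> continuous_on UNIV g \<Longrightarrow> avg (\<lambda>y. f y - g y) = avg f - avg g"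
  for f :: "real \<Rightarrow> 'a::banach"
  by (intro avg_eqI has_integral_diff has_integral_avg)

lemma avg_cmult: "avg (\<lambda>y. c * f y) = c * avg f" for c :: "'a::{real_normed_field,banach}"
  by (simp add: avg_def)

lemma avg_const: "avg (\<lambda>y. c) = c"
  by (simp add: avg_def)

lemma avg_deriv:
  fixes F :: "real \<Rightarrow> 'a::banach"
  assumes "\<And>y. (F has_vector_derivative f y) (at y)"
  shows "avg f = F 1 - F 0"
  by (rule avg_eqI, rule fundamental_theorem_of_calculus)
    (auto intro: has_vector_derivative_at_within assms)

lemma avg_periodic_deriv:
  fixes F :: "real \<Rightarrow> 'a::banach"
  assumes "\<And>y. (F has_vector_derivative f y) (at y)" "one_periodic F"
  shows "avg f = 0"
  using avg_deriv[OF assms(1)] assms(2)[unfolded one_periodic_def, rule_format, of 0] by simp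

lemma avg_odd:
  fixes f :: "real \<Rightarrow> real"
  assumes "continuous_on UNIV f" "one_periodic f" "\<And>y. f (- y) = - f y"
  shows "avg f = 0"
proof -
  define F where "F = signed_integral f"
  have d: "(F has_real_derivative f y) (at y)" for y
    unfolding F_def by (rule signed_integral_deriv[OF assms(1)])
  have "((\<lambda>y. F y - F (- y)) has_real_derivative 0) (at y)" for y
    by (auto intro!: derivative_eq_intros DERIV_chain2[OF d] d simp: assms(3))
  then have 1: "F (1/2) - F (- (1/2)) = F 0 - F (- 0)" by (rule DERIV_isconst_all[rule_format])
  have "((\<lambda>y. F (y + 1) - F y) has_real_derivative 0) (at y)" for y
    using assms(2) by (auto intro!: derivative_eq_intros DERIV_chain2[OF d] d simp: one_periodic_def)
  then have 2: "F (0 + 1) - F 0 = F (- (1/2) + 1) - F (- (1/2))" by (rule DERIV_isconst_all[rule_format])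
  have "avg f = F 1 - F 0"
    by (rule avg_deriv) (use d in \<open>simp add: has_real_derivative_iff_has_vector_derivative\<close>)
  then show ?thesis using 1 2 by simp
qed

section \<open>The linearized KdV operator\<close>

text \<open>Uniqueness for \<open>h'' = q h\<close> by Gronwall: \<open>h\<^sup>2 + h'\<^sup>2\<close> times a decaying exponential is nonincreasing.\<close>

lemma linear_ode_zero:
  fixes h h1 q :: "real \<Rightarrow> real"
  assumes h: "\<And>y. (h has_real_derivative h1 y) (at y)"
    and h1: "\<And>y. (h1 has_real_derivative q y * h y) (at y)"
    and q: "continuous_on {0..1} q" and init: "h 0 = 0" "h1 0 = 0"
    and y: "0 \<le> y" "y \<le> 1"
  shows "h y = 0"
proof -
  obtain C where C: "\<And>t. t \<in> {0..1} \<Longrightarrow> \<bar>q t\<bar> \<le> C"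
    using compact_imp_bounded[OF compact_continuous_image[OF q]] by (force simp: bounded_iff)
  define e where "e t = (h t)\<^sup>2 + (h1 t)\<^sup>2" for t
  define w where "w t = e t * exp (- (1 + C) * t)" for t
  have "w y \<le> w 0"
  proof (rule DERIV_nonpos_imp_nonincreasing[OF y(1)])
    fix t assume t: "0 \<le> t" "t \<le> y"
    have dw: "(w has_real_derivative (2 * (1 + q t) * (h t * h1 t) - (1 + C) * e t) * exp (- (1 + C) * t)) (at t)"
      unfolding w_def e_def by (rule derivative_eq_intros h h1 refl)+ (simp add: algebra_simps power2_eq_square)
    have "\<bar>q t\<bar> \<le> C" using C[of t] t y by auto
    have "2 * (1 + q t) * (h t * h1 t) = (1 + q t) * (2 * h t * h1 t)" by simp
    also have "\<dots> \<le> \<bar>(1 + q t) * (2 * h t * h1 t)\<bar>" by (rule abs_ge_self)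
    also have "\<dots> = \<bar>1 + q t\<bar> * \<bar>2 * h t * h1 t\<bar>" by (rule abs_mult)
    also have "\<dots> \<le> (1 + C) * e t"
    proof (rule mult_mono)
      show "\<bar>2 * h t * h1 t\<bar> \<le> e t"
        using sum_squares_bound[of "h t" "h1 t"] sum_squares_bound[of "h t" "- h1 t"] by (auto simp: e_def abs_le_iff)
    qed (use \<open>\<bar>q t\<bar> \<le> C\<close> in auto)
    finally show "\<exists>z. (w has_real_derivative z) (at t) \<and> z \<le> 0"
      using dw by (intro exI conjI) (auto intro!: mult_nonpos_nonneg)
  qed
  then have "e y \<le> 0" by (simp add: w_def e_def init mult_le_0_iff)
  then show ?thesis by (simp add: e_def sum_power2_le_zero_iff)
qed

lemma periodic_zero:
  fixes f :: "real \<Rightarrow> 'a::zero"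
  assumes "one_periodic f" "\<And>y. 0 \<le> y \<Longrightarrow> y \<le> 1 \<Longrightarrow> f y = 0"
  shows "f y = 0"
proof -
  have up: "f (x + real n) = f x" for x n
  proof (induction n)
    case (Suc n)
    have "f (x + real (Suc n)) = f ((x + real n) + 1)" by (simp add: algebra_simps)
    then show ?case using Suc assms(1) by (simp add: one_periodic_def)
  qed simp
  have 0: "f (frac y) = 0" using assms(2) frac_lt_1[of y] by (simp add: less_imp_le)
  show ?thesis
  proof (cases "0 \<le> \<lfloor>y\<rfloor>")
    case True
    then have "y = frac y + real (nat \<lfloor>y\<rfloor>)" by (simp add: frac_def)
    then show ?thesis using up[of "frac y" "nat \<lfloor>y\<rfloor>"] 0 by simp
  next
    case False
    then have "frac y = y + real (nat (- \<lfloor>y\<rfloor>))" by (simp add: frac_def)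
    then show ?thesis using up[of y "nat (- \<lfloor>y\<rfloor>)"] 0 by simp
  qed
qed

locale kdv_wave =
  fixes k p :: real
  assumes k: "0 < k" and p: "0 < p" "p < 1"
begin

text \<open>\<open>V\<close> is the wave of mean zero and \<open>W\<close> its derivative in the modulus; numbered names are their
  derivatives in \<open>y\<close>.  From the second derivative on they are defined by the profile equation and its
  derivatives, so that regularity of any order comes from the equation.\<close>

abbreviation "V \<equiv> kdv_Ut k p"
abbreviation "V1 \<equiv> kdv_Uy k p"
abbreviation "W \<equiv> kdv_Up k p"
abbreviation "W1 \<equiv> kdv_Uyp k p"
abbreviation "ct \<equiv> kdv_ct k p"
abbreviation "ctp \<equiv> kdv_ct_p k p"
abbreviation "b \<equiv> kdv_b k p"
abbreviation "bp \<equiv> kdv_b_p k p"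

definition "V2 y = (b + ct * V y - 3 * (V y)\<^sup>2) / k\<^sup>2"
definition "V3 y = (ct * V1 y - 6 * V y * V1 y) / k\<^sup>2"
definition "V4 y = (ct * V2 y - 6 * (V1 y)\<^sup>2 - 6 * V y * V2 y) / k\<^sup>2"
definition "W2 y = (bp + ctp * V y + ct * W y - 6 * V y * W y) / k\<^sup>2"
definition "W3 y = (ctp * V1 y + ct * W1 y - 6 * V1 y * W y - 6 * V y * W1 y) / k\<^sup>2"

lemma k_nz: "k \<noteq> 0" using k by simp
lemma ctp_nz: "ctp \<noteq> 0" using kdv_ct_p_pos[OF p k_nz] by simp

lemma dV: "(V has_real_derivative V1 y) (at y)" by (rule kdv_Ut_deriv_y[OF p])
lemma dV1: "(V1 has_real_derivative V2 y) (at y)"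
  unfolding V2_def by (rule kdv_Uy_deriv_y[OF p k_nz])
lemma dV2: "(V2 has_real_derivative V3 y) (at y)"
  unfolding V2_def[abs_def] V3_def
  by (rule DERIV_cdivide, (rule derivative_eq_intros dV refl)+) simp
lemma dV3: "(V3 has_real_derivative V4 y) (at y)"
  unfolding V3_def[abs_def] V4_def
  by (rule DERIV_cdivide, (rule derivative_eq_intros dV dV1 refl)+) (simp add: power2_eq_square)
lemma dW: "(W has_real_derivative W1 y) (at y)" by (rule kdv_Up_deriv_y[OF p])
lemma dW1: "(W1 has_real_derivative W2 y) (at y)"
  unfolding W2_def by (rule kdv_Uyp_deriv_y[OF p k_nz])
lemma dW2: "(W2 has_real_derivative W3 y) (at y)"
  unfolding W2_def[abs_def] W3_def
  by (rule DERIV_cdivide, (rule derivative_eq_intros dV dW refl)+) simp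

lemma cont: "continuous_on S V" "continuous_on S V1" "continuous_on S V2" "continuous_on S V3"
  "continuous_on S W" "continuous_on S W1" "continuous_on S W2" "continuous_on S W3"
proof -
  show "continuous_on S V" "continuous_on S V1" "continuous_on S V2" "continuous_on S V3"
    "continuous_on S W" "continuous_on S W1" "continuous_on S W2"
    by (rule DERIV_continuous_on, rule has_field_derivative_at_within, rule dV dV1 dV2 dV3 dW dW1 dW2)+
  then show "continuous_on S W3" unfolding W3_def[abs_def] using k_nz by (intro continuous_intros) auto
qed

lemma cont_V4: "continuous_on S V4"
  unfolding V4_def[abs_def] using k_nz by (intro continuous_intros cont) auto

lemma periodic_V: "one_periodic V" unfolding one_periodic_def using kdv_Ut_shift[OF p] by blast

lemma W_cong: "(\<And>q. 0 < q \<Longrightarrow> q < 1 \<Longrightarrow> kdv_Ut k q y = kdv_Ut k q z) \<Longrightarrow> W y = W z"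
proof -
  assume *: "\<And>q. 0 < q \<Longrightarrow> q < 1 \<Longrightarrow> kdv_Ut k q y = kdv_Ut k q z"
  have "((\<lambda>q. kdv_Ut k q z) has_real_derivative W y) (at p)"
    by (rule has_field_derivative_transform_within_open[OF kdv_Ut_deriv_p[OF p], of "{0<..<1}"]) (use p * in auto)
  then show ?thesis using kdv_Ut_deriv_p[OF p] DERIV_unique by blast
qed

lemma periodic_W: "one_periodic W"
  unfolding one_periodic_def using W_cong kdv_Ut_shift by blast

lemma even_V: "V (- y) = V y" by (rule kdv_Ut_minus[OF p])
lemma even_W: "W (- y) = W y" using W_cong kdv_Ut_minus by blast
lemma odd_V1: "V1 (- y) = - V1 y"
proof -
  have "((\<lambda>y. V (- y)) has_real_derivative - V1 (- y)) (at y)"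
    by (rule DERIV_cong, rule DERIV_chain2[OF dV], rule DERIV_minus, rule DERIV_ident) simp
  then have "(V has_real_derivative - V1 (- y)) (at y)" by (simp add: even_V)
  then show ?thesis using DERIV_unique[OF dV] by force
qed

lemma vd:
  "(V has_vector_derivative V1 y) (at y)" "(V1 has_vector_derivative V2 y) (at y)"
  "(V2 has_vector_derivative V3 y) (at y)" "(V3 has_vector_derivative V4 y) (at y)"
  "(W has_vector_derivative W1 y) (at y)" "(W1 has_vector_derivative W2 y) (at y)"
  "(W2 has_vector_derivative W3 y) (at y)"
  using dV dV1 dV2 dV3 dW dW1 dW2 by (simp_all add: has_real_derivative_iff_has_vector_derivative)

lemma periodic: "one_periodic V" "one_periodic V1" "one_periodic V2" "one_periodic V3"
  "one_periodic W" "one_periodic W1" "one_periodic W2"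
proof -
  show 1: "one_periodic V" "one_periodic W" by (fact periodic_V periodic_W)+
  show 2: "one_periodic V1" "one_periodic W1"
    using 1 periodic_deriv[of V V1] periodic_deriv[of W W1] vd unfolding one_periodic_def by blast+
  show 3: "one_periodic V2" "one_periodic W2"
    using 2 periodic_deriv[of V1 V2] periodic_deriv[of W1 W2] vd unfolding one_periodic_def by blast+
  show "one_periodic V3"
    using 3 periodic_deriv[of V2 V3] vd unfolding one_periodic_def by blast
qed

lemma mean_V: "avg V = 0" using kdv_Ut_mean[OF p] by simp

lemma mean_W: "avg W = 0"
proof -
  have d: "((\<lambda>q. integral {0..1} (kdv_Ut k q)) has_real_derivative integral {0..1} W) (at p)"
  proof (rule deriv_integral_param[where S = "{0<..<1}"])
    show "continuous_on ({0<..<1} \<times> {0..1}) (\<lambda>(q, y). kdv_Up k q y)"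
    proof -
      have "continuous_on ({0<..<1} \<times> {0..1}) (\<lambda>z. (\<lambda>(y, q). kdv_Up k q y) (snd z, fst z))"
        by (rule continuous_on_compose2[OF continuous_on_kdv_Up]) (auto intro!: continuous_intros)
      then show ?thesis by (simp add: split_beta)
    qed
    show "continuous_on {0..1} (kdv_Ut k q)" if "q \<in> {0<..<1}" for q
      by (rule DERIV_continuous_on) (use that in \<open>auto intro: has_field_derivative_at_within kdv_Ut_deriv_y\<close>)
  qed (use p in \<open>auto intro: kdv_Ut_deriv_p\<close>)
  have "((\<lambda>q. 0) has_real_derivative integral {0..1} W) (at p)"
    by (rule has_field_derivative_transform_within_open[OF d, of "{0<..<1}"])
      (use p kdv_Ut_mean in \<open>auto simp: avg_def\<close>)
  then show ?thesis unfolding avg_def by (rule DERIV_unique) simp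
qed

lemma V1_0: "V1 0 = 0" using odd_V1[of 0] by simp
lemma V2_0: "V2 0 \<noteq> 0" using kdv_Uyy_0_neg[OF p k_nz] unfolding V2_def by (rule less_imp_neq)

text \<open>The kernel element of the linearized operator that has mean one.\<close>

definition "kphi y = 1 - 6 / ctp * W y"

text \<open>Subtracting a multiple of \<open>kphi\<close> leaves a mean-zero kernel element \<open>g\<close>, and one integration gives
\<open>k\<^sup>2 g'' + (6 V - c) g = A\<close>.  Pairing this with \<open>1\<close> and with \<open>\<partial>\<^sub>pV\<close> gives \<open>A = 0\<close> and
\<open>\<langle>V g\<rangle> = 0\<close>.  Then the scaling field \<open>2 V + y V'\<close>, which the operator maps to
\<open>4 b + 2 c V\<close> and which is not periodic, pairs with \<open>g\<close> to a boundary term proportional to \<open>V''(0) g(0)\<close>, so \<open>g(0) = 0\<close>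
and \<open>g\<close> is a multiple of \<open>V'\<close> by uniqueness for the second-order equation.\<close>

lemma linearized_kernel_real:
  fixes f f1 f2 f3 :: "real \<Rightarrow> real"
  assumes f: "\<And>y. (f has_real_derivative f1 y) (at y)" "\<And>y. (f1 has_real_derivative f2 y) (at y)"
      "\<And>y. (f2 has_real_derivative f3 y) (at y)"
    and per: "one_periodic f"
    and eq: "\<And>y. k * (6 * V1 y * f y + (6 * V y - ct) * f1 y) + k ^ 3 * f3 y = 0"
  shows "\<exists>\<alpha>. \<forall>y. f y = avg f * kphi y + \<alpha> * V1 y"
proof -
  define m where "m = avg f"
  define r where "r = 6 / ctp"
  have r: "r * ctp = 6" using ctp_nz by (simp add: r_def)
  define g where "g y = f y - m * (1 - r * W y)" for y
  define g1 where "g1 y = f1 y + m * r * W1 y" for y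
  define g2 where "g2 y = f2 y + m * r * W2 y" for y
  define g3 where "g3 y = f3 y + m * r * W3 y" for y
  have dg: "(g has_real_derivative g1 y) (at y)" "(g1 has_real_derivative g2 y) (at y)"
    "(g2 has_real_derivative g3 y) (at y)" for y
    unfolding g_def[abs_def] g1_def[abs_def] g2_def[abs_def] g3_def[abs_def]
    by (rule derivative_eq_intros f dW dW1 dW2 refl | simp)+
  have cf: "continuous_on S f" for S by (rule DERIV_continuous_on[OF has_field_derivative_at_within[OF f(1)]])
  have cg: "continuous_on S g" "continuous_on S g1" for S
    by (rule DERIV_continuous_on[OF has_field_derivative_at_within[OF dg(1)]])
       (rule DERIV_continuous_on[OF has_field_derivative_at_within[OF dg(2)]])
  have pg: "g (y + 1) = g y" for y
    using per periodic(5) by (simp add: g_def one_periodic_def)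
  have pg1: "g1 (y + 1) = g1 y" for y
    by (rule periodic_deriv[of g g1]) (use dg(1) pg in \<open>auto simp: has_real_derivative_iff_has_vector_derivative\<close>)
  have mg: "avg g = 0"
  proof -
    have "g = (\<lambda>y. f y - (m - (m * r) * W y))" by (simp add: g_def[abs_def] algebra_simps)
    then have "avg g = avg f - (m - m * r * avg W)"
      by (simp add: avg_diff avg_cmult avg_const cf cont continuous_on_diff continuous_on_mult continuous_on_const)
    then show ?thesis by (simp add: m_def mean_W)
  qed
  have eqg: "k\<^sup>2 * g3 y + (6 * V1 y * g y + (6 * V y - ct) * g1 y) = 0" for y
  proof -
    have W3: "k\<^sup>2 * W3 y = ctp * V1 y + ct * W1 y - 6 * V1 y * W y - 6 * V y * W1 y"
      using k_nz by (simp add: W3_def)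
    have "k * (k\<^sup>2 * g3 y + (6 * V1 y * g y + (6 * V y - ct) * g1 y)) =
      (k * (6 * V1 y * f y + (6 * V y - ct) * f1 y) + k ^ 3 * f3 y) + k * m * (r * (k\<^sup>2 * W3 y) - 6 * V1 y * (1 - r * W y)
        + (6 * V y - ct) * (r * W1 y))"
      unfolding g_def g1_def g3_def by algebra
    also have "\<dots> = k * m * (r * ctp - 6) * V1 y"
      unfolding eq W3 by algebra
    finally show ?thesis using r k_nz by simp
  qed
  have "((\<lambda>y. k\<^sup>2 * g2 y + (6 * V y - ct) * g y) has_real_derivative 0) (at y)" for y
    by (rule derivative_eq_intros dg dV refl)+ (use eqg[of y] in \<open>simp add: algebra_simps\<close>)
  then have A: "k\<^sup>2 * g2 y + (6 * V y - ct) * g y = k\<^sup>2 * g2 0 + (6 * V 0 - ct) * g 0" (is "_ = ?A") for y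
    by (rule DERIV_isconst_all[rule_format])
  define A where "A = ?A"
  have A: "k\<^sup>2 * g2 y = A - (6 * V y - ct) * g y" for y using A[of y] unfolding A_def by simp
  have cVg: "continuous_on UNIV (\<lambda>y. V y * g y)" by (intro continuous_intros cont cg)
  define i where "i = avg (\<lambda>y. V y * g y)"
  have iVg: "((\<lambda>y. V y * g y) has_integral i) {0..1}" unfolding i_def by (rule has_integral_avg[OF cVg])
  have ig: "(g has_integral 0) {0..1}" using has_integral_avg[OF cg(1)] mg by simp
  have iW: "(W has_integral 0) {0..1}" using has_integral_avg[OF cont(5)] mean_W by simp
  have ftc: "(z has_integral 0) {0..1}" if "\<And>y. (Z has_real_derivative z y) (at y)" "Z 1 = Z 0" for Z z :: "real \<Rightarrow> real"
    using fundamental_theorem_of_calculus[of 0 1 Z z] that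
    by (auto simp: has_real_derivative_iff_has_vector_derivative intro: has_vector_derivative_at_within)
  have V_per: "V 1 = V 0" "V1 1 = V1 0" "V2 1 = V2 0" "W 1 = W 0" "W1 1 = W1 0" "g 1 = g 0" "g1 1 = g1 0"
    using periodic[unfolded one_periodic_def, rule_format, of 0] pg[of 0] pg1[of 0] by auto
  have "((\<lambda>y. A - 6 * (V y * g y) + ct * g y) has_integral 0) {0..1}"
  proof (rule ftc[of "\<lambda>y. k\<^sup>2 * g1 y"])
    fix y
    have "A - 6 * (V y * g y) + ct * g y = k\<^sup>2 * g2 y" using A[of y] by (simp add: algebra_simps)
    then show "((\<lambda>y. k\<^sup>2 * g1 y) has_real_derivative A - 6 * (V y * g y) + ct * g y) (at y)"
      by (simp only:) (rule DERIV_cmult[OF dg(2)])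
  qed (simp only: V_per)
  moreover have "((\<lambda>y. A - 6 * (V y * g y) + ct * g y) has_integral A - 6 * i + ct * 0) {0..1}"
    by (intro has_integral_add has_integral_diff has_integral_mult_right iVg ig) (use has_integral_const_real[of A 0 1] in simp)
  ultimately have "0 = A - 6 * i + ct * 0" by (rule has_integral_unique)
  then have A1: "A = 6 * i" by simp
  have kW2: "k\<^sup>2 * W2 y = bp + ctp * V y + ct * W y - 6 * V y * W y" for y using k_nz by (simp add: W2_def)
  have "((\<lambda>y. A * W y - bp * g y - ctp * (V y * g y)) has_integral 0) {0..1}"
  proof (rule ftc[of "\<lambda>y. k\<^sup>2 * (W y * g1 y - W1 y * g y)"])
    fix y
    have "A * W y - bp * g y - ctp * (V y * g y) = W y * (k\<^sup>2 * g2 y) - (k\<^sup>2 * W2 y) * g y"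
      unfolding A kW2 by algebra
    moreover have "((\<lambda>y. k\<^sup>2 * (W y * g1 y - W1 y * g y)) has_real_derivative W y * (k\<^sup>2 * g2 y) - (k\<^sup>2 * W2 y) * g y) (at y)"
      by (rule derivative_eq_intros dg dW dW1 refl)+ (simp add: algebra_simps)
    ultimately show "((\<lambda>y. k\<^sup>2 * (W y * g1 y - W1 y * g y)) has_real_derivative A * W y - bp * g y - ctp * (V y * g y)) (at y)"
      by (simp only:)
  qed (simp only: V_per)
  moreover have "((\<lambda>y. A * W y - bp * g y - ctp * (V y * g y)) has_integral A * 0 - bp * 0 - ctp * i) {0..1}"
    by (intro has_integral_diff has_integral_mult_right iVg ig iW)
  ultimately have "0 = A * 0 - bp * 0 - ctp * i" by (rule has_integral_unique)
  then have "ctp * i = 0" by simp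
  then have i: "i = 0" "A = 0" using ctp_nz A1 by auto
  have kV2: "k\<^sup>2 * V2 y = b + ct * V y - 3 * (V y)\<^sup>2" for y using k_nz by (simp add: V2_def)
  have kV3: "k\<^sup>2 * V3 y = ct * V1 y - 6 * V y * V1 y" for y using k_nz by (simp add: V3_def)
  let ?Z = "\<lambda>y. k\<^sup>2 * ((2 * V y + y * V1 y) * g1 y - (3 * V1 y + y * V2 y) * g y)"
  have "((\<lambda>y. - 4 * b * g y - 2 * ct * (V y * g y)) has_integral ?Z 1 - ?Z 0) {0..1}"
  proof (rule fundamental_theorem_of_calculus)
    fix y
    have "- 4 * b * g y - 2 * ct * (V y * g y)
       = (2 * V y + y * V1 y) * (k\<^sup>2 * g2 y) - (4 * (k\<^sup>2 * V2 y) + y * (k\<^sup>2 * V3 y)) * g y"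
      unfolding A kV2 kV3 i by algebra
    moreover have "(?Z has_real_derivative (2 * V y + y * V1 y) * (k\<^sup>2 * g2 y) - (4 * (k\<^sup>2 * V2 y) + y * (k\<^sup>2 * V3 y)) * g y) (at y)"
      by (rule derivative_eq_intros dg dV dV1 dV2 refl)+ (simp add: algebra_simps)
    ultimately have "(?Z has_real_derivative - 4 * b * g y - 2 * ct * (V y * g y)) (at y)"
      by (simp only:)
    then show "(?Z has_vector_derivative - 4 * b * g y - 2 * ct * (V y * g y)) (at y within {0..1})"
      by (simp add: has_real_derivative_iff_has_vector_derivative has_vector_derivative_at_within)
  qed simp
  moreover have "((\<lambda>y. - 4 * b * g y - 2 * ct * (V y * g y)) has_integral - 4 * b * 0 - 2 * ct * i) {0..1}"
    by (intro has_integral_diff has_integral_mult_right iVg ig)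
  ultimately have "?Z 1 - ?Z 0 = - 4 * b * 0 - 2 * ct * i" by (rule has_integral_unique)
  then have "?Z 1 - ?Z 0 = 0" by (simp only: i mult_zero_right)
  then have g0: "g 0 = 0" using k_nz V2_0 by (simp add: V_per V1_0 algebra_simps)
  \<comment> \<open>\<open>\<alpha> V1\<close> has the same initial values as \<open>g\<close> at the crest, where \<open>V1\<close> vanishes\<close>
  define \<alpha> where "\<alpha> = g1 0 / V2 0"
  define q where "q y = - (6 * V y - ct) / k\<^sup>2" for y
  define h where "h y = g y - \<alpha> * V1 y" for y
  have "h y = 0" for y
  proof (rule periodic_zero[of h])
    show "one_periodic h" using pg periodic(2) by (simp add: one_periodic_def h_def)
    fix y :: real assume "0 \<le> y" "y \<le> 1"
    then show "h y = 0"
    proof (rule linear_ode_zero[of h "\<lambda>y. g1 y - \<alpha> * V2 y" q, rotated 5])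
      show "(h has_real_derivative g1 y - \<alpha> * V2 y) (at y)" for y
        unfolding h_def by (rule derivative_eq_intros dg dV1 refl)+ simp
      have "g2 y - \<alpha> * V3 y = q y * h y" for y
      proof -
        have "k\<^sup>2 * (g2 y - \<alpha> * V3 y) = - (6 * V y - ct) * h y"
          unfolding right_diff_distrib A mult.left_commute[of "k\<^sup>2"] kV3 i h_def by algebra
        then show ?thesis using k_nz by (simp add: q_def field_simps)
      qed
      then show "((\<lambda>y. g1 y - \<alpha> * V2 y) has_real_derivative q y * h y) (at y)" for y
        using DERIV_diff[OF dg(2)[of y] DERIV_cmult[OF dV2[of y], of \<alpha>]] by (simp only:)
      show "continuous_on {0..1} q" unfolding q_def using k_nz by (intro continuous_intros cont) auto
    qed (use g0 V1_0 V2_0 in \<open>auto simp: h_def \<alpha>_def\<close>)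
  qed
  then have "f y = avg f * kphi y + \<alpha> * V1 y" for y
    by (simp add: h_def g_def m_def kphi_def r_def algebra_simps)
  then show ?thesis by blast
qed

lemma linearized_kernel:
  fixes f f1 f2 f3 :: "real \<Rightarrow> complex"
  assumes f: "\<And>y. (f has_vector_derivative f1 y) (at y)" "\<And>y. (f1 has_vector_derivative f2 y) (at y)"
      "\<And>y. (f2 has_vector_derivative f3 y) (at y)"
    and per: "one_periodic f"
    and eq: "\<And>y. of_real k * (of_real (6 * V1 y) * f y + of_real (6 * V y - ct) * f1 y) + of_real (k ^ 3) * f3 y = 0"
  shows "\<exists>\<alpha>. \<forall>y. f y = avg f * of_real (kphi y) + \<alpha> * of_real (V1 y)"
proof -
  have cf: "continuous_on UNIV f"
    using f(1) by (auto intro!: continuous_at_imp_continuous_on has_vector_derivative_continuous)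
  have Re: "((\<lambda>y. Re (g y)) has_real_derivative Re g') (at y)" and Im: "((\<lambda>y. Im (g y)) has_real_derivative Im g') (at y)"
    if "(g has_vector_derivative g') (at y)" for g g' y
    using bounded_linear.has_vector_derivative[OF bounded_linear_Re that]
      bounded_linear.has_vector_derivative[OF bounded_linear_Im that]
    by (auto simp: has_real_derivative_iff_has_vector_derivative)
  have aR: "avg (\<lambda>y. Re (f y)) = Re (avg f)" and aI: "avg (\<lambda>y. Im (f y)) = Im (avg f)"
    using has_integral_linear[OF has_integral_avg[OF cf] bounded_linear_Re]
      has_integral_linear[OF has_integral_avg[OF cf] bounded_linear_Im]
    by (auto intro!: avg_eqI simp: o_def)
  have eR: "k * (6 * V1 y * Re (f y) + (6 * V y - ct) * Re (f1 y)) + k ^ 3 * Re (f3 y) = 0"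
    and eI: "k * (6 * V1 y * Im (f y) + (6 * V y - ct) * Im (f1 y)) + k ^ 3 * Im (f3 y) = 0" for y
    using arg_cong[OF eq[of y], of Re] arg_cong[OF eq[of y], of Im] by simp_all
  obtain \<alpha> where a: "\<forall>y. Re (f y) = avg (\<lambda>y. Re (f y)) * kphi y + \<alpha> * V1 y"
    using linearized_kernel_real[OF Re[OF f(1)] Re[OF f(2)] Re[OF f(3)] _ eR] per
    by (auto simp: one_periodic_def)
  obtain \<beta> where b: "\<forall>y. Im (f y) = avg (\<lambda>y. Im (f y)) * kphi y + \<beta> * V1 y"
    using linearized_kernel_real[OF Im[OF f(1)] Im[OF f(2)] Im[OF f(3)] _ eI] per
    by (auto simp: one_periodic_def)
  have "f y = avg f * of_real (kphi y) + Complex \<alpha> \<beta> * of_real (V1 y)" for y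
    using a b by (simp add: complex_eq_iff aR aI)
  then show ?thesis by blast
qed

end

section \<open>Parameter derivatives of the averaged quantities\<close>

definition kdv_Uyy :: "real \<Rightarrow> real \<Rightarrow> real \<Rightarrow> real" where
  "kdv_Uyy k p y = (kdv_b k p + kdv_ct k p * kdv_Ut k p y - 3 * (kdv_Ut k p y)\<^sup>2) / k\<^sup>2"

lemma kdv_U_derivs:
  assumes "k \<noteq> 0" "0 < p" "p < 1"
  shows "D (kdv_U k M p) = kdv_Uy k p" "(D ^^ 2) (kdv_U k M p) = kdv_Uyy k p"
proof -
  have "((\<lambda>y. kdv_U k M p y) has_real_derivative kdv_Uy k p y) (at y)" for y
    unfolding kdv_U_def using kdv_Ut_deriv_y[OF assms(2,3)] by (auto intro!: derivative_eq_intros)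
  then show 1: "D (kdv_U k M p) = kdv_Uy k p" by (rule D_funI)
  have "D (kdv_Uy k p) = kdv_Uyy k p"
    by (rule D_funI) (use kdv_Uy_deriv_y[OF assms(2,3,1)] in \<open>simp add: kdv_Uyy_def\<close>)
  then show "(D ^^ 2) (kdv_U k M p) = kdv_Uyy k p" by (simp add: 1 eval_nat_numeral)
qed

text \<open>The wave depends on \<open>k\<close> only by a factor \<open>k\<^sup>2\<close>, hence \<open>\<partial>\<^sub>kU = 2 V / k\<close>.\<close>

lemma kdv_scaling:
  "kdv_Ut k p y = k\<^sup>2 * kdv_Ut 1 p y" "kdv_Uy k p y = k\<^sup>2 * kdv_Uy 1 p y"
  "kdv_ct k p = k\<^sup>2 * kdv_ct 1 p"
  "k \<noteq> 0 \<Longrightarrow> kdv_Uyy k p y = k\<^sup>2 * kdv_Uyy 1 p y"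
proof -
  show 1: "kdv_Ut k p y = k\<^sup>2 * kdv_Ut 1 p y" "kdv_Uy k p y = k\<^sup>2 * kdv_Uy 1 p y" "kdv_ct k p = k\<^sup>2 * kdv_ct 1 p"
    by (simp_all add: kdv_Ut_def kdv_Uy_def kdv_ct_def)
  have b: "kdv_b k p = k ^ 4 * kdv_b 1 p" by (simp add: kdv_b_def)
  show "kdv_Uyy k p y = k\<^sup>2 * kdv_Uyy 1 p y" if "k \<noteq> 0"
  proof -
    have "kdv_Uyy k p y = (k ^ 4 * (kdv_b 1 p + kdv_ct 1 p * kdv_Ut 1 p y - 3 * (kdv_Ut 1 p y)\<^sup>2)) / k\<^sup>2"
      unfolding kdv_Uyy_def 1 b by (simp add: algebra_simps eval_nat_numeral)
    then show ?thesis using that by (simp add: kdv_Uyy_def eval_nat_numeral)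
  qed
qed

lemma avg_deriv_param:
  fixes f :: "real \<Rightarrow> real \<Rightarrow> real"
  assumes S: "open S" "convex S" "x \<in> S"
    and d: "\<And>x t. x \<in> S \<Longrightarrow> ((\<lambda>x. f x t) has_real_derivative f' x t) (at x)"
    and c: "continuous_on (S \<times> UNIV) (\<lambda>(x, t). f x t)"
    and c': "continuous_on (S \<times> UNIV) (\<lambda>(x, t). f' x t)"
  shows "((\<lambda>x. avg (f x)) has_real_derivative avg (f' x)) (at x)"
  unfolding avg_def
proof (rule deriv_integral_param[OF S d])
  show "continuous_on {0..1} (f q)" if "q \<in> S" for q
    by (rule continuous_on_compose2[OF c, of "{0..1}" "\<lambda>t. (q, t)", simplified]) (use that in \<open>auto intro!: continuous_intros\<close>)
  show "continuous_on (S \<times> {0..1}) (\<lambda>(x, t). f' x t)"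
    by (rule continuous_on_subset[OF c']) auto
qed

text \<open>The four averaged quantities along a one-parameter family; the three partial derivatives in
\<open>(k, M, p)\<close> are instances.\<close>

lemma family_avg_derivs:
  fixes \<kappa> \<kappa>' :: "real \<Rightarrow> real" and u u1 u2 u' u1' u2' :: "real \<Rightarrow> real \<Rightarrow> real"
  assumes S: "open S" "convex S" "x \<in> S"
    and d\<kappa>: "\<And>x. x \<in> S \<Longrightarrow> (\<kappa> has_real_derivative \<kappa>' x) (at x)" and c\<kappa>: "continuous_on S \<kappa>'"
    and d: "\<And>x y. x \<in> S \<Longrightarrow> ((\<lambda>x. u x y) has_real_derivative u' x y) (at x)"
      "\<And>x y. x \<in> S \<Longrightarrow> ((\<lambda>x. u1 x y) has_real_derivative u1' x y) (at x)"
      "\<And>x y. x \<in> S \<Longrightarrow> ((\<lambda>x. u2 x y) has_real_derivative u2' x y) (at x)"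
    and c: "continuous_on (S \<times> UNIV) (\<lambda>z. u (fst z) (snd z))" "continuous_on (S \<times> UNIV) (\<lambda>z. u' (fst z) (snd z))"
      "continuous_on (S \<times> UNIV) (\<lambda>z. u1 (fst z) (snd z))" "continuous_on (S \<times> UNIV) (\<lambda>z. u1' (fst z) (snd z))"
      "continuous_on (S \<times> UNIV) (\<lambda>z. u2 (fst z) (snd z))" "continuous_on (S \<times> UNIV) (\<lambda>z. u2' (fst z) (snd z))"
    and cv: "continuous_on UNIV v1" "continuous_on UNIV v2"
  shows "((\<lambda>x. avg (\<lambda>y. 3 * (u x y)\<^sup>2)) has_real_derivative avg (\<lambda>y. 6 * u x y * u' x y)) (at x)"
    "((\<lambda>x. avg (\<lambda>y. (u x y)\<^sup>2 / 2)) has_real_derivative avg (\<lambda>y. u x y * u' x y)) (at x)"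
    "((\<lambda>x. avg (\<lambda>y. 2 * (u x y) ^ 3 - 3 / 2 * (\<kappa> x)\<^sup>2 * (u1 x y)\<^sup>2)) has_real_derivative
       avg (\<lambda>y. 6 * (u x y)\<^sup>2 * u' x y - 3 * \<kappa> x * \<kappa>' x * (u1 x y)\<^sup>2 - 3 * (\<kappa> x)\<^sup>2 * u1 x y * u1' x y)) (at x)"
    "((\<lambda>x. avg (\<lambda>y. (\<kappa> x)\<^sup>2 * (v1 y * u1 x y) - \<kappa> x ^ 4 * (v2 y * u2 x y))) has_real_derivative
       avg (\<lambda>y. 2 * \<kappa> x * \<kappa>' x * (v1 y * u1 x y) + (\<kappa> x)\<^sup>2 * (v1 y * u1' x y)
          - 4 * \<kappa> x ^ 3 * \<kappa>' x * (v2 y * u2 x y) - \<kappa> x ^ 4 * (v2 y * u2' x y))) (at x)"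
proof -
  have c0: "continuous_on S \<kappa>"
    by (rule DERIV_continuous_on) (rule has_field_derivative_at_within[OF d\<kappa>])
  have ck: "continuous_on (S \<times> UNIV) (\<lambda>z::real \<times> real. \<kappa> (fst z))" "continuous_on (S \<times> UNIV) (\<lambda>z::real \<times> real. \<kappa>' (fst z))"
    by (auto intro!: continuous_on_compose2[OF c0] continuous_on_compose2[OF c\<kappa>] continuous_intros)
  have cv': "continuous_on (S \<times> UNIV) (\<lambda>z::real \<times> real. v1 (snd z))" "continuous_on (S \<times> UNIV) (\<lambda>z::real \<times> real. v2 (snd z))"
    by (auto intro!: continuous_on_compose2[OF cv(1)] continuous_on_compose2[OF cv(2)] continuous_intros)
  show "((\<lambda>x. avg (\<lambda>y. 3 * (u x y)\<^sup>2)) has_real_derivative avg (\<lambda>y. 6 * u x y * u' x y)) (at x)"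
    by (rule avg_deriv_param[OF S])
      (auto intro!: derivative_eq_intros d continuous_intros c simp: split_beta)
  show "((\<lambda>x. avg (\<lambda>y. (u x y)\<^sup>2 / 2)) has_real_derivative avg (\<lambda>y. u x y * u' x y)) (at x)"
    by (rule avg_deriv_param[OF S])
      (auto intro!: derivative_eq_intros d continuous_intros c simp: split_beta)
  show "((\<lambda>x. avg (\<lambda>y. 2 * (u x y) ^ 3 - 3 / 2 * (\<kappa> x)\<^sup>2 * (u1 x y)\<^sup>2)) has_real_derivative
       avg (\<lambda>y. 6 * (u x y)\<^sup>2 * u' x y - 3 * \<kappa> x * \<kappa>' x * (u1 x y)\<^sup>2 - 3 * (\<kappa> x)\<^sup>2 * u1 x y * u1' x y)) (at x)"
  proof (rule avg_deriv_param[OF S])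
    fix x t assume "x \<in> S"
    then show "((\<lambda>x. 2 * u x t ^ 3 - 3 / 2 * (\<kappa> x)\<^sup>2 * (u1 x t)\<^sup>2) has_real_derivative
         6 * (u x t)\<^sup>2 * u' x t - 3 * \<kappa> x * \<kappa>' x * (u1 x t)\<^sup>2 - 3 * (\<kappa> x)\<^sup>2 * u1 x t * u1' x t) (at x)"
      by (auto intro!: derivative_eq_intros d d\<kappa> simp: algebra_simps power2_eq_square)
  qed (auto intro!: continuous_intros c ck simp: split_beta)
  show "((\<lambda>x. avg (\<lambda>y. (\<kappa> x)\<^sup>2 * (v1 y * u1 x y) - \<kappa> x ^ 4 * (v2 y * u2 x y))) has_real_derivative
       avg (\<lambda>y. 2 * \<kappa> x * \<kappa>' x * (v1 y * u1 x y) + (\<kappa> x)\<^sup>2 * (v1 y * u1' x y)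
          - 4 * \<kappa> x ^ 3 * \<kappa>' x * (v2 y * u2 x y) - \<kappa> x ^ 4 * (v2 y * u2' x y))) (at x)"
  proof (rule avg_deriv_param[OF S])
    fix x t assume "x \<in> S"
    then show "((\<lambda>x. (\<kappa> x)\<^sup>2 * (v1 t * u1 x t) - \<kappa> x ^ 4 * (v2 t * u2 x t)) has_real_derivative
         2 * \<kappa> x * \<kappa>' x * (v1 t * u1 x t) + (\<kappa> x)\<^sup>2 * (v1 t * u1' x t)
          - 4 * \<kappa> x ^ 3 * \<kappa>' x * (v2 t * u2 x t) - \<kappa> x ^ 4 * (v2 t * u2' x t)) (at x)"
      by (auto intro!: derivative_eq_intros d d\<kappa> simp: algebra_simps)
  qed (auto intro!: continuous_intros c ck cv' simp: split_beta)
qed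

lemma dpar_eq:
  assumes "((\<lambda>s. F s M p) has_real_derivative Fk) (at k)" "((\<lambda>s. F k s p) has_real_derivative Fm) (at M)"
    "((\<lambda>s. F k M s) has_real_derivative Fp) (at p)"
  shows "dpar F k M p a m e = Fk *\<^sub>R a + Fm *\<^sub>R m + Fp *\<^sub>R e"
  using assms by (simp add: dpar_def DERIV_imp_deriv)

lemma avg_of_real_mult:
  "continuous_on UNIV f \<Longrightarrow> avg (\<lambda>y. of_real (f y) * c) = of_real (avg f) * (c :: 'a::{real_normed_field,banach})"
  by (intro avg_eqI has_integral_mult_left has_integral_linear[OF has_integral_avg bounded_linear_of_real, unfolded o_def])

locale kdv_state = kdv_wave k p for k p + fixes M :: real
begin

abbreviation "U \<equiv> kdv_U k M p"
abbreviation "c \<equiv> kdv_c k M p"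

lemma U_eq: "U y = M + V y" by (simp add: kdv_U_def)
lemma c_eq: "c = 6 * M + ct" by (simp add: kdv_c_def)

lemma V2_eq: "V2 = kdv_Uyy k p" by (simp add: V2_def kdv_Uyy_def fun_eq_iff)

lemma D_U: "D U = V1" "(D ^^ 2) U = V2" "(D ^^ 3) U = V3" "(D ^^ 4) U = V4"
  and D_V: "D V = V1" "(D ^^ 2) V = V2" "(D ^^ 3) V = V3" "(D ^^ 4) V = V4"
proof -
  have 1: "D V1 = V2" "D V2 = V3" "D V3 = V4" "D V = V1"
    by (rule D_funI, rule dV dV1 dV2 dV3)+
  have 2: "D U = V1" using kdv_U_derivs[of k p M] k p by simp
  show "D U = V1" "(D ^^ 2) U = V2" "(D ^^ 3) U = V3" "(D ^^ 4) U = V4"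
     "D V = V1" "(D ^^ 2) V = V2" "(D ^^ 3) V = V3" "(D ^^ 4) V = V4"
    using 1 2 by (simp_all add: eval_nat_numeral)
qed

lemma Ck_V: "Ck n V \<and> Ck n V1"
proof (induction n)
  case 0
  then show ?case by (simp add: cont)
next
  case (Suc n)
  have e: "V2 = (\<lambda>y. b / k\<^sup>2 + (ct / k\<^sup>2) * V y - (3 / k\<^sup>2) * (V y * V y))"
    by (auto simp: V2_def diff_divide_distrib add_divide_distrib power2_eq_square)
  have "Ck n V2" unfolding e using Suc by (intro Ck_diff Ck_add Ck_cmult Ck_mult Ck_const) auto
  then show ?case using Suc vd by (blast intro: Ck_SucI_real)
qed

lemma Ck_U: "Ck n U" unfolding kdv_U_def using Ck_V[of n] by (intro Ck_add Ck_const) auto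

lemma deriv_k: "0 < s \<Longrightarrow> ((\<lambda>s. kdv_Ut s p y) has_real_derivative 2 * s * kdv_Ut 1 p y) (at s)"
  "0 < s \<Longrightarrow> ((\<lambda>s. kdv_Uy s p y) has_real_derivative 2 * s * kdv_Uy 1 p y) (at s)"
  "0 < s \<Longrightarrow> ((\<lambda>s. s\<^sup>2 * kdv_Uyy 1 p y) has_real_derivative 2 * s * kdv_Uyy 1 p y) (at s)"
  by (subst kdv_scaling, auto intro!: derivative_eq_intros)
    (subst kdv_scaling, auto intro!: derivative_eq_intros)

lemma at_k: "2 * k * kdv_Ut 1 p y = 2 * V y / k" "2 * k * kdv_Uy 1 p y = 2 * V1 y / k" "2 * k * kdv_Uyy 1 p y = 2 * V2 y / k"
  unfolding V2_eq kdv_scaling(1,2)[of k] kdv_scaling(4)[OF k_nz] using k_nz by (simp_all add: power2_eq_square)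

lemma Uyy_deriv_p:
  assumes "0 < q" "q < 1"
  shows "((\<lambda>q. kdv_Uyy k q y) has_real_derivative
    (kdv_b_p k q + kdv_ct_p k q * kdv_Ut k q y + kdv_ct k q * kdv_Up k q y - 6 * kdv_Ut k q y * kdv_Up k q y) / k\<^sup>2) (at q)"
  unfolding kdv_Uyy_def
  by (rule DERIV_cdivide, (rule derivative_eq_intros kdv_b_deriv_p kdv_ct_deriv_p kdv_Ut_deriv_p assms refl)+) simp

lemma UNIV_times: "continuous_on (UNIV \<times> S) (\<lambda>(y, q). f q y) \<Longrightarrow> continuous_on (S \<times> UNIV) (\<lambda>z. f (fst z) (snd z))"
  for f :: "real \<Rightarrow> real \<Rightarrow> real" and S :: "real set"
proof -
  assume c: "continuous_on (UNIV \<times> S) (\<lambda>(y, q). f q y)"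
  have "continuous_on (S \<times> UNIV) (\<lambda>z. (\<lambda>(y, q). f q y) (snd z, fst z))"
    by (rule continuous_on_compose2[OF c]) (auto intro!: continuous_intros)
  then show ?thesis by simp
qed

lemma cont_snd: "continuous_on (S \<times> UNIV) (\<lambda>z. g (snd z))" if "continuous_on UNIV g" for g :: "real \<Rightarrow> real" and S :: "real set"
  by (rule continuous_on_compose2[OF that]) (auto intro!: continuous_intros)

lemma cont_Uyy: "continuous_on S (kdv_Uyy k p)" using cont(3) unfolding V2_eq .

lemma cont_1: "continuous_on S (kdv_Ut 1 p)" "continuous_on S (kdv_Uy 1 p)" "continuous_on S (kdv_Uyy 1 p)"
proof -
  interpret one: kdv_state 1 p M by unfold_locales (use p in auto)
  show "continuous_on S (kdv_Ut 1 p)" "continuous_on S (kdv_Uy 1 p)" "continuous_on S (kdv_Uyy 1 p)"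
    using one.cont one.cont_Uyy by auto
qed

lemma avg_derivs_k:
  "((\<lambda>s. av_3U2 s M p) has_real_derivative avg (\<lambda>y. 6 * U y * (2 * V y / k))) (at k)"
  "((\<lambda>s. av_half_U2 s M p) has_real_derivative avg (\<lambda>y. U y * (2 * V y / k))) (at k)"
  "((\<lambda>s. av_flux s M p) has_real_derivative
      avg (\<lambda>y. 6 * (U y)\<^sup>2 * (2 * V y / k) - 3 * k * (V1 y)\<^sup>2 - 3 * k\<^sup>2 * V1 y * (2 * V1 y / k))) (at k)"
  "((\<lambda>s. av_dissip U s M p) has_real_derivative
      avg (\<lambda>y. 2 * k * (V1 y * V1 y) + k\<^sup>2 * (V1 y * (2 * V1 y / k)) - 4 * k ^ 3 * (V2 y * V2 y) - k ^ 4 * (V2 y * (2 * V2 y / k)))) (at k)"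
proof -
  have S: "open {0::real<..}" "convex {0::real<..}" "k \<in> {0<..}" using k by auto
  have F: "((\<lambda>x. avg (\<lambda>y. 3 * (M + kdv_Ut x p y)\<^sup>2)) has_real_derivative avg (\<lambda>y. 6 * U y * (2 * V y / k))) (at k)"
    "((\<lambda>x. avg (\<lambda>y. (M + kdv_Ut x p y)\<^sup>2 / 2)) has_real_derivative avg (\<lambda>y. U y * (2 * V y / k))) (at k)"
    "((\<lambda>x. avg (\<lambda>y. 2 * (M + kdv_Ut x p y) ^ 3 - 3 / 2 * x\<^sup>2 * (kdv_Uy x p y)\<^sup>2)) has_real_derivative
      avg (\<lambda>y. 6 * (U y)\<^sup>2 * (2 * V y / k) - 3 * k * (V1 y)\<^sup>2 - 3 * k\<^sup>2 * V1 y * (2 * V1 y / k))) (at k)"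
    "((\<lambda>x. avg (\<lambda>y. x\<^sup>2 * (V1 y * kdv_Uy x p y) - x ^ 4 * (V2 y * (x\<^sup>2 * kdv_Uyy 1 p y)))) has_real_derivative
      avg (\<lambda>y. 2 * k * (V1 y * V1 y) + k\<^sup>2 * (V1 y * (2 * V1 y / k)) - 4 * k ^ 3 * (V2 y * V2 y) - k ^ 4 * (V2 y * (2 * V2 y / k)))) (at k)"
  proof -
    have d0: "((\<lambda>x. M + kdv_Ut x p y) has_real_derivative 2 * x * kdv_Ut 1 p y) (at x)" if "x \<in> {0<..}" for x y
      using deriv_k(1)[of x y] that by (auto intro!: derivative_eq_intros)
    have c: "continuous_on ({0<..} \<times> UNIV) (\<lambda>z. M + kdv_Ut (fst z) p (snd z))"
        "continuous_on ({0<..} \<times> UNIV) (\<lambda>z. kdv_Uy (fst z) p (snd z))"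
      unfolding kdv_scaling(1,2)[of "fst _"]
      by (auto intro!: continuous_intros cont_snd cont_1)
    note F = family_avg_derivs[OF S, of "\<lambda>s. s" "\<lambda>s. 1" "\<lambda>s y. M + kdv_Ut s p y" "\<lambda>s y. 2 * s * kdv_Ut 1 p y"
      "\<lambda>s y. kdv_Uy s p y" "\<lambda>s y. 2 * s * kdv_Uy 1 p y" "\<lambda>s y. s\<^sup>2 * kdv_Uyy 1 p y" "\<lambda>s y. 2 * s * kdv_Uyy 1 p y" V1 V2,
      unfolded at_k kdv_scaling(4)[OF k_nz, symmetric] V2_eq[symmetric] U_eq[symmetric] mult_1_right,
      OF DERIV_ident continuous_on_const d0 deriv_k(2) deriv_k(3) c(1) _ c(2)]
    show "((\<lambda>x. avg (\<lambda>y. 3 * (M + kdv_Ut x p y)\<^sup>2)) has_real_derivative avg (\<lambda>y. 6 * U y * (2 * V y / k))) (at k)"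
    "((\<lambda>x. avg (\<lambda>y. (M + kdv_Ut x p y)\<^sup>2 / 2)) has_real_derivative avg (\<lambda>y. U y * (2 * V y / k))) (at k)"
    "((\<lambda>x. avg (\<lambda>y. 2 * (M + kdv_Ut x p y) ^ 3 - 3 / 2 * x\<^sup>2 * (kdv_Uy x p y)\<^sup>2)) has_real_derivative
      avg (\<lambda>y. 6 * (U y)\<^sup>2 * (2 * V y / k) - 3 * k * (V1 y)\<^sup>2 - 3 * k\<^sup>2 * V1 y * (2 * V1 y / k))) (at k)"
    "((\<lambda>x. avg (\<lambda>y. x\<^sup>2 * (V1 y * kdv_Uy x p y) - x ^ 4 * (V2 y * (x\<^sup>2 * kdv_Uyy 1 p y)))) has_real_derivative
      avg (\<lambda>y. 2 * k * (V1 y * V1 y) + k\<^sup>2 * (V1 y * (2 * V1 y / k)) - 4 * k ^ 3 * (V2 y * V2 y) - k ^ 4 * (V2 y * (2 * V2 y / k)))) (at k)"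
      by (rule F; auto intro!: continuous_intros cont_snd cont_1 cont)+
  qed
  have U: "kdv_U s M p = (\<lambda>y. M + kdv_Ut s p y)" for s by (simp add: kdv_U_def fun_eq_iff)
  show "((\<lambda>s. av_3U2 s M p) has_real_derivative avg (\<lambda>y. 6 * U y * (2 * V y / k))) (at k)"
    using F(1) by (simp add: av_3U2_def U)
  show "((\<lambda>s. av_half_U2 s M p) has_real_derivative avg (\<lambda>y. U y * (2 * V y / k))) (at k)"
    using F(2) by (simp add: av_half_U2_def U)
  show "((\<lambda>s. av_flux s M p) has_real_derivative
      avg (\<lambda>y. 6 * (U y)\<^sup>2 * (2 * V y / k) - 3 * k * (V1 y)\<^sup>2 - 3 * k\<^sup>2 * V1 y * (2 * V1 y / k))) (at k)"
    by (rule has_field_derivative_transform_within_open[OF F(3), of "{0<..}"])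
      (use k p in \<open>simp_all add: av_flux_def kdv_U_derivs\<close>, simp add: U)
  show "((\<lambda>s. av_dissip U s M p) has_real_derivative
      avg (\<lambda>y. 2 * k * (V1 y * V1 y) + k\<^sup>2 * (V1 y * (2 * V1 y / k)) - 4 * k ^ 3 * (V2 y * V2 y) - k ^ 4 * (V2 y * (2 * V2 y / k)))) (at k)"
    by (rule has_field_derivative_transform_within_open[OF F(4), of "{0<..}"])
      (use k p in \<open>simp_all add: av_dissip_def kdv_U_derivs D_U kdv_scaling(4)[symmetric]\<close>)
qed

lemma avg_derivs_M:
  "((\<lambda>s. av_3U2 k s p) has_real_derivative avg (\<lambda>y. 6 * U y)) (at M)"
  "((\<lambda>s. av_half_U2 k s p) has_real_derivative avg U) (at M)"
  "((\<lambda>s. av_flux k s p) has_real_derivative avg (\<lambda>y. 6 * (U y)\<^sup>2)) (at M)"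
  "((\<lambda>s. av_dissip U k s p) has_real_derivative 0) (at M)"
proof -
  note F = family_avg_derivs[where S = "UNIV :: real set" and x = M and \<kappa> = "\<lambda>s. k" and \<kappa>' = "\<lambda>s. 0" and u = "\<lambda>s y. s + V y"
      and u' = "\<lambda>s y. 1" and ?u1.0 = "\<lambda>s y. V1 y" and u1' = "\<lambda>s y. 0" and ?u2.0 = "\<lambda>s y. V2 y" and u2' = "\<lambda>s y. 0"
      and ?v1.0 = V1 and ?v2.0 = V2]
  note cs = cont_snd[of _ "UNIV :: real set", simplified, OF cont(1)] cont_snd[of _ "UNIV :: real set", simplified, OF cont(2)]
    cont_snd[of _ "UNIV :: real set", simplified, OF cont(3)]
  have F: "((\<lambda>s. avg (\<lambda>y. 3 * (s + V y)\<^sup>2)) has_real_derivative avg (\<lambda>y. 6 * (M + V y) * 1)) (at M)"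
    "((\<lambda>s. avg (\<lambda>y. (s + V y)\<^sup>2 / 2)) has_real_derivative avg (\<lambda>y. (M + V y) * 1)) (at M)"
    "((\<lambda>s. avg (\<lambda>y. 2 * (s + V y) ^ 3 - 3 / 2 * k\<^sup>2 * (V1 y)\<^sup>2)) has_real_derivative
       avg (\<lambda>y. 6 * (M + V y)\<^sup>2 * 1 - 3 * k * 0 * (V1 y)\<^sup>2 - 3 * k\<^sup>2 * V1 y * 0)) (at M)"
    by (rule F; auto intro!: continuous_intros cs cont derivative_eq_intros)+
  have U: "kdv_U k s p = (\<lambda>y. s + V y)" for s by (simp add: kdv_U_def fun_eq_iff)
  show "((\<lambda>s. av_3U2 k s p) has_real_derivative avg (\<lambda>y. 6 * U y)) (at M)"
    "((\<lambda>s. av_half_U2 k s p) has_real_derivative avg U) (at M)"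
    using F(1,2) by (simp_all add: av_3U2_def av_half_U2_def U)
  have "av_flux k s p = avg (\<lambda>y. 2 * (s + V y) ^ 3 - 3 / 2 * k\<^sup>2 * (V1 y)\<^sup>2)" for s
    unfolding av_flux_def kdv_U_derivs(1)[OF k_nz p] by (simp only: U)
  then show "((\<lambda>s. av_flux k s p) has_real_derivative avg (\<lambda>y. 6 * (U y)\<^sup>2)) (at M)"
    using F(3) by (simp add: U)
  have "av_dissip U k s p = av_dissip U k M p" for s
    by (simp add: av_dissip_def kdv_U_derivs[OF k_nz p])
  then have "(\<lambda>s. av_dissip U k s p) = (\<lambda>s. av_dissip U k M p)" by (rule ext)
  then show "((\<lambda>s. av_dissip U k s p) has_real_derivative 0) (at M)" by (simp only: DERIV_const)
qed

lemma avg_derivs_p: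
  "((\<lambda>q. av_3U2 k M q) has_real_derivative avg (\<lambda>y. 6 * U y * W y)) (at p)"
  "((\<lambda>q. av_half_U2 k M q) has_real_derivative avg (\<lambda>y. U y * W y)) (at p)"
  "((\<lambda>q. av_flux k M q) has_real_derivative avg (\<lambda>y. 6 * (U y)\<^sup>2 * W y - 3 * k\<^sup>2 * V1 y * W1 y)) (at p)"
  "((\<lambda>q. av_dissip U k M q) has_real_derivative avg (\<lambda>y. k\<^sup>2 * (V1 y * W1 y) - k ^ 4 * (V2 y * W2 y))) (at p)"
proof -
  define uyyp where "uyyp q y = (kdv_b_p k q + kdv_ct_p k q * kdv_Ut k q y + kdv_ct k q * kdv_Up k q y - 6 * kdv_Ut k q y * kdv_Up k q y) / k\<^sup>2" for q y
  have cb: "continuous_on {0<..<1} (\<lambda>p. kdv_b k p)"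
    by (rule DERIV_continuous_on) (auto intro: has_field_derivative_at_within kdv_b_deriv_p)
  have cc: "continuous_on {0<..<1} (\<lambda>p. kdv_ct k p)"
    by (rule DERIV_continuous_on) (auto intro: has_field_derivative_at_within kdv_ct_deriv_p)
  have e: "q\<^sup>2 \<noteq> 1" if "0 < q" "q < 1" for q :: real
    using that by (simp add: power2_eq_1_iff)
  have cb': "continuous_on {0<..<1} (\<lambda>p. kdv_b_p k p)" unfolding kdv_b_p_def
    using e by (auto intro!: continuous_intros continuous_on_ellK continuous_on_ellE)
  have cc': "continuous_on {0<..<1} (\<lambda>p. kdv_ct_p k p)" unfolding kdv_ct_p_def
    using e by (auto intro!: continuous_intros continuous_on_ellK continuous_on_ellE)
  note c = UNIV_times[OF continuous_on_kdv_Ut] UNIV_times[OF continuous_on_kdv_Up]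
    UNIV_times[OF continuous_on_kdv_Uy] UNIV_times[OF continuous_on_kdv_Uyp]
  note c4 = continuous_on_compose2[OF cb] continuous_on_compose2[OF cc] continuous_on_compose2[OF cb'] continuous_on_compose2[OF cc']
  have c2: "continuous_on ({0<..<1} \<times> UNIV) (\<lambda>z. kdv_Uyy k (fst z) (snd z))"
    "continuous_on ({0<..<1} \<times> UNIV) (\<lambda>z. uyyp (fst z) (snd z))"
    unfolding kdv_Uyy_def uyyp_def using k_nz by (auto intro!: continuous_intros c c4)
  have d: "((\<lambda>q. M + kdv_Ut k q y) has_real_derivative kdv_Up k q y) (at q)"
    "((\<lambda>q. kdv_Uy k q y) has_real_derivative kdv_Uyp k q y) (at q)"
    "((\<lambda>q. kdv_Uyy k q y) has_real_derivative uyyp q y) (at q)" if "q \<in> {0<..<1}" for q y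
    using kdv_Ut_deriv_p[of q k y] kdv_Uy_deriv_p[of q k y] Uyy_deriv_p[of q y] that
    by (auto intro!: derivative_eq_intros simp: uyyp_def)
  have up: "uyyp p y = W2 y" for y by (simp add: uyyp_def W2_def)
  have S: "open {0::real<..<1}" "convex {0::real<..<1}" "p \<in> {0<..<1}" using p by auto
  note F = family_avg_derivs[OF S, where \<kappa> = "\<lambda>s. k" and \<kappa>' = "\<lambda>s. 0" and u = "\<lambda>q y. M + kdv_Ut k q y"
      and u' = "\<lambda>q y. kdv_Up k q y" and ?u1.0 = "\<lambda>q y. kdv_Uy k q y" and u1' = "\<lambda>q y. kdv_Uyp k q y"
      and ?u2.0 = "\<lambda>q y. kdv_Uyy k q y" and u2' = uyyp and ?v1.0 = V1 and ?v2.0 = V2]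
  have F: "((\<lambda>q. avg (\<lambda>y. 3 * (M + kdv_Ut k q y)\<^sup>2)) has_real_derivative avg (\<lambda>y. 6 * (M + V y) * W y)) (at p)"
    "((\<lambda>q. avg (\<lambda>y. (M + kdv_Ut k q y)\<^sup>2 / 2)) has_real_derivative avg (\<lambda>y. (M + V y) * W y)) (at p)"
    "((\<lambda>q. avg (\<lambda>y. 2 * (M + kdv_Ut k q y) ^ 3 - 3 / 2 * k\<^sup>2 * (kdv_Uy k q y)\<^sup>2)) has_real_derivative
       avg (\<lambda>y. 6 * (M + V y)\<^sup>2 * W y - 3 * k * 0 * (V1 y)\<^sup>2 - 3 * k\<^sup>2 * V1 y * W1 y)) (at p)"
    "((\<lambda>q. avg (\<lambda>y. k\<^sup>2 * (V1 y * kdv_Uy k q y) - k ^ 4 * (V2 y * kdv_Uyy k q y))) has_real_derivative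
       avg (\<lambda>y. 2 * k * 0 * (V1 y * V1 y) + k\<^sup>2 * (V1 y * W1 y) - 4 * k ^ 3 * 0 * (V2 y * kdv_Uyy k p y) - k ^ 4 * (V2 y * uyyp p y))) (at p)"
    by (rule F; (rule d)?; auto intro!: continuous_intros c c2 cont derivative_eq_intros)+
  show "((\<lambda>q. av_3U2 k M q) has_real_derivative avg (\<lambda>y. 6 * U y * W y)) (at p)"
    "((\<lambda>q. av_half_U2 k M q) has_real_derivative avg (\<lambda>y. U y * W y)) (at p)"
    using F(1,2) by (simp_all add: av_3U2_def av_half_U2_def kdv_U_def)
  show "((\<lambda>q. av_flux k M q) has_real_derivative avg (\<lambda>y. 6 * (U y)\<^sup>2 * W y - 3 * k\<^sup>2 * V1 y * W1 y)) (at p)"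
    by (rule has_field_derivative_transform_within_open[of _ _ _ "{0<..<1}"], rule F(3)[simplified, folded U_eq])
      (use k p in \<open>simp_all add: av_flux_def kdv_U_derivs\<close>, simp add: kdv_U_def)
  show "((\<lambda>q. av_dissip U k M q) has_real_derivative avg (\<lambda>y. k\<^sup>2 * (V1 y * W1 y) - k ^ 4 * (V2 y * W2 y))) (at p)"
    by (rule has_field_derivative_transform_within_open[of _ _ _ "{0<..<1}"], rule F(4)[unfolded up, simplified])
      (use k p in \<open>simp_all add: av_dissip_def kdv_U_derivs D_U\<close>)
qed

lemma kdv_c_derivs:
  "((\<lambda>s. kdv_c s M p) has_real_derivative 2 * ct / k) (at k)" "((\<lambda>s. kdv_c k s p) has_real_derivative 6) (at M)"
  "((\<lambda>q. kdv_c k M q) has_real_derivative ctp) (at p)"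
proof -
  have "((\<lambda>s. 6 * M + s\<^sup>2 * kdv_ct 1 p) has_real_derivative 2 * ct / k) (at k)"
    unfolding kdv_scaling(3)[of k] using k_nz by (auto intro!: derivative_eq_intros simp: power2_eq_square)
  then show "((\<lambda>s. kdv_c s M p) has_real_derivative 2 * ct / k) (at k)"
    unfolding kdv_c_def by (subst kdv_scaling(3))
qed (auto simp: kdv_c_def intro!: derivative_eq_intros kdv_ct_deriv_p p)

lemma kdv_U_param_derivs:
  "((\<lambda>s. kdv_U s M p y) has_real_derivative 2 * V y / k) (at k)" "((\<lambda>s. kdv_U k s p y) has_real_derivative 1) (at M)"
  "((\<lambda>q. kdv_U k M q y) has_real_derivative W y) (at p)"
  using deriv_k(1)[OF k, of y] unfolding at_k kdv_U_def
  by (auto intro!: derivative_eq_intros kdv_Ut_deriv_p p)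

text \<open>The differential of the family in the direction \<open>(a, m, e)\<close>, and its derivatives in \<open>y\<close>, over
  the reals (for the modulation system) and over the complex numbers (for the spectral problem).\<close>

definition dU0 :: "'a::{real_normed_field,banach} \<Rightarrow> 'a \<Rightarrow> 'a \<Rightarrow> real \<Rightarrow> 'a" where
  "dU0 a m e y = of_real (2 * V y / k) * a + m + of_real (W y) * e"
definition dU1 :: "'a::{real_normed_field,banach} \<Rightarrow> 'a \<Rightarrow> 'a \<Rightarrow> real \<Rightarrow> 'a" where
  "dU1 a m e y = of_real (2 * V1 y / k) * a + of_real (W1 y) * e"
definition dU2 :: "'a::{real_normed_field,banach} \<Rightarrow> 'a \<Rightarrow> 'a \<Rightarrow> real \<Rightarrow> 'a" where
  "dU2 a m e y = of_real (2 * V2 y / k) * a + of_real (W2 y) * e"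

lemma dpar_c: "dpar kdv_c k M p a m e = of_real (2 * ct / k) * a + 6 * m + of_real ctp * e"
  for a :: "'a::{real_normed_field,banach}"
  by (subst dpar_eq[OF kdv_c_derivs]) (simp add: scaleR_conv_of_real)

lemma dpar_kc: "dpar (\<lambda>k M p. k * kdv_c k M p) k M p a m e = of_real c * a + of_real k * dpar kdv_c k M p a m e"
  for a :: "'a::{real_normed_field,banach}"
proof -
  have d: "((\<lambda>s. s * kdv_c s M p) has_real_derivative c + 2 * ct) (at k)"
    "((\<lambda>s. k * kdv_c k s p) has_real_derivative k * 6) (at M)"
    "((\<lambda>q. k * kdv_c k M q) has_real_derivative k * ctp) (at p)"
    using DERIV_mult[OF DERIV_ident kdv_c_derivs(1)] DERIV_cmult[OF kdv_c_derivs(2), of k] DERIV_cmult[OF kdv_c_derivs(3), of k]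
      k_nz by (simp_all add: mult.commute)
  show ?thesis
    unfolding dpar_eq[of "\<lambda>k M p. k * kdv_c k M p", OF d] dpar_c scaleR_conv_of_real
    using k_nz by (simp add: algebra_simps)
qed

lemma dpar_U: "dpar (\<lambda>k M p. kdv_U k M p y) k M p a m e = dU0 a m e y"
  for a :: "'a::{real_normed_field,banach}"
  by (subst dpar_eq[OF kdv_U_param_derivs]) (simp add: scaleR_conv_of_real dU0_def)

lemma dpar_kU: "dpar (\<lambda>k M p. k * kdv_U k M p y) k M p a m e = of_real (U y) * a + of_real k * dU0 a m e y"
  for a :: "'a::{real_normed_field,banach}"
proof -
  have d: "((\<lambda>s. s * kdv_U s M p y) has_real_derivative U y + 2 * V y) (at k)"
    "((\<lambda>s. k * kdv_U k s p y) has_real_derivative k) (at M)"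
    "((\<lambda>q. k * kdv_U k M q y) has_real_derivative k * W y) (at p)"
    using DERIV_mult[OF DERIV_ident kdv_U_param_derivs(1)[of y]] DERIV_cmult[OF kdv_U_param_derivs(2), of k]
       DERIV_cmult[OF kdv_U_param_derivs(3), of k]
      k_nz by (simp_all add: mult.commute)
  show ?thesis
    unfolding dpar_eq[of "\<lambda>k M p. k * kdv_U k M p y", OF d] dU0_def scaleR_conv_of_real
    using k_nz by (simp add: algebra_simps)
qed

lemma avg_lin3:
  fixes a m e :: "'a::{real_normed_field,banach}"
  assumes "continuous_on UNIV f" "continuous_on UNIV g" "continuous_on UNIV h"
    "\<And>y. F y = of_real (f y) * a + of_real (g y) * m + of_real (h y) * e"
  shows "of_real (avg f) * a + of_real (avg g) * m + of_real (avg h) * e = avg F"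
proof -
  have "F = (\<lambda>y. of_real (f y) * a + of_real (g y) * m + of_real (h y) * e)" using assms(4) by blast
  then show ?thesis
    by (simp add: avg_add avg_of_real_mult assms continuous_on_add continuous_on_mult continuous_on_of_real continuous_on_const)
qed

lemma cont_U: "continuous_on S U" unfolding kdv_U_def by (intro continuous_intros cont)

lemma dpar_3U2: "dpar av_3U2 k M p a m e = avg (\<lambda>y. of_real (6 * U y) * dU0 a m e y)"
  for a :: "'a::{real_normed_field,banach}"
  unfolding dpar_eq[OF avg_derivs_k(1) avg_derivs_M(1) avg_derivs_p(1)] scaleR_conv_of_real
  by (rule avg_lin3) (use k_nz in \<open>auto intro!: continuous_intros cont cont_U simp: dU0_def algebra_simps\<close>)

lemma dpar_half_U2: "dpar av_half_U2 k M p a m e = avg (\<lambda>y. of_real (U y) * dU0 a m e y)"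
  for a :: "'a::{real_normed_field,banach}"
  unfolding dpar_eq[OF avg_derivs_k(2) avg_derivs_M(2) avg_derivs_p(2)] scaleR_conv_of_real
  by (rule avg_lin3) (use k_nz in \<open>auto intro!: continuous_intros cont cont_U simp: dU0_def algebra_simps\<close>)

lemma dpar_flux: "dpar av_flux k M p a m e = avg (\<lambda>y. of_real (6 * (U y)\<^sup>2) * dU0 a m e y
     - of_real (3 * k * (V1 y)\<^sup>2) * a - of_real (3 * k\<^sup>2 * V1 y) * dU1 a m e y)"
  for a :: "'a::{real_normed_field,banach}"
  unfolding dpar_eq[OF avg_derivs_k(3) avg_derivs_M(3) avg_derivs_p(3)] scaleR_conv_of_real
  by (rule avg_lin3) (use k_nz in \<open>auto intro!: continuous_intros cont cont_U simp: dU0_def dU1_def algebra_simps\<close>)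

lemma dpar_dissip: "dpar (av_dissip U) k M p a m e = avg (\<lambda>y. of_real (2 * k * (V1 y)\<^sup>2 - 4 * k ^ 3 * (V2 y)\<^sup>2) * a
     + of_real (k\<^sup>2 * V1 y) * dU1 a m e y - of_real (k ^ 4 * V2 y) * dU2 a m e y)"
  for a :: "'a::{real_normed_field,banach}"
proof -
  have "avg (\<lambda>y. 0::real) = 0" by (simp add: avg_const)
  then have d: "((\<lambda>s. av_dissip U k s p) has_real_derivative avg (\<lambda>y. 0)) (at M)" using avg_derivs_M(4) by simp
  show ?thesis
  unfolding dpar_eq[OF avg_derivs_k(4) d avg_derivs_p(4)] scaleR_conv_of_real
  by (rule avg_lin3) (use k_nz in \<open>auto intro!: continuous_intros cont cont_U simp: dU1_def dU2_def algebra_simps power2_eq_square\<close>)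
qed

end

section \<open>Second-order expansions\<close>

lemma expands_eqI: "expands f a b c \<Longrightarrow> a = a' \<Longrightarrow> b = b' \<Longrightarrow> c = c' \<Longrightarrow> expands f a' b' c'"
  by simp

lemma expandsE:
  assumes "expands f a0 a1 a2"
  obtains C where "0 \<le> C" "\<forall>\<^sub>F e in at_right 0. norm (f e - (a0 + e *\<^sub>R a1 + e\<^sup>2 *\<^sub>R a2)) \<le> C * e ^ 3"
proof -
  from assms obtain C where C: "\<forall>\<^sub>F e in at_right 0. norm (f e - (a0 + e *\<^sub>R a1 + e\<^sup>2 *\<^sub>R a2)) \<le> C * e ^ 3"
    by (auto simp: expands_def)
  have "\<forall>\<^sub>F e in at_right 0. norm (f e - (a0 + e *\<^sub>R a1 + e\<^sup>2 *\<^sub>R a2)) \<le> \<bar>C\<bar> * e ^ 3"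
    using C eventually_at_right_less[of 0]
  proof eventually_elim
    case (elim e)
    have "C * e ^ 3 \<le> \<bar>C\<bar> * e ^ 3" using elim by (intro mult_right_mono) auto
    with elim show ?case by linarith
  qed
  then show ?thesis using that[of "\<bar>C\<bar>"] by auto
qed

lemma expands_exact: "(\<And>e. f e = a0 + e *\<^sub>R a1 + e\<^sup>2 *\<^sub>R a2) \<Longrightarrow> expands f a0 a1 a2"
  unfolding expands_def by (intro exI[of _ 0]) simp

lemma expands_const: "expands (\<lambda>_. a) a 0 0"
  by (rule expands_exact) simp

lemma expands_linear: "expands (\<lambda>e. of_real e * a) 0 a 0" for a :: "'a::real_normed_algebra_1"
  by (rule expands_exact) (simp add: scaleR_conv_of_real)

lemma expands_add:
  assumes "expands f a0 a1 a2" "expands g b0 b1 b2"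
  shows "expands (\<lambda>e. f e + g e) (a0 + b0) (a1 + b1) (a2 + b2)"
proof -
  from assms[unfolded expands_def] obtain A B where
    A: "\<forall>\<^sub>F e in at_right 0. norm (f e - (a0 + e *\<^sub>R a1 + e\<^sup>2 *\<^sub>R a2)) \<le> A * e ^ 3" and
    B: "\<forall>\<^sub>F e in at_right 0. norm (g e - (b0 + e *\<^sub>R b1 + e\<^sup>2 *\<^sub>R b2)) \<le> B * e ^ 3" by auto
  from A B have "\<forall>\<^sub>F e in at_right 0. norm (f e + g e - (a0 + b0 + e *\<^sub>R (a1 + b1) + e\<^sup>2 *\<^sub>R (a2 + b2))) \<le> (A + B) * e ^ 3"
  proof eventually_elim
    case (elim e)
    have "f e + g e - (a0 + b0 + e *\<^sub>R (a1 + b1) + e\<^sup>2 *\<^sub>R (a2 + b2))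
      = (f e - (a0 + e *\<^sub>R a1 + e\<^sup>2 *\<^sub>R a2)) + (g e - (b0 + e *\<^sub>R b1 + e\<^sup>2 *\<^sub>R b2))"
      by (simp add: algebra_simps)
    also have "norm \<dots> \<le> A * e ^ 3 + B * e ^ 3" by (rule norm_triangle_mono) (use elim in auto)
    finally show ?case by (simp add: algebra_simps)
  qed
  then show ?thesis unfolding expands_def by blast
qed

lemma expands_bounded_linear:
  assumes "bounded_linear L" "expands f a0 a1 a2"
  shows "expands (\<lambda>e. L (f e)) (L a0) (L a1) (L a2)"
proof -
  interpret bounded_linear L by fact
  obtain K where K: "0 < K" "\<And>x. norm (L x) \<le> norm x * K" using pos_bounded by blast
  from assms(2) obtain A where
    A: "\<forall>\<^sub>F e in at_right 0. norm (f e - (a0 + e *\<^sub>R a1 + e\<^sup>2 *\<^sub>R a2)) \<le> A * e ^ 3" by (auto simp: expands_def)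
  then have "\<forall>\<^sub>F e in at_right 0. norm (L (f e) - (L a0 + e *\<^sub>R L a1 + e\<^sup>2 *\<^sub>R L a2)) \<le> (A * K) * e ^ 3"
  proof eventually_elim
    case (elim e)
    have "L (f e) - (L a0 + e *\<^sub>R L a1 + e\<^sup>2 *\<^sub>R L a2) = L (f e - (a0 + e *\<^sub>R a1 + e\<^sup>2 *\<^sub>R a2))"
      by (simp add: diff add scaleR)
    also have "norm \<dots> \<le> (A * e ^ 3) * K"
      using K(2) elim K(1) by (meson mult_right_mono order_trans less_imp_le)
    finally show ?case by (simp add: algebra_simps)
  qed
  then show ?thesis unfolding expands_def by blast
qed

lemma expands_diff:
  assumes "expands f a0 a1 a2" "expands g b0 b1 b2"
  shows "expands (\<lambda>e. f e - g e) (a0 - b0) (a1 - b1) (a2 - b2)"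
  using expands_add[OF assms(1) expands_bounded_linear[OF bounded_linear_minus[OF bounded_linear_ident] assms(2)]] by simp

lemma expands_mult:
  fixes f g :: "real \<Rightarrow> 'a::real_normed_field"
  assumes "expands f a0 a1 a2" "expands g b0 b1 b2"
  shows "expands (\<lambda>e. f e * g e) (a0 * b0) (a0 * b1 + a1 * b0) (a0 * b2 + a1 * b1 + a2 * b0)"
proof -
  from expandsE[OF assms(1)] obtain A where
    A: "0 \<le> A" "\<forall>\<^sub>F e in at_right 0. norm (f e - (a0 + e *\<^sub>R a1 + e\<^sup>2 *\<^sub>R a2)) \<le> A * e ^ 3" by auto
  from expandsE[OF assms(2)] obtain B where
    B: "0 \<le> B" "\<forall>\<^sub>F e in at_right 0. norm (g e - (b0 + e *\<^sub>R b1 + e\<^sup>2 *\<^sub>R b2)) \<le> B * e ^ 3" by auto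
  define m where "m = norm a0 + norm a1 + norm a2"
  define n where "n = norm b0 + norm b1 + norm b2"
  have poly: "norm (c0 + e *\<^sub>R c1 + e\<^sup>2 *\<^sub>R c2) \<le> norm c0 + norm c1 + norm c2" if "0 < e" "e < 1" for e and c0 c1 c2 :: 'a
  proof -
    have "e\<^sup>2 \<le> 1" using that by (simp add: power_le_one)
    then have "\<bar>e\<bar> * norm c1 \<le> 1 * norm c1" "e\<^sup>2 * norm c2 \<le> 1 * norm c2" using that mult_right_mono[of e 1 "norm c1"] mult_right_mono[of "e\<^sup>2" 1 "norm c2"] by auto
    moreover have "norm (c0 + e *\<^sub>R c1 + e\<^sup>2 *\<^sub>R c2) \<le> norm c0 + \<bar>e\<bar> * norm c1 + e\<^sup>2 * norm c2"
      using norm_triangle_ineq[of "c0 + e *\<^sub>R c1" "e\<^sup>2 *\<^sub>R c2"] norm_triangle_ineq[of c0 "e *\<^sub>R c1"] by simp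
    ultimately show ?thesis by simp
  qed
  have ev: "\<forall>\<^sub>F e in at_right (0::real). 0 < e \<and> e < 1"
    using eventually_at_right_real[of 0 1] by (auto elim: eventually_mono)
  have "\<forall>\<^sub>F e in at_right 0. norm (f e * g e - (a0 * b0 + e *\<^sub>R (a0 * b1 + a1 * b0) + e\<^sup>2 *\<^sub>R (a0 * b2 + a1 * b1 + a2 * b0)))
     \<le> ((m + A) * B + A * n + (norm (a1 * b2 + a2 * b1) + norm (a2 * b2))) * e ^ 3"
    using A(2) B(2) ev
  proof eventually_elim
    case (elim e)
    define pa pb where "pa = a0 + e *\<^sub>R a1 + e\<^sup>2 *\<^sub>R a2" and "pb = b0 + e *\<^sub>R b1 + e\<^sup>2 *\<^sub>R b2"
    have pa: "norm pa \<le> m" and pb: "norm pb \<le> n" unfolding pa_def pb_def m_def n_def using poly elim by auto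
    have e3: "e ^ 3 \<le> 1" "0 \<le> e ^ 3" using elim by (auto simp: power_le_one)
    have fa: "norm (f e - pa) \<le> A * e ^ 3" and gb: "norm (g e - pb) \<le> B * e ^ 3" using elim by (auto simp: pa_def pb_def)
    have "A * e ^ 3 \<le> A * 1" using e3 A(1) by (intro mult_left_mono) auto
    then have nf: "norm (f e) \<le> m + A"
      using norm_triangle_ineq[of pa "f e - pa"] pa fa by simp
    have "norm (f e * (g e - pb)) \<le> (m + A) * (B * e ^ 3)"
      unfolding norm_mult using nf gb by (intro mult_mono) (auto intro: order_trans[OF norm_ge_zero])
    moreover have "norm ((f e - pa) * pb) \<le> (A * e ^ 3) * n"
      unfolding norm_mult using fa pb by (intro mult_mono) (auto intro: order_trans[OF norm_ge_zero])
    moreover have "norm (e ^ 3 *\<^sub>R (a1 * b2 + a2 * b1 + e *\<^sub>R (a2 * b2))) \<le> e ^ 3 * (norm (a1 * b2 + a2 * b1) + norm (a2 * b2))"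
    proof -
      have "norm (a1 * b2 + a2 * b1 + e *\<^sub>R (a2 * b2)) \<le> norm (a1 * b2 + a2 * b1) + \<bar>e\<bar> * norm (a2 * b2)"
        using norm_triangle_ineq[of "a1 * b2 + a2 * b1" "e *\<^sub>R (a2 * b2)"] by simp
      also have "\<bar>e\<bar> * norm (a2 * b2) \<le> 1 * norm (a2 * b2)" using elim by (intro mult_right_mono) auto
      finally have "norm (a1 * b2 + a2 * b1 + e *\<^sub>R (a2 * b2)) \<le> norm (a1 * b2 + a2 * b1) + norm (a2 * b2)" by simp
      then show ?thesis using e3 by (simp add: mult_left_mono)
    qed
    moreover have "f e * g e - (a0 * b0 + e *\<^sub>R (a0 * b1 + a1 * b0) + e\<^sup>2 *\<^sub>R (a0 * b2 + a1 * b1 + a2 * b0))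
       = f e * (g e - pb) + (f e - pa) * pb + e ^ 3 *\<^sub>R (a1 * b2 + a2 * b1 + e *\<^sub>R (a2 * b2))"
      unfolding pa_def pb_def scaleR_conv_of_real of_real_power by algebra
    ultimately have "norm (f e * g e - (a0 * b0 + e *\<^sub>R (a0 * b1 + a1 * b0) + e\<^sup>2 *\<^sub>R (a0 * b2 + a1 * b1 + a2 * b0)))
      \<le> (m + A) * (B * e ^ 3) + (A * e ^ 3) * n + e ^ 3 * (norm (a1 * b2 + a2 * b1) + norm (a2 * b2))"
      by (simp only:) (intro norm_triangle_mono)
    then show ?case by (simp add: algebra_simps)
  qed
  then show ?thesis unfolding expands_def by blast
qed

lemma expands_scale:
  assumes "expands f a0 a1 a2" "0 < d"
  shows "expands (\<lambda>e. f (e * d)) a0 (d *\<^sub>R a1) (d\<^sup>2 *\<^sub>R a2)"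
proof -
  from assms(1) obtain A where
    A: "\<forall>\<^sub>F e in at_right 0. norm (f e - (a0 + e *\<^sub>R a1 + e\<^sup>2 *\<^sub>R a2)) \<le> A * e ^ 3" by (auto simp: expands_def)
  have "filterlim (\<lambda>e. e * d) (at_right 0) (at_right 0)"
    unfolding filterlim_at using assms(2) eventually_at_right_less[of 0]
    by (auto intro!: tendsto_eq_intros elim: eventually_mono)
  from eventually_compose_filterlim[OF A this]
  have "\<forall>\<^sub>F e in at_right 0. norm (f (e * d) - (a0 + e *\<^sub>R (d *\<^sub>R a1) + e\<^sup>2 *\<^sub>R (d\<^sup>2 *\<^sub>R a2))) \<le> (A * d ^ 3) * e ^ 3"
    by (simp add: power_mult_distrib mult.assoc mult.commute mult.left_commute)
  then show ?thesis unfolding expands_def by blast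
qed

text \<open>Uniqueness of the coefficients, which turns an equation for the sums into one equation for each order.\<close>

lemma expands_zero:
  assumes "expands f a0 a1 a2" "\<forall>\<^sub>F e in at_right 0. f e = 0"
  shows "a0 = 0" "a1 = 0" "a2 = 0"
proof -
  from expandsE[OF assms(1)] obtain A where
    A: "0 \<le> A" "\<forall>\<^sub>F e in at_right 0. norm (f e - (a0 + e *\<^sub>R a1 + e\<^sup>2 *\<^sub>R a2)) \<le> A * e ^ 3" by auto
  have z: "\<forall>\<^sub>F e in at_right 0. norm (a0 + e *\<^sub>R a1 + e\<^sup>2 *\<^sub>R a2) \<le> A * e ^ 3"
    using A(2) assms(2) by eventually_elim (metis diff_0 norm_minus_cancel)
  have lim: "c = 0" if "\<forall>\<^sub>F e in at_right 0. norm (c + e *\<^sub>R r1 + e\<^sup>2 *\<^sub>R r2) \<le> B * e" for c r1 r2 :: 'a and B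
  proof -
    have "((\<lambda>e. c + e *\<^sub>R r1 + e\<^sup>2 *\<^sub>R r2) \<longlongrightarrow> 0) (at_right 0)"
      by (rule Lim_null_comparison[OF that]) (auto intro!: tendsto_eq_intros)
    moreover have "((\<lambda>e. c + e *\<^sub>R r1 + e\<^sup>2 *\<^sub>R r2) \<longlongrightarrow> c + 0 *\<^sub>R r1 + 0\<^sup>2 *\<^sub>R r2) (at_right 0)"
      by (intro tendsto_intros)
    ultimately show ?thesis using tendsto_unique[OF trivial_limit_at_right_real] by force
  qed
  have ev: "\<forall>\<^sub>F e in at_right (0::real). 0 < e \<and> e < 1"
    using eventually_at_right_real[of 0 1] by (auto elim: eventually_mono)
  show 0: "a0 = 0"
  proof (rule lim)
    show "\<forall>\<^sub>F e in at_right 0. norm (a0 + e *\<^sub>R a1 + e\<^sup>2 *\<^sub>R a2) \<le> A * e"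
      using z ev
    proof eventually_elim
      case (elim e)
      have "A * e ^ 3 \<le> A * e ^ 1" using A(1) elim by (intro mult_left_mono power_decreasing) auto
      with elim show ?case by simp
    qed
  qed
  show 1: "a1 = 0"
  proof (rule lim)
    show "\<forall>\<^sub>F e in at_right 0. norm (a1 + e *\<^sub>R a2 + e\<^sup>2 *\<^sub>R 0) \<le> A * e"
      using z ev
    proof eventually_elim
      case (elim e)
      have "e * norm (a1 + e *\<^sub>R a2) = norm (a0 + e *\<^sub>R a1 + e\<^sup>2 *\<^sub>R a2)"
      proof -
        have "a0 + e *\<^sub>R a1 + e\<^sup>2 *\<^sub>R a2 = e *\<^sub>R (a1 + e *\<^sub>R a2)" by (simp add: 0 algebra_simps power2_eq_square)
        then show ?thesis using elim by simp
      qed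
      also have "\<dots> \<le> e * (A * e ^ 2)" using elim by (simp add: eval_nat_numeral mult_ac)
      finally have "norm (a1 + e *\<^sub>R a2) \<le> A * e ^ 2" using elim by simp
      also have "\<dots> \<le> A * e ^ 1" using A(1) elim by (intro mult_left_mono power_decreasing) auto
      finally show ?case by simp
    qed
  qed
  show "a2 = 0"
  proof (rule lim)
    show "\<forall>\<^sub>F e in at_right 0. norm (a2 + e *\<^sub>R 0 + e\<^sup>2 *\<^sub>R 0) \<le> A * e"
      using z ev
    proof eventually_elim
      case (elim e)
      have "e\<^sup>2 * norm a2 \<le> e\<^sup>2 * (A * e)" using elim by (simp add: 0 1 eval_nat_numeral mult_ac)
      then show ?case using elim by simp
    qed
  qed
qed

lemma funpow_D_lincomb:
  assumes "Ck n F" "Ck n f0" "Ck n f1" "Ck n f2" "j \<le> n"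
  shows "(D ^^ j) (\<lambda>z. F z - (f0 z + e *\<^sub>R f1 z + e' *\<^sub>R f2 z))
     = (\<lambda>z. (D ^^ j) F z - ((D ^^ j) f0 z + e *\<^sub>R (D ^^ j) f1 z + e' *\<^sub>R (D ^^ j) f2 z))"
  using assms(5)
proof (induction j)
  case (Suc j)
  then have j: "j < n" by simp
  note d = Ck_funpow_D_deriv[OF _ j]
  have "((\<lambda>z. (D ^^ j) F z - ((D ^^ j) f0 z + e *\<^sub>R (D ^^ j) f1 z + e' *\<^sub>R (D ^^ j) f2 z)) has_vector_derivative
    (D ^^ Suc j) F y - ((D ^^ Suc j) f0 y + e *\<^sub>R (D ^^ Suc j) f1 y + e' *\<^sub>R (D ^^ Suc j) f2 y)) (at y)" for y
    by (intro has_vector_derivative_diff has_vector_derivative_add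
        bounded_linear.has_vector_derivative[OF bounded_linear_scaleR_right] d assms)
  then have "D (\<lambda>z. (D ^^ j) F z - ((D ^^ j) f0 z + e *\<^sub>R (D ^^ j) f1 z + e' *\<^sub>R (D ^^ j) f2 z)) =
    (\<lambda>y. (D ^^ Suc j) F y - ((D ^^ Suc j) f0 y + e *\<^sub>R (D ^^ Suc j) f1 y + e' *\<^sub>R (D ^^ Suc j) f2 y))"
    by (intro ext D_eqI)
  then show ?case using Suc by simp
qed simp

lemma expands_C4_at:
  assumes "expands_C4 F f0 f1 f2" "\<forall>\<^sub>F e in at_right 0. Ck 4 (F e)" "Ck 4 f0" "Ck 4 f1" "Ck 4 f2" "j \<le> 4"
  shows "expands (\<lambda>e. (D ^^ j) (F e) y) ((D ^^ j) f0 y) ((D ^^ j) f1 y) ((D ^^ j) f2 y)"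
proof -
  from assms(1) obtain C where C: "\<forall>\<^sub>F e in at_right 0. \<forall>j\<le>4. \<forall>y.
        norm ((D ^^ j) (\<lambda>z. F e z - (f0 z + e *\<^sub>R f1 z + e\<^sup>2 *\<^sub>R f2 z)) y) \<le> C * e ^ 3" by (auto simp: expands_C4_def)
  from C assms(2) have "\<forall>\<^sub>F e in at_right 0.
      norm ((D ^^ j) (F e) y - ((D ^^ j) f0 y + e *\<^sub>R (D ^^ j) f1 y + e\<^sup>2 *\<^sub>R (D ^^ j) f2 y)) \<le> C * e ^ 3"
  proof eventually_elim
    case (elim e)
    then show ?case using funpow_D_lincomb[OF elim(2) assms(3-6), of e "e\<^sup>2"] assms(6) by (metis (no_types, lifting))
  qed
  then show ?thesis unfolding expands_def by blast
qed

lemma D\<nu>_eqI: "(f has_vector_derivative f' x) (at x) \<Longrightarrow> D\<nu> \<nu> f x = f' x + \<nu> * f x"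
  by (simp add: D\<nu>_def D_eqI)

lemma D\<nu>_powers:
  assumes "Ck 4 u"
  shows "(D\<nu> \<nu> ^^ 2) u = (\<lambda>x. (D ^^ 2) u x + 2 * \<nu> * D u x + \<nu>\<^sup>2 * u x)"
    "(D\<nu> \<nu> ^^ 3) u = (\<lambda>x. (D ^^ 3) u x + 3 * \<nu> * (D ^^ 2) u x + 3 * \<nu>\<^sup>2 * D u x + \<nu> ^ 3 * u x)"
    "(D\<nu> \<nu> ^^ 4) u = (\<lambda>x. (D ^^ 4) u x + 4 * \<nu> * (D ^^ 3) u x + 6 * \<nu>\<^sup>2 * (D ^^ 2) u x + 4 * \<nu> ^ 3 * D u x + \<nu> ^ 4 * u x)"
proof -
  have d: "(u has_vector_derivative D u x) (at x)" "(D u has_vector_derivative (D ^^ 2) u x) (at x)"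
    "((D ^^ 2) u has_vector_derivative (D ^^ 3) u x) (at x)" "((D ^^ 3) u has_vector_derivative (D ^^ 4) u x) (at x)" for x
    using Ck_funpow_D_deriv[OF assms, of 0 x] Ck_funpow_D_deriv[OF assms, of 1 x]
      Ck_funpow_D_deriv[OF assms, of 2 x] Ck_funpow_D_deriv[OF assms, of 3 x] by (simp_all add: eval_nat_numeral)
  note hv = has_vector_derivative_add has_vector_derivative_mult_right d
  have 1: "D\<nu> \<nu> u = (\<lambda>x. D u x + \<nu> * u x)" by (simp add: D\<nu>_def fun_eq_iff)
  have 2: "D\<nu> \<nu> (\<lambda>x. D u x + \<nu> * u x) = (\<lambda>x. (D ^^ 2) u x + 2 * \<nu> * D u x + \<nu>\<^sup>2 * u x)"
  proof
    fix x
    have "((\<lambda>x. D u x + \<nu> * u x) has_vector_derivative (D ^^ 2) u x + \<nu> * D u x) (at x)" by (intro hv)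
    from D_eqI[OF this] show "D\<nu> \<nu> (\<lambda>x. D u x + \<nu> * u x) x = (D ^^ 2) u x + 2 * \<nu> * D u x + \<nu>\<^sup>2 * u x"
      by (simp add: D\<nu>_def algebra_simps power2_eq_square)
  qed
  have 3: "D\<nu> \<nu> (\<lambda>x. (D ^^ 2) u x + 2 * \<nu> * D u x + \<nu>\<^sup>2 * u x) =
    (\<lambda>x. (D ^^ 3) u x + 3 * \<nu> * (D ^^ 2) u x + 3 * \<nu>\<^sup>2 * D u x + \<nu> ^ 3 * u x)"
  proof
    fix x
    have "((\<lambda>x. (D ^^ 2) u x + 2 * \<nu> * D u x + \<nu>\<^sup>2 * u x) has_vector_derivative
      (D ^^ 3) u x + 2 * \<nu> * (D ^^ 2) u x + \<nu>\<^sup>2 * D u x) (at x)" by (intro hv)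
    from D_eqI[OF this] show "D\<nu> \<nu> (\<lambda>x. (D ^^ 2) u x + 2 * \<nu> * D u x + \<nu>\<^sup>2 * u x) x =
      (D ^^ 3) u x + 3 * \<nu> * (D ^^ 2) u x + 3 * \<nu>\<^sup>2 * D u x + \<nu> ^ 3 * u x"
      by (simp add: D\<nu>_def algebra_simps power2_eq_square power3_eq_cube)
  qed
  have 4: "D\<nu> \<nu> (\<lambda>x. (D ^^ 3) u x + 3 * \<nu> * (D ^^ 2) u x + 3 * \<nu>\<^sup>2 * D u x + \<nu> ^ 3 * u x) =
    (\<lambda>x. (D ^^ 4) u x + 4 * \<nu> * (D ^^ 3) u x + 6 * \<nu>\<^sup>2 * (D ^^ 2) u x + 4 * \<nu> ^ 3 * D u x + \<nu> ^ 4 * u x)"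
  proof
    fix x
    have "((\<lambda>x. (D ^^ 3) u x + 3 * \<nu> * (D ^^ 2) u x + 3 * \<nu>\<^sup>2 * D u x + \<nu> ^ 3 * u x) has_vector_derivative
      (D ^^ 4) u x + 3 * \<nu> * (D ^^ 3) u x + 3 * \<nu>\<^sup>2 * (D ^^ 2) u x + \<nu> ^ 3 * D u x) (at x)" by (intro hv)
    from D_eqI[OF this] show "D\<nu> \<nu> (\<lambda>x. (D ^^ 3) u x + 3 * \<nu> * (D ^^ 2) u x + 3 * \<nu>\<^sup>2 * D u x + \<nu> ^ 3 * u x) x =
      (D ^^ 4) u x + 4 * \<nu> * (D ^^ 3) u x + 6 * \<nu>\<^sup>2 * (D ^^ 2) u x + 4 * \<nu> ^ 3 * D u x + \<nu> ^ 4 * u x"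
      by (simp add: D\<nu>_def algebra_simps eval_nat_numeral)
  qed
  have n: "(D\<nu> \<nu> ^^ 2) u = D\<nu> \<nu> (D\<nu> \<nu> u)" "(D\<nu> \<nu> ^^ 3) u = D\<nu> \<nu> (D\<nu> \<nu> (D\<nu> \<nu> u))"
    "(D\<nu> \<nu> ^^ 4) u = D\<nu> \<nu> (D\<nu> \<nu> (D\<nu> \<nu> (D\<nu> \<nu> u)))" by (simp_all add: eval_nat_numeral)
  show "(D\<nu> \<nu> ^^ 2) u = (\<lambda>x. (D ^^ 2) u x + 2 * \<nu> * D u x + \<nu>\<^sup>2 * u x)"
    "(D\<nu> \<nu> ^^ 3) u = (\<lambda>x. (D ^^ 3) u x + 3 * \<nu> * (D ^^ 2) u x + 3 * \<nu>\<^sup>2 * D u x + \<nu> ^ 3 * u x)"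
    "(D\<nu> \<nu> ^^ 4) u = (\<lambda>x. (D ^^ 4) u x + 4 * \<nu> * (D ^^ 3) u x + 6 * \<nu>\<^sup>2 * (D ^^ 2) u x + 4 * \<nu> ^ 3 * D u x + \<nu> ^ 4 * u x)"
    unfolding n 1 2 3 4 by (rule refl)+
qed

section \<open>The orders of the Bloch problem\<close>

locale gks_wave = kdv_state +
  fixes \<delta> c2 :: real and Ud :: "real \<Rightarrow> real \<Rightarrow> real" and cd X Y :: "real \<Rightarrow> real"
  assumes \<delta>: "0 < \<delta>" and gks: "gks_profiles k M p Ud cd X Y c2"
begin

abbreviation "X1 \<equiv> D X"
abbreviation "X2 \<equiv> (D ^^ 2) X"
abbreviation "X3 \<equiv> (D ^^ 3) X"
abbreviation "X4 \<equiv> (D ^^ 4) X"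
abbreviation "Y1 \<equiv> D Y"
abbreviation "Y2 \<equiv> (D ^^ 2) Y"
abbreviation "Y3 \<equiv> (D ^^ 3) Y"

lemma gks_X: "Ck 4 X" "one_periodic X" "X (- y) = - X y"
  and gks_Y: "Ck 4 Y" "one_periodic Y"
  and gks_expand: "expands_C4 Ud U X Y" "expands cd c 0 c2"
  and gks_Ck: "\<forall>\<^sub>F d in at_right 0. Ck 4 (Ud d)"
  using gks unfolding gks_profiles_def by (auto elim: eventually_mono)

lemma jet_derivs:
  assumes "Ck 4 f"
  shows "(f has_vector_derivative D f y) (at y)" "(D f has_vector_derivative (D ^^ 2) f y) (at y)"
    "((D ^^ 2) f has_vector_derivative (D ^^ 3) f y) (at y)" "((D ^^ 3) f has_vector_derivative (D ^^ 4) f y) (at y)"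
  using Ck_funpow_D_deriv[OF assms, of 0 y] Ck_funpow_D_deriv[OF assms, of 1 y]
    Ck_funpow_D_deriv[OF assms, of 2 y] Ck_funpow_D_deriv[OF assms, of 3 y] by (simp_all add: eval_nat_numeral)

lemma jet_periodic:
  assumes "Ck 4 f" "one_periodic f"
  shows "one_periodic (D f)" "one_periodic ((D ^^ 2) f)" "one_periodic ((D ^^ 3) f)" "one_periodic ((D ^^ 4) f)"
  using one_periodic_funpow_D[OF assms, of 1] one_periodic_funpow_D[OF assms, of 2]
    one_periodic_funpow_D[OF assms, of 3] one_periodic_funpow_D[OF assms, of 4] by simp_all

lemma jet_continuous:
  assumes "Ck 4 f"
  shows "continuous_on UNIV f" "continuous_on UNIV (D f)" "continuous_on UNIV ((D ^^ 2) f)"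
    "continuous_on UNIV ((D ^^ 3) f)" "continuous_on UNIV ((D ^^ 4) f)"
  using Ck_funpow_D_continuous[OF assms, of 0] Ck_funpow_D_continuous[OF assms, of 1]
    Ck_funpow_D_continuous[OF assms, of 2] Ck_funpow_D_continuous[OF assms, of 3] Ck_funpow_D_continuous[OF assms, of 4]
  by simp_all

lemma dX: "(X has_real_derivative X1 y) (at y)" "(X1 has_real_derivative X2 y) (at y)"
    "(X2 has_real_derivative X3 y) (at y)" "(X3 has_real_derivative X4 y) (at y)"
  using jet_derivs[OF gks_X(1)] by (simp_all add: has_real_derivative_iff_has_vector_derivative)

lemma dY: "(Y has_real_derivative Y1 y) (at y)" "(Y1 has_real_derivative Y2 y) (at y)"
    "(Y2 has_real_derivative Y3 y) (at y)"
  using jet_derivs[OF gks_Y(1)] by (simp_all add: has_real_derivative_iff_has_vector_derivative)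

lemma X_eq: "k ^ 3 * X3 y + k * (6 * V1 y * X y + (6 * V y - ct) * X1 y) + k\<^sup>2 * V2 y + k ^ 4 * V4 y = 0"
proof -
  have "((\<lambda>z. (6 * V z - ct) * X z) has_real_derivative 6 * V1 y * X y + (6 * V y - ct) * X1 y) (at y)"
    by (auto intro!: derivative_eq_intros dV dX)
  note e = D_eqI_real[OF this]
  have "k ^ 3 * X3 y + k * D (\<lambda>z. (6 * V z - ct) * X z) y + k\<^sup>2 * (D ^^ 2) V y + k ^ 4 * (D ^^ 4) V y = 0"
    using gks unfolding gks_profiles_def by blast
  then show ?thesis unfolding e D_V .
qed

lemma Y_eq: "k ^ 3 * Y3 y + k * (6 * V1 y * Y y + (6 * V y - ct) * Y1 y + 6 * X y * X1 y - c2 * V1 y)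
  + k\<^sup>2 * X2 y + k ^ 4 * X4 y = 0"
proof -
  have "((\<lambda>z. (6 * V z - ct) * Y z + 3 * (X z)\<^sup>2 - c2 * V z) has_real_derivative
     6 * V1 y * Y y + (6 * V y - ct) * Y1 y + 6 * X y * X1 y - c2 * V1 y) (at y)"
    by (auto intro!: derivative_eq_intros dV dX dY)
  note e = D_eqI_real[OF this]
  have "k ^ 3 * Y3 y + k * D (\<lambda>z. (6 * V z - ct) * Y z + 3 * (X z)\<^sup>2 - c2 * V z) y + k\<^sup>2 * X2 y + k ^ 4 * X4 y = 0"
    using gks unfolding gks_profiles_def by blast
  then show ?thesis unfolding e .
qed

text \<open>At a fixed point \<open>y\<close> all ingredients are scalar expansions, so the equation is expanded by the calculus
of \<open>expands\<close> and its three coefficients vanish.\<close>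

lemma bloch_orders:
  assumes "bloch_expansion k \<delta> Ud cd \<nu> lam0 lam1 u0 u1 u2"
  defines "K \<equiv> complex_of_real k" and "d \<equiv> complex_of_real \<delta>"
    and "q \<equiv> \<lambda>y. complex_of_real (6 * V y - ct)" and "q1 \<equiv> \<lambda>y. complex_of_real (6 * V1 y)"
    and "x \<equiv> \<lambda>y. complex_of_real (X y)" and "x1 \<equiv> \<lambda>y. complex_of_real (X1 y)"
    and "z \<equiv> \<lambda>y. complex_of_real (Y y)" and "z1 \<equiv> \<lambda>y. complex_of_real (Y1 y)"
  shows "K * (q1 y * u0 y + q y * D u0 y) + K ^ 3 * (D ^^ 3) u0 y = 0"
    "\<nu> * lam0 * u0 y + K * (q1 y * u1 y + q y * D u1 y) + K * (6 * d * (x1 y * u0 y + x y * D u0 y)) + K * \<nu> * (q y * u0 y)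
      + K ^ 3 * ((D ^^ 3) u1 y + 3 * \<nu> * (D ^^ 2) u0 y) + d * (K\<^sup>2 * (D ^^ 2) u0 y + K ^ 4 * (D ^^ 4) u0 y) = 0"
    "\<nu>\<^sup>2 * lam1 * u0 y + \<nu> * lam0 * u1 y + K * (q1 y * u2 y + q y * D u2 y)
      + K * (6 * d * (x1 y * u1 y + x y * D u1 y) + d\<^sup>2 * (6 * z1 y * u0 y + (6 * z y - of_real c2) * D u0 y))
      + K * \<nu> * (q y * u1 y + 6 * d * x y * u0 y)
      + K ^ 3 * ((D ^^ 3) u2 y + 3 * \<nu> * (D ^^ 2) u1 y + 3 * \<nu>\<^sup>2 * D u0 y)
      + d * (K\<^sup>2 * ((D ^^ 2) u1 y + 2 * \<nu> * D u0 y) + K ^ 4 * ((D ^^ 4) u1 y + 4 * \<nu> * (D ^^ 3) u0 y)) = 0"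
proof -
  from assms(1) obtain lam u where Ck: "Ck 4 u0" "Ck 4 u1" "Ck 4 u2"
    and ev: "\<forall>\<^sub>F e in at_right 0. bloch_eigenpair k (e * \<delta>) (Ud (e * \<delta>)) (cd (e * \<delta>)) (of_real e * \<nu>) (lam e) (u e)"
    and lam: "expands lam 0 (\<nu> * lam0) (\<nu>\<^sup>2 * lam1)" and u: "expands_C4 u u0 u1 u2"
    unfolding bloch_expansion_def by blast
  have Cku: "\<forall>\<^sub>F e in at_right 0. Ck 4 (u e)" using ev by eventually_elim (simp add: bloch_eigenpair_def)
  have "filterlim (\<lambda>e. e * \<delta>) (at_right 0) (at_right 0)"
    unfolding filterlim_at using \<delta> eventually_at_right_less[of 0]
    by (auto intro!: tendsto_eq_intros elim: eventually_mono)
  from eventually_compose_filterlim[OF gks_Ck this] have CkU: "\<forall>\<^sub>F e in at_right 0. Ck 4 (Ud (e * \<delta>))" .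
  define w where "w j e = (D ^^ j) (u e) y" for j e
  define P where "P e = complex_of_real (Ud (e * \<delta>) y)" for e
  define P1 where "P1 e = complex_of_real (D (Ud (e * \<delta>)) y)" for e
  define C where "C e = complex_of_real (cd (e * \<delta>))" for e
  define n where "n e = complex_of_real e * \<nu>" for e
  define l where "l e = complex_of_real e * d" for e
  have w: "expands (w j) ((D ^^ j) u0 y) ((D ^^ j) u1 y) ((D ^^ j) u2 y)" if "j \<le> 4" for j
    unfolding w_def by (rule expands_C4_at[OF u Cku Ck that])
  have w': "expands (w 0) (u0 y) (u1 y) (u2 y)" "expands (w 1) (D u0 y) (D u1 y) (D u2 y)"
    "expands (w 2) ((D ^^ 2) u0 y) ((D ^^ 2) u1 y) ((D ^^ 2) u2 y)" "expands (w 3) ((D ^^ 3) u0 y) ((D ^^ 3) u1 y) ((D ^^ 3) u2 y)"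
    "expands (w 4) ((D ^^ 4) u0 y) ((D ^^ 4) u1 y) ((D ^^ 4) u2 y)"
    using w[of 0] w[of 1] w[of 2] w[of 3] w[of 4] by simp_all
  have "expands (\<lambda>e. Ud e y) (U y) (X y) (Y y)"
    using expands_C4_at[OF gks_expand(1) gks_Ck Ck_U gks_X(1) gks_Y(1), of 0 y] by simp
  from expands_bounded_linear[OF bounded_linear_of_real expands_scale[OF this \<delta>]]
  have P: "expands P (of_real (U y)) (d * x y) (d\<^sup>2 * z y)" unfolding P_def by (simp add: d_def x_def z_def)
  have "expands (\<lambda>e. D (Ud e) y) (V1 y) (X1 y) (Y1 y)"
    using expands_C4_at[OF gks_expand(1) gks_Ck Ck_U gks_X(1) gks_Y(1), of 1 y] by (simp add: D_U)
  from expands_bounded_linear[OF bounded_linear_of_real expands_scale[OF this \<delta>]]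
  have P1: "expands P1 (of_real (V1 y)) (d * x1 y) (d\<^sup>2 * z1 y)" unfolding P1_def by (simp add: d_def x1_def z1_def)
  from expands_bounded_linear[OF bounded_linear_of_real expands_scale[OF gks_expand(2) \<delta>]]
  have C: "expands C (of_real c) 0 (d\<^sup>2 * of_real c2)" unfolding C_def by (simp add: d_def)
  have n: "expands n 0 \<nu> 0" unfolding n_def by (rule expands_linear)
  have l: "expands l 0 d 0" unfolding l_def by (rule expands_linear)
  define Q where "Q e = 6 * P e - C e" for e
  define Q1 where "Q1 e = 6 * P1 e" for e
  have Q: "expands Q (q y) (6 * d * x y) (d\<^sup>2 * (6 * z y - of_real c2))"
    unfolding Q_def by (rule expands_eqI[OF expands_diff[OF expands_mult[OF expands_const P] C]])
      (simp_all add: q_def U_eq c_eq algebra_simps)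
  have Q1: "expands Q1 (q1 y) (6 * d * x1 y) (6 * d\<^sup>2 * z1 y)"
    unfolding Q1_def by (rule expands_eqI[OF expands_mult[OF expands_const P1]]) (simp_all add: q1_def algebra_simps)
  have n2: "expands (\<lambda>e. (n e)\<^sup>2) 0 0 (\<nu>\<^sup>2)"
    unfolding power2_eq_square by (rule expands_eqI[OF expands_mult[OF n n]]) simp_all
  have n3: "expands (\<lambda>e. (n e) ^ 3) 0 0 0"
    using expands_mult[OF n n2] by (simp add: eval_nat_numeral)
  have n4: "expands (\<lambda>e. (n e) ^ 4) 0 0 0"
    using expands_mult[OF n n3] by (simp add: eval_nat_numeral)
  let ?B1 = "\<lambda>e. Q1 e * w 0 e + Q e * w 1 e + n e * (Q e * w 0 e)"
  let ?B2 = "\<lambda>e. w 2 e + 2 * n e * w 1 e + (n e)\<^sup>2 * w 0 e"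
  let ?B3 = "\<lambda>e. w 3 e + 3 * n e * w 2 e + 3 * (n e)\<^sup>2 * w 1 e + n e ^ 3 * w 0 e"
  let ?B4 = "\<lambda>e. w 4 e + 4 * n e * w 3 e + 6 * (n e)\<^sup>2 * w 2 e + 4 * n e ^ 3 * w 1 e + n e ^ 4 * w 0 e"
  let ?E = "\<lambda>e. lam e * w 0 e + K * ?B1 e + K ^ 3 * ?B3 e + l e * (K\<^sup>2 * ?B2 e + K ^ 4 * ?B4 e)"
  have zero: "\<forall>\<^sub>F e in at_right 0. ?E e = 0"
    using ev Cku CkU
  proof eventually_elim
    case (elim e)
    have dU: "(Ud (e * \<delta>) has_vector_derivative D (Ud (e * \<delta>)) y) (at y)" using jet_derivs(1)[OF elim(3)] .
    have "((\<lambda>z. complex_of_real (6 * Ud (e * \<delta>) z - cd (e * \<delta>)) * u e z) has_vector_derivative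
        complex_of_real (6 * Ud (e * \<delta>) y - cd (e * \<delta>)) * D (u e) y + complex_of_real (6 * D (Ud (e * \<delta>)) y) * u e y) (at y)"
    proof (rule has_vector_derivative_mult[OF _ jet_derivs(1)[OF elim(2)]])
      have "((\<lambda>z. 6 * Ud (e * \<delta>) z - cd (e * \<delta>)) has_vector_derivative 6 * D (Ud (e * \<delta>)) y) (at y)"
        using has_vector_derivative_diff[OF has_vector_derivative_mult_right[OF dU, of 6] has_vector_derivative_const[of "cd (e * \<delta>)"]]
        by simp
      from bounded_linear.has_vector_derivative[OF bounded_linear_of_real this]
      show "((\<lambda>z. complex_of_real (6 * Ud (e * \<delta>) z - cd (e * \<delta>))) has_vector_derivative complex_of_real (6 * D (Ud (e * \<delta>)) y)) (at y)" .
    qed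
    from D_eqI[OF this] have B1: "D\<nu> (n e) (\<lambda>z. of_real (6 * Ud (e * \<delta>) z - cd (e * \<delta>)) * u e z) y = ?B1 e"
      by (simp add: D\<nu>_def Q_def Q1_def P_def P1_def C_def w_def)
    have "lam e * u e y + of_real k * D\<nu> (n e) (\<lambda>z. of_real (6 * Ud (e * \<delta>) z - cd (e * \<delta>)) * u e z) y
        + of_real (k ^ 3) * (D\<nu> (n e) ^^ 3) (u e) y
        + of_real (e * \<delta>) * (of_real (k\<^sup>2) * (D\<nu> (n e) ^^ 2) (u e) y + of_real (k ^ 4) * (D\<nu> (n e) ^^ 4) (u e) y) = 0"
      using elim(1) unfolding bloch_eigenpair_def n_def by blast
    then show ?case unfolding B1 D\<nu>_powers[OF elim(2)] by (simp add: w_def K_def l_def d_def)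
  qed
  note ex = expands_add expands_mult expands_const w' Q Q1 n n2 n3 n4 l lam
  have exp: "expands ?E
     (K * (q1 y * u0 y + q y * D u0 y) + K ^ 3 * (D ^^ 3) u0 y)
     (\<nu> * lam0 * u0 y + K * (q1 y * u1 y + q y * D u1 y) + K * (6 * d * (x1 y * u0 y + x y * D u0 y)) + K * \<nu> * (q y * u0 y)
      + K ^ 3 * ((D ^^ 3) u1 y + 3 * \<nu> * (D ^^ 2) u0 y) + d * (K\<^sup>2 * (D ^^ 2) u0 y + K ^ 4 * (D ^^ 4) u0 y))
    (\<nu>\<^sup>2 * lam1 * u0 y + \<nu> * lam0 * u1 y + K * (q1 y * u2 y + q y * D u2 y)
      + K * (6 * d * (x1 y * u1 y + x y * D u1 y) + d\<^sup>2 * (6 * z1 y * u0 y + (6 * z y - of_real c2) * D u0 y))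
      + K * \<nu> * (q y * u1 y + 6 * d * x y * u0 y)
      + K ^ 3 * ((D ^^ 3) u2 y + 3 * \<nu> * (D ^^ 2) u1 y + 3 * \<nu>\<^sup>2 * D u0 y)
      + d * (K\<^sup>2 * ((D ^^ 2) u1 y + 2 * \<nu> * D u0 y) + K ^ 4 * ((D ^^ 4) u1 y + 4 * \<nu> * (D ^^ 3) u0 y)))"
    by (rule expands_eqI, (rule ex)+) (simp_all add: algebra_simps eval_nat_numeral)
  note e = expands_zero[OF exp zero]
  show "K * (q1 y * u0 y + q y * D u0 y) + K ^ 3 * (D ^^ 3) u0 y = 0" by (rule e(1))
  show "\<nu> * lam0 * u0 y + K * (q1 y * u1 y + q y * D u1 y) + K * (6 * d * (x1 y * u0 y + x y * D u0 y)) + K * \<nu> * (q y * u0 y)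
      + K ^ 3 * ((D ^^ 3) u1 y + 3 * \<nu> * (D ^^ 2) u0 y) + d * (K\<^sup>2 * (D ^^ 2) u0 y + K ^ 4 * (D ^^ 4) u0 y) = 0" by (rule e(2))
  show "\<nu>\<^sup>2 * lam1 * u0 y + \<nu> * lam0 * u1 y + K * (q1 y * u2 y + q y * D u2 y)
      + K * (6 * d * (x1 y * u1 y + x y * D u1 y) + d\<^sup>2 * (6 * z1 y * u0 y + (6 * z y - of_real c2) * D u0 y))
      + K * \<nu> * (q y * u1 y + 6 * d * x y * u0 y)
      + K ^ 3 * ((D ^^ 3) u2 y + 3 * \<nu> * (D ^^ 2) u1 y + 3 * \<nu>\<^sup>2 * D u0 y)
      + d * (K\<^sup>2 * ((D ^^ 2) u1 y + 2 * \<nu> * D u0 y) + K ^ 4 * ((D ^^ 4) u1 y + 4 * \<nu> * (D ^^ 3) u0 y)) = 0" by (rule e(3))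
qed

end

section \<open>Solvability conditions of the Bloch problem\<close>

lemma hvd_eqI: "(f has_vector_derivative d) F \<Longrightarrow> d = d' \<Longrightarrow> (f has_vector_derivative d') F"
  by simp

lemmas hvd = has_vector_derivative_add has_vector_derivative_diff has_vector_derivative_mult_right
  has_vector_derivative_mult

lemma avg_zero_if_exact:
  fixes Z :: "real \<Rightarrow> 'a::banach"
  assumes "\<And>y. (Z has_vector_derivative - I y) (at y)" "Z 1 = Z 0"
  shows "avg I = 0"
proof -
  have "avg (\<lambda>y. - I y) = 0" using avg_deriv[OF assms(1)] assms(2) by simp
  then show ?thesis by (simp add: avg_def)
qed

text \<open>The solvability condition of the first-order equation against a weight \<open>w\<close> in the kernel of the adjoint
operator: the equation times \<open>w\<close> is, up to the integrand of the conclusion, the derivative of the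
periodic function \<open>?Z\<close> that collects the boundary terms of all integrations by parts.\<close>

lemma pairing_order_one:
  fixes w w1 w2 w3 w4 q q1 x x1 f f1 f2 f3 f4 g g1 g2 g3 :: "real \<Rightarrow> complex"
  assumes w: "\<And>y. (w has_vector_derivative w1 y) (at y)" "\<And>y. (w1 has_vector_derivative w2 y) (at y)"
      "\<And>y. (w2 has_vector_derivative w3 y) (at y)" "\<And>y. (w3 has_vector_derivative w4 y) (at y)"
    and q: "\<And>y. (q has_vector_derivative q1 y) (at y)" and x: "\<And>y. (x has_vector_derivative x1 y) (at y)"
    and f: "\<And>y. (f has_vector_derivative f1 y) (at y)" "\<And>y. (f1 has_vector_derivative f2 y) (at y)"
      "\<And>y. (f2 has_vector_derivative f3 y) (at y)" "\<And>y. (f3 has_vector_derivative f4 y) (at y)"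
    and g: "\<And>y. (g has_vector_derivative g1 y) (at y)" "\<And>y. (g1 has_vector_derivative g2 y) (at y)"
      "\<And>y. (g2 has_vector_derivative g3 y) (at y)"
    and per: "w 1 = w 0" "w1 1 = w1 0" "w2 1 = w2 0" "w3 1 = w3 0" "q 1 = q 0" "x 1 = x 0" "f 1 = f 0" "f1 1 = f1 0"
      "f2 1 = f2 0" "f3 1 = f3 0" "g 1 = g 0" "g1 1 = g1 0" "g2 1 = g2 0"
    and adj: "\<And>y. K\<^sup>2 * w3 y + q y * w1 y = 0"
    and eq: "\<And>y. \<nu> * l * f y + K * (q1 y * g y + q y * g1 y) + K * (6 * d * (x1 y * f y + x y * f1 y)) + K * \<nu> * (q y * f y)
      + K ^ 3 * (g3 y + 3 * \<nu> * f2 y) + d * (K\<^sup>2 * f2 y + K ^ 4 * f4 y) = 0"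
  shows "avg (\<lambda>y. \<nu> * l * (w y * f y) + K * \<nu> * (q y * w y * f y) - 6 * K * d * (w1 y * x y * f y) + 3 * K ^ 3 * \<nu> * (w2 y * f y)
     + d * ((K\<^sup>2 * w2 y + K ^ 4 * w4 y) * f y)) = 0"
proof (rule avg_zero_if_exact)
  let ?Z = "\<lambda>y. K * (w y * (q y * g y)) + K ^ 3 * (w y * g2 y - w1 y * g1 y + w2 y * g y) + 6 * K * d * (w y * (x y * f y))
    + 3 * K ^ 3 * \<nu> * (w y * f1 y - w1 y * f y)
    + d * (K\<^sup>2 * (w y * f1 y - w1 y * f y) + K ^ 4 * (w y * f3 y - w1 y * f2 y + w2 y * f1 y - w3 y * f y))"
  fix y
  have "(?Z has_vector_derivative K * (w y * (q y * g1 y + q1 y * g y) + w1 y * (q y * g y)) + K ^ 3 * (w y * g3 y + w3 y * g y)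
      + 6 * K * d * (w y * (x y * f1 y + x1 y * f y) + w1 y * (x y * f y))
      + 3 * K ^ 3 * \<nu> * (w y * f2 y - w2 y * f y) + d * (K\<^sup>2 * (w y * f2 y - w2 y * f y) + K ^ 4 * (w y * f4 y - w4 y * f y))) (at y)"
    by (rule hvd_eqI, (rule hvd w q x f g)+) (simp add: algebra_simps)
  moreover have "K * (w y * (q y * g1 y + q1 y * g y) + w1 y * (q y * g y)) + K ^ 3 * (w y * g3 y + w3 y * g y)
      + 6 * K * d * (w y * (x y * f1 y + x1 y * f y) + w1 y * (x y * f y))
      + 3 * K ^ 3 * \<nu> * (w y * f2 y - w2 y * f y) + d * (K\<^sup>2 * (w y * f2 y - w2 y * f y) + K ^ 4 * (w y * f4 y - w4 y * f y))
    = w y * (\<nu> * l * f y + K * (q1 y * g y + q y * g1 y) + K * (6 * d * (x1 y * f y + x y * f1 y)) + K * \<nu> * (q y * f y)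
      + K ^ 3 * (g3 y + 3 * \<nu> * f2 y) + d * (K\<^sup>2 * f2 y + K ^ 4 * f4 y)) + K * g y * (K\<^sup>2 * w3 y + q y * w1 y)
     - (\<nu> * l * (w y * f y) + K * \<nu> * (q y * w y * f y) - 6 * K * d * (w1 y * x y * f y) + 3 * K ^ 3 * \<nu> * (w2 y * f y)
     + d * ((K\<^sup>2 * w2 y + K ^ 4 * w4 y) * f y))"
    by algebra
  ultimately show "(?Z has_vector_derivative - (\<nu> * l * (w y * f y) + K * \<nu> * (q y * w y * f y) - 6 * K * d * (w1 y * x y * f y)
     + 3 * K ^ 3 * \<nu> * (w2 y * f y) + d * ((K\<^sup>2 * w2 y + K ^ 4 * w4 y) * f y))) (at y)"
    unfolding eq adj by simp
qed (simp only: per)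

text \<open>The same integration by parts, one order further.\<close>

lemma pairing_order_two:
  fixes w w1 w2 w3 w4 q q1 x x1 z z1 f f1 f3 g g1 g2 g3 g4 h h1 h2 h3 :: "real \<Rightarrow> complex"
  assumes w: "\<And>y. (w has_vector_derivative w1 y) (at y)" "\<And>y. (w1 has_vector_derivative w2 y) (at y)"
      "\<And>y. (w2 has_vector_derivative w3 y) (at y)" "\<And>y. (w3 has_vector_derivative w4 y) (at y)"
    and q: "\<And>y. (q has_vector_derivative q1 y) (at y)" and x: "\<And>y. (x has_vector_derivative x1 y) (at y)"
    and z: "\<And>y. (z has_vector_derivative z1 y) (at y)"
    and f: "\<And>y. (f has_vector_derivative f1 y) (at y)"
    and g: "\<And>y. (g has_vector_derivative g1 y) (at y)" "\<And>y. (g1 has_vector_derivative g2 y) (at y)"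
      "\<And>y. (g2 has_vector_derivative g3 y) (at y)" "\<And>y. (g3 has_vector_derivative g4 y) (at y)"
    and h: "\<And>y. (h has_vector_derivative h1 y) (at y)" "\<And>y. (h1 has_vector_derivative h2 y) (at y)"
      "\<And>y. (h2 has_vector_derivative h3 y) (at y)"
    and per: "w 1 = w 0" "w1 1 = w1 0" "w2 1 = w2 0" "w3 1 = w3 0" "q 1 = q 0" "x 1 = x 0" "z 1 = z 0" "f 1 = f 0"
      "g 1 = g 0" "g1 1 = g1 0" "g2 1 = g2 0" "g3 1 = g3 0" "h 1 = h 0" "h1 1 = h1 0" "h2 1 = h2 0"
    and adj: "\<And>y. K\<^sup>2 * w3 y + q y * w1 y = 0"
    and eq: "\<And>y. \<nu>\<^sup>2 * l1 * f y + \<nu> * l * g y + K * (q1 y * h y + q y * h1 y)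
      + K * (6 * d * (x1 y * g y + x y * g1 y) + d\<^sup>2 * (6 * z1 y * f y + (6 * z y - c2) * f1 y))
      + K * \<nu> * (q y * g y + 6 * d * x y * f y)
      + K ^ 3 * (h3 y + 3 * \<nu> * g2 y + 3 * \<nu>\<^sup>2 * f1 y)
      + d * (K\<^sup>2 * (g2 y + 2 * \<nu> * f1 y) + K ^ 4 * (g4 y + 4 * \<nu> * f3 y)) = 0"
  shows "avg (\<lambda>y. \<nu>\<^sup>2 * l1 * (w y * f y) + \<nu> * l * (w y * g y) - 6 * K * d * (w1 y * x y * g y)
     - K * d\<^sup>2 * (w1 y * (6 * z y - c2) * f y) + K * \<nu> * (w y * q y * g y + 6 * d * (w y * x y * f y))
     + K ^ 3 * (3 * \<nu> * (w2 y * g y) + 3 * \<nu>\<^sup>2 * (w y * f1 y))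
     + d * ((K\<^sup>2 * w2 y + K ^ 4 * w4 y) * g y + w y * (2 * \<nu> * K\<^sup>2 * f1 y + 4 * \<nu> * K ^ 4 * f3 y))) = 0"
proof (rule avg_zero_if_exact)
  let ?Z = "\<lambda>y. K * (w y * (q y * h y)) + K ^ 3 * (w y * h2 y - w1 y * h1 y + w2 y * h y) + 6 * K * d * (w y * (x y * g y))
    + K * d\<^sup>2 * (w y * ((6 * z y - c2) * f y)) + 3 * K ^ 3 * \<nu> * (w y * g1 y - w1 y * g y)
    + d * (K\<^sup>2 * (w y * g1 y - w1 y * g y) + K ^ 4 * (w y * g3 y - w1 y * g2 y + w2 y * g1 y - w3 y * g y))"
  let ?Z' = "\<lambda>y. K * (w y * (q y * h1 y + q1 y * h y) + w1 y * (q y * h y)) + K ^ 3 * (w y * h3 y + w3 y * h y)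
      + 6 * K * d * (w y * (x y * g1 y + x1 y * g y) + w1 y * (x y * g y))
      + K * d\<^sup>2 * (w y * ((6 * z y - c2) * f1 y + 6 * z1 y * f y) + w1 y * ((6 * z y - c2) * f y))
      + 3 * K ^ 3 * \<nu> * (w y * g2 y - w2 y * g y) + d * (K\<^sup>2 * (w y * g2 y - w2 y * g y) + K ^ 4 * (w y * g4 y - w4 y * g y))"
  fix y
  have "((\<lambda>y. 6 * z y - c2) has_vector_derivative 6 * z1 y) (at y)" for y
    using has_vector_derivative_diff[OF has_vector_derivative_mult_right[OF z, of 6] has_vector_derivative_const[of c2]] by simp
  then have "(?Z has_vector_derivative ?Z' y) (at y)"
    by - (rule hvd_eqI, (assumption | rule has_vector_derivative_add has_vector_derivative_diff
       has_vector_derivative_mult_right has_vector_derivative_mult w q x f g h)+, simp add: algebra_simps)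
  moreover have "?Z' y
    = w y * (\<nu>\<^sup>2 * l1 * f y + \<nu> * l * g y + K * (q1 y * h y + q y * h1 y)
      + K * (6 * d * (x1 y * g y + x y * g1 y) + d\<^sup>2 * (6 * z1 y * f y + (6 * z y - c2) * f1 y))
      + K * \<nu> * (q y * g y + 6 * d * x y * f y)
      + K ^ 3 * (h3 y + 3 * \<nu> * g2 y + 3 * \<nu>\<^sup>2 * f1 y)
      + d * (K\<^sup>2 * (g2 y + 2 * \<nu> * f1 y) + K ^ 4 * (g4 y + 4 * \<nu> * f3 y))) + K * h y * (K\<^sup>2 * w3 y + q y * w1 y)
     - (\<nu>\<^sup>2 * l1 * (w y * f y) + \<nu> * l * (w y * g y) - 6 * K * d * (w1 y * x y * g y)
     - K * d\<^sup>2 * (w1 y * (6 * z y - c2) * f y) + K * \<nu> * (w y * q y * g y + 6 * d * (w y * x y * f y))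
     + K ^ 3 * (3 * \<nu> * (w2 y * g y) + 3 * \<nu>\<^sup>2 * (w y * f1 y))
     + d * ((K\<^sup>2 * w2 y + K ^ 4 * w4 y) * g y + w y * (2 * \<nu> * K\<^sup>2 * f1 y + 4 * \<nu> * K ^ 4 * f3 y)))"
    by algebra
  ultimately show "(?Z has_vector_derivative - (\<nu>\<^sup>2 * l1 * (w y * f y) + \<nu> * l * (w y * g y) - 6 * K * d * (w1 y * x y * g y)
     - K * d\<^sup>2 * (w1 y * (6 * z y - c2) * f y) + K * \<nu> * (w y * q y * g y + 6 * d * (w y * x y * f y))
     + K ^ 3 * (3 * \<nu> * (w2 y * g y) + 3 * \<nu>\<^sup>2 * (w y * f1 y))
     + d * ((K\<^sup>2 * w2 y + K ^ 4 * w4 y) * g y + w y * (2 * \<nu> * K\<^sup>2 * f1 y + 4 * \<nu> * K ^ 4 * f3 y)))) (at y)"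
    unfolding eq adj by simp
qed (simp only: per)

context kdv_wave
begin

definition "V5 y = (ct * V3 y - 18 * V1 y * V2 y - 6 * V y * V3 y) / k\<^sup>2"

lemma dV4: "(V4 has_real_derivative V5 y) (at y)"
  unfolding V4_def[abs_def] V5_def
  by (rule DERIV_cdivide, (rule derivative_eq_intros dV dV1 dV2 refl)+) (simp add: algebra_simps)

lemma periodic_V4: "one_periodic V4"
  unfolding V4_def one_periodic_def using periodic[unfolded one_periodic_def] by simp

lemma k2V2: "k\<^sup>2 * V2 y = b + ct * V y - 3 * (V y)\<^sup>2" using k_nz by (simp add: V2_def)
lemma k2V3: "k\<^sup>2 * V3 y = ct * V1 y - 6 * V y * V1 y" using k_nz by (simp add: V3_def)
lemma k2W2: "k\<^sup>2 * W2 y = bp + ctp * V y + ct * W y - 6 * V y * W y" using k_nz by (simp add: W2_def)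
lemma k2W3: "k\<^sup>2 * W3 y = ctp * V1 y + ct * W1 y - 6 * V1 y * W y - 6 * V y * W1 y" using k_nz by (simp add: W3_def)

lemma at_1: "V 1 = V 0" "V1 1 = V1 0" "V2 1 = V2 0" "V3 1 = V3 0" "W 1 = W 0" "W1 1 = W1 0" "W2 1 = W2 0"
  using periodic[unfolded one_periodic_def, rule_format, of 0] by auto

lemma has_integral_exact: "\<lbrakk>\<And>y. (F has_real_derivative f y) (at y); F 1 = F 0\<rbrakk> \<Longrightarrow> (f has_integral 0) {0..1}" for f :: "real \<Rightarrow> real"
  using fundamental_theorem_of_calculus[of 0 1 F f]
  by (auto simp: has_real_derivative_iff_has_vector_derivative intro: has_vector_derivative_at_within)

lemma moment_V: "(V has_integral 0) {0..1}" and moment_W: "(W has_integral 0) {0..1}"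
  using has_integral_avg[of V] has_integral_avg[of W] cont mean_V mean_W by simp_all

lemma has_integral_const01: "((\<lambda>y. c) has_integral c) {0..1::real}" for c :: real
  using has_integral_const_real[of c 0 1] by simp

lemma moment_V2: "((\<lambda>y. (V y)\<^sup>2) has_integral b / 3) {0..1}"
proof -
  have "((\<lambda>y. k\<^sup>2 * V2 y) has_integral 0) {0..1}"
    by (rule has_integral_exact[of "\<lambda>y. k\<^sup>2 * V1 y"]) (simp_all add: DERIV_cmult dV1 at_1)
  then have "((\<lambda>y. (b + ct * V y - k\<^sup>2 * V2 y) / 3) has_integral (b + ct * 0 - 0) / 3) {0..1}"
    by (intro has_integral_divide has_integral_diff has_integral_add has_integral_mult_right moment_V has_integral_const01)
  then show ?thesis unfolding k2V2 by simp
qed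

text \<open>Averages of products of \<open>V\<close> and \<open>W\<close>, obtained by averaging the profile equation and its derivative in
the modulus instead of evaluating elliptic integrals.\<close>

lemma moment_VW: "((\<lambda>y. V y * W y) has_integral bp / 6) {0..1}"
proof -
  have "((\<lambda>y. k\<^sup>2 * W2 y) has_integral 0) {0..1}"
    by (rule has_integral_exact[of "\<lambda>y. k\<^sup>2 * W1 y"]) (simp_all add: DERIV_cmult dW1 at_1)
  then have "((\<lambda>y. (bp + ctp * V y + ct * W y - k\<^sup>2 * W2 y) / 6) has_integral (bp + ctp * 0 + ct * 0 - 0) / 6) {0..1}"
    by (intro has_integral_divide has_integral_diff has_integral_add has_integral_mult_right moment_V moment_W has_integral_const01)
  then show ?thesis unfolding k2W2 by simp
qed

text \<open>The Wronskian of \<open>V\<close> and \<open>W\<close> is periodic.\<close>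

lemma moment_V2W: "((\<lambda>y. (V y)\<^sup>2 * W y) has_integral ctp * b / 9) {0..1}"
proof -
  let ?I = "\<lambda>y. V y * (k\<^sup>2 * W2 y) - (k\<^sup>2 * V2 y) * W y"
  have "(?I has_integral 0) {0..1}"
  proof (rule has_integral_exact[of "\<lambda>y. k\<^sup>2 * (V y * W1 y - V1 y * W y)"])
    show "((\<lambda>y. k\<^sup>2 * (V y * W1 y - V1 y * W y)) has_real_derivative ?I y) (at y)" for y
      by (rule derivative_eq_intros dV dV1 dW dW1 refl)+ (simp add: algebra_simps)
  qed (simp only: at_1)
  then have "((\<lambda>y. (bp * V y + ctp * (V y)\<^sup>2 - b * W y - ?I y) / 3) has_integral (bp * 0 + ctp * (b / 3) - b * 0 - 0) / 3) {0..1}"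
    by (intro has_integral_divide has_integral_diff has_integral_add has_integral_mult_right moment_V moment_W moment_V2)
  moreover have "(bp * V y + ctp * (V y)\<^sup>2 - b * W y - ?I y) / 3 = (V y)\<^sup>2 * W y" for y
    unfolding k2V2 k2W2 by (simp add: algebra_simps power2_eq_square)
  ultimately show ?thesis by simp
qed

text \<open>\<open>kappa\<close> is the mean of \<open>V\<close> against \<open>kphi\<close>.\<close>

definition "kappa = - bp / ctp"

lemma moment_phi: "(kphi has_integral 1) {0..1}"
proof -
  have "((\<lambda>y. 1 - 6 / ctp * W y) has_integral 1 - 6 / ctp * 0) {0..1}"
    by (intro has_integral_diff has_integral_mult_right moment_W has_integral_const01)
  then show ?thesis by (simp add: kphi_def[abs_def])
qed

lemma moment_V_phi: "((\<lambda>y. V y * kphi y) has_integral kappa) {0..1}"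
proof -
  have "((\<lambda>y. V y - 6 / ctp * (V y * W y)) has_integral 0 - 6 / ctp * (bp / 6)) {0..1}"
    by (intro has_integral_diff has_integral_mult_right moment_V moment_VW)
  then show ?thesis by (simp add: kphi_def kappa_def algebra_simps)
qed

lemma moment_V2_phi: "((\<lambda>y. (V y)\<^sup>2 * kphi y) has_integral - b / 3) {0..1}"
proof -
  have "((\<lambda>y. (V y)\<^sup>2 - 6 / ctp * ((V y)\<^sup>2 * W y)) has_integral b / 3 - 6 / ctp * (ctp * b / 9)) {0..1}"
    by (intro has_integral_diff has_integral_mult_right moment_V2 moment_V2W)
  then show ?thesis using ctp_nz by (simp add: kphi_def algebra_simps)
qed

lemma moment_q_phi: "((\<lambda>y. (6 * V y - ct) * kphi y) has_integral 6 * kappa - ct) {0..1}"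
proof -
  have "((\<lambda>y. 6 * (V y * kphi y) - ct * kphi y) has_integral 6 * kappa - ct * 1) {0..1}"
    by (intro has_integral_diff has_integral_mult_right moment_V_phi moment_phi)
  then show ?thesis by (simp add: algebra_simps)
qed

lemma moment_pairing_phi:
  "((\<lambda>y. ((6 * V y - ct) * V y + 3 * (k\<^sup>2 * V2 y)) * kphi y) has_integral 4 * b + 2 * ct * kappa) {0..1}"
proof -
  have "((\<lambda>y. - 3 * ((V y)\<^sup>2 * kphi y) + 2 * ct * (V y * kphi y) + 3 * b * kphi y) has_integral
     - 3 * (- b / 3) + 2 * ct * kappa + 3 * b * 1) {0..1}"
    by (intro has_integral_add has_integral_mult_right moment_V_phi moment_V2_phi moment_phi)
  then show ?thesis unfolding k2V2 by (simp add: algebra_simps power2_eq_square)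
qed

lemma kappa_not_resonant: "4 * b + 3 * ct * kappa - 6 * kappa\<^sup>2 < 0"
  using kdv_not_resonant[OF p k_nz] by (simp add: kappa_def)

lemma even_V2: "V2 (- y) = V2 y" and even_V4: "V4 (- y) = V4 y"
  by (simp_all add: V2_def V4_def even_V odd_V1)

end

section \<open>The leading order of a Bloch wave\<close>

lemma has_integral_complex: "(f has_integral i) {0..1} \<Longrightarrow> ((\<lambda>y. complex_of_real (f y)) has_integral complex_of_real i) {0..1::real}"
  using has_integral_linear[OF _ bounded_linear_of_real, of f i "{0..1}"] by (simp add: o_def)

lemma complex_deriv: "(f has_real_derivative f') (at y) \<Longrightarrow> ((\<lambda>y. complex_of_real (f y)) has_vector_derivative complex_of_real f') (at y)"
  using bounded_linear.has_vector_derivative[OF bounded_linear_of_real, of f f'] by (simp add: has_real_derivative_iff_has_vector_derivative)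

lemma has_integral_odd:
  fixes f :: "real \<Rightarrow> real"
  assumes "continuous_on UNIV f" "one_periodic f" "\<And>y. f (- y) = - f y"
  shows "(f has_integral 0) {0..1}"
  using has_integral_avg[OF assms(1)] avg_odd[OF assms] by simp

lemma one_periodic_1: "one_periodic f \<Longrightarrow> f 1 = f 0"
  unfolding one_periodic_def by (metis add_0)

context gks_wave
begin

lemma dq: "((\<lambda>y. 6 * V y - ct) has_real_derivative 6 * V1 y) (at y)"
  by (auto intro!: derivative_eq_intros dV)

lemma X_at_1: "X 1 = X 0" "X1 1 = X1 0" "X2 1 = X2 0" "X3 1 = X3 0" "X4 1 = X4 0"
  using gks_X jet_periodic[OF gks_X(1,2)] by (auto intro: one_periodic_1)

lemma Y_at_1: "Y 1 = Y 0" "Y1 1 = Y1 0" "Y2 1 = Y2 0"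
  using gks_Y jet_periodic[OF gks_Y(1,2)] by (auto intro: one_periodic_1)

lemma contX: "continuous_on UNIV X" "continuous_on UNIV X1" "continuous_on UNIV X2" "continuous_on UNIV X3" "continuous_on UNIV X4"
  using jet_continuous[OF gks_X(1)] by auto

text \<open>With \<open>u0 = \<beta> kphi + \<alpha> V1\<close>, all averages against \<open>V1\<close> vanish by parity.  The two solvability conditions
then are homogeneous in \<open>\<beta>\<close>; if \<open>\<beta> \<noteq> 0\<close>, eliminating the eigenvalue leaves
\<open>\<nu> k (4 b + 3 c \<kappa> - 6 \<kappa>\<^sup>2) + \<delta> r = 0\<close> with \<open>r\<close> real, and the imaginary part contradicts
\<open>kappa_not_resonant\<close>.\<close>

lemma bloch_leading:
  assumes \<nu>: "Re \<nu> = 0" "\<nu> \<noteq> 0" and be: "bloch_expansion k \<delta> Ud cd \<nu> lam0 lam1 u0 u1 u2"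
  shows "\<exists>\<alpha>. \<forall>y. u0 y = \<alpha> * of_real (V1 y)"
proof -
  define K where "K = complex_of_real k"
  define d where "d = complex_of_real \<delta>"
  note o = bloch_orders[OF be, folded K_def d_def]
  have Ck: "Ck 4 u0" "Ck 4 u1" and per: "one_periodic u0" "one_periodic u1"
    using be by (auto simp: bloch_expansion_def)
  obtain \<alpha> where u0: "u0 y = avg u0 * of_real (kphi y) + \<alpha> * of_real (V1 y)" for y
    using linearized_kernel[OF jet_derivs(1-3)[OF Ck(1)] per(1)] o(1) by (auto simp: K_def)
  define \<beta> where "\<beta> = avg u0"
  note u0 = u0[folded \<beta>_def]
  note at1 = one_periodic_1[OF per(1)] one_periodic_1[OF per(2)]
     jet_periodic[OF Ck(1) per(1), THEN one_periodic_1] jet_periodic[OF Ck(2) per(2), THEN one_periodic_1]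
  have q1: "complex_of_real (6 * V 1 - ct) = complex_of_real (6 * V 0 - ct)" by (simp add: at_1)
  have "avg (\<lambda>y. \<nu> * lam0 * (1 * u0 y) + K * \<nu> * (complex_of_real (6 * V y - ct) * 1 * u0 y) - 6 * K * d * (0 * complex_of_real (X y) * u0 y)
     + 3 * K ^ 3 * \<nu> * (0 * u0 y) + d * ((K\<^sup>2 * 0 + K ^ 4 * 0) * u0 y)) = 0"
    by (rule pairing_order_one[where ?w = "\<lambda>_. 1" and ?w1.0 = "\<lambda>_. 0" and ?w2.0 = "\<lambda>_. 0" and ?w3.0 = "\<lambda>_. 0" and ?w4.0 = "\<lambda>_. 0",
          OF _ _ _ _ complex_deriv[OF dq] complex_deriv[OF dX(1)] jet_derivs[OF Ck(1)] jet_derivs(1-3)[OF Ck(2)]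
          _ _ _ _ _ _ _ _ _ _ _ _ _ _ o(2)])
      (simp_all add: at1 at_1 X_at_1)
  then have S1: "avg (\<lambda>y. \<nu> * (lam0 * u0 y + K * (complex_of_real (6 * V y - ct) * u0 y))) = 0"
    by (simp add: algebra_simps)
  have adj: "K\<^sup>2 * complex_of_real (V3 y) + complex_of_real (6 * V y - ct) * complex_of_real (V1 y) = 0" for y
    using arg_cong[OF k2V3[of y], of complex_of_real] by (simp add: K_def algebra_simps)
  have S2: "avg (\<lambda>y. \<nu> * lam0 * (complex_of_real (V y) * u0 y) + K * \<nu> * (complex_of_real (6 * V y - ct) * complex_of_real (V y) * u0 y)
      - 6 * K * d * (complex_of_real (V1 y) * complex_of_real (X y) * u0 y)
     + 3 * K ^ 3 * \<nu> * (complex_of_real (V2 y) * u0 y) + d * ((K\<^sup>2 * complex_of_real (V2 y) + K ^ 4 * complex_of_real (V4 y)) * u0 y)) = 0"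
    by (rule pairing_order_one[OF complex_deriv[OF dV] complex_deriv[OF dV1] complex_deriv[OF dV2] complex_deriv[OF dV3]
          complex_deriv[OF dq] complex_deriv[OF dX(1)] jet_derivs[OF Ck(1)] jet_derivs(1-3)[OF Ck(2)]
          _ _ _ _ _ _ _ _ _ _ _ _ _ adj o(2)])
      (simp_all add: at1 at_1 X_at_1)
  have oddI: "((\<lambda>y. g y * V1 y) has_integral 0) {0..1}" if "continuous_on UNIV g" "one_periodic g" "\<And>y. g (- y) = g y" for g :: "real \<Rightarrow> real"
    by (rule has_integral_odd) (use that periodic(2) cont(2) odd_V1 in \<open>auto simp: one_periodic_def intro!: continuous_intros\<close>)
  have pV: "V (y + 1) = V y" "V1 (y + 1) = V1 y" "V2 (y + 1) = V2 y" "V4 (y + 1) = V4 y" "X (y + 1) = X y" "W (y + 1) = W y" for y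
    using periodic periodic_V4 gks_X by (auto simp: one_periodic_def)
  have "((\<lambda>y. \<nu> * (\<beta> * (lam0 * of_real (kphi y) + K * of_real ((6 * V y - ct) * kphi y)) + \<alpha> * (lam0 * of_real (1 * V1 y) + K * of_real ((6 * V y - ct) * V1 y))))
      has_integral \<nu> * (\<beta> * (lam0 * of_real 1 + K * of_real (6 * kappa - ct)) + \<alpha> * (lam0 * of_real 0 + K * of_real 0))) {0..1}"
    by (intro has_integral_mult_right has_integral_add has_integral_complex moment_phi moment_q_phi oddI)
      (auto simp: one_periodic_def pV even_V intro!: continuous_intros cont)
  then have "avg (\<lambda>y. \<nu> * (lam0 * u0 y + K * (complex_of_real (6 * V y - ct) * u0 y))) = \<nu> * (\<beta> * (lam0 * of_real 1 + K * of_real (6 * kappa - ct)) + \<alpha> * (lam0 * of_real 0 + K * of_real 0))"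
    unfolding avg_def by (intro integral_unique) (simp add: u0 algebra_simps)
  then have B1: "\<beta> * (lam0 + K * of_real (6 * kappa - ct)) = 0" using S1 \<nu> by simp
  define G where "G y = - 6 * k * (V1 y * X y) + k\<^sup>2 * V2 y + k ^ 4 * V4 y" for y
  define H where "H y = (6 * V y - ct) * V y + 3 * (k\<^sup>2 * V2 y)" for y
  define r where "r = avg (\<lambda>y. G y * kphi y)"
  have cG: "continuous_on UNIV G" "continuous_on UNIV H" unfolding G_def H_def by (intro continuous_intros cont cont_V4 contX)+
  have cp: "continuous_on UNIV kphi" unfolding kphi_def[abs_def] by (intro continuous_intros cont)
  have r: "((\<lambda>y. G y * kphi y) has_integral r) {0..1}"
    unfolding r_def by (intro has_integral_avg continuous_intros cG cp)
  have ev: "G (- y) = G y" "H (- y) = H y" "one_periodic G" "one_periodic H" for y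
    by (simp_all add: one_periodic_def G_def H_def pV even_V odd_V1 even_V2 even_V4 gks_X(3))
  have "((\<lambda>y. \<beta> * (\<nu> * (lam0 * of_real (V y * kphi y) + K * of_real (H y * kphi y)) + d * of_real (G y * kphi y))
       + \<alpha> * (\<nu> * (lam0 * of_real (V y * V1 y) + K * of_real (H y * V1 y)) + d * of_real (G y * V1 y)))
      has_integral \<beta> * (\<nu> * (lam0 * of_real kappa + K * of_real (4 * b + 2 * ct * kappa)) + d * of_real r)
       + \<alpha> * (\<nu> * (lam0 * of_real 0 + K * of_real 0) + d * of_real 0)) {0..1}"
    by (intro has_integral_mult_right has_integral_add has_integral_complex moment_V_phi
        moment_pairing_phi[folded H_def] r oddI cG cont ev even_V periodic)
  moreover have "\<nu> * lam0 * (complex_of_real (V y) * u0 y) + K * \<nu> * (complex_of_real (6 * V y - ct) * complex_of_real (V y) * u0 y)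
      - 6 * K * d * (complex_of_real (V1 y) * complex_of_real (X y) * u0 y)
     + 3 * K ^ 3 * \<nu> * (complex_of_real (V2 y) * u0 y) + d * ((K\<^sup>2 * complex_of_real (V2 y) + K ^ 4 * complex_of_real (V4 y)) * u0 y)
     = \<beta> * (\<nu> * (lam0 * of_real (V y * kphi y) + K * of_real (H y * kphi y)) + d * of_real (G y * kphi y))
       + \<alpha> * (\<nu> * (lam0 * of_real (V y * V1 y) + K * of_real (H y * V1 y)) + d * of_real (G y * V1 y))" for y
    unfolding u0 G_def H_def K_def by (simp add: algebra_simps eval_nat_numeral)
  ultimately have "\<beta> * (\<nu> * (lam0 * of_real kappa + K * of_real (4 * b + 2 * ct * kappa)) + d * of_real r) = 0"
    using S2 unfolding avg_def by (simp add: integral_unique)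
  then have B2: "\<beta> = 0 \<or> \<nu> * (lam0 * of_real kappa + K * of_real (4 * b + 2 * ct * kappa)) + d * of_real r = 0" by simp
  have "\<beta> = 0"
  proof (rule ccontr)
    assume "\<beta> \<noteq> 0"
    then have l: "lam0 = - (K * of_real (6 * kappa - ct))" using B1 by (simp add: eq_neg_iff_add_eq_0)
    have "lam0 * of_real kappa + K * of_real (4 * b + 2 * ct * kappa) = of_real (k * (4 * b + 3 * ct * kappa - 6 * kappa\<^sup>2))"
      unfolding l by (simp add: K_def algebra_simps power2_eq_square)
    with B2 \<open>\<beta> \<noteq> 0\<close> have "\<nu> * of_real (k * (4 * b + 3 * ct * kappa - 6 * kappa\<^sup>2)) + d * of_real r = 0" by simp
    from arg_cong[OF this, of Im] have "Im \<nu> * (k * (4 * b + 3 * ct * kappa - 6 * kappa\<^sup>2)) = 0"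
      by (simp add: d_def)
    moreover have "Im \<nu> \<noteq> 0" using \<nu> by (simp add: complex_eq_iff)
    ultimately show False using k_nz kappa_not_resonant by simp
  qed
  then show ?thesis using u0 by auto
qed

end

section \<open>The three relations\<close>

lemma avg_mod_exact:
  fixes A Z Z' I :: "real \<Rightarrow> 'a::banach"
  assumes "continuous_on UNIV A" "\<And>y. (Z has_vector_derivative Z' y) (at y)" "Z 1 = Z 0" "\<And>y. I y = A y + Z' y"
  shows "avg I = avg A"
proof (rule avg_eqI)
  have "(Z' has_integral Z 1 - Z 0) {0..1}"
    by (rule fundamental_theorem_of_calculus) (auto intro: has_vector_derivative_at_within assms)
  with has_integral_add[OF has_integral_avg[OF assms(1)] this] assms(3,4)
  show "(I has_integral avg A) {0..1}" by (simp add: assms(4)[abs_def])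
qed

lemma hvd_continuous: "(\<And>y. (f has_vector_derivative f' y) (at y)) \<Longrightarrow> continuous_on UNIV f"
  by (auto intro!: continuous_at_imp_continuous_on has_vector_derivative_continuous)

text \<open>The left-hand side is the second-order solvability condition of \<open>pairing_order_two\<close> against the weight \<open>1\<close>,
with the known forms of \<open>u0\<close> and \<open>u1\<close> inserted; \<open>s\<close> stands for the differential of the family.\<close>

lemma order_two_mass:
  fixes u v1 v2 v3 v4 x x1 s :: "real \<Rightarrow> complex"
  assumes u: "\<And>y. (u has_vector_derivative v1 y) (at y)" "\<And>y. (v1 has_vector_derivative v2 y) (at y)"
      "\<And>y. (v2 has_vector_derivative v3 y) (at y)" "\<And>y. (v3 has_vector_derivative v4 y) (at y)"
    and x: "\<And>y. (x has_vector_derivative x1 y) (at y)"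
    and s: "continuous_on UNIV s"
    and per: "u 1 = u 0" "v1 1 = v1 0" "v2 1 = v2 0" "v3 1 = v3 0" "x 1 = x 0"
  shows "avg (\<lambda>y. \<nu>\<^sup>2 * l1 * (1 * (\<kappa> * v1 y)) + \<nu> * (K * l) * (1 * (\<nu> * K * s y + \<kappa> * d * x1 y + \<beta> * v1 y))
      - 6 * K * d * (0 * x y * (\<nu> * K * s y + \<kappa> * d * x1 y + \<beta> * v1 y))
     - K * d\<^sup>2 * (0 * (6 * z y - c2) * (\<kappa> * v1 y)) + K * \<nu> * (1 * (6 * u y - c) * (\<nu> * K * s y + \<kappa> * d * x1 y + \<beta> * v1 y) + 6 * d * (1 * x y * (\<kappa> * v1 y)))
     + K ^ 3 * (3 * \<nu> * (0 * (\<nu> * K * s y + \<kappa> * d * x1 y + \<beta> * v1 y)) + 3 * \<nu>\<^sup>2 * (1 * (\<kappa> * v2 y)))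
     + d * ((K\<^sup>2 * 0 + K ^ 4 * 0) * (\<nu> * K * s y + \<kappa> * d * x1 y + \<beta> * v1 y) + 1 * (2 * \<nu> * K\<^sup>2 * (\<kappa> * v2 y) + 4 * \<nu> * K ^ 4 * (\<kappa> * v4 y))))
    = \<nu>\<^sup>2 * K\<^sup>2 * ((l - c) * avg s + avg (\<lambda>y. 6 * u y * s y))"
proof -
  note c = hvd_continuous[OF u(1)] s
  let ?Z = "\<lambda>y. \<nu>\<^sup>2 * l1 * \<kappa> * u y + \<nu> * K * \<kappa> * d * ((l - c) * x y + 6 * (u y * x y))
     + \<nu> * K * \<beta> * ((l - c) * u y + 3 * (u y * u y)) + 3 * K ^ 3 * \<nu>\<^sup>2 * \<kappa> * v1 y
     + d * (2 * \<nu> * K\<^sup>2 * \<kappa> * v1 y + 4 * \<nu> * K ^ 4 * \<kappa> * v3 y)"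
  let ?Z' = "\<lambda>y. \<nu>\<^sup>2 * l1 * \<kappa> * v1 y + \<nu> * K * \<kappa> * d * ((l - c) * x1 y + 6 * (u y * x1 y + v1 y * x y))
     + \<nu> * K * \<beta> * ((l - c) * v1 y + 3 * (u y * v1 y + v1 y * u y)) + 3 * K ^ 3 * \<nu>\<^sup>2 * \<kappa> * v2 y
     + d * (2 * \<nu> * K\<^sup>2 * \<kappa> * v2 y + 4 * \<nu> * K ^ 4 * \<kappa> * v4 y)"
  have "avg (\<lambda>y. \<nu>\<^sup>2 * l1 * (1 * (\<kappa> * v1 y)) + \<nu> * (K * l) * (1 * (\<nu> * K * s y + \<kappa> * d * x1 y + \<beta> * v1 y))
      - 6 * K * d * (0 * x y * (\<nu> * K * s y + \<kappa> * d * x1 y + \<beta> * v1 y))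
     - K * d\<^sup>2 * (0 * (6 * z y - c2) * (\<kappa> * v1 y)) + K * \<nu> * (1 * (6 * u y - c) * (\<nu> * K * s y + \<kappa> * d * x1 y + \<beta> * v1 y) + 6 * d * (1 * x y * (\<kappa> * v1 y)))
     + K ^ 3 * (3 * \<nu> * (0 * (\<nu> * K * s y + \<kappa> * d * x1 y + \<beta> * v1 y)) + 3 * \<nu>\<^sup>2 * (1 * (\<kappa> * v2 y)))
     + d * ((K\<^sup>2 * 0 + K ^ 4 * 0) * (\<nu> * K * s y + \<kappa> * d * x1 y + \<beta> * v1 y) + 1 * (2 * \<nu> * K\<^sup>2 * (\<kappa> * v2 y) + 4 * \<nu> * K ^ 4 * (\<kappa> * v4 y))))
    = avg (\<lambda>y. \<nu>\<^sup>2 * K\<^sup>2 * ((l - c) * s y + 6 * u y * s y))"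
  proof (rule avg_mod_exact)
    show "(?Z has_vector_derivative ?Z' y) (at y)" for y
      by (rule hvd u x)+
    show "continuous_on UNIV (\<lambda>y. \<nu>\<^sup>2 * K\<^sup>2 * ((l - c) * s y + 6 * u y * s y))" by (intro continuous_intros c)
  qed (simp_all only: per, algebra)
  also have "\<dots> = \<nu>\<^sup>2 * K\<^sup>2 * ((l - c) * avg s + avg (\<lambda>y. 6 * u y * s y))"
    by (intro avg_eqI has_integral_mult_right has_integral_add has_integral_avg continuous_intros c)
  finally show ?thesis .
qed

text \<open>The corresponding computation for the weight \<open>U\<close>.  The terms in \<open>d\<^sup>2\<close>, which contain the second
corrector \<open>z\<close>, are an exact derivative by the equation of \<open>z\<close>.  Of the component \<open>\<beta> v1\<close> of \<open>u1\<close>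
only an odd integrand is left.\<close>

lemma order_two_energy:
  fixes u v1 v2 v3 v4 x x1 x2 x3 x4 z z1 z2 z3 s s1 s2 :: "real \<Rightarrow> complex"
  assumes u: "\<And>y. (u has_vector_derivative v1 y) (at y)" "\<And>y. (v1 has_vector_derivative v2 y) (at y)"
      "\<And>y. (v2 has_vector_derivative v3 y) (at y)" "\<And>y. (v3 has_vector_derivative v4 y) (at y)"
    and x: "\<And>y. (x has_vector_derivative x1 y) (at y)" "\<And>y. (x1 has_vector_derivative x2 y) (at y)"
       "\<And>y. (x2 has_vector_derivative x3 y) (at y)" "\<And>y. (x3 has_vector_derivative x4 y) (at y)"
    and z: "\<And>y. (z has_vector_derivative z1 y) (at y)" "\<And>y. (z1 has_vector_derivative z2 y) (at y)"
       "\<And>y. (z2 has_vector_derivative z3 y) (at y)"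
    and s: "\<And>y. (s has_vector_derivative s1 y) (at y)" "\<And>y. (s1 has_vector_derivative s2 y) (at y)" "continuous_on UNIV s2"
    and per: "u 1 = u 0" "v1 1 = v1 0" "v2 1 = v2 0" "v3 1 = v3 0" "x 1 = x 0" "x1 1 = x1 0" "x2 1 = x2 0" "x3 1 = x3 0"
      "z1 1 = z1 0" "z2 1 = z2 0" "s 1 = s 0" "s1 1 = s1 0"
    and adj: "\<And>y. K\<^sup>2 * v3 y + (6 * u y - c) * v1 y = 0"
    and zeq: "\<And>y. K ^ 3 * z3 y + K * (6 * v1 y * z y + (6 * u y - c) * z1 y + 6 * x y * x1 y - c2 * v1 y) + K\<^sup>2 * x2 y + K ^ 4 * x4 y = 0"
  shows "avg (\<lambda>y. \<nu>\<^sup>2 * l1 * (u y * (\<kappa> * v1 y)) + \<nu> * (K * l) * (u y * (\<nu> * K * s y + \<kappa> * d * x1 y + \<beta> * v1 y))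
     - 6 * K * d * (v1 y * x y * (\<nu> * K * s y + \<kappa> * d * x1 y + \<beta> * v1 y))
     - K * d\<^sup>2 * (v1 y * (6 * z y - c2) * (\<kappa> * v1 y)) + K * \<nu> * (u y * (6 * u y - c) * (\<nu> * K * s y + \<kappa> * d * x1 y + \<beta> * v1 y)
       + 6 * d * (u y * x y * (\<kappa> * v1 y)))
     + K ^ 3 * (3 * \<nu> * (v2 y * (\<nu> * K * s y + \<kappa> * d * x1 y + \<beta> * v1 y)) + 3 * \<nu>\<^sup>2 * (u y * (\<kappa> * v2 y)))
     + d * ((K\<^sup>2 * v2 y + K ^ 4 * v4 y) * (\<nu> * K * s y + \<kappa> * d * x1 y + \<beta> * v1 y)
        + u y * (2 * \<nu> * K\<^sup>2 * (\<kappa> * v2 y) + 4 * \<nu> * K ^ 4 * (\<kappa> * v4 y))))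
    = avg (\<lambda>y. \<nu> * K * (\<nu> * K * ((l - c) * (u y * s y) + (6 * (u y)\<^sup>2 * s y - 3 * K * (v1 y)\<^sup>2 * \<kappa> - 3 * K\<^sup>2 * v1 y * s1 y))
        - d * ((2 * K * (v1 y)\<^sup>2 - 4 * K ^ 3 * (v2 y)\<^sup>2) * \<kappa> + K\<^sup>2 * v1 y * s1 y - K ^ 4 * v2 y * s2 y)
        - 6 * K * d * (x y * v1 y * s y)
        + \<kappa> * d * ((l - c) * (x1 y * u y) - (3 * K\<^sup>2 * x2 y + 6 * x y * u y) * v1 y))
      - 6 * K * d * \<beta> * (v1 y * v1 y * x y))"
    (is "avg ?I = avg ?A")
proof (rule avg_mod_exact)
  let ?Z = "\<lambda>y. \<nu>\<^sup>2 * l1 * \<kappa> / 2 * (u y * u y)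
     + \<beta> * (\<nu> * K * (l - c) / 2 * (u y * u y) + 2 * \<nu> * K * (u y * (u y * u y)) + 3 * K ^ 3 * \<nu> / 2 * (v1 y * v1 y)
        + d * (K\<^sup>2 / 2 * (v1 y * v1 y) + K ^ 4 * (v3 y * v1 y - 1 / 2 * (v2 y * v2 y))))
     + 3 * \<nu>\<^sup>2 * K ^ 4 * (v1 y * s y) + d * \<nu> * K * (K\<^sup>2 * (v1 y * s y) + K ^ 4 * (v3 y * s y - v2 y * s1 y))
     + 3 * \<nu>\<^sup>2 * K ^ 3 * \<kappa> * (u y * v1 y) + d * \<kappa> * \<nu> * (2 * K\<^sup>2 * (u y * v1 y) + 4 * K ^ 4 * (u y * v3 y - v1 y * v2 y))
     + \<nu> * K * \<kappa> * d * (6 * (u y * (u y * x y)) + 3 * K\<^sup>2 * (v1 y * x1 y))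
     + \<kappa> * d\<^sup>2 * (K ^ 3 * (v1 y * z2 y - v2 y * z1 y) + K\<^sup>2 * (v1 y * x1 y) + K ^ 4 * (v1 y * x3 y - v2 y * x2 y + v3 y * x1 y))"
  let ?Z' = "\<lambda>y. \<nu>\<^sup>2 * l1 * \<kappa> / 2 * (u y * v1 y + v1 y * u y)
     + \<beta> * (\<nu> * K * (l - c) / 2 * (u y * v1 y + v1 y * u y) + 2 * \<nu> * K * (u y * (u y * v1 y + v1 y * u y) + v1 y * (u y * u y))
        + 3 * K ^ 3 * \<nu> / 2 * (v1 y * v2 y + v2 y * v1 y)
        + d * (K\<^sup>2 / 2 * (v1 y * v2 y + v2 y * v1 y) + K ^ 4 * (v3 y * v2 y + v4 y * v1 y - 1 / 2 * (v2 y * v3 y + v3 y * v2 y))))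
     + 3 * \<nu>\<^sup>2 * K ^ 4 * (v1 y * s1 y + v2 y * s y)
     + d * \<nu> * K * (K\<^sup>2 * (v1 y * s1 y + v2 y * s y) + K ^ 4 * (v3 y * s1 y + v4 y * s y - (v2 y * s2 y + v3 y * s1 y)))
     + 3 * \<nu>\<^sup>2 * K ^ 3 * \<kappa> * (u y * v2 y + v1 y * v1 y)
     + d * \<kappa> * \<nu> * (2 * K\<^sup>2 * (u y * v2 y + v1 y * v1 y) + 4 * K ^ 4 * (u y * v4 y + v1 y * v3 y - (v1 y * v3 y + v2 y * v2 y)))
     + \<nu> * K * \<kappa> * d * (6 * (u y * (u y * x1 y + v1 y * x y) + v1 y * (u y * x y)) + 3 * K\<^sup>2 * (v1 y * x2 y + v2 y * x1 y))
     + \<kappa> * d\<^sup>2 * (K ^ 3 * (v1 y * z3 y + v2 y * z2 y - (v2 y * z2 y + v3 y * z1 y)) + K\<^sup>2 * (v1 y * x2 y + v2 y * x1 y)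
        + K ^ 4 * (v1 y * x4 y + v2 y * x3 y - (v2 y * x3 y + v3 y * x2 y) + (v3 y * x2 y + v4 y * x1 y)))"
  show "(?Z has_vector_derivative ?Z' y) (at y)" for y
    by (rule hvd u x z s)+
  show "?Z 1 = ?Z 0" by (simp only: per)
  note c = hvd_continuous[OF u(1)] hvd_continuous[OF u(2)] hvd_continuous[OF u(3)] hvd_continuous[OF x(1)]
    hvd_continuous[OF x(2)] hvd_continuous[OF x(3)] hvd_continuous[OF s(1)] hvd_continuous[OF s(2)] s(3)
  show "continuous_on UNIV ?A" by (intro continuous_intros c)
  show "?I y = ?A y + ?Z' y" for y
  proof -
    have "?I y = ?A y + ?Z' y
      - \<kappa> * d\<^sup>2 * v1 y * (K ^ 3 * z3 y + K * (6 * v1 y * z y + (6 * u y - c) * z1 y + 6 * x y * x1 y - c2 * v1 y) + K\<^sup>2 * x2 y + K ^ 4 * x4 y)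
      + \<kappa> * d\<^sup>2 * K * z1 y * (K\<^sup>2 * v3 y + (6 * u y - c) * v1 y)"
      by (simp add: field_simps eval_nat_numeral)
    then show ?thesis unfolding zeq adj by simp
  qed
qed

context gks_wave
begin

definition dU3 :: "'a::{real_normed_field,banach} \<Rightarrow> 'a \<Rightarrow> 'a \<Rightarrow> real \<Rightarrow> 'a" where
  "dU3 a m e y = of_real (2 * V3 y / k) * a + of_real (W3 y) * e"

lemma dU_derivs:
  fixes a m e :: complex
  shows "(dU0 a m e has_vector_derivative dU1 a m e y) (at y)" "(dU1 a m e has_vector_derivative dU2 a m e y) (at y)"
    "(dU2 a m e has_vector_derivative dU3 a m e y) (at y)"
proof -
  have v: "((\<lambda>y. complex_of_real (2 * V y / k)) has_vector_derivative complex_of_real (2 * V1 y / k)) (at y)"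
    "((\<lambda>y. complex_of_real (2 * V1 y / k)) has_vector_derivative complex_of_real (2 * V2 y / k)) (at y)"
    "((\<lambda>y. complex_of_real (2 * V2 y / k)) has_vector_derivative complex_of_real (2 * V3 y / k)) (at y)"
    by (rule complex_deriv, rule DERIV_cdivide, rule DERIV_cmult, rule dV dV1 dV2)+
  have m: "((\<lambda>y. complex_of_real (2 * V y / k) * a + m + of_real (W y) * e) has_vector_derivative
     (complex_of_real (2 * V1 y / k) * a + 0 + of_real (W1 y) * e)) (at y)"
    by (intro has_vector_derivative_add has_vector_derivative_mult_left v complex_deriv dW has_vector_derivative_const)
  show "(dU0 a m e has_vector_derivative dU1 a m e y) (at y)"
    using m by (simp add: dU0_def[abs_def] dU1_def)
  show "(dU1 a m e has_vector_derivative dU2 a m e y) (at y)" "(dU2 a m e has_vector_derivative dU3 a m e y) (at y)"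
    unfolding dU1_def[abs_def] dU2_def[abs_def] dU3_def
    by (intro has_vector_derivative_add has_vector_derivative_mult_left v complex_deriv dW1 dW2)+
qed

lemma dU_at_1:
  fixes a m e :: "'a::{real_normed_field,banach}"
  shows "dU0 a m e 1 = dU0 a m e 0" "dU1 a m e 1 = dU1 a m e 0" "dU2 a m e 1 = dU2 a m e 0"
  by (simp_all add: dU0_def dU1_def dU2_def at_1)

lemma avg_dU0: "avg (dU0 a m e) = m" for a m e :: "'a::{real_normed_field,banach}"
proof -
  have "avg (dU0 a m e) = of_real (avg (\<lambda>y. 2 * V y / k)) * a + of_real (avg (\<lambda>y. 1)) * m + of_real (avg W) * e"
    by (rule avg_lin3[symmetric]) (use k_nz in \<open>auto intro!: continuous_intros cont simp: dU0_def\<close>)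
  moreover have "avg (\<lambda>y. 2 * V y / k) = 0"
    using avg_cmult[of "2 / k" V] mean_V by simp
  ultimately show ?thesis by (simp add: avg_const mean_W)
qed

lemma cont_dU: "continuous_on S (dU0 a m e)" "continuous_on S (dU1 a m e)" "continuous_on S (dU2 a m e)"
  for a m e :: "'a::{real_normed_field,banach}"
  unfolding dU0_def[abs_def] dU1_def[abs_def] dU2_def[abs_def] using k_nz by (auto intro!: continuous_intros cont)

lemma X_eq_deriv: "k ^ 3 * X4 y + k * (6 * V2 y * X y + 12 * V1 y * X1 y + (6 * V y - ct) * X2 y) + k\<^sup>2 * V3 y + k ^ 4 * V5 y = 0"
proof -
  have "((\<lambda>y. k ^ 3 * X3 y + k * (6 * V1 y * X y + (6 * V y - ct) * X1 y) + k\<^sup>2 * V2 y + k ^ 4 * V4 y) has_real_derivative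
     k ^ 3 * X4 y + k * (6 * V2 y * X y + 12 * V1 y * X1 y + (6 * V y - ct) * X2 y) + k\<^sup>2 * V3 y + k ^ 4 * V5 y) (at y)"
    by (rule derivative_eq_intros dV dV1 dV2 dV4 dX refl)+ (simp add: algebra_simps)
  then have "((\<lambda>y. 0) has_real_derivative
     k ^ 3 * X4 y + k * (6 * V2 y * X y + 12 * V1 y * X1 y + (6 * V y - ct) * X2 y) + k\<^sup>2 * V3 y + k ^ 4 * V5 y) (at y)"
    by (simp only: X_eq)
  then show ?thesis using DERIV_unique DERIV_const by blast
qed

text \<open>The travelling wave equation differentiated in the parameters: the right-hand side comes from the
derivatives of its coefficients \<open>k\<close> and \<open>c\<close>, after use of the equation for \<open>V1\<close>.\<close>

lemma linearized_dU:
  fixes a m e :: "'a::{real_normed_field,banach}"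
  shows "of_real k * (of_real (6 * V1 y) * dU0 a m e y + of_real (6 * V y - ct) * dU1 a m e y) + of_real (k ^ 3) * dU3 a m e y
    = of_real (V1 y) * (12 * of_real (V y) * a + 6 * of_real k * m + of_real k * of_real ctp * e)"
proof -
  have V: "k * (6 * V1 y * (2 * V y / k) + (6 * V y - ct) * (2 * V1 y / k)) + k ^ 3 * (2 * V3 y / k) = V1 y * (12 * V y)"
  proof -
    have "k ^ 3 * (2 * V3 y / k) = 2 * (k\<^sup>2 * V3 y)" using k_nz by (simp add: eval_nat_numeral)
    then show ?thesis unfolding k2V3 using k_nz by (simp add: field_simps)
  qed
  have W: "k * (6 * V1 y * W y + (6 * V y - ct) * W1 y) + k ^ 3 * W3 y = V1 y * (k * ctp)"
  proof -
    have "k ^ 3 * W3 y = k * (k\<^sup>2 * W3 y)" by (simp add: eval_nat_numeral)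
    then show ?thesis unfolding k2W3 by (simp add: algebra_simps)
  qed
  have "of_real k * (of_real (6 * V1 y) * dU0 a m e y + of_real (6 * V y - ct) * dU1 a m e y) + of_real (k ^ 3) * dU3 a m e y
    = of_real (k * (6 * V1 y * (2 * V y / k) + (6 * V y - ct) * (2 * V1 y / k)) + k ^ 3 * (2 * V3 y / k)) * a
      + of_real (k * 6 * V1 y) * m + of_real (k * (6 * V1 y * W y + (6 * V y - ct) * W1 y) + k ^ 3 * W3 y) * e"
    by (simp add: dU0_def dU1_def dU3_def algebra_simps)
  then show ?thesis unfolding V W by (simp add: algebra_simps)
qed

lemma spectral_k_eq: "of_real k * spectral_k k M p l a m e = of_real k * l * a + 2 * of_real k * of_real ct * a + 6 * (of_real k)\<^sup>2 * m + (of_real k)\<^sup>2 * of_real ctp * e"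
  unfolding spectral_k_def dpar_c using k_nz by (simp add: field_simps power2_eq_square)

lemma spectral_M_eq: "spectral_M k M p l a m e = (l - of_real c) * avg (dU0 a m e) + avg (\<lambda>y. 6 * of_real (U y) * dU0 a m e y)"
  unfolding spectral_M_def dpar_3U2 avg_dU0 by simp

lemma spectral_p_eq:
  defines "K \<equiv> complex_of_real k" and "d \<equiv> complex_of_real \<delta>" and "u \<equiv> \<lambda>y. complex_of_real (U y)"
    and "v1 \<equiv> \<lambda>y. complex_of_real (V1 y)" and "v2 \<equiv> \<lambda>y. complex_of_real (V2 y)"
    and "x \<equiv> \<lambda>y. complex_of_real (X y)" and "x1 \<equiv> \<lambda>y. complex_of_real (X1 y)" and "x2 \<equiv> \<lambda>y. complex_of_real (X2 y)"
  shows "spectral_p k M p \<delta> \<nu> X l a m e = avg (\<lambda>y.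
        \<nu> * K * ((l - of_real c) * (u y * dU0 a m e y) + (6 * (u y)\<^sup>2 * dU0 a m e y - 3 * K * (v1 y)\<^sup>2 * a - 3 * K\<^sup>2 * v1 y * dU1 a m e y))
        - d * ((2 * K * (v1 y)\<^sup>2 - 4 * K ^ 3 * (v2 y)\<^sup>2) * a + K\<^sup>2 * v1 y * dU1 a m e y - K ^ 4 * v2 y * dU2 a m e y)
        - 6 * K * d * (x y * v1 y * dU0 a m e y)
        + a * d * ((l - of_real c) * (x1 y * u y) - (3 * K\<^sup>2 * x2 y + 6 * x y * u y) * v1 y))"
proof -
  note cc = cont cont_U cont_dU contX
  have "avg (\<lambda>y.
        \<nu> * K * ((l - of_real c) * (of_real (U y) * dU0 a m e y) + (of_real (6 * (U y)\<^sup>2) * dU0 a m e y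
             - of_real (3 * k * (V1 y)\<^sup>2) * a - of_real (3 * k\<^sup>2 * V1 y) * dU1 a m e y))
        - d * (of_real (2 * k * (V1 y)\<^sup>2 - 4 * k ^ 3 * (V2 y)\<^sup>2) * a + of_real (k\<^sup>2 * V1 y) * dU1 a m e y - of_real (k ^ 4 * V2 y) * dU2 a m e y)
        - 6 * K * d * (of_real (X y * V1 y) * dU0 a m e y)
        + a * d * ((l - of_real c) * of_real (X1 y * U y) - of_real ((3 * k\<^sup>2 * X2 y + 6 * X y * U y) * V1 y)))
     = spectral_p k M p \<delta> \<nu> X l a m e"
    unfolding spectral_p_def Let_def dpar_half_U2 dpar_flux dpar_dissip dpar_U D_U K_def d_def
    by (intro avg_eqI has_integral_add has_integral_diff has_integral_mult_right has_integral_complex has_integral_avg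
        continuous_intros cc)
  then show ?thesis by (simp add: assms)
qed

text \<open>\<open>u1\<close> minus \<open>\<nu> k dU\<close> minus \<open>\<alpha> \<delta> X'\<close> solves the linearized equation with a right-hand side that is a multiple
of \<open>V1\<close>, and the multiple is the first relation.  The coefficient \<open>e\<close> is chosen to make it vanish, which
is possible as \<open>\<partial>\<^sub>pc \<noteq> 0\<close>.  What is left is a mean-zero element of the kernel.\<close>

lemma bloch_relations:
  assumes \<nu>: "Re \<nu> = 0" "\<nu> \<noteq> 0" and be: "bloch_expansion k \<delta> Ud cd \<nu> lam0 lam1 u0 u1 u2"
    and u0: "\<And>y. u0 y = \<alpha> * of_real (V1 y)"
  defines "l \<equiv> lam0 / of_real k" and "m \<equiv> avg u1 / (\<nu> * of_real k)"
  shows "\<exists>e \<beta>. (\<forall>y. u1 y = \<nu> * of_real k * dU0 \<alpha> m e y + \<alpha> * of_real \<delta> * of_real (X1 y) + \<beta> * of_real (V1 y)) \<and>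
     spectral_k k M p l \<alpha> m e = 0 \<and> spectral_M k M p l \<alpha> m e = 0 \<and> spectral_p k M p \<delta> \<nu> X l \<alpha> m e = 0"
proof -
  define K where "K = complex_of_real k"
  define d where "d = complex_of_real \<delta>"
  have K: "K \<noteq> 0" using k_nz by (simp add: K_def)
  have lam0: "lam0 = K * l" using K by (simp add: l_def K_def)
  note o = bloch_orders[OF be, folded K_def d_def]
  have Ck: "Ck 4 u0" "Ck 4 u1" "Ck 4 u2" and per: "one_periodic u0" "one_periodic u1" "one_periodic u2"
    using be by (auto simp: bloch_expansion_def)
  have u0': "u0 = (\<lambda>y. \<alpha> * of_real (V1 y))" using u0 by blast
  have D1: "D u0 = (\<lambda>y. \<alpha> * of_real (V2 y))" "D (\<lambda>y. \<alpha> * of_real (V2 y)) = (\<lambda>y. \<alpha> * of_real (V3 y))"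
    "D (\<lambda>y. \<alpha> * of_real (V3 y)) = (\<lambda>y. \<alpha> * of_real (V4 y))" "D (\<lambda>y. \<alpha> * of_real (V4 y)) = (\<lambda>y. \<alpha> * of_real (V5 y))"
    unfolding u0' by (intro ext D_eqI has_vector_derivative_mult_right complex_deriv dV1 dV2 dV3 dV4)+
  have Du0: "D u0 = (\<lambda>y. \<alpha> * of_real (V2 y))" "(D ^^ 2) u0 = (\<lambda>y. \<alpha> * of_real (V3 y))"
    "(D ^^ 3) u0 = (\<lambda>y. \<alpha> * of_real (V4 y))" "(D ^^ 4) u0 = (\<lambda>y. \<alpha> * of_real (V5 y))"
    using D1 by (simp_all add: eval_nat_numeral)
  define e where "e = - (K * l * \<alpha> + 2 * K * of_real ct * \<alpha> + 6 * K\<^sup>2 * m) / (K\<^sup>2 * of_real ctp)"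
  have e: "K * l * \<alpha> + 2 * K * of_real ct * \<alpha> + 6 * K\<^sup>2 * m + K\<^sup>2 * of_real ctp * e = 0"
    using K ctp_nz by (simp add: e_def)
  have sk: "spectral_k k M p l \<alpha> m e = 0"
    using spectral_k_eq[of l \<alpha> m e] e K by (simp add: K_def)
  define f where "f y = u1 y - \<nu> * K * dU0 \<alpha> m e y - \<alpha> * d * of_real (X1 y)" for y
  define f1 where "f1 y = D u1 y - \<nu> * K * dU1 \<alpha> m e y - \<alpha> * d * of_real (X2 y)" for y
  define f2 where "f2 y = (D ^^ 2) u1 y - \<nu> * K * dU2 \<alpha> m e y - \<alpha> * d * of_real (X3 y)" for y
  define f3 where "f3 y = (D ^^ 3) u1 y - \<nu> * K * dU3 \<alpha> m e y - \<alpha> * d * of_real (X4 y)" for y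
  have df: "(f has_vector_derivative f1 y) (at y)" "(f1 has_vector_derivative f2 y) (at y)" "(f2 has_vector_derivative f3 y) (at y)" for y
    unfolding f_def[abs_def] f1_def[abs_def] f2_def[abs_def] f3_def
    by (intro has_vector_derivative_diff has_vector_derivative_mult_right jet_derivs[OF Ck(2)] dU_derivs complex_deriv dX)+
  have pf: "one_periodic f"
    using per(2) jet_periodic[OF gks_X(1,2)] periodic by (simp add: one_periodic_def f_def dU0_def)
  have "avg f = 0"
  proof -
    have "avg (\<lambda>y. complex_of_real (X1 y)) = 0"
      by (rule avg_periodic_deriv[OF complex_deriv[OF dX(1)]]) (use gks_X(2) in \<open>simp add: one_periodic_def\<close>)
    moreover have "avg f = avg u1 - \<nu> * K * avg (dU0 \<alpha> m e) - \<alpha> * d * avg (\<lambda>y. complex_of_real (X1 y))"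
      unfolding f_def[abs_def]
      by (intro avg_eqI has_integral_diff has_integral_mult_right has_integral_avg cont_dU jet_continuous[OF Ck(2)]
          continuous_intros contX)
    ultimately show ?thesis using \<nu>(2) K by (simp add: avg_dU0 m_def K_def)
  qed
  have kern: "of_real k * (of_real (6 * V1 y) * f y + of_real (6 * V y - ct) * f1 y) + of_real (k ^ 3) * f3 y = 0" for y
  proof -
    define v v1 v2 v3 v5 where "v = complex_of_real (V y)" and "v1 = complex_of_real (V1 y)" and "v2 = complex_of_real (V2 y)"
      and "v3 = complex_of_real (V3 y)" and "v5 = complex_of_real (V5 y)"
    define x x1 x2 x4 where "x = complex_of_real (X y)" and "x1 = complex_of_real (X1 y)" and "x2 = complex_of_real (X2 y)"
      and "x4 = complex_of_real (X4 y)"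
    define q where "q = 6 * v - of_real ct"
    note ab = v_def v1_def v2_def v3_def v5_def x_def x1_def x2_def x4_def q_def K_def
    have q: "complex_of_real (6 * V y - ct) = q" by (simp add: ab)
    have c1: "K\<^sup>2 * v3 + q * v1 = 0"
      using arg_cong[OF k2V3[of y], of complex_of_real] by (simp add: ab algebra_simps)
    have c2: "K ^ 3 * x4 + K * (6 * v2 * x + 12 * v1 * x1 + q * x2) + K\<^sup>2 * v3 + K ^ 4 * v5 = 0"
      using arg_cong[OF X_eq_deriv[of y], of complex_of_real] by (simp add: ab)
    have c3: "K * (6 * v1 * dU0 \<alpha> m e y + q * dU1 \<alpha> m e y) + K ^ 3 * dU3 \<alpha> m e y
       = v1 * (12 * v * \<alpha> + 6 * K * m + K * of_real ctp * e)"
      using linearized_dU[of y \<alpha> m e] by (simp add: ab)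
    have c4: "\<nu> * (K * l) * (\<alpha> * v1) + K * (6 * v1 * u1 y + q * D u1 y) + K * (6 * d * (x1 * (\<alpha> * v1) + x * (\<alpha> * v2))) + K * \<nu> * (q * (\<alpha> * v1))
      + K ^ 3 * ((D ^^ 3) u1 y + 3 * \<nu> * (\<alpha> * v3)) + d * (K\<^sup>2 * (\<alpha> * v3) + K ^ 4 * (\<alpha> * v5)) = 0"
      using o(2)[of y] unfolding Du0 u0 lam0 by (simp add: ab)
    have "K * (6 * v1 * f y + q * f1 y) + K ^ 3 * f3 y
      = (\<nu> * (K * l) * (\<alpha> * v1) + K * (6 * v1 * u1 y + q * D u1 y) + K * (6 * d * (x1 * (\<alpha> * v1) + x * (\<alpha> * v2))) + K * \<nu> * (q * (\<alpha> * v1))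
      + K ^ 3 * ((D ^^ 3) u1 y + 3 * \<nu> * (\<alpha> * v3)) + d * (K\<^sup>2 * (\<alpha> * v3) + K ^ 4 * (\<alpha> * v5)))
       - \<alpha> * d * (K ^ 3 * x4 + K * (6 * v2 * x + 12 * v1 * x1 + q * x2) + K\<^sup>2 * v3 + K ^ 4 * v5)
       - \<nu> * K * (K * (6 * v1 * dU0 \<alpha> m e y + q * dU1 \<alpha> m e y) + K ^ 3 * dU3 \<alpha> m e y)
       - 3 * \<nu> * K * \<alpha> * (K\<^sup>2 * v3 + q * v1) - \<nu> * v1 * \<alpha> * (K * l - 2 * K * q)"
      unfolding f_def f1_def f3_def x1_def[symmetric] x2_def[symmetric] x4_def[symmetric] by algebra
    also have "\<dots> = - \<nu> * v1 * (K * l * \<alpha> + 2 * K * of_real ct * \<alpha> + 6 * K\<^sup>2 * m + K\<^sup>2 * of_real ctp * e)"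
      unfolding c1 c2 c3 c4 unfolding q_def by algebra
    finally show ?thesis unfolding q using e by (simp add: ab)
  qed
  obtain \<beta> where \<beta>: "f y = \<beta> * of_real (V1 y)" for y
    using linearized_kernel[OF df pf kern] \<open>avg f = 0\<close> by auto
  have u1: "u1 y = \<nu> * K * dU0 \<alpha> m e y + \<alpha> * d * of_real (X1 y) + \<beta> * of_real (V1 y)" for y
    using \<beta>[of y] by (simp add: f_def algebra_simps)
  note at1 = one_periodic_1[OF per(1)] one_periodic_1[OF per(2)] one_periodic_1[OF per(3)]
     jet_periodic[OF Ck(1) per(1), THEN one_periodic_1] jet_periodic[OF Ck(2) per(2), THEN one_periodic_1]
     jet_periodic[OF Ck(3) per(3), THEN one_periodic_1]
  have q: "complex_of_real (6 * V y - ct) = 6 * of_real (U y) - of_real c" for y by (simp add: U_eq c_eq algebra_simps)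
  have dU: "(U has_real_derivative V1 y) (at y)" for y
    unfolding kdv_U_def using dV by (auto intro!: derivative_eq_intros)
  have U1: "U 1 = U 0" by (simp add: U_eq at_1)
  have adj: "K\<^sup>2 * complex_of_real (V3 y) + (6 * of_real (U y) - of_real c) * complex_of_real (V1 y) = 0" for y
    using arg_cong[OF k2V3[of y], of complex_of_real] unfolding q[symmetric] by (simp add: K_def algebra_simps)
  have Yc: "K ^ 3 * complex_of_real (Y3 y) + K * (6 * complex_of_real (V1 y) * complex_of_real (Y y) + (6 * of_real (U y) - of_real c) * complex_of_real (Y1 y)
     + 6 * complex_of_real (X y) * complex_of_real (X1 y) - of_real c2 * complex_of_real (V1 y)) + K\<^sup>2 * complex_of_real (X2 y) + K ^ 4 * complex_of_real (X4 y) = 0" for y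
    using arg_cong[OF Y_eq[of y], of complex_of_real] unfolding q[symmetric] by (simp add: K_def)
  have f01: "(u0 has_vector_derivative D u0 y) (at y)" for y by (rule jet_derivs(1)[OF Ck(1)])
  have "avg (\<lambda>y. \<nu>\<^sup>2 * lam1 * (1 * u0 y) + \<nu> * lam0 * (1 * u1 y) - 6 * K * d * (0 * complex_of_real (X y) * u1 y)
     - K * d\<^sup>2 * (0 * (6 * complex_of_real (Y y) - of_real c2) * u0 y) + K * \<nu> * (1 * complex_of_real (6 * V y - ct) * u1 y + 6 * d * (1 * complex_of_real (X y) * u0 y))
     + K ^ 3 * (3 * \<nu> * (0 * u1 y) + 3 * \<nu>\<^sup>2 * (1 * D u0 y))
     + d * ((K\<^sup>2 * 0 + K ^ 4 * 0) * u1 y + 1 * (2 * \<nu> * K\<^sup>2 * D u0 y + 4 * \<nu> * K ^ 4 * (D ^^ 3) u0 y))) = 0"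
    by (rule pairing_order_two[where ?w = "\<lambda>_. 1" and ?w1.0 = "\<lambda>_. 0" and ?w2.0 = "\<lambda>_. 0" and ?w3.0 = "\<lambda>_. 0" and ?w4.0 = "\<lambda>_. 0",
          OF _ _ _ _ complex_deriv[OF dq] complex_deriv[OF dX(1)] complex_deriv[OF dY(1)] f01 jet_derivs[OF Ck(2)] jet_derivs(1-3)[OF Ck(3)]
          _ _ _ _ _ _ _ _ _ _ _ _ _ _ _ _ o(3)])
      (simp_all add: at1 at_1 X_at_1 Y_at_1)
  then have "\<nu>\<^sup>2 * K\<^sup>2 * ((l - of_real c) * avg (dU0 \<alpha> m e) + avg (\<lambda>y. 6 * of_real (U y) * dU0 \<alpha> m e y)) = 0"
    unfolding lam0 u0 u1 Du0 q
    by (subst (asm) order_two_mass[OF complex_deriv[OF dU] complex_deriv[OF dV1] complex_deriv[OF dV2] complex_deriv[OF dV3]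
          complex_deriv[OF dX(1)] cont_dU(1)])
       (simp_all add: U1 at_1 X_at_1)
  then have sM: "spectral_M k M p l \<alpha> m e = 0"
    using \<nu>(2) K by (simp add: spectral_M_eq)
  have "avg (\<lambda>y. \<nu>\<^sup>2 * lam1 * (complex_of_real (U y) * u0 y) + \<nu> * lam0 * (complex_of_real (U y) * u1 y)
     - 6 * K * d * (complex_of_real (V1 y) * complex_of_real (X y) * u1 y)
     - K * d\<^sup>2 * (complex_of_real (V1 y) * (6 * complex_of_real (Y y) - of_real c2) * u0 y)
     + K * \<nu> * (complex_of_real (U y) * complex_of_real (6 * V y - ct) * u1 y + 6 * d * (complex_of_real (U y) * complex_of_real (X y) * u0 y))
     + K ^ 3 * (3 * \<nu> * (complex_of_real (V2 y) * u1 y) + 3 * \<nu>\<^sup>2 * (complex_of_real (U y) * D u0 y))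
     + d * ((K\<^sup>2 * complex_of_real (V2 y) + K ^ 4 * complex_of_real (V4 y)) * u1 y
         + complex_of_real (U y) * (2 * \<nu> * K\<^sup>2 * D u0 y + 4 * \<nu> * K ^ 4 * (D ^^ 3) u0 y))) = 0"
    by (rule pairing_order_two[OF complex_deriv[OF dU] complex_deriv[OF dV1] complex_deriv[OF dV2] complex_deriv[OF dV3]
          complex_deriv[OF dq] complex_deriv[OF dX(1)] complex_deriv[OF dY(1)] f01 jet_derivs[OF Ck(2)] jet_derivs(1-3)[OF Ck(3)]
          _ _ _ _ _ _ _ _ _ _ _ _ _ _ _ adj[folded q] o(3)])
      (simp_all add: at1 at_1 X_at_1 Y_at_1 U1)
  note S = this[unfolded lam0 u0 u1 Du0 q]
  let ?B = "\<lambda>y. \<nu> * K * ((l - of_real c) * (complex_of_real (U y) * dU0 \<alpha> m e y)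
         + (6 * (complex_of_real (U y))\<^sup>2 * dU0 \<alpha> m e y - 3 * K * (complex_of_real (V1 y))\<^sup>2 * \<alpha> - 3 * K\<^sup>2 * complex_of_real (V1 y) * dU1 \<alpha> m e y))
        - d * ((2 * K * (complex_of_real (V1 y))\<^sup>2 - 4 * K ^ 3 * (complex_of_real (V2 y))\<^sup>2) * \<alpha>
            + K\<^sup>2 * complex_of_real (V1 y) * dU1 \<alpha> m e y - K ^ 4 * complex_of_real (V2 y) * dU2 \<alpha> m e y)
        - 6 * K * d * (complex_of_real (X y) * complex_of_real (V1 y) * dU0 \<alpha> m e y)
        + \<alpha> * d * ((l - of_real c) * (complex_of_real (X1 y) * complex_of_real (U y))
             - (3 * K\<^sup>2 * complex_of_real (X2 y) + 6 * complex_of_real (X y) * complex_of_real (U y)) * complex_of_real (V1 y))"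
  have "avg (\<lambda>y. \<nu> * K * ?B y - 6 * K * d * \<beta> * (complex_of_real (V1 y) * complex_of_real (V1 y) * complex_of_real (X y))) = 0"
    by (rule trans[OF order_two_energy[symmetric, OF complex_deriv[OF dU] complex_deriv[OF dV1] complex_deriv[OF dV2] complex_deriv[OF dV3]
          complex_deriv[OF dX(1)] complex_deriv[OF dX(2)] complex_deriv[OF dX(3)] complex_deriv[OF dX(4)]
          complex_deriv[OF dY(1)] complex_deriv[OF dY(2)] complex_deriv[OF dY(3)] dU_derivs(1) dU_derivs(2) cont_dU(3)
          _ _ _ _ _ _ _ _ _ _ _ _ adj Yc] S])
      (simp_all add: U1 at_1 X_at_1 Y_at_1 dU_at_1)
  moreover have "avg (\<lambda>y. \<nu> * K * ?B y - 6 * K * d * \<beta> * (complex_of_real (V1 y) * complex_of_real (V1 y) * complex_of_real (X y)))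
    = \<nu> * K * avg ?B - 6 * K * d * \<beta> * complex_of_real 0"
  proof (intro avg_eqI has_integral_diff has_integral_mult_right)
    show "(?B has_integral avg ?B) {0..1}"
      by (intro has_integral_avg continuous_intros cont cont_U cont_dU contX)
    have "((\<lambda>y. V1 y * V1 y * X y) has_integral 0) {0..1}"
      by (rule has_integral_odd)
        (use periodic(2) gks_X(2) in \<open>auto simp: odd_V1 gks_X(3) one_periodic_def intro!: continuous_intros cont contX\<close>)
    from has_integral_complex[OF this]
    show "((\<lambda>y. complex_of_real (V1 y) * complex_of_real (V1 y) * complex_of_real (X y)) has_integral complex_of_real 0) {0..1}"
      by simp
  qed
  ultimately have "\<nu> * K * avg ?B = 0" by simp
  then have sp: "spectral_p k M p \<delta> \<nu> X l \<alpha> m e = 0"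
    unfolding spectral_p_eq K_def[symmetric] d_def[symmetric] using \<nu>(2) K by simp
  show ?thesis using u1 sk sM sp unfolding K_def d_def by blast
qed

end

section \<open>The dispersion relation and plane waves\<close>

lemma dpar_linear:
  "dpar F k M p a m e = of_real (deriv (\<lambda>s. F s M p) k) * a + of_real (deriv (\<lambda>s. F k s p) M) * m
     + of_real (deriv (\<lambda>s. F k M s) p) * e"
  for a :: "'a::{real_normed_field,banach}"
  by (simp add: dpar_def scaleR_conv_of_real)

lemma dpar_scale: "dpar F k M p (z * a) (z * m) (z * e) = z * dpar F k M p a m e"
  for a :: "'a::{real_normed_field,banach}"
  by (simp add: dpar_linear algebra_simps)

lemma matrix_vector_ker:
  fixes A :: "complex ^ 'n ^ 'n"
  shows "det A = 0 \<longleftrightarrow> (\<exists>v. v \<noteq> 0 \<and> A *v v = 0)"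
proof -
  have "(\<exists>B. B ** A = mat 1) \<longleftrightarrow> det A \<noteq> 0"
    using invertible_det_nz[of A] invertible_left_inverse[of A] by blast
  then show ?thesis using matrix_left_invertible_ker[of A] by blast
qed

context gks_wave
begin

text \<open>Only the coefficient of \<open>l e\<close> has to be known, for the leading coefficient of the determinant.\<close>

lemma spectral_p_linear:
  "\<exists>r1 r2 s1 s2 s3. \<forall>l a m e. spectral_p k M p \<delta> \<nu> X l a m e
     = (l * r1 + s1) * a + (l * r2 + s2) * m + (l * (\<nu> * of_real k * of_real (bp / 6)) + s3) * e"
proof -
  have UW: "deriv (\<lambda>s. av_half_U2 k M s) p = bp / 6"
  proof -
    have "((\<lambda>y. M * W y + V y * W y) has_integral M * 0 + bp / 6) {0..1}"
      by (intro has_integral_add has_integral_mult_right moment_W moment_VW)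
    then have "avg (\<lambda>y. U y * W y) = bp / 6" by (intro avg_eqI) (simp add: U_eq algebra_simps)
    then show ?thesis using DERIV_imp_deriv[OF avg_derivs_p(2)] by simp
  qed
  define gk gm gp where "gk = complex_of_real (avg (\<lambda>y. X y * V1 y * (2 * V y / k)))"
    and "gm = complex_of_real (avg (\<lambda>y. X y * V1 y))" and "gp = complex_of_real (avg (\<lambda>y. X y * V1 y * W y))"
  have g: "avg (\<lambda>y. of_real (X y * V1 y) * dU0 a m e y) = gk * a + gm * m + gp * e" for a m e
    unfolding gk_def gm_def gp_def
    by (rule avg_lin3[symmetric]) (use k_nz in \<open>auto intro!: continuous_intros cont contX simp: dU0_def algebra_simps\<close>)
  define H1 H2 where "H1 = complex_of_real (deriv (\<lambda>s. av_half_U2 s M p) k)" and "H2 = complex_of_real (deriv (\<lambda>s. av_half_U2 k s p) M)"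
  have H: "dpar av_half_U2 k M p a m e = H1 * a + H2 * m + of_real (bp / 6) * e" for a m e :: complex
    unfolding dpar_linear UW H1_def H2_def by simp
  define F1 F2 F3 where "F1 = complex_of_real (deriv (\<lambda>s. av_flux s M p) k)" and "F2 = complex_of_real (deriv (\<lambda>s. av_flux k s p) M)"
    and "F3 = complex_of_real (deriv (\<lambda>s. av_flux k M s) p)"
  have F: "dpar av_flux k M p a m e = F1 * a + F2 * m + F3 * e" for a m e :: complex
    unfolding dpar_linear F1_def F2_def F3_def by simp
  define G1 G2 G3 where "G1 = complex_of_real (deriv (\<lambda>s. av_dissip U s M p) k)" and "G2 = complex_of_real (deriv (\<lambda>s. av_dissip U k s p) M)"
    and "G3 = complex_of_real (deriv (\<lambda>s. av_dissip U k M s) p)"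
  have G: "dpar (av_dissip U) k M p a m e = G1 * a + G2 * m + G3 * e" for a m e :: complex
    unfolding dpar_linear G1_def G2_def G3_def by simp
  define K d where "K = complex_of_real k" and "d = complex_of_real \<delta>"
  define A1 A2 where "A1 = complex_of_real (avg (\<lambda>y. X1 y * U y))" and
     "A2 = complex_of_real (avg (\<lambda>y. (3 * k\<^sup>2 * X2 y + 6 * X y * U y) * V1 y))"
  define C where "C = complex_of_real c"
  have eq: "spectral_p k M p \<delta> \<nu> X l a m e
     = \<nu> * K * ((l - C) * (H1 * a + H2 * m + of_real (bp / 6) * e) + (F1 * a + F2 * m + F3 * e))
       - d * (G1 * a + G2 * m + G3 * e) - 6 * K * d * (gk * a + gm * m + gp * e) + a * d * ((l - C) * A1 - A2)" for l a m e
    unfolding spectral_p_def Let_def D_U H F G dpar_U g K_def d_def A1_def A2_def C_def ..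
  have "spectral_p k M p \<delta> \<nu> X l a m e
     = (l * (\<nu> * K * H1 + d * A1) + (\<nu> * K * (F1 - C * H1) - d * G1 - 6 * K * d * gk - d * (C * A1 + A2))) * a
      + (l * (\<nu> * K * H2) + (\<nu> * K * (F2 - C * H2) - d * G2 - 6 * K * d * gm)) * m
      + (l * (\<nu> * K * of_real (bp / 6)) + (\<nu> * K * (F3 - C * of_real (bp / 6)) - d * G3 - 6 * K * d * gp)) * e" for l a m e
    unfolding eq by algebra
  then show ?thesis unfolding K_def[symmetric] by blast
qed

text \<open>The entries with \<open>l\<close> in the first two rows are on the diagonal, so the cubic term of the determinant is
the product of the three diagonal coefficients \<open>1\<close>, \<open>1\<close> and \<open>r3\<close>.\<close>

lemma dispersion_polynomial:
  assumes \<nu>: "\<nu> \<noteq> 0"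
  shows "\<exists>E :: complex poly. degree E = 3 \<and>
        (\<forall>l. poly E l = det (matrix (spectral_map k M p \<delta> \<nu> X l))) \<and>
        (\<forall>l. poly E l = 0 \<longleftrightarrow> (\<exists>v. v \<noteq> 0 \<and> spectral_map k M p \<delta> \<nu> X l v = 0))"
proof -
  obtain r1 r2 s1 s2 s3 where sp: "\<And>l a m e. spectral_p k M p \<delta> \<nu> X l a m e
     = (l * r1 + s1) * a + (l * r2 + s2) * m + (l * (\<nu> * of_real k * of_real (bp / 6)) + s3) * e"
    using spectral_p_linear by blast
  define r3 where "r3 = \<nu> * complex_of_real k * of_real (bp / 6)"
  have r3: "r3 \<noteq> 0" using \<nu> k_nz kdv_b_p_pos[OF p k_nz] by (simp add: r3_def)
  note sp = sp[folded r3_def]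
  define a1 a2 a3 where "a1 = complex_of_real (2 * ct)" and "a2 = complex_of_real (6 * k)" and "a3 = complex_of_real (k * ctp)"
  have sk: "spectral_k k M p l a m e = (l + a1) * a + a2 * m + a3 * e" for l a m e
    unfolding spectral_k_def dpar_c a1_def a2_def a3_def using k_nz by (simp add: algebra_simps)
  define b1 b2 b3 where "b1 = complex_of_real (deriv (\<lambda>s. av_3U2 s M p) k)"
    and "b2 = complex_of_real (deriv (\<lambda>s. av_3U2 k s p) M) - of_real c"
    and "b3 = complex_of_real (deriv (\<lambda>s. av_3U2 k M s) p)"
  have sM: "spectral_M k M p l a m e = b1 * a + (l + b2) * m + b3 * e" for l a m e
    unfolding spectral_M_def dpar_linear b1_def b2_def b3_def by (simp add: algebra_simps)
  define A where "A l = matrix (spectral_map k M p \<delta> \<nu> X l)" for l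
  have A: "A l $ 1 $ 1 = l + a1" "A l $ 1 $ 2 = a2" "A l $ 1 $ 3 = a3" "A l $ 2 $ 1 = b1" "A l $ 2 $ 2 = l + b2" "A l $ 2 $ 3 = b3"
    "A l $ 3 $ 1 = l * r1 + s1" "A l $ 3 $ 2 = l * r2 + s2" "A l $ 3 $ 3 = l * r3 + s3" for l
    by (simp_all add: A_def matrix_def spectral_map_def sk sM sp axis_def)
  have map: "spectral_map k M p \<delta> \<nu> X l v = A l *v v" for l v
    by (simp add: vec_eq_iff forall_3 matrix_vector_mult_def sum_3 A spectral_map_def sk sM sp)
  define e0 e1 e2 where "e0 = a1 * (b2 * s3 - b3 * s2) - a2 * (b1 * s3 - b3 * s1) + a3 * (b1 * s2 - b2 * s1)"
    and "e1 = b2 * s3 - b3 * s2 + a1 * (s3 + b2 * r3 - b3 * r2) - a2 * (b1 * r3 - b3 * r1) + a3 * (b1 * r2 - s1 - b2 * r1)"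
    and "e2 = s3 + b2 * r3 + a1 * r3 - b3 * r2 - a3 * r1"
  define E where "E = [:e0, e1, e2, r3:]"
  have "degree E = 3" using r3 by (simp add: E_def)
  moreover have pE: "poly E l = det (A l)" for l
    unfolding det_3 A E_def e0_def e1_def e2_def by (simp add: algebra_simps)
  moreover have "poly E l = 0 \<longleftrightarrow> (\<exists>v. v \<noteq> 0 \<and> spectral_map k M p \<delta> \<nu> X l v = 0)" for l
    unfolding pE map by (rule matrix_vector_ker)
  ultimately show ?thesis unfolding A_def by blast
qed

text \<open>The term \<open>d[kU] = U dk + k dU\<close> splits; its first part completes the coefficient \<open>3 k\<^sup>2 X'' U'\<close> of \<open>dk\<close> to
the one that occurs in the third relation.\<close>

lemma third_modulation_equation:
  fixes a m e a' m' e' aX mX eX :: "'a::{real_normed_field,banach}"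
  shows "dpar av_half_U2 k M p a' m' e' + dpar av_flux k M p aX mX eX
        - \<delta> *\<^sub>R dpar (av_dissip U) k M p a m e
        - (6 * \<delta>) *\<^sub>R avg (\<lambda>y. (X y * D U y) *\<^sub>R dpar (\<lambda>k M p. k * kdv_U k M p y) k M p a m e)
        - (3 * \<delta> * k\<^sup>2 * avg (\<lambda>y. (D ^^ 2) X y * D U y)) *\<^sub>R a
        - (\<delta> * avg (\<lambda>y. D X y * U y)) *\<^sub>R dpar (\<lambda>k M p. k * kdv_c k M p) k M p a m e
    = dpar av_half_U2 k M p a' m' e' + dpar av_flux k M p aX mX eX - of_real \<delta> * dpar (av_dissip U) k M p a m e
      - 6 * of_real k * of_real \<delta> * avg (\<lambda>y. of_real (X y * V1 y) * dU0 a m e y)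
      - of_real \<delta> * of_real (avg (\<lambda>y. (3 * k\<^sup>2 * X2 y + 6 * X y * U y) * V1 y)) * a
      - of_real \<delta> * of_real (avg (\<lambda>y. X1 y * U y)) * dpar (\<lambda>k M p. k * kdv_c k M p) k M p a m e"
proof -
  have 1: "avg (\<lambda>y. (X y * V1 y) *\<^sub>R dpar (\<lambda>k M p. k * kdv_U k M p y) k M p a m e)
     = of_real (avg (\<lambda>y. X y * V1 y * U y)) * a + of_real k * avg (\<lambda>y. of_real (X y * V1 y) * dU0 a m e y)"
  proof (rule avg_eqI)
    have "((\<lambda>y. of_real (X y * V1 y * U y) * a + of_real k * (of_real (X y * V1 y) * dU0 a m e y)) has_integral
        of_real (avg (\<lambda>y. X y * V1 y * U y)) * a + of_real k * avg (\<lambda>y. of_real (X y * V1 y) * dU0 a m e y)) {0..1}"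
      by (intro has_integral_add has_integral_mult_right has_integral_mult_left has_integral_avg
          has_integral_linear[OF has_integral_avg bounded_linear_of_real, unfolded o_def]
          continuous_intros cont contX cont_U cont_dU)
    then show "((\<lambda>y. (X y * V1 y) *\<^sub>R dpar (\<lambda>k M p. k * kdv_U k M p y) k M p a m e) has_integral
        of_real (avg (\<lambda>y. X y * V1 y * U y)) * a + of_real k * avg (\<lambda>y. of_real (X y * V1 y) * dU0 a m e y)) {0..1}"
      by (simp add: dpar_kU scaleR_conv_of_real algebra_simps)
  qed
  have 2: "avg (\<lambda>y. (3 * k\<^sup>2 * X2 y + 6 * X y * U y) * V1 y) = 3 * k\<^sup>2 * avg (\<lambda>y. X2 y * V1 y) + 6 * avg (\<lambda>y. X y * V1 y * U y)"
  proof (rule avg_eqI)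
    have "((\<lambda>y. 3 * k\<^sup>2 * (X2 y * V1 y) + 6 * (X y * V1 y * U y)) has_integral
      3 * k\<^sup>2 * avg (\<lambda>y. X2 y * V1 y) + 6 * avg (\<lambda>y. X y * V1 y * U y)) {0..1}"
      by (intro has_integral_add has_integral_mult_right has_integral_avg continuous_intros cont contX cont_U)
    then show "((\<lambda>y. (3 * k\<^sup>2 * X2 y + 6 * X y * U y) * V1 y) has_integral
      3 * k\<^sup>2 * avg (\<lambda>y. X2 y * V1 y) + 6 * avg (\<lambda>y. X y * V1 y * U y)) {0..1}"
      by (simp add: algebra_simps)
  qed
  show ?thesis unfolding D_U 1 2 by (simp add: scaleR_conv_of_real algebra_simps)
qed

text \<open>On plane waves the first two equations are nonzero multiples of the first two relations.  The third one
is the third relation minus \<open>\<delta> \<langle>X' U\<rangle>\<close> times the first, because it contains \<open>d[kc]\<close> where the relation has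
\<open>(c - l) dk\<close>.\<close>

lemma plane_waves:
  fixes l a m e \<nu> :: complex
  assumes \<nu>: "\<nu> \<noteq> 0"
  defines "w \<equiv> \<lambda>X T. exp (\<nu> * of_real k * (of_real (X - kdv_c k M p * T) + l * of_real T))"
  shows "modulation_system k M p \<delta> X (\<lambda>X T. w X T * a) (\<lambda>X T. w X T * m) (\<lambda>X T. w X T * e)
     \<longleftrightarrow> spectral_map k M p \<delta> \<nu> X l (vector [a, m, e]) = 0"
proof -
  define K d C where "K = complex_of_real k" and "d = complex_of_real \<delta>" and "C = complex_of_real c"
  have dx: "dX (\<lambda>X T. w X T * z) x t = (\<nu> * K * w x t) * z" for z x t
  proof -
    have "((\<lambda>s. exp (\<nu> * K * ((s - C * of_real t) + l * of_real t)) * z) has_field_derivative (\<nu> * K * w x t) * z) (at (of_real x))"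
      by (auto intro!: derivative_eq_intros simp: w_def K_def C_def)
    from has_vector_derivative_real_field[OF this]
    show ?thesis unfolding dX_def by (intro D_eqI) (simp add: w_def K_def C_def)
  qed
  have dt: "dT (\<lambda>X T. w X T * z) x t = (\<nu> * K * (l - C) * w x t) * z" for z x t
  proof -
    have "((\<lambda>s. exp (\<nu> * K * ((of_real x - C * s) + l * s)) * z) has_field_derivative (\<nu> * K * (l - C) * w x t) * z) (at (of_real t))"
      by (auto intro!: derivative_eq_intros simp: w_def K_def C_def algebra_simps)
    from has_vector_derivative_real_field[OF this]
    show ?thesis unfolding dT_def by (intro D_eqI) (simp add: w_def K_def C_def)
  qed
  have w: "w x t \<noteq> 0" for x t by (simp add: w_def)
  have K: "K \<noteq> 0" using k_nz by (simp add: K_def)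
  define sk where "sk = spectral_k k M p l a m e"
  define sM where "sM = spectral_M k M p l a m e"
  define sp where "sp = spectral_p k M p \<delta> \<nu> X l a m e"
  define A1 where "A1 = complex_of_real (avg (\<lambda>y. X1 y * U y))"
  have kc: "dpar (\<lambda>k M p. k * kdv_c k M p) k M p a m e = sk + (C - l) * a"
    by (simp add: dpar_kc sk_def spectral_k_def C_def algebra_simps)
  have dUz: "dU0 (z * a) (z * m) (z * e) y = z * dU0 a m e y" for z y
    by (simp add: dU0_def algebra_simps)
  have i1: "(\<nu> * K * (l - C) * w x t) * a + dpar (\<lambda>k M p. k * kdv_c k M p) k M p (\<nu> * K * w x t * a) (\<nu> * K * w x t * m) (\<nu> * K * w x t * e)
      = \<nu> * K * w x t * sk" for x t
    unfolding dpar_scale kc by (simp add: algebra_simps)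
  have i2: "(\<nu> * K * (l - C) * w x t) * m + dpar av_3U2 k M p (\<nu> * K * w x t * a) (\<nu> * K * w x t * m) (\<nu> * K * w x t * e)
      = \<nu> * K * w x t * sM" for x t
    unfolding dpar_scale sM_def spectral_M_def C_def by (simp add: algebra_simps)
  have i3: "dpar av_half_U2 k M p ((\<nu> * K * (l - C) * w x t) * a) ((\<nu> * K * (l - C) * w x t) * m) ((\<nu> * K * (l - C) * w x t) * e)
        + dpar av_flux k M p (\<nu> * K * w x t * a) (\<nu> * K * w x t * m) (\<nu> * K * w x t * e)
        - \<delta> *\<^sub>R dpar (av_dissip U) k M p (w x t * a) (w x t * m) (w x t * e)
        - (6 * \<delta>) *\<^sub>R avg (\<lambda>y. (X y * D U y) *\<^sub>R dpar (\<lambda>k M p. k * kdv_U k M p y) k M p (w x t * a) (w x t * m) (w x t * e))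
        - (3 * \<delta> * k\<^sup>2 * avg (\<lambda>y. (D ^^ 2) X y * D U y)) *\<^sub>R (w x t * a)
        - (\<delta> * avg (\<lambda>y. D X y * U y)) *\<^sub>R dpar (\<lambda>k M p. k * kdv_c k M p) k M p (w x t * a) (w x t * m) (w x t * e)
      = w x t * (sp - d * A1 * sk)" for x t
  proof -
    have g: "avg (\<lambda>y. of_real (X y * V1 y) * dU0 (w x t * a) (w x t * m) (w x t * e) y)
        = w x t * avg (\<lambda>y. of_real (X y * V1 y) * dU0 a m e y)"
      unfolding dUz avg_cmult[symmetric] by (simp add: mult.left_commute)
    show ?thesis
      unfolding third_modulation_equation g unfolding dpar_scale kc sp_def spectral_p_def Let_def D_U dpar_U
        K_def[symmetric] d_def[symmetric] C_def[symmetric] A1_def[symmetric]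
      by (simp add: algebra_simps)
  qed
  have "modulation_system k M p \<delta> X (\<lambda>X T. w X T * a) (\<lambda>X T. w X T * m) (\<lambda>X T. w X T * e)
     \<longleftrightarrow> (\<forall>x t. \<nu> * K * w x t * sk = 0 \<and> \<nu> * K * w x t * sM = 0 \<and> w x t * (sp - d * A1 * sk) = 0)"
    unfolding modulation_system_def Let_def dx dt i1 i2 i3 ..
  also have "\<dots> \<longleftrightarrow> sk = 0 \<and> sM = 0 \<and> sp = 0" using w \<nu> K by auto
  also have "\<dots> \<longleftrightarrow> spectral_map k M p \<delta> \<nu> X l (vector [a, m, e]) = 0"
    by (simp add: spectral_map_def vec_eq_iff forall_3 sk_def sM_def sp_def)
  finally show ?thesis .
qed

end

section \<open>Two-scale expansions\<close>

definition smooth_twoscale :: "twoscale \<Rightarrow> bool" where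
  "smooth_twoscale F \<longleftrightarrow> (\<forall>n. Ck n (\<lambda>(\<theta>, X, T). F \<theta> X T))"

definition pt :: "twoscale \<Rightarrow> twoscale" where "pt F = (\<lambda>\<theta> X T. D (\<lambda>s. F s X T) \<theta>)"
definition pX :: "twoscale \<Rightarrow> twoscale" where "pX F = (\<lambda>\<theta> X T. dX (F \<theta>) X T)"
definition pT :: "twoscale \<Rightarrow> twoscale" where "pT F = (\<lambda>\<theta> X T. dT (F \<theta>) X T)"

lemma smooth_twoscale_partial:
  assumes F: "smooth_twoscale F"
    and d: "(c has_derivative (\<lambda>h. h *\<^sub>R v)) (at s)"
  shows "((\<lambda>s. (\<lambda>(\<theta>, X, T). F \<theta> X T) (c s)) has_real_derivative frechet_derivative (\<lambda>(\<theta>, X, T). F \<theta> X T) (at (c s)) v) (at s)"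
proof -
  let ?G = "\<lambda>(\<theta>, X, T). F \<theta> X T"
  have "Ck (Suc 0) ?G" using F by (simp only: smooth_twoscale_def)
  from has_derivative_compose[OF d Ck_SucD(1)[OF this, of "c s"]]
  have "((\<lambda>s. ?G (c s)) has_derivative (\<lambda>h. frechet_derivative ?G (at (c s)) (h *\<^sub>R v))) (at s)" .
  moreover have "frechet_derivative ?G (at (c s)) (h *\<^sub>R v) = frechet_derivative ?G (at (c s)) v * h" for h
    using linear_scale[OF has_derivative_linear[OF Ck_SucD(1)[OF \<open>Ck (Suc 0) ?G\<close>, of "c s"]], of h v] by simp
  ultimately show ?thesis by (simp add: has_field_derivative_def)
qed

lemma
  assumes F: "smooth_twoscale F"
  shows smooth_twoscale_pt: "smooth_twoscale (pt F)" and smooth_twoscale_pX: "smooth_twoscale (pX F)" and smooth_twoscale_pT: "smooth_twoscale (pT F)"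
    and pt_deriv: "((\<lambda>s. F s X T) has_real_derivative pt F \<theta> X T) (at \<theta>)"
    and pX_deriv: "((\<lambda>s. F \<theta> s T) has_real_derivative pX F \<theta> X T) (at X)"
    and pT_deriv: "((\<lambda>s. F \<theta> X s) has_real_derivative pT F \<theta> X T) (at T)"
proof -
  let ?G = "\<lambda>(\<theta>, X, T). F \<theta> X T"
  let ?f = "\<lambda>\<theta> X T v. frechet_derivative ?G (at (\<theta>, X, T)) v"
  have 1: "((\<lambda>s. F s X T) has_real_derivative ?f \<theta> X T (1, 0, 0)) (at \<theta>)" for \<theta> X T
  proof -
    have "((\<lambda>s. (s, X, T)) has_derivative (\<lambda>h. h *\<^sub>R (1, 0, 0))) (at \<theta>)"
      by simp (intro has_derivative_Pair has_derivative_ident has_derivative_const)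
    from smooth_twoscale_partial[OF F this] show ?thesis by simp
  qed
  have 2: "((\<lambda>s. F \<theta> s T) has_real_derivative ?f \<theta> X T (0, 1, 0)) (at X)" for \<theta> X T
  proof -
    have "((\<lambda>s. (\<theta>, s, T)) has_derivative (\<lambda>h. h *\<^sub>R (0, 1, 0))) (at X)"
      by simp (intro has_derivative_Pair has_derivative_ident has_derivative_const)
    from smooth_twoscale_partial[OF F this] show ?thesis by simp
  qed
  have 3: "((\<lambda>s. F \<theta> X s) has_real_derivative ?f \<theta> X T (0, 0, 1)) (at T)" for \<theta> X T
  proof -
    have "((\<lambda>s. (\<theta>, X, s)) has_derivative (\<lambda>h. h *\<^sub>R (0, 0, 1))) (at T)"
      by simp (intro has_derivative_Pair has_derivative_ident has_derivative_const)
    from smooth_twoscale_partial[OF F this] show ?thesis by simp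
  qed
  have e: "pt F \<theta> X T = ?f \<theta> X T (1, 0, 0)" "pX F \<theta> X T = ?f \<theta> X T (0, 1, 0)" "pT F \<theta> X T = ?f \<theta> X T (0, 0, 1)" for \<theta> X T
    using 1 2 3 by (auto simp: pt_def pX_def pT_def dX_def dT_def intro: D_eqI_real)
  show "((\<lambda>s. F s X T) has_real_derivative pt F \<theta> X T) (at \<theta>)" "((\<lambda>s. F \<theta> s T) has_real_derivative pX F \<theta> X T) (at X)"
    "((\<lambda>s. F \<theta> X s) has_real_derivative pT F \<theta> X T) (at T)"
    unfolding e by (rule 1 2 3)+
  have "(\<lambda>(\<theta>, X, T). pt F \<theta> X T) = (\<lambda>z. frechet_derivative ?G (at z) (1, 0, 0))"
    "(\<lambda>(\<theta>, X, T). pX F \<theta> X T) = (\<lambda>z. frechet_derivative ?G (at z) (0, 1, 0))"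
    "(\<lambda>(\<theta>, X, T). pT F \<theta> X T) = (\<lambda>z. frechet_derivative ?G (at z) (0, 0, 1))"
    by (auto simp: e)
  moreover have "Ck (Suc n) ?G" for n using F by (simp only: smooth_twoscale_def)
  ultimately show "smooth_twoscale (pt F)" "smooth_twoscale (pX F)" "smooth_twoscale (pT F)"
    unfolding smooth_twoscale_def using Ck_SucD(2) by metis+
qed

lemma smooth_twoscale_add: "smooth_twoscale F \<Longrightarrow> smooth_twoscale G \<Longrightarrow> smooth_twoscale (\<lambda>\<theta> X T. F \<theta> X T + G \<theta> X T)"
  using Ck_add[of _ "\<lambda>(\<theta>, X, T). F \<theta> X T" "\<lambda>(\<theta>, X, T). G \<theta> X T"] by (simp add: smooth_twoscale_def split_beta')

lemma smooth_twoscale_mult: "smooth_twoscale F \<Longrightarrow> smooth_twoscale G \<Longrightarrow> smooth_twoscale (\<lambda>\<theta> X T. F \<theta> X T * G \<theta> X T)"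
  using Ck_mult[of _ "\<lambda>(\<theta>, X, T). F \<theta> X T" "\<lambda>(\<theta>, X, T). G \<theta> X T"] by (simp add: smooth_twoscale_def split_beta')

lemma smooth_twoscale_const: "smooth_twoscale (\<lambda>\<theta> X T. c)"
  unfolding smooth_twoscale_def split_beta' by (intro allI Ck_const)

lemma smooth_twoscale_fast: "(\<And>n. Ck n f) \<Longrightarrow> smooth_twoscale (\<lambda>\<theta> X T. f \<theta>)"
  unfolding smooth_twoscale_def split_beta' by (intro allI Ck_compose_linear[OF bounded_linear_fst])

lemma smooth_twoscale_slow: "(\<And>n. Ck n (\<lambda>(X, T). f X T)) \<Longrightarrow> smooth_twoscale (\<lambda>\<theta> X T. f X T)"
  unfolding smooth_twoscale_def split_beta' by (intro allI Ck_compose_linear[OF bounded_linear_snd, of _ "\<lambda>z. f (fst z) (snd z)"])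

lemma smooth_twoscale_continuous:
  assumes "smooth_twoscale F" "continuous_on S f" "continuous_on S g" "continuous_on S h"
  shows "continuous_on S (\<lambda>z. F (f z) (g z) (h z))"
proof -
  have "continuous_on UNIV (\<lambda>(\<theta>, X, T). F \<theta> X T)" using assms(1) Ck_imp_continuous[of 0] unfolding smooth_twoscale_def by blast
  moreover have "continuous_on S (\<lambda>z. (f z, g z, h z))" by (intro continuous_on_Pair assms)
  ultimately have "continuous_on S (\<lambda>z. (\<lambda>(\<theta>, X, T). F \<theta> X T) (f z, g z, h z))"
    by (rule continuous_on_compose2) simp
  then show ?thesis by simp
qed

lemma pt_pX_commute: assumes F: "smooth_twoscale F" shows "pt (pX F) = pX (pt F)"
proof (intro ext)
  fix \<theta> X T
  have "((\<lambda>\<theta>. pX F \<theta> X T) has_real_derivative pX (pt F) \<theta> X T) (at \<theta>)"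
    by (rule mixed_partials[where S = UNIV and g = "\<lambda>\<theta> X. F \<theta> X T" and h = "\<lambda>\<theta> X. pt F \<theta> X T" and hp = "\<lambda>\<theta> X. pX (pt F) \<theta> X T"])
      (auto simp: split_beta intro!: pt_deriv pX_deriv smooth_twoscale_pt smooth_twoscale_pX F smooth_twoscale_continuous[OF smooth_twoscale_pt[OF F]]
        smooth_twoscale_continuous[OF smooth_twoscale_pX[OF smooth_twoscale_pt[OF F]]] continuous_intros)
  then show "pt (pX F) \<theta> X T = pX (pt F) \<theta> X T" unfolding pt_def[of "pX F"] by (rule D_eqI_real)
qed

lemma pX_pT_commute: assumes F: "smooth_twoscale F" shows "pX (pT F) = pT (pX F)"
proof (intro ext)
  fix \<theta> X T
  have "((\<lambda>X. pT F \<theta> X T) has_real_derivative pT (pX F) \<theta> X T) (at X)"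
    by (rule mixed_partials[where S = UNIV and g = "\<lambda>X T. F \<theta> X T" and h = "\<lambda>X T. pX F \<theta> X T" and hp = "\<lambda>X T. pT (pX F) \<theta> X T"])
      (auto simp: split_beta intro!: pT_deriv pX_deriv smooth_twoscale_pT smooth_twoscale_pX F smooth_twoscale_continuous[OF smooth_twoscale_pX[OF F]]
        smooth_twoscale_continuous[OF smooth_twoscale_pT[OF smooth_twoscale_pX[OF F]]] continuous_intros)
  then show "pX (pT F) \<theta> X T = pT (pX F) \<theta> X T" unfolding pX_def[of "pT F"] dX_def by (rule D_eqI_real)
qed

lemma pt_eqI: "(\<And>\<theta> X T. ((\<lambda>s. F s X T) has_real_derivative F' \<theta> X T) (at \<theta>)) \<Longrightarrow> pt F = F'"
  unfolding pt_def by (intro ext D_eqI_real)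
lemma pX_eqI: "(\<And>\<theta> X T. ((\<lambda>s. F \<theta> s T) has_real_derivative F' \<theta> X T) (at X)) \<Longrightarrow> pX F = F'"
  unfolding pX_def dX_def by (intro ext D_eqI_real)
lemma pT_eqI: "(\<And>\<theta> X T. ((\<lambda>s. F \<theta> X s) has_real_derivative F' \<theta> X T) (at T)) \<Longrightarrow> pT F = F'"
  unfolding pT_def dT_def by (intro ext D_eqI_real)

text \<open>Polynomials in \<open>\<epsilon>\<close> with smooth coefficients.  Remainders of this form are bounded at each point for small
\<open>\<epsilon>\<close> and stay so under differentiation, which a mere bound would not.\<close>

inductive eps_poly :: "(real \<Rightarrow> twoscale) \<Rightarrow> bool" where
  base: "smooth_twoscale g \<Longrightarrow> eps_poly (\<lambda>\<epsilon>. g)"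
| add: "eps_poly G \<Longrightarrow> eps_poly H \<Longrightarrow> eps_poly (\<lambda>\<epsilon> \<theta> X T. G \<epsilon> \<theta> X T + H \<epsilon> \<theta> X T)"
| mult: "eps_poly G \<Longrightarrow> eps_poly H \<Longrightarrow> eps_poly (\<lambda>\<epsilon> \<theta> X T. G \<epsilon> \<theta> X T * H \<epsilon> \<theta> X T)"
| eps: "eps_poly G \<Longrightarrow> eps_poly (\<lambda>\<epsilon> \<theta> X T. \<epsilon> * G \<epsilon> \<theta> X T)"

lemma eps_poly_smooth: "eps_poly G \<Longrightarrow> smooth_twoscale (G \<epsilon>)"
  by (induction rule: eps_poly.induct) (auto intro: smooth_twoscale_add smooth_twoscale_mult smooth_twoscale_const)

lemma eps_poly_bounded: "eps_poly G \<Longrightarrow> \<exists>C. \<forall>\<epsilon>. 0 < \<epsilon> \<and> \<epsilon> < 1 \<longrightarrow> \<bar>G \<epsilon> \<theta> X T\<bar> \<le> C"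
proof (induction rule: eps_poly.induct)
  case (add G H)
  then obtain A B where "\<forall>\<epsilon>. 0 < \<epsilon> \<and> \<epsilon> < 1 \<longrightarrow> \<bar>G \<epsilon> \<theta> X T\<bar> \<le> A" "\<forall>\<epsilon>. 0 < \<epsilon> \<and> \<epsilon> < 1 \<longrightarrow> \<bar>H \<epsilon> \<theta> X T\<bar> \<le> B" by blast
  then have "\<forall>\<epsilon>. 0 < \<epsilon> \<and> \<epsilon> < 1 \<longrightarrow> \<bar>G \<epsilon> \<theta> X T + H \<epsilon> \<theta> X T\<bar> \<le> A + B"
    by (intro allI impI order_trans[OF abs_triangle_ineq] add_mono) auto
  then show ?case by blast
next
  case (mult G H)
  then obtain A B where "\<forall>\<epsilon>. 0 < \<epsilon> \<and> \<epsilon> < 1 \<longrightarrow> \<bar>G \<epsilon> \<theta> X T\<bar> \<le> A" "\<forall>\<epsilon>. 0 < \<epsilon> \<and> \<epsilon> < 1 \<longrightarrow> \<bar>H \<epsilon> \<theta> X T\<bar> \<le> B" by blast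
  then have "\<forall>\<epsilon>. 0 < \<epsilon> \<and> \<epsilon> < 1 \<longrightarrow> \<bar>G \<epsilon> \<theta> X T * H \<epsilon> \<theta> X T\<bar> \<le> \<bar>A\<bar> * B"
    unfolding abs_mult by (intro allI impI mult_mono) (auto intro: order_trans[OF _ abs_ge_self])
  then show ?case by blast
next
  case (eps G)
  then obtain A where A: "\<forall>\<epsilon>. 0 < \<epsilon> \<and> \<epsilon> < 1 \<longrightarrow> \<bar>G \<epsilon> \<theta> X T\<bar> \<le> A" by blast
  have "\<bar>\<epsilon> * G \<epsilon> \<theta> X T\<bar> \<le> 1 * A" if "0 < \<epsilon>" "\<epsilon> < 1" for \<epsilon>
    unfolding abs_mult using A that by (intro mult_mono) auto
  then show ?case by blast
qed auto

lemma eps_poly_pt: "eps_poly G \<Longrightarrow> eps_poly (\<lambda>\<epsilon>. pt (G \<epsilon>))"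
proof (induction rule: eps_poly.induct)
  case (base g)
  then show ?case by (intro eps_poly.base smooth_twoscale_pt)
next
  case (add G H)
  note s = eps_poly_smooth[OF add.hyps(1)] eps_poly_smooth[OF add.hyps(2)]
  have "pt (\<lambda>\<theta> X T. G \<epsilon> \<theta> X T + H \<epsilon> \<theta> X T) = (\<lambda>\<theta> X T. pt (G \<epsilon>) \<theta> X T + pt (H \<epsilon>) \<theta> X T)" for \<epsilon>
    by (rule pt_eqI) (intro DERIV_add pt_deriv s)
  then show ?case using eps_poly.add[OF add.IH] by simp
next
  case (mult G H)
  note s = eps_poly_smooth[OF mult.hyps(1)] eps_poly_smooth[OF mult.hyps(2)]
  have "pt (\<lambda>\<theta> X T. G \<epsilon> \<theta> X T * H \<epsilon> \<theta> X T) = (\<lambda>\<theta> X T. pt (G \<epsilon>) \<theta> X T * H \<epsilon> \<theta> X T + pt (H \<epsilon>) \<theta> X T * G \<epsilon> \<theta> X T)" for \<epsilon>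
    by (rule pt_eqI) (intro DERIV_mult pt_deriv s)
  then show ?case using eps_poly.add[OF eps_poly.mult[OF mult.IH(1) mult.hyps(2)] eps_poly.mult[OF mult.IH(2) mult.hyps(1)]] by simp
next
  case (eps G)
  have "pt (\<lambda>\<theta> X T. \<epsilon> * G \<epsilon> \<theta> X T) = (\<lambda>\<theta> X T. \<epsilon> * pt (G \<epsilon>) \<theta> X T)" for \<epsilon>
    by (rule pt_eqI) (intro DERIV_cmult pt_deriv eps_poly_smooth[OF eps.hyps])
  then show ?case using eps_poly.eps[OF eps.IH] by simp
qed

lemma eps_poly_pX: "eps_poly G \<Longrightarrow> eps_poly (\<lambda>\<epsilon>. pX (G \<epsilon>))"
proof (induction rule: eps_poly.induct)
  case (base g)
  then show ?case by (intro eps_poly.base smooth_twoscale_pX)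
next
  case (add G H)
  note s = eps_poly_smooth[OF add.hyps(1)] eps_poly_smooth[OF add.hyps(2)]
  have "pX (\<lambda>\<theta> X T. G \<epsilon> \<theta> X T + H \<epsilon> \<theta> X T) = (\<lambda>\<theta> X T. pX (G \<epsilon>) \<theta> X T + pX (H \<epsilon>) \<theta> X T)" for \<epsilon>
    by (rule pX_eqI) (intro DERIV_add pX_deriv s)
  then show ?case using eps_poly.add[OF add.IH] by simp
next
  case (mult G H)
  note s = eps_poly_smooth[OF mult.hyps(1)] eps_poly_smooth[OF mult.hyps(2)]
  have "pX (\<lambda>\<theta> X T. G \<epsilon> \<theta> X T * H \<epsilon> \<theta> X T) = (\<lambda>\<theta> X T. pX (G \<epsilon>) \<theta> X T * H \<epsilon> \<theta> X T + pX (H \<epsilon>) \<theta> X T * G \<epsilon> \<theta> X T)" for \<epsilon>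
    by (rule pX_eqI) (intro DERIV_mult pX_deriv s)
  then show ?case using eps_poly.add[OF eps_poly.mult[OF mult.IH(1) mult.hyps(2)] eps_poly.mult[OF mult.IH(2) mult.hyps(1)]] by simp
next
  case (eps G)
  have "pX (\<lambda>\<theta> X T. \<epsilon> * G \<epsilon> \<theta> X T) = (\<lambda>\<theta> X T. \<epsilon> * pX (G \<epsilon>) \<theta> X T)" for \<epsilon>
    by (rule pX_eqI) (intro DERIV_cmult pX_deriv eps_poly_smooth[OF eps.hyps])
  then show ?case using eps_poly.eps[OF eps.IH] by simp
qed

definition two_scale_expands :: "(real \<Rightarrow> twoscale) \<Rightarrow> twoscale \<Rightarrow> twoscale \<Rightarrow> twoscale \<Rightarrow> bool" where
  "two_scale_expands G g0 g1 g2 \<longleftrightarrow> smooth_twoscale g0 \<and> smooth_twoscale g1 \<and> smooth_twoscale g2 \<and>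
    (\<exists>R. eps_poly R \<and> (\<forall>\<epsilon> \<theta> X T. G \<epsilon> \<theta> X T = g0 \<theta> X T + \<epsilon> * g1 \<theta> X T + \<epsilon> ^ 2 * g2 \<theta> X T + \<epsilon> ^ 3 * R \<epsilon> \<theta> X T))"

lemma two_scale_expands_eqI: "two_scale_expands G g0 g1 g2 \<Longrightarrow> g0 = h0 \<Longrightarrow> g1 = h1 \<Longrightarrow> g2 = h2 \<Longrightarrow> two_scale_expands G h0 h1 h2" by simp

lemma two_scale_expands_smooth: "two_scale_expands G g0 g1 g2 \<Longrightarrow> smooth_twoscale (G \<epsilon>)"
proof -
  assume "two_scale_expands G g0 g1 g2"
  then obtain R where s: "smooth_twoscale g0" "smooth_twoscale g1" "smooth_twoscale g2" "eps_poly R"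
    and G: "\<And>\<epsilon> \<theta> X T. G \<epsilon> \<theta> X T = g0 \<theta> X T + \<epsilon> * g1 \<theta> X T + \<epsilon> ^ 2 * g2 \<theta> X T + \<epsilon> ^ 3 * R \<epsilon> \<theta> X T"
    by (auto simp: two_scale_expands_def)
  have "G \<epsilon> = (\<lambda>\<theta> X T. g0 \<theta> X T + \<epsilon> * g1 \<theta> X T + \<epsilon> ^ 2 * g2 \<theta> X T + \<epsilon> ^ 3 * R \<epsilon> \<theta> X T)" using G by blast
  then show ?thesis by (simp only:) (intro smooth_twoscale_add smooth_twoscale_mult smooth_twoscale_const s(1-3) eps_poly_smooth[OF s(4)])
qed

lemma eps_poly_pow: "eps_poly G \<Longrightarrow> eps_poly (\<lambda>\<epsilon> \<theta> X T. \<epsilon> ^ n * G \<epsilon> \<theta> X T)"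
proof (induction n)
  case (Suc n)
  then show ?case using eps_poly.eps[of "\<lambda>\<epsilon> \<theta> X T. \<epsilon> ^ n * G \<epsilon> \<theta> X T"] by (simp add: mult.assoc)
qed simp

lemma two_scale_expands_const: "smooth_twoscale g \<Longrightarrow> two_scale_expands (\<lambda>_. g) g (\<lambda>_ _ _. 0) (\<lambda>_ _ _. 0)"
  unfolding two_scale_expands_def using eps_poly.base[OF smooth_twoscale_const[of 0]] by (auto intro!: smooth_twoscale_const exI[of _ "\<lambda>_ _ _ _. 0"])

lemma two_scale_expands_poly:
  "smooth_twoscale g0 \<Longrightarrow> smooth_twoscale g1 \<Longrightarrow> smooth_twoscale g2 \<Longrightarrow> two_scale_expands (\<lambda>\<epsilon> \<theta> X T. g0 \<theta> X T + \<epsilon> * g1 \<theta> X T + \<epsilon>\<^sup>2 * g2 \<theta> X T) g0 g1 g2"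
  unfolding two_scale_expands_def using eps_poly.base[OF smooth_twoscale_const[of 0]] by (auto intro!: exI[of _ "\<lambda>_ _ _ _. 0"])

lemma two_scale_expands_add:
  assumes "two_scale_expands G g0 g1 g2" "two_scale_expands H h0 h1 h2"
  shows "two_scale_expands (\<lambda>\<epsilon> \<theta> X T. G \<epsilon> \<theta> X T + H \<epsilon> \<theta> X T) (\<lambda>\<theta> X T. g0 \<theta> X T + h0 \<theta> X T) (\<lambda>\<theta> X T. g1 \<theta> X T + h1 \<theta> X T) (\<lambda>\<theta> X T. g2 \<theta> X T + h2 \<theta> X T)"
proof -
  from assms obtain R S where s: "smooth_twoscale g0" "smooth_twoscale g1" "smooth_twoscale g2" "eps_poly R" "smooth_twoscale h0" "smooth_twoscale h1" "smooth_twoscale h2" "eps_poly S"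
    and G: "\<And>\<epsilon> \<theta> X T. G \<epsilon> \<theta> X T = g0 \<theta> X T + \<epsilon> * g1 \<theta> X T + \<epsilon> ^ 2 * g2 \<theta> X T + \<epsilon> ^ 3 * R \<epsilon> \<theta> X T"
    and H: "\<And>\<epsilon> \<theta> X T. H \<epsilon> \<theta> X T = h0 \<theta> X T + \<epsilon> * h1 \<theta> X T + \<epsilon> ^ 2 * h2 \<theta> X T + \<epsilon> ^ 3 * S \<epsilon> \<theta> X T"
    by (auto simp: two_scale_expands_def)
  show ?thesis unfolding two_scale_expands_def
    by (intro conjI smooth_twoscale_add s exI[of _ "\<lambda>\<epsilon> \<theta> X T. R \<epsilon> \<theta> X T + S \<epsilon> \<theta> X T"] eps_poly.add) (simp add: G H algebra_simps)
qed

lemma two_scale_expands_mult: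
  assumes "two_scale_expands G g0 g1 g2" "two_scale_expands H h0 h1 h2"
  shows "two_scale_expands (\<lambda>\<epsilon> \<theta> X T. G \<epsilon> \<theta> X T * H \<epsilon> \<theta> X T) (\<lambda>\<theta> X T. g0 \<theta> X T * h0 \<theta> X T)
    (\<lambda>\<theta> X T. g0 \<theta> X T * h1 \<theta> X T + g1 \<theta> X T * h0 \<theta> X T)
    (\<lambda>\<theta> X T. g0 \<theta> X T * h2 \<theta> X T + g1 \<theta> X T * h1 \<theta> X T + g2 \<theta> X T * h0 \<theta> X T)"
proof -
  from assms obtain R S where s: "smooth_twoscale g0" "smooth_twoscale g1" "smooth_twoscale g2" "eps_poly R" "smooth_twoscale h0" "smooth_twoscale h1" "smooth_twoscale h2" "eps_poly S"
    and G: "\<And>\<epsilon> \<theta> X T. G \<epsilon> \<theta> X T = g0 \<theta> X T + \<epsilon> * g1 \<theta> X T + \<epsilon> ^ 2 * g2 \<theta> X T + \<epsilon> ^ 3 * R \<epsilon> \<theta> X T"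
    and H: "\<And>\<epsilon> \<theta> X T. H \<epsilon> \<theta> X T = h0 \<theta> X T + \<epsilon> * h1 \<theta> X T + \<epsilon> ^ 2 * h2 \<theta> X T + \<epsilon> ^ 3 * S \<epsilon> \<theta> X T"
    by (auto simp: two_scale_expands_def)
  let ?R = "\<lambda>\<epsilon> \<theta> X T. (g1 \<theta> X T * h2 \<theta> X T + g2 \<theta> X T * h1 \<theta> X T) + \<epsilon> * (g2 \<theta> X T * h2 \<theta> X T)
     + ((g0 \<theta> X T + \<epsilon> * g1 \<theta> X T + \<epsilon> ^ 2 * g2 \<theta> X T) * S \<epsilon> \<theta> X T
     + R \<epsilon> \<theta> X T * (h0 \<theta> X T + \<epsilon> * h1 \<theta> X T + \<epsilon> ^ 2 * h2 \<theta> X T + \<epsilon> ^ 3 * S \<epsilon> \<theta> X T))"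
  note b = eps_poly.base[OF s(1)] eps_poly.base[OF s(2)] eps_poly.base[OF s(3)] eps_poly.base[OF s(5)] eps_poly.base[OF s(6)] eps_poly.base[OF s(7)]
  have "eps_poly ?R" by (intro eps_poly.add eps_poly.mult eps_poly.eps eps_poly_pow b s(4) s(8))
  then show ?thesis unfolding two_scale_expands_def
    by (intro conjI smooth_twoscale_add smooth_twoscale_mult s exI[of _ ?R]) (auto simp: G H algebra_simps eval_nat_numeral)
qed

lemma two_scale_expands_eps:
  assumes "two_scale_expands G g0 g1 g2"
  shows "two_scale_expands (\<lambda>\<epsilon> \<theta> X T. \<epsilon> * G \<epsilon> \<theta> X T) (\<lambda>_ _ _. 0) g0 g1"
proof -
  from assms obtain R where s: "smooth_twoscale g0" "smooth_twoscale g1" "smooth_twoscale g2" "eps_poly R"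
    and G: "\<And>\<epsilon> \<theta> X T. G \<epsilon> \<theta> X T = g0 \<theta> X T + \<epsilon> * g1 \<theta> X T + \<epsilon> ^ 2 * g2 \<theta> X T + \<epsilon> ^ 3 * R \<epsilon> \<theta> X T"
    by (auto simp: two_scale_expands_def)
  have "eps_poly (\<lambda>\<epsilon> \<theta> X T. g2 \<theta> X T + \<epsilon> * R \<epsilon> \<theta> X T)"
    by (intro eps_poly.add eps_poly.eps eps_poly.base s)
  then show ?thesis unfolding two_scale_expands_def
    by (intro conjI s smooth_twoscale_const exI[of _ "\<lambda>\<epsilon> \<theta> X T. g2 \<theta> X T + \<epsilon> * R \<epsilon> \<theta> X T"])
      (auto simp: G algebra_simps eval_nat_numeral)
qed

lemma two_scale_expands_pt:
  assumes "two_scale_expands G g0 g1 g2"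
  shows "two_scale_expands (\<lambda>\<epsilon>. pt (G \<epsilon>)) (pt g0) (pt g1) (pt g2)"
proof -
  from assms obtain R where s: "smooth_twoscale g0" "smooth_twoscale g1" "smooth_twoscale g2" "eps_poly R"
    and G: "\<And>\<epsilon> \<theta> X T. G \<epsilon> \<theta> X T = g0 \<theta> X T + \<epsilon> * g1 \<theta> X T + \<epsilon> ^ 2 * g2 \<theta> X T + \<epsilon> ^ 3 * R \<epsilon> \<theta> X T"
    by (auto simp: two_scale_expands_def)
  have "pt (G \<epsilon>) = (\<lambda>\<theta> X T. pt g0 \<theta> X T + \<epsilon> * pt g1 \<theta> X T + \<epsilon> ^ 2 * pt g2 \<theta> X T + \<epsilon> ^ 3 * pt (R \<epsilon>) \<theta> X T)" for \<epsilon>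
    by (rule pt_eqI, unfold G) (intro DERIV_add DERIV_cmult pt_deriv s eps_poly_smooth)
  then show ?thesis unfolding two_scale_expands_def
    by (intro conjI s smooth_twoscale_pt exI[of _ "\<lambda>\<epsilon>. pt (R \<epsilon>)"] eps_poly_pt) auto
qed

lemma two_scale_expands_pX:
  assumes "two_scale_expands G g0 g1 g2"
  shows "two_scale_expands (\<lambda>\<epsilon>. pX (G \<epsilon>)) (pX g0) (pX g1) (pX g2)"
proof -
  from assms obtain R where s: "smooth_twoscale g0" "smooth_twoscale g1" "smooth_twoscale g2" "eps_poly R"
    and G: "\<And>\<epsilon> \<theta> X T. G \<epsilon> \<theta> X T = g0 \<theta> X T + \<epsilon> * g1 \<theta> X T + \<epsilon> ^ 2 * g2 \<theta> X T + \<epsilon> ^ 3 * R \<epsilon> \<theta> X T"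
    by (auto simp: two_scale_expands_def)
  have "pX (G \<epsilon>) = (\<lambda>\<theta> X T. pX g0 \<theta> X T + \<epsilon> * pX g1 \<theta> X T + \<epsilon> ^ 2 * pX g2 \<theta> X T + \<epsilon> ^ 3 * pX (R \<epsilon>) \<theta> X T)" for \<epsilon>
    by (rule pX_eqI, unfold G) (intro DERIV_add DERIV_cmult pX_deriv s eps_poly_smooth)
  then show ?thesis unfolding two_scale_expands_def
    by (intro conjI s smooth_twoscale_pX exI[of _ "\<lambda>\<epsilon>. pX (R \<epsilon>)"] eps_poly_pX) auto
qed

lemma two_scale_expands_expands:
  assumes "two_scale_expands G g0 g1 g2"
  shows "expands (\<lambda>\<epsilon>. G \<epsilon> \<theta> X T) (g0 \<theta> X T) (g1 \<theta> X T) (g2 \<theta> X T)"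
proof -
  from assms obtain R where R: "eps_poly R"
    and G: "\<And>\<epsilon>. G \<epsilon> \<theta> X T = g0 \<theta> X T + \<epsilon> * g1 \<theta> X T + \<epsilon> ^ 2 * g2 \<theta> X T + \<epsilon> ^ 3 * R \<epsilon> \<theta> X T"
    by (auto simp: two_scale_expands_def)
  from eps_poly_bounded[OF R] obtain C where C: "\<And>\<epsilon>. 0 < \<epsilon> \<Longrightarrow> \<epsilon> < 1 \<Longrightarrow> \<bar>R \<epsilon> \<theta> X T\<bar> \<le> C" by blast
  have "\<forall>\<^sub>F \<epsilon> in at_right (0::real). 0 < \<epsilon> \<and> \<epsilon> < 1"
    using eventually_at_right_real[of 0 1] by (auto elim: eventually_mono)
  then have "\<forall>\<^sub>F \<epsilon> in at_right 0. norm (G \<epsilon> \<theta> X T - (g0 \<theta> X T + \<epsilon> *\<^sub>R g1 \<theta> X T + \<epsilon>\<^sup>2 *\<^sub>R g2 \<theta> X T)) \<le> C * \<epsilon> ^ 3"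
  proof eventually_elim
    case (elim \<epsilon>)
    have "norm (G \<epsilon> \<theta> X T - (g0 \<theta> X T + \<epsilon> *\<^sub>R g1 \<theta> X T + \<epsilon>\<^sup>2 *\<^sub>R g2 \<theta> X T)) = \<bar>R \<epsilon> \<theta> X T\<bar> * \<epsilon> ^ 3"
      using elim by (simp add: G abs_mult)
    also have "\<dots> \<le> C * \<epsilon> ^ 3" using elim C by (intro mult_right_mono) auto
    finally show ?case .
  qed
  then show ?thesis unfolding expands_def by blast
qed

context gks_wave
begin

text \<open>In the residual times \<open>\<epsilon>\<close>, the two-scale derivative \<open>\<partial>\<^sub>X\<close> occurs only through \<open>op \<epsilon> = \<epsilon> \<partial>\<^sub>X\<close>, applied
up to four times; \<open>op\<close> has no singularity at \<open>\<epsilon> = 0\<close>, so the expansion is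
purely algebraic.  The bound on the residual makes the coefficients of \<open>\<epsilon>\<close> and \<open>\<epsilon>\<^sup>2\<close> vanish.\<close>

lemma modulation_orders:
  assumes me: "modulation_expansion k M p \<delta> \<phi>1 \<phi>2 A B"
  defines "a \<equiv> dX \<phi>1" and "b' \<equiv> dX \<phi>2"
  shows "smooth_twoscale A" "smooth_twoscale B" "smooth_twoscale (\<lambda>\<theta> x T. \<phi>1 x T)"
    "- k * c * pt A \<theta> x T + dT \<phi>1 x T * V1 \<theta> + 6 * (U \<theta> * (k * pt A \<theta> x T + a x T * V1 \<theta>) + A \<theta> x T * (k * V1 \<theta>))
      + k ^ 3 * pt (pt (pt A)) \<theta> x T + 3 * k\<^sup>2 * a x T * V3 \<theta> + \<delta> * (k\<^sup>2 * V2 \<theta> + k ^ 4 * V4 \<theta>) = 0"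
    "- k * c * pt B \<theta> x T + dT \<phi>1 x T * pt A \<theta> x T + pT A \<theta> x T + dT \<phi>2 x T * V1 \<theta>
      + 6 * (U \<theta> * (k * pt B \<theta> x T + a x T * pt A \<theta> x T + pX A \<theta> x T + b' x T * V1 \<theta>)
         + A \<theta> x T * (k * pt A \<theta> x T + a x T * V1 \<theta>) + B \<theta> x T * (k * V1 \<theta>))
      + k ^ 3 * pt (pt (pt B)) \<theta> x T + 3 * k\<^sup>2 * a x T * pt (pt (pt A)) \<theta> x T + 3 * k\<^sup>2 * pt (pt (pX A)) \<theta> x T
      + 3 * k\<^sup>2 * b' x T * V3 \<theta> + 3 * k * (a x T)\<^sup>2 * V3 \<theta> + 3 * k * dX a x T * V2 \<theta>
      + \<delta> * (k\<^sup>2 * pt (pt A) \<theta> x T + 2 * k * a x T * V2 \<theta> + k ^ 4 * pt (pt (pt (pt A))) \<theta> x T + 4 * k ^ 3 * a x T * V4 \<theta>) = 0"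
proof -
  show A: "smooth_twoscale A" and B: "smooth_twoscale B" and P1: "smooth_twoscale (\<lambda>\<theta> x T. \<phi>1 x T)"
    using me unfolding modulation_expansion_def smooth_twoscale_def[of A] smooth_twoscale_def[of B] by (auto intro: smooth_twoscale_slow)
  have P2: "smooth_twoscale (\<lambda>\<theta> x T. \<phi>2 x T)"
    using me unfolding modulation_expansion_def by (auto intro: smooth_twoscale_slow)
  have a: "pX (\<lambda>\<theta> x T. \<phi>1 x T) = (\<lambda>\<theta> x T. a x T)" "pX (\<lambda>\<theta> x T. \<phi>2 x T) = (\<lambda>\<theta> x T. b' x T)"
    by (simp_all add: pX_def a_def b'_def fun_eq_iff)
  have t: "pT (\<lambda>\<theta> x T. \<phi>1 x T) = (\<lambda>\<theta> x T. dT \<phi>1 x T)" "pT (\<lambda>\<theta> x T. \<phi>2 x T) = (\<lambda>\<theta> x T. dT \<phi>2 x T)"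
    by (simp_all add: pT_def fun_eq_iff)
  note sa = smooth_twoscale_pX[OF P1, unfolded a] smooth_twoscale_pX[OF P2, unfolded a]
  note st = smooth_twoscale_pT[OF P1, unfolded t] smooth_twoscale_pT[OF P2, unfolded t]
  have dxa: "((\<lambda>s. a s T) has_real_derivative dX a x T) (at x)" for x T
    using pX_deriv[OF sa(1), of T undefined x] by (simp add: pX_def)
  have sU: "smooth_twoscale (\<lambda>\<theta> x T. U \<theta>)" by (rule smooth_twoscale_fast) (rule Ck_U)
  define \<Phi> where "\<Phi> \<epsilon> = (\<lambda>x T. k * (x - c * T) + \<epsilon> * \<phi>1 x T + \<epsilon>\<^sup>2 * \<phi>2 x T)" for \<epsilon>
  have \<Phi>x: "dX (\<Phi> \<epsilon>) x T = k + \<epsilon> * a x T + \<epsilon>\<^sup>2 * b' x T" for \<epsilon> x T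
    unfolding dX_def \<Phi>_def
    by (rule D_eqI_real) (auto intro!: derivative_eq_intros pX_deriv[OF P1, unfolded a] pX_deriv[OF P2, unfolded a])
  have \<Phi>T: "dT (\<Phi> \<epsilon>) x T = - k * c + \<epsilon> * dT \<phi>1 x T + \<epsilon>\<^sup>2 * dT \<phi>2 x T" for \<epsilon> x T
    unfolding dT_def[of "\<Phi> \<epsilon>"] unfolding \<Phi>_def
    by (rule D_eqI_real) (auto intro!: derivative_eq_intros pT_deriv[OF P1, unfolded t] pT_deriv[OF P2, unfolded t])
  define op :: "real \<Rightarrow> twoscale \<Rightarrow> twoscale" where
    "op \<epsilon> F = (\<lambda>\<theta> x T. (k + \<epsilon> * a x T + \<epsilon>\<^sup>2 * b' x T) * pt F \<theta> x T + \<epsilon> * pX F \<theta> x T)" for \<epsilon> F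
  have op_ord: "two_scale_expands (\<lambda>\<epsilon>. op \<epsilon> (G \<epsilon>)) (\<lambda>\<theta> x T. k * pt g0 \<theta> x T)
      (\<lambda>\<theta> x T. k * pt g1 \<theta> x T + a x T * pt g0 \<theta> x T + pX g0 \<theta> x T)
      (\<lambda>\<theta> x T. k * pt g2 \<theta> x T + a x T * pt g1 \<theta> x T + b' x T * pt g0 \<theta> x T + pX g1 \<theta> x T)"
    if G: "two_scale_expands G g0 g1 g2" for G g0 g1 g2
    unfolding op_def
    by (rule two_scale_expands_eqI[OF two_scale_expands_add[OF two_scale_expands_mult[OF two_scale_expands_poly[OF smooth_twoscale_const[of k] sa] two_scale_expands_pt[OF G]] two_scale_expands_eps[OF two_scale_expands_pX[OF G]]]])
      (auto simp: fun_eq_iff)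
  have op_ms: "msX \<epsilon> (\<Phi> \<epsilon>) F = (\<lambda>\<theta> x T. (1 / \<epsilon>) * op \<epsilon> F \<theta> x T)" if "\<epsilon> \<noteq> 0" for \<epsilon> F
    using that by (simp add: msX_def op_def \<Phi>x pt_def pX_def fun_eq_iff field_simps)
  have op_scale: "op \<epsilon> (\<lambda>\<theta> x T. r * F \<theta> x T) = (\<lambda>\<theta> x T. r * op \<epsilon> F \<theta> x T)" if "smooth_twoscale F" for \<epsilon> r F
  proof -
    have "pt (\<lambda>\<theta> x T. r * F \<theta> x T) = (\<lambda>\<theta> x T. r * pt F \<theta> x T)"
      by (rule pt_eqI) (intro DERIV_cmult pt_deriv that)
    moreover have "pX (\<lambda>\<theta> x T. r * F \<theta> x T) = (\<lambda>\<theta> x T. r * pX F \<theta> x T)"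
      by (rule pX_eqI) (intro DERIV_cmult pX_deriv that)
    ultimately show ?thesis by (simp add: op_def fun_eq_iff algebra_simps)
  qed
  define F where "F \<epsilon> = (\<lambda>\<theta> x T. U \<theta> + \<epsilon> * A \<theta> x T + \<epsilon>\<^sup>2 * B \<theta> x T)" for \<epsilon>
  define H1 where "H1 \<epsilon> = op \<epsilon> (F \<epsilon>)" for \<epsilon>
  define H2 where "H2 \<epsilon> = op \<epsilon> (H1 \<epsilon>)" for \<epsilon>
  define H3 where "H3 \<epsilon> = op \<epsilon> (H2 \<epsilon>)" for \<epsilon>
  define H4 where "H4 \<epsilon> = op \<epsilon> (H3 \<epsilon>)" for \<epsilon>
  have F: "two_scale_expands F (\<lambda>\<theta> x T. U \<theta>) A B" unfolding F_def by (rule two_scale_expands_poly[OF sU A B])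
  note sA = A smooth_twoscale_pt[OF A] smooth_twoscale_pt[OF smooth_twoscale_pt[OF A]] smooth_twoscale_pt[OF smooth_twoscale_pt[OF smooth_twoscale_pt[OF A]]]
  note sB = B smooth_twoscale_pt[OF B] smooth_twoscale_pt[OF smooth_twoscale_pt[OF B]]
  note sX = smooth_twoscale_pX[OF A] smooth_twoscale_pt[OF smooth_twoscale_pX[OF A]]
  note cA = pt_pX_commute[OF A] pt_pX_commute[OF smooth_twoscale_pt[OF A]]
  have dU: "(U has_real_derivative V1 y) (at y)" for y
    unfolding kdv_U_def using dV by (auto intro!: derivative_eq_intros)
  note dt = pt_deriv[OF sA(1)] pt_deriv[OF sA(2)] pt_deriv[OF sA(3)] pt_deriv[OF sA(4)]
     pt_deriv[OF sB(1)] pt_deriv[OF sB(2)] pt_deriv[OF sB(3)] pt_deriv[OF sX(1)] pt_deriv[OF sX(2)] dU dV1 dV2 dV3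
  note dx = pX_deriv[OF sA(1)] pX_deriv[OF sA(2)] pX_deriv[OF sA(3)] dxa
  have H1: "two_scale_expands H1 (\<lambda>\<theta> x T. k * V1 \<theta>) (\<lambda>\<theta> x T. k * pt A \<theta> x T + a x T * V1 \<theta>)
     (\<lambda>\<theta> x T. k * pt B \<theta> x T + a x T * pt A \<theta> x T + b' x T * V1 \<theta> + pX A \<theta> x T)"
  proof -
    have 1: "pt (\<lambda>\<theta> x T. U \<theta>) = (\<lambda>\<theta> x T. V1 \<theta>)" by (rule pt_eqI) (rule dU)
    have 2: "pX (\<lambda>\<theta> x T. U \<theta>) = (\<lambda>\<theta> x T. 0)" by (rule pX_eqI) simp
    show ?thesis unfolding H1_def by (rule two_scale_expands_eqI[OF op_ord[OF F]]) (simp_all add: 1 2)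
  qed
  have H2: "two_scale_expands H2 (\<lambda>\<theta> x T. k\<^sup>2 * V2 \<theta>) (\<lambda>\<theta> x T. k\<^sup>2 * pt (pt A) \<theta> x T + 2 * k * a x T * V2 \<theta>)
     (\<lambda>\<theta> x T. k\<^sup>2 * pt (pt B) \<theta> x T + 2 * k * a x T * pt (pt A) \<theta> x T + 2 * k * pt (pX A) \<theta> x T + 2 * k * b' x T * V2 \<theta>
        + (a x T)\<^sup>2 * V2 \<theta> + dX a x T * V1 \<theta>)"
  proof -
    have 1: "pt (\<lambda>\<theta> x T. k * V1 \<theta>) = (\<lambda>\<theta> x T. k * V2 \<theta>)" by (rule pt_eqI) (rule derivative_eq_intros dt refl | simp)+
    have 2: "pX (\<lambda>\<theta> x T. k * V1 \<theta>) = (\<lambda>\<theta> x T. 0)" by (rule pX_eqI) simp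
    have 3: "pt (\<lambda>\<theta> x T. k * pt A \<theta> x T + a x T * V1 \<theta>) = (\<lambda>\<theta> x T. k * pt (pt A) \<theta> x T + a x T * V2 \<theta>)"
      by (rule pt_eqI) (rule derivative_eq_intros dt refl | simp)+
    have 4: "pX (\<lambda>\<theta> x T. k * pt A \<theta> x T + a x T * V1 \<theta>) = (\<lambda>\<theta> x T. k * pt (pX A) \<theta> x T + dX a x T * V1 \<theta>)"
      unfolding cA by (rule pX_eqI) (rule derivative_eq_intros dx refl | simp)+
    have 5: "pt (\<lambda>\<theta> x T. k * pt B \<theta> x T + a x T * pt A \<theta> x T + b' x T * V1 \<theta> + pX A \<theta> x T)
       = (\<lambda>\<theta> x T. k * pt (pt B) \<theta> x T + a x T * pt (pt A) \<theta> x T + b' x T * V2 \<theta> + pt (pX A) \<theta> x T)"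
      by (rule pt_eqI) (rule derivative_eq_intros dt refl | simp)+
    show ?thesis unfolding H2_def
      by (rule two_scale_expands_eqI[OF op_ord[OF H1]], unfold 1 2 3 4 5) (simp_all add: fun_eq_iff algebra_simps power2_eq_square)
  qed
  have H3: "two_scale_expands H3 (\<lambda>\<theta> x T. k ^ 3 * V3 \<theta>) (\<lambda>\<theta> x T. k ^ 3 * pt (pt (pt A)) \<theta> x T + 3 * k\<^sup>2 * a x T * V3 \<theta>)
     (\<lambda>\<theta> x T. k ^ 3 * pt (pt (pt B)) \<theta> x T + 3 * k\<^sup>2 * a x T * pt (pt (pt A)) \<theta> x T + 3 * k\<^sup>2 * pt (pt (pX A)) \<theta> x T
      + 3 * k\<^sup>2 * b' x T * V3 \<theta> + 3 * k * (a x T)\<^sup>2 * V3 \<theta> + 3 * k * dX a x T * V2 \<theta>)"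
  proof -
    have 1: "pt (\<lambda>\<theta> x T. k\<^sup>2 * V2 \<theta>) = (\<lambda>\<theta> x T. k\<^sup>2 * V3 \<theta>)" by (rule pt_eqI) (rule derivative_eq_intros dt refl | simp)+
    have 2: "pX (\<lambda>\<theta> x T. k\<^sup>2 * V2 \<theta>) = (\<lambda>\<theta> x T. 0)" by (rule pX_eqI) simp
    have 3: "pt (\<lambda>\<theta> x T. k\<^sup>2 * pt (pt A) \<theta> x T + 2 * k * a x T * V2 \<theta>)
       = (\<lambda>\<theta> x T. k\<^sup>2 * pt (pt (pt A)) \<theta> x T + 2 * k * a x T * V3 \<theta>)"
      by (rule pt_eqI) (rule derivative_eq_intros dt refl | simp)+
    have 4: "pX (\<lambda>\<theta> x T. k\<^sup>2 * pt (pt A) \<theta> x T + 2 * k * a x T * V2 \<theta>)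
       = (\<lambda>\<theta> x T. k\<^sup>2 * pt (pt (pX A)) \<theta> x T + 2 * k * dX a x T * V2 \<theta>)"
      unfolding cA by (rule pX_eqI) (rule derivative_eq_intros dx refl | simp)+
    have 5: "pt (\<lambda>\<theta> x T. k\<^sup>2 * pt (pt B) \<theta> x T + 2 * k * a x T * pt (pt A) \<theta> x T + 2 * k * pt (pX A) \<theta> x T + 2 * k * b' x T * V2 \<theta>
        + (a x T)\<^sup>2 * V2 \<theta> + dX a x T * V1 \<theta>)
      = (\<lambda>\<theta> x T. k\<^sup>2 * pt (pt (pt B)) \<theta> x T + 2 * k * a x T * pt (pt (pt A)) \<theta> x T + 2 * k * pt (pt (pX A)) \<theta> x T + 2 * k * b' x T * V3 \<theta>
        + (a x T)\<^sup>2 * V3 \<theta> + dX a x T * V2 \<theta>)"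
      by (rule pt_eqI) (rule derivative_eq_intros dt refl | simp)+
    show ?thesis unfolding H3_def
      by (rule two_scale_expands_eqI[OF op_ord[OF H2]], unfold 1 2 3 4 5) (simp_all add: fun_eq_iff algebra_simps power2_eq_square power3_eq_cube)
  qed
  have "\<exists>h. two_scale_expands H4 (\<lambda>\<theta> x T. k ^ 4 * V4 \<theta>) (\<lambda>\<theta> x T. k ^ 4 * pt (pt (pt (pt A))) \<theta> x T + 4 * k ^ 3 * a x T * V4 \<theta>) h"
  proof -
    have 1: "pt (\<lambda>\<theta> x T. k ^ 3 * V3 \<theta>) = (\<lambda>\<theta> x T. k ^ 3 * V4 \<theta>)" by (rule pt_eqI) (rule derivative_eq_intros dt refl | simp)+
    have 2: "pX (\<lambda>\<theta> x T. k ^ 3 * V3 \<theta>) = (\<lambda>\<theta> x T. 0)" by (rule pX_eqI) simp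
    have 3: "pt (\<lambda>\<theta> x T. k ^ 3 * pt (pt (pt A)) \<theta> x T + 3 * k\<^sup>2 * a x T * V3 \<theta>)
       = (\<lambda>\<theta> x T. k ^ 3 * pt (pt (pt (pt A))) \<theta> x T + 3 * k\<^sup>2 * a x T * V4 \<theta>)"
      by (rule pt_eqI) (rule derivative_eq_intros dt refl | simp)+
    show ?thesis unfolding H4_def
      by (rule exI, rule two_scale_expands_eqI[OF op_ord[OF H3] _ _ refl], unfold 1 2 3) (simp_all add: fun_eq_iff algebra_simps eval_nat_numeral)
  qed
  then obtain h4 where H4: "two_scale_expands H4 (\<lambda>\<theta> x T. k ^ 4 * V4 \<theta>) (\<lambda>\<theta> x T. k ^ 4 * pt (pt (pt (pt A))) \<theta> x T + 4 * k ^ 3 * a x T * V4 \<theta>) h4"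
    by blast
  define R where "R \<epsilon> = (\<lambda>\<theta> x T. (- k * c + \<epsilon> * dT \<phi>1 x T + \<epsilon>\<^sup>2 * dT \<phi>2 x T) * pt (F \<epsilon>) \<theta> x T
     + \<epsilon> * (pT (\<lambda>\<theta> x T. U \<theta>) \<theta> x T + \<epsilon> * pT A \<theta> x T + \<epsilon>\<^sup>2 * pT B \<theta> x T) + 6 * (F \<epsilon> \<theta> x T * H1 \<epsilon> \<theta> x T)
     + H3 \<epsilon> \<theta> x T + \<delta> * (\<epsilon> * H2 \<epsilon> \<theta> x T + \<epsilon> * H4 \<epsilon> \<theta> x T))" for \<epsilon>
  note o = two_scale_expands_add[OF two_scale_expands_add[OF two_scale_expands_add[OF two_scale_expands_add[OF two_scale_expands_mult[OF two_scale_expands_poly[OF smooth_twoscale_const[of "- k * c"] st] two_scale_expands_pt[OF F]]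
      two_scale_expands_eps[OF two_scale_expands_poly[OF smooth_twoscale_pT[OF sU] smooth_twoscale_pT[OF A] smooth_twoscale_pT[OF B]]]]
      two_scale_expands_mult[OF two_scale_expands_const[OF smooth_twoscale_const[of 6]] two_scale_expands_mult[OF F H1]]] H3]
      two_scale_expands_mult[OF two_scale_expands_const[OF smooth_twoscale_const[of \<delta>]] two_scale_expands_add[OF two_scale_expands_eps[OF H2] two_scale_expands_eps[OF H4]]], folded R_def]
  have rel: "R \<epsilon> \<theta> x T = \<epsilon> * ms_residual \<delta> \<epsilon> (\<Phi> \<epsilon>) (F \<epsilon>) \<theta> x T" if "\<epsilon> \<noteq> 0" for \<epsilon> \<theta> x T
  proof -
    have F4: "smooth_twoscale (F \<epsilon>)" "smooth_twoscale (H1 \<epsilon>)" "smooth_twoscale (H2 \<epsilon>)" "smooth_twoscale (H3 \<epsilon>)"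
      by (rule two_scale_expands_smooth[OF F] two_scale_expands_smooth[OF H1] two_scale_expands_smooth[OF H2] two_scale_expands_smooth[OF H3])+
    have m1: "msX \<epsilon> (\<Phi> \<epsilon>) (F \<epsilon>) = (\<lambda>\<theta> x T. (1 / \<epsilon>) * H1 \<epsilon> \<theta> x T)" by (simp add: op_ms[OF that] H1_def)
    have m2: "(msX \<epsilon> (\<Phi> \<epsilon>) ^^ 2) (F \<epsilon>) = (\<lambda>\<theta> x T. (1 / \<epsilon>\<^sup>2) * H2 \<epsilon> \<theta> x T)"
    proof -
      have "(msX \<epsilon> (\<Phi> \<epsilon>) ^^ 2) (F \<epsilon>) = msX \<epsilon> (\<Phi> \<epsilon>) (msX \<epsilon> (\<Phi> \<epsilon>) (F \<epsilon>))" by (simp add: eval_nat_numeral)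
      also have "\<dots> = msX \<epsilon> (\<Phi> \<epsilon>) (\<lambda>\<theta> x T. (1 / \<epsilon>) * H1 \<epsilon> \<theta> x T)" by (simp only: m1)
      also have "\<dots> = (\<lambda>\<theta> x T. (1 / \<epsilon>) * ((1 / \<epsilon>) * H2 \<epsilon> \<theta> x T))"
        by (simp only: op_ms[OF that] op_scale[OF F4(2)] H2_def)
      finally show ?thesis by (simp add: fun_eq_iff power2_eq_square)
    qed
    have m3: "(msX \<epsilon> (\<Phi> \<epsilon>) ^^ 3) (F \<epsilon>) = (\<lambda>\<theta> x T. (1 / \<epsilon> ^ 3) * H3 \<epsilon> \<theta> x T)"
    proof -
      have "(msX \<epsilon> (\<Phi> \<epsilon>) ^^ 3) (F \<epsilon>) = msX \<epsilon> (\<Phi> \<epsilon>) ((msX \<epsilon> (\<Phi> \<epsilon>) ^^ 2) (F \<epsilon>))" by (simp add: eval_nat_numeral)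
      then show ?thesis unfolding m2 op_ms[OF that] op_scale[OF F4(3)] H3_def[symmetric]
        by (simp add: fun_eq_iff power2_eq_square power3_eq_cube)
    qed
    have m4: "(msX \<epsilon> (\<Phi> \<epsilon>) ^^ 4) (F \<epsilon>) = (\<lambda>\<theta> x T. (1 / \<epsilon> ^ 4) * H4 \<epsilon> \<theta> x T)"
    proof -
      have "(msX \<epsilon> (\<Phi> \<epsilon>) ^^ 4) (F \<epsilon>) = msX \<epsilon> (\<Phi> \<epsilon>) ((msX \<epsilon> (\<Phi> \<epsilon>) ^^ 3) (F \<epsilon>))" by (simp add: eval_nat_numeral)
      then show ?thesis unfolding m3 op_ms[OF that] op_scale[OF F4(4)] H4_def[symmetric]
        by (simp add: fun_eq_iff eval_nat_numeral)
    qed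
    have pTF: "dT (F \<epsilon> \<theta>) x T = pT (\<lambda>\<theta> x T. U \<theta>) \<theta> x T + \<epsilon> * pT A \<theta> x T + \<epsilon>\<^sup>2 * pT B \<theta> x T"
      unfolding dT_def[of "F \<epsilon> \<theta>"] unfolding F_def
      by (rule D_eqI_real) (intro DERIV_add DERIV_cmult pT_deriv[OF sU] pT_deriv[OF A] pT_deriv[OF B])
    have mT: "msT \<epsilon> (\<Phi> \<epsilon>) (F \<epsilon>) \<theta> x T = (- k * c + \<epsilon> * dT \<phi>1 x T + \<epsilon>\<^sup>2 * dT \<phi>2 x T) / \<epsilon> * pt (F \<epsilon>) \<theta> x T
       + (pT (\<lambda>\<theta> x T. U \<theta>) \<theta> x T + \<epsilon> * pT A \<theta> x T + \<epsilon>\<^sup>2 * pT B \<theta> x T)"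
      unfolding msT_def \<Phi>T pTF pt_def ..
    show ?thesis unfolding ms_residual_def m1 m2 m3 m4 mT R_def
      using that by (simp add: field_simps eval_nat_numeral)
  qed
  have R0: "expands (\<lambda>\<epsilon>. R \<epsilon> \<theta> x T) 0 0 0" for \<theta> x T
  proof -
    obtain C where C: "\<forall>\<^sub>F \<epsilon> in at_right 0. \<bar>ms_residual \<delta> \<epsilon> (\<Phi> \<epsilon>) (F \<epsilon>) \<theta> x T\<bar> \<le> C * \<epsilon>\<^sup>2"
      using me unfolding modulation_expansion_def \<Phi>_def F_def by blast
    have "\<forall>\<^sub>F \<epsilon> in at_right 0. norm (R \<epsilon> \<theta> x T - (0 + \<epsilon> *\<^sub>R 0 + \<epsilon>\<^sup>2 *\<^sub>R 0)) \<le> C * \<epsilon> ^ 3"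
      using C eventually_at_right_less[of 0]
    proof eventually_elim
      case (elim \<epsilon>)
      have "\<epsilon> * \<bar>ms_residual \<delta> \<epsilon> (\<Phi> \<epsilon>) (F \<epsilon>) \<theta> x T\<bar> \<le> \<epsilon> * (C * \<epsilon>\<^sup>2)" using elim by (intro mult_left_mono) auto
      then show ?case using elim rel[of \<epsilon> \<theta> x T] by (simp add: abs_mult eval_nat_numeral mult_ac)
    qed
    then show ?thesis unfolding expands_def by blast
  qed
  note z = expands_zero[OF expands_diff[OF two_scale_expands_expands[OF o] R0]]
  have pU: "pt (\<lambda>\<theta> x T. U \<theta>) = (\<lambda>\<theta> x T. V1 \<theta>)" by (rule pt_eqI) (rule dU)
  have TU: "pT (\<lambda>\<theta> x T. U \<theta>) = (\<lambda>\<theta> x T. 0)" by (rule pT_eqI) simp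
  show "- k * c * pt A \<theta> x T + dT \<phi>1 x T * V1 \<theta> + 6 * (U \<theta> * (k * pt A \<theta> x T + a x T * V1 \<theta>) + A \<theta> x T * (k * V1 \<theta>))
      + k ^ 3 * pt (pt (pt A)) \<theta> x T + 3 * k\<^sup>2 * a x T * V3 \<theta> + \<delta> * (k\<^sup>2 * V2 \<theta> + k ^ 4 * V4 \<theta>) = 0"
    using z(2)[of \<theta> x T \<theta> x T] by (simp add: pU TU algebra_simps)
  show "- k * c * pt B \<theta> x T + dT \<phi>1 x T * pt A \<theta> x T + pT A \<theta> x T + dT \<phi>2 x T * V1 \<theta>
      + 6 * (U \<theta> * (k * pt B \<theta> x T + a x T * pt A \<theta> x T + pX A \<theta> x T + b' x T * V1 \<theta>)
         + A \<theta> x T * (k * pt A \<theta> x T + a x T * V1 \<theta>) + B \<theta> x T * (k * V1 \<theta>))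
      + k ^ 3 * pt (pt (pt B)) \<theta> x T + 3 * k\<^sup>2 * a x T * pt (pt (pt A)) \<theta> x T + 3 * k\<^sup>2 * pt (pt (pX A)) \<theta> x T
      + 3 * k\<^sup>2 * b' x T * V3 \<theta> + 3 * k * (a x T)\<^sup>2 * V3 \<theta> + 3 * k * dX a x T * V2 \<theta>
      + \<delta> * (k\<^sup>2 * pt (pt A) \<theta> x T + 2 * k * a x T * V2 \<theta> + k ^ 4 * pt (pt (pt (pt A))) \<theta> x T + 4 * k ^ 3 * a x T * V4 \<theta>) = 0"
    using z(3)[of \<theta> x T \<theta> x T] by (simp add: pU TU algebra_simps)
qed

end

section \<open>The modulation equations\<close>

lemma Ck1_from_partials:
  fixes f fx fy :: "real \<Rightarrow> real \<Rightarrow> real"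
  assumes "\<And>x y. ((\<lambda>x. f x y) has_real_derivative fx x y) (at x)" "\<And>x y. ((\<lambda>y. f x y) has_real_derivative fy x y) (at y)"
    and c: "continuous_on UNIV (\<lambda>(x, y). fx x y)" "continuous_on UNIV (\<lambda>(x, y). fy x y)"
  shows "Ck 1 (\<lambda>(x, y). f x y)"
proof -
  have "Ck (Suc 0) (\<lambda>z. (\<lambda>(x, y). f x y) z)"
  proof (rule Ck_SucI)
    show "((\<lambda>(x, y). f x y) has_derivative (\<lambda>v. fx (fst z) (snd z) * fst v + fy (fst z) (snd z) * snd v)) (at z)" for z
      using has_derivative_from_partials[where S = UNIV and f = f and x = "fst z" and y = "snd z" and fx = "fx (fst z) (snd z)" and fy = fy] assms
      by (simp add: split_beta')
    show "Ck 0 (\<lambda>x. fx (fst x) (snd x) * fst v + fy (fst x) (snd x) * snd v)" for v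
      using c by (auto simp: split_beta' intro!: continuous_intros)
  qed
  then show ?thesis by simp
qed

context gks_wave
begin

lemma dU_real:
  fixes a m e :: real
  shows "(dU0 a m e has_real_derivative dU1 a m e y) (at y)" "(dU1 a m e has_real_derivative dU2 a m e y) (at y)"
    "(dU2 a m e has_real_derivative dU3 a m e y) (at y)"
  unfolding dU0_def[abs_def] dU1_def[abs_def] dU2_def[abs_def] dU3_def of_real_eq_id id_apply
  using k_nz by (auto intro!: derivative_eq_intros dV dV1 dV2 dW dW1 dW2)

lemma real_vd: "(f has_real_derivative f') (at y) \<Longrightarrow> (f has_vector_derivative f') (at y)"
  by (simp add: has_real_derivative_iff_has_vector_derivative)

lemma dU: "(U has_real_derivative V1 y) (at y)"
  unfolding kdv_U_def using dV by (auto intro!: derivative_eq_intros)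

lemma U_at_1: "U 1 = U 0" by (simp add: U_eq at_1)

lemma k2V3_U: "k\<^sup>2 * V3 y = (c - 6 * U y) * V1 y"
  unfolding k2V3 by (simp add: U_eq c_eq algebra_simps)

lemma k2V4_U: "k\<^sup>2 * V4 y = (c - 6 * U y) * V2 y - 6 * (V1 y)\<^sup>2"
proof -
  have "k\<^sup>2 * V4 y = ct * V2 y - 6 * (V1 y)\<^sup>2 - 6 * V y * V2 y" using k_nz by (simp add: V4_def)
  then show ?thesis by (simp add: U_eq c_eq algebra_simps)
qed

text \<open>As for \<open>u1\<close> in \<open>bloch_relations\<close>; here \<open>X\<close> itself enters, not its derivative, because the forcing
comes from the dissipation acting on the wave.\<close>

lemma first_order_profile:
  fixes w w1 w2 w3 :: "real \<Rightarrow> real"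
  assumes w: "\<And>y. (w has_real_derivative w1 y) (at y)" "\<And>y. (w1 has_real_derivative w2 y) (at y)"
      "\<And>y. (w2 has_real_derivative w3 y) (at y)"
    and per: "one_periodic w"
    and eq: "\<And>y. - k * c * w1 y + \<tau> * V1 y + 6 * (U y * (k * w1 y + a * V1 y) + w y * (k * V1 y))
      + k ^ 3 * w3 y + 3 * k\<^sup>2 * a * V3 y + \<delta> * (k\<^sup>2 * V2 y + k ^ 4 * V4 y) = 0"
    and \<tau>: "\<tau> + dpar (\<lambda>k M p. k * kdv_c k M p) k M p a (avg w) e = 0"
  shows "\<exists>\<beta>. \<forall>y. w y = dU0 a (avg w) e y + \<delta> * X y + \<beta> * V1 y"
proof -
  define m where "m = avg w"
  have \<tau>: "\<tau> = - (c * a + 2 * ct * a + 6 * k * m + k * ctp * e)"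
    using \<tau> k_nz unfolding dpar_kc dpar_c m_def by (simp add: algebra_simps)
  define f f1 f2 f3 where "f y = w y - dU0 a m e y - \<delta> * X y" and "f1 y = w1 y - dU1 a m e y - \<delta> * X1 y"
    and "f2 y = w2 y - dU2 a m e y - \<delta> * X2 y" and "f3 y = w3 y - dU3 a m e y - \<delta> * X3 y" for y
  have df: "(f has_real_derivative f1 y) (at y)" "(f1 has_real_derivative f2 y) (at y)" "(f2 has_real_derivative f3 y) (at y)" for y
    unfolding f_def[abs_def] f1_def[abs_def] f2_def[abs_def] f3_def
    by (intro DERIV_diff DERIV_cmult w dU_real dX)+
  have pf: "one_periodic f"
    using per gks_X(2) periodic by (simp add: one_periodic_def f_def dU0_def)
  have kern: "k * (6 * V1 y * f y + (6 * V y - ct) * f1 y) + k ^ 3 * f3 y = 0" for y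
  proof -
    have S: "k * (6 * V1 y * dU0 a m e y + (6 * V y - ct) * dU1 a m e y) + k ^ 3 * dU3 a m e y
      = V1 y * (12 * V y * a + 6 * k * m + k * ctp * e)"
      using linearized_dU[of y a m e] by simp
    have U: "U y = M + V y" "c = 6 * M + ct" by (simp_all add: U_eq c_eq)
    have "k * (6 * V1 y * f y + (6 * V y - ct) * f1 y) + k ^ 3 * f3 y
      = (- k * c * w1 y + \<tau> * V1 y + 6 * (U y * (k * w1 y + a * V1 y) + w y * (k * V1 y))
      + k ^ 3 * w3 y + 3 * k\<^sup>2 * a * V3 y + \<delta> * (k\<^sup>2 * V2 y + k ^ 4 * V4 y))
       - (k * (6 * V1 y * dU0 a m e y + (6 * V y - ct) * dU1 a m e y) + k ^ 3 * dU3 a m e y)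
       - \<delta> * (k ^ 3 * X3 y + k * (6 * V1 y * X y + (6 * V y - ct) * X1 y) + k\<^sup>2 * V2 y + k ^ 4 * V4 y)
       - \<tau> * V1 y - 6 * U y * a * V1 y - 3 * a * (k\<^sup>2 * V3 y)"
      unfolding f_def f1_def f3_def U by algebra
    also have "\<dots> = 0"
      unfolding eq S X_eq k2V3_U unfolding \<tau> U by algebra
    finally show ?thesis .
  qed
  have cw: "continuous_on UNIV w" by (rule DERIV_continuous_on) (rule w(1))
  have "avg f = 0"
  proof -
    have "avg f = avg w - avg (dU0 a m e) - \<delta> * avg X"
      unfolding f_def[abs_def]
      by (intro avg_eqI has_integral_diff has_integral_mult_right has_integral_avg cw cont_dU contX)
    then show ?thesis using avg_odd[OF contX(1) gks_X(2,3)] by (simp add: avg_dU0 m_def)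
  qed
  then obtain \<beta> where "\<And>y. f y = \<beta> * V1 y"
    using linearized_kernel_real[OF df pf kern] by auto
  then have "\<forall>y. w y = dU0 a (avg w) e y + \<delta> * X y + \<beta> * V1 y" by (simp add: f_def m_def algebra_simps)
  then show ?thesis by blast
qed

text \<open>The averages of the second-order equation against \<open>1\<close> and \<open>U\<close>.  Everything quadratic in \<open>w\<close>, and
everything that contains \<open>\<beta>\<close> or \<open>\<delta>\<^sup>2\<close>, contributes either an exact derivative or one of the odd
terms collected in \<open>Od\<close>, except for the cross terms of \<open>dU\<close> and \<open>X\<close>.\<close>

lemma modulation_solvability:
  fixes w w1 w2 w3 w4 wx wx1 wx2 wt h h1 h2 h3 :: "real \<Rightarrow> real"
  assumes w: "\<And>y. (w has_real_derivative w1 y) (at y)" "\<And>y. (w1 has_real_derivative w2 y) (at y)"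
      "\<And>y. (w2 has_real_derivative w3 y) (at y)" "\<And>y. (w3 has_real_derivative w4 y) (at y)"
    and wx: "\<And>y. (wx has_real_derivative wx1 y) (at y)" "\<And>y. (wx1 has_real_derivative wx2 y) (at y)"
    and wt: "continuous_on UNIV wt"
    and h: "\<And>y. (h has_real_derivative h1 y) (at y)" "\<And>y. (h1 has_real_derivative h2 y) (at y)"
      "\<And>y. (h2 has_real_derivative h3 y) (at y)"
    and per: "w 1 = w 0" "w1 1 = w1 0" "w2 1 = w2 0" "w3 1 = w3 0" "wx 1 = wx 0" "wx1 1 = wx1 0" "h 1 = h 0" "h1 1 = h1 0" "h2 1 = h2 0"
    and eq: "\<And>y. - k * c * h1 y + \<tau> * w1 y + wt y + \<tau>2 * V1 y
      + 6 * (U y * (k * h1 y + a * w1 y + wx y + b' * V1 y) + w y * (k * w1 y + a * V1 y) + h y * (k * V1 y))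
      + k ^ 3 * h3 y + 3 * k\<^sup>2 * a * w3 y + 3 * k\<^sup>2 * wx2 y
      + 3 * k\<^sup>2 * b' * V3 y + 3 * k * a\<^sup>2 * V3 y + 3 * k * aX * V2 y
      + \<delta> * (k\<^sup>2 * w2 y + 2 * k * a * V2 y + k ^ 4 * w4 y + 4 * k ^ 3 * a * V4 y) = 0"
    and w_eq: "\<And>y. w y = dU0 a m e y + \<delta> * X y + \<beta> * V1 y"
    and \<tau>: "\<tau> + dpar (\<lambda>k M p. k * kdv_c k M p) k M p a m e = 0"
  shows "avg wt + avg (\<lambda>y. 6 * U y * wx y) = 0"
    "avg (\<lambda>y. U y * wt y) + avg (\<lambda>y. (6 * (U y)\<^sup>2 + 3 * k\<^sup>2 * V2 y) * wx y) - 3 * k * aX * avg (\<lambda>y. (V1 y)\<^sup>2)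
      - \<delta> * dpar (av_dissip U) k M p a m e - 6 * k * \<delta> * avg (\<lambda>y. X y * V1 y * dU0 a m e y)
      - \<delta> * avg (\<lambda>y. (3 * k\<^sup>2 * X2 y + 6 * X y * U y) * V1 y) * a
      - \<delta> * avg (\<lambda>y. X1 y * U y) * dpar (\<lambda>k M p. k * kdv_c k M p) k M p a m e = 0"
proof -
  note vd = real_vd[OF w(1)] real_vd[OF w(2)] real_vd[OF w(3)] real_vd[OF w(4)] real_vd[OF wx(1)] real_vd[OF wx(2)]
    real_vd[OF h(1)] real_vd[OF h(2)] real_vd[OF h(3)] real_vd[OF dU] real_vd[OF dV1] real_vd[OF dV2] real_vd[OF dV3]
    real_vd[OF dX(1)] real_vd[OF dX(2)]
  note hvd' = has_vector_derivative_add has_vector_derivative_diff has_vector_derivative_mult_right has_vector_derivative_mult vd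
  have cwx: "continuous_on UNIV wx" by (rule DERIV_continuous_on) (rule wx(1))
  let ?R = "\<lambda>y. - k * c * h1 y + \<tau> * w1 y + wt y + \<tau>2 * V1 y
      + 6 * (U y * (k * h1 y + a * w1 y + wx y + b' * V1 y) + w y * (k * w1 y + a * V1 y) + h y * (k * V1 y))
      + k ^ 3 * h3 y + 3 * k\<^sup>2 * a * w3 y + 3 * k\<^sup>2 * wx2 y
      + 3 * k\<^sup>2 * b' * V3 y + 3 * k * a\<^sup>2 * V3 y + 3 * k * aX * V2 y
      + \<delta> * (k\<^sup>2 * w2 y + 2 * k * a * V2 y + k ^ 4 * w4 y + 4 * k ^ 3 * a * V4 y)"
  have "avg ?R = avg (\<lambda>y. wt y + 6 * U y * wx y)"
  proof (rule avg_mod_exact)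
    let ?Z = "\<lambda>y. - k * c * h y + \<tau> * w y + \<tau>2 * U y + 6 * k * (U y * h y) + 6 * a * (U y * w y) + 3 * b' * (U y * U y) + 3 * k * (w y * w y)
       + k ^ 3 * h2 y + 3 * k\<^sup>2 * a * w2 y + 3 * k\<^sup>2 * wx1 y + (3 * k\<^sup>2 * b' + 3 * k * a\<^sup>2) * V2 y + 3 * k * aX * V1 y
       + \<delta> * (k\<^sup>2 * w1 y + 2 * k * a * V1 y + k ^ 4 * w3 y + 4 * k ^ 3 * a * V3 y)"
    let ?Z' = "\<lambda>y. - k * c * h1 y + \<tau> * w1 y + \<tau>2 * V1 y + 6 * k * (U y * h1 y + V1 y * h y) + 6 * a * (U y * w1 y + V1 y * w y)
       + 3 * b' * (U y * V1 y + V1 y * U y) + 3 * k * (w y * w1 y + w1 y * w y)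
       + k ^ 3 * h3 y + 3 * k\<^sup>2 * a * w3 y + 3 * k\<^sup>2 * wx2 y + (3 * k\<^sup>2 * b' + 3 * k * a\<^sup>2) * V3 y + 3 * k * aX * V2 y
       + \<delta> * (k\<^sup>2 * w2 y + 2 * k * a * V2 y + k ^ 4 * w4 y + 4 * k ^ 3 * a * V4 y)"
    show "(?Z has_vector_derivative ?Z' y) (at y)" for y by (rule hvd')+
    show "?Z 1 = ?Z 0" by (simp only: per at_1 U_at_1)
    show "?R y = wt y + 6 * U y * wx y + ?Z' y" for y by algebra
    show "continuous_on UNIV (\<lambda>y. wt y + 6 * U y * wx y)" by (intro continuous_intros wt cwx cont_U)
  qed
  then have "avg (\<lambda>y. wt y + 6 * U y * wx y) = 0" unfolding eq by (simp add: avg_const)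
  then show "avg wt + avg (\<lambda>y. 6 * U y * wx y) = 0"
    by (subst avg_add[symmetric]) (auto intro!: continuous_intros wt cwx cont_U)
  define s s1 s2 s3 where "s = dU0 a m e" and "s1 = dU1 a m e" and "s2 = dU2 a m e" and "s3 = dU3 a m e"
  have ds: "(s has_vector_derivative s1 y) (at y)" "(s1 has_vector_derivative s2 y) (at y)" "(s2 has_vector_derivative s3 y) (at y)" for y
    unfolding s_def s1_def s2_def s3_def by (rule real_vd[OF dU_real(1)] real_vd[OF dU_real(2)] real_vd[OF dU_real(3)])+
  note cs = cont_dU(1)[of _ a m e, folded s_def] cont_dU(2)[of _ a m e, folded s1_def] cont_dU(3)[of _ a m e, folded s2_def]
  have per_s: "s 1 = s 0" "s1 1 = s1 0" "s2 1 = s2 0"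
    unfolding s_def s1_def s2_def by (rule dU_at_1)+
  have \<tau>': "\<tau> = - (c * a + 2 * ct * a + 6 * k * m + k * ctp * e)"
    using \<tau> k_nz unfolding dpar_kc dpar_c by (simp add: algebra_simps)
  define Od where "Od y = (- \<tau> + 12 * a * U y - 3 * a * c) * (V1 y * s y) - 3 * k * (V1 y * (s y)\<^sup>2) - 6 * k * \<delta> * \<beta> * ((V1 y)\<^sup>2 * X y)
     - 3 * k * \<delta>\<^sup>2 * (V1 y * (X y)\<^sup>2) - 3 * k * \<beta>\<^sup>2 * V1 y ^ 3 + \<delta>\<^sup>2 * ((k\<^sup>2 * V2 y + k ^ 4 * V4 y) * X y)" for y
  let ?T = "\<lambda>y. U y * wt y + (6 * (U y)\<^sup>2 + 3 * k\<^sup>2 * V2 y) * wx y - 3 * k * aX * (V1 y)\<^sup>2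
      - \<delta> * ((2 * k * (V1 y)\<^sup>2 - 4 * k ^ 3 * (V2 y)\<^sup>2) * a + k\<^sup>2 * V1 y * s1 y - k ^ 4 * V2 y * s2 y)
      - 6 * k * \<delta> * (X y * V1 y * s y)
      - \<delta> * ((3 * k\<^sup>2 * X2 y + 6 * X y * U y) * V1 y) * a + \<delta> * (X1 y * U y) * \<tau> + Od y"
  have "avg (\<lambda>y. U y * ?R y) = avg ?T"
  proof (rule avg_mod_exact)
    let ?Z = "\<lambda>y. k * (U y * ((6 * U y - c) * h y)) + k ^ 3 * (U y * h2 y - V1 y * h1 y + V2 y * h y) + \<tau> * (U y * w y)
      + \<tau>2 / 2 * (U y * U y) + 2 * b' * (U y * (U y * U y)) + (3 * k\<^sup>2 * b' + 3 * k * a\<^sup>2) * (U y * V2 y - 1 / 2 * (V1 y * V1 y))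
      + 6 * a * (U y * (U y * w y)) + 3 * k * (U y * (w y * w y)) + 3 * k\<^sup>2 * a * (U y * w2 y - V1 y * w1 y + V2 y * w y)
      + 3 * k\<^sup>2 * (U y * wx1 y - V1 y * wx y) + 3 * k * aX * (U y * V1 y)
      + \<delta> * (k\<^sup>2 * (U y * w1 y - V1 y * w y) + k ^ 4 * (U y * w3 y - V1 y * w2 y + V2 y * w1 y - V3 y * w y)
         + 2 * k * a * (U y * V1 y) + 4 * k ^ 3 * a * (U y * V3 y - V1 y * V2 y))
      + \<delta> * (k\<^sup>2 * (V1 y * s y) + k ^ 4 * (V3 y * s y - V2 y * s1 y)) - \<delta> * \<tau> * (U y * X y)
      + 3 * \<delta> * a * k\<^sup>2 * (X1 y * V1 y - X y * V2 y)
      + \<delta> * \<beta> * (k\<^sup>2 / 2 * (V1 y * V1 y) + k ^ 4 * (V3 y * V1 y - 1 / 2 * (V2 y * V2 y)))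
      + \<beta> * (k * (V1 y * ((6 * U y - c) * s y)) + k ^ 3 * (V1 y * s2 y - V2 y * s1 y + V3 y * s y))"
    let ?Z' = "\<lambda>y. k * (U y * ((6 * U y - c) * h1 y + 6 * V1 y * h y) + V1 y * ((6 * U y - c) * h y))
      + k ^ 3 * (U y * h3 y + V1 y * h2 y - (V1 y * h2 y + V2 y * h1 y) + (V2 y * h1 y + V3 y * h y)) + \<tau> * (U y * w1 y + V1 y * w y)
      + \<tau>2 / 2 * (U y * V1 y + V1 y * U y) + 2 * b' * (U y * (U y * V1 y + V1 y * U y) + V1 y * (U y * U y))
      + (3 * k\<^sup>2 * b' + 3 * k * a\<^sup>2) * (U y * V3 y + V1 y * V2 y - 1 / 2 * (V1 y * V2 y + V2 y * V1 y))
      + 6 * a * (U y * (U y * w1 y + V1 y * w y) + V1 y * (U y * w y)) + 3 * k * (U y * (w y * w1 y + w1 y * w y) + V1 y * (w y * w y))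
      + 3 * k\<^sup>2 * a * (U y * w3 y + V1 y * w2 y - (V1 y * w2 y + V2 y * w1 y) + (V2 y * w1 y + V3 y * w y))
      + 3 * k\<^sup>2 * (U y * wx2 y + V1 y * wx1 y - (V1 y * wx1 y + V2 y * wx y)) + 3 * k * aX * (U y * V2 y + V1 y * V1 y)
      + \<delta> * (k\<^sup>2 * (U y * w2 y + V1 y * w1 y - (V1 y * w1 y + V2 y * w y))
         + k ^ 4 * (U y * w4 y + V1 y * w3 y - (V1 y * w3 y + V2 y * w2 y) + (V2 y * w2 y + V3 y * w1 y) - (V3 y * w1 y + V4 y * w y))
         + 2 * k * a * (U y * V2 y + V1 y * V1 y) + 4 * k ^ 3 * a * (U y * V4 y + V1 y * V3 y - (V1 y * V3 y + V2 y * V2 y)))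
      + \<delta> * (k\<^sup>2 * (V1 y * s1 y + V2 y * s y) + k ^ 4 * (V3 y * s1 y + V4 y * s y - (V2 y * s2 y + V3 y * s1 y))) - \<delta> * \<tau> * (U y * X1 y + V1 y * X y)
      + 3 * \<delta> * a * k\<^sup>2 * (X1 y * V2 y + X2 y * V1 y - (X y * V3 y + X1 y * V2 y))
      + \<delta> * \<beta> * (k\<^sup>2 / 2 * (V1 y * V2 y + V2 y * V1 y) + k ^ 4 * (V3 y * V2 y + V4 y * V1 y - 1 / 2 * (V2 y * V3 y + V3 y * V2 y)))
      + \<beta> * (k * (V1 y * ((6 * U y - c) * s1 y + 6 * V1 y * s y) + V2 y * ((6 * U y - c) * s y))
         + k ^ 3 * (V1 y * s3 y + V2 y * s2 y - (V2 y * s2 y + V3 y * s1 y) + (V3 y * s1 y + V4 y * s y)))"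
    have q: "((\<lambda>y. 6 * U y - c) has_vector_derivative 6 * V1 y) (at y)" for y
      using real_vd[OF DERIV_diff[OF DERIV_cmult[OF dU[of y], of 6] DERIV_const[of c]]] by simp
    show "(?Z has_vector_derivative ?Z' y) (at y)" for y
      by (rule q ds hvd')+
    show "?Z 1 = ?Z 0" by (simp only: per at_1 U_at_1 X_at_1 per_s)
    show "continuous_on UNIV ?T" unfolding Od_def by (intro continuous_intros wt cwx cont_U cont cont_V4 contX cs)
    show "U y * ?R y = ?T y + ?Z' y" for y
    proof -
      have S: "k * (6 * V1 y * s y + (6 * V y - ct) * s1 y) + k ^ 3 * s3 y = V1 y * (12 * V y * a + 6 * k * m + k * ctp * e)"
        using linearized_dU[of y a m e] by (simp add: s_def s1_def s3_def)
      have we: "w y = s y + \<delta> * X y + \<beta> * V1 y" using w_eq by (simp add: s_def)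
      have U: "V y = U y - M" "ct = c - 6 * M" by (simp_all add: U_eq c_eq)
      have "U y * ?R y - (?T y + ?Z' y)
        = - (k * h y + 3 * a * w y - 3 * \<delta> * a * X y) * (k\<^sup>2 * V3 y - (c - 6 * U y) * V1 y)
          - \<beta> * k * s y * (k\<^sup>2 * V4 y - ((c - 6 * U y) * V2 y - 6 * (V1 y)\<^sup>2))
          - \<beta> * V1 y * (k * (6 * V1 y * s y + (6 * V y - ct) * s1 y) + k ^ 3 * s3 y - V1 y * (12 * V y * a + 6 * k * m + k * ctp * e))
          - \<beta> * (V1 y)\<^sup>2 * (\<tau> + (c * a + 2 * ct * a + 6 * k * m + k * ctp * e))"
        unfolding we Od_def U by (simp add: field_simps eval_nat_numeral)
      also have "\<dots> = 0" unfolding k2V3_U k2V4_U S \<tau>' by simp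
      finally show ?thesis by simp
    qed
  qed
  then have T0: "avg ?T = 0" unfolding eq by (simp add: avg_const)
  have "avg Od = 0"
  proof (rule avg_odd)
    show "continuous_on UNIV Od" unfolding Od_def[abs_def] by (intro continuous_intros cont_U cont cont_V4 contX cs)
    show "one_periodic Od"
      using periodic periodic_V4 gks_X(2) by (simp add: one_periodic_def Od_def U_eq s_def dU0_def)
    show "Od (- y) = - Od y" for y
      by (simp add: Od_def U_eq s_def dU0_def even_V even_W odd_V1 even_V2 even_V4 gks_X(3))
  qed
  moreover have "avg ?T = avg (\<lambda>y. U y * wt y) + avg (\<lambda>y. (6 * (U y)\<^sup>2 + 3 * k\<^sup>2 * V2 y) * wx y) - 3 * k * aX * avg (\<lambda>y. (V1 y)\<^sup>2)
      - \<delta> * avg (\<lambda>y. (2 * k * (V1 y)\<^sup>2 - 4 * k ^ 3 * (V2 y)\<^sup>2) * a + k\<^sup>2 * V1 y * s1 y - k ^ 4 * V2 y * s2 y)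
      - 6 * k * \<delta> * avg (\<lambda>y. X y * V1 y * s y)
      - \<delta> * avg (\<lambda>y. (3 * k\<^sup>2 * X2 y + 6 * X y * U y) * V1 y) * a + \<delta> * avg (\<lambda>y. X1 y * U y) * \<tau> + avg Od"
    by (intro avg_eqI has_integral_add has_integral_diff has_integral_mult_right has_integral_mult_left has_integral_avg)
      (unfold Od_def[abs_def], (intro continuous_intros wt cwx cont_U cont cont_V4 contX cs)+)
  moreover have "dpar (av_dissip U) k M p a m e = avg (\<lambda>y. (2 * k * (V1 y)\<^sup>2 - 4 * k ^ 3 * (V2 y)\<^sup>2) * a + k\<^sup>2 * V1 y * s1 y - k ^ 4 * V2 y * s2 y)"
    unfolding dpar_dissip s1_def s2_def by simp
  moreover have "dpar (\<lambda>k M p. k * kdv_c k M p) k M p a m e = - \<tau>" using \<tau> by simp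
  ultimately show "avg (\<lambda>y. U y * wt y) + avg (\<lambda>y. (6 * (U y)\<^sup>2 + 3 * k\<^sup>2 * V2 y) * wx y) - 3 * k * aX * avg (\<lambda>y. (V1 y)\<^sup>2)
      - \<delta> * dpar (av_dissip U) k M p a m e - 6 * k * \<delta> * avg (\<lambda>y. X y * V1 y * dU0 a m e y)
      - \<delta> * avg (\<lambda>y. (3 * k\<^sup>2 * X2 y + 6 * X y * U y) * V1 y) * a
      - \<delta> * avg (\<lambda>y. X1 y * U y) * dpar (\<lambda>k M p. k * kdv_c k M p) k M p a m e = 0"
    using T0 unfolding s_def by (simp add: algebra_simps)
qed

end

context gks_wave
begin

text \<open>The parameter \<open>e\<close> is defined by the first equation before differentiation, \<open>\<partial>\<^sub>T\<phi>1 + d[kc](a, m, e) = 0\<close>; its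
\<open>X\<close>-derivative is the first equation of the system.  The function \<open>\<beta>\<close> comes without any
regularity, so \<open>A\<close> may not be differentiated termwise: its averages against even weights are
differentiated instead, and \<open>\<beta>\<close> does not occur in them.\<close>

lemma modulation_equations:
  assumes me: "modulation_expansion k M p \<delta> \<phi>1 \<phi>2 A B"
  defines "a \<equiv> dX \<phi>1" and "m \<equiv> \<lambda>x T. avg (\<lambda>\<theta>. A \<theta> x T)"
  shows "\<exists>e \<beta>. Ck 1 (\<lambda>(x, T). e x T) \<and>
     (\<forall>\<theta> x T. A \<theta> x T = dU0 (a x T) (m x T) (e x T) \<theta> + \<delta> * X \<theta> + \<beta> x T * V1 \<theta>) \<and>
     modulation_system k M p \<delta> X a m e"
proof -
  note o = modulation_orders[OF me, folded a_def]
  have perA: "one_periodic (\<lambda>\<theta>. A \<theta> x T)" and perB: "one_periodic (\<lambda>\<theta>. B \<theta> x T)" for x T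
    using me by (auto simp: modulation_expansion_def)
  note sA = o(1) smooth_twoscale_pt[OF o(1)] smooth_twoscale_pt[OF smooth_twoscale_pt[OF o(1)]] smooth_twoscale_pt[OF smooth_twoscale_pt[OF smooth_twoscale_pt[OF o(1)]]]
  note sB = o(2) smooth_twoscale_pt[OF o(2)] smooth_twoscale_pt[OF smooth_twoscale_pt[OF o(2)]]
  note sX = smooth_twoscale_pX[OF o(1)] smooth_twoscale_pt[OF smooth_twoscale_pX[OF o(1)]]
  have contF: "continuous_on S (\<lambda>\<theta>. F \<theta> x T)" if "smooth_twoscale F" for F x T and S :: "real set"
    by (rule smooth_twoscale_continuous[OF that]) (intro continuous_intros)+
  have cont_avg: "continuous_on UNIV (\<lambda>(x, T). avg (\<lambda>\<theta>. F \<theta> x T))" if F: "smooth_twoscale F" for F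
  proof -
    have "continuous_on (UNIV \<times> cbox 0 1) (\<lambda>(z::real \<times> real, \<theta>::real). F \<theta> (fst z) (snd z))"
      unfolding split_beta' by (rule smooth_twoscale_continuous[OF F]) (intro continuous_intros)+
    from integral_continuous_on_param[OF this]
    show ?thesis by (simp add: avg_def split_beta')
  qed
  have avg_dX: "((\<lambda>x. avg (\<lambda>\<theta>. g \<theta> * A \<theta> x T)) has_real_derivative avg (\<lambda>\<theta>. g \<theta> * pX A \<theta> x T)) (at x)"
    if g: "continuous_on UNIV g" for g x T
  proof -
    have gs: "continuous_on (UNIV \<times> UNIV) (\<lambda>z::real \<times> real. g (snd z))"
      by (rule continuous_on_compose2[OF g]) (auto intro!: continuous_intros)
    show ?thesis
      by (rule avg_deriv_param[where S = UNIV])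
        (auto simp: split_beta' intro!: DERIV_cmult pX_deriv sA(1) continuous_on_mult gs[simplified]
          smooth_twoscale_continuous[OF sA(1)] smooth_twoscale_continuous[OF sX(1)] continuous_intros)
  qed
  have avg_dT: "((\<lambda>T. avg (\<lambda>\<theta>. g \<theta> * A \<theta> x T)) has_real_derivative avg (\<lambda>\<theta>. g \<theta> * pT A \<theta> x T)) (at T)"
    if g: "continuous_on UNIV g" for g x T
  proof -
    have gs: "continuous_on (UNIV \<times> UNIV) (\<lambda>z::real \<times> real. g (snd z))"
      by (rule continuous_on_compose2[OF g]) (auto intro!: continuous_intros)
    show ?thesis
      by (rule avg_deriv_param[where S = UNIV])
        (auto simp: split_beta' intro!: DERIV_cmult pT_deriv sA(1) continuous_on_mult gs[simplified]
          smooth_twoscale_continuous[OF sA(1)] smooth_twoscale_continuous[OF smooth_twoscale_pT[OF sA(1)]] continuous_intros)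
  qed
  have mX: "((\<lambda>x. m x T) has_real_derivative avg (\<lambda>\<theta>. pX A \<theta> x T)) (at x)"
    and mT: "((\<lambda>T. m x T) has_real_derivative avg (\<lambda>\<theta>. pT A \<theta> x T)) (at T)" for x T
    using avg_dX[of "\<lambda>_. 1"] avg_dT[of "\<lambda>_. 1"] by (simp_all add: m_def)
  have pa: "pX (\<lambda>\<theta> x T. \<phi>1 x T) = (\<lambda>\<theta> x T. a x T)" by (simp add: pX_def a_def fun_eq_iff)
  have pt1: "pT (\<lambda>\<theta> x T. \<phi>1 x T) = (\<lambda>\<theta> x T. dT \<phi>1 x T)" by (simp add: pT_def fun_eq_iff)
  note sa = smooth_twoscale_pX[OF o(3), unfolded pa] and st = smooth_twoscale_pT[OF o(3), unfolded pt1]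
  have paX: "pX (\<lambda>\<theta> x T. a x T) = (\<lambda>\<theta> x T. dX a x T)" "pT (\<lambda>\<theta> x T. a x T) = (\<lambda>\<theta> x T. dT a x T)"
    "pX (\<lambda>\<theta> x T. dT \<phi>1 x T) = (\<lambda>\<theta> x T. dX (dT \<phi>1) x T)" "pT (\<lambda>\<theta> x T. dT \<phi>1 x T) = (\<lambda>\<theta> x T. dT (dT \<phi>1) x T)"
    by (simp_all add: pX_def pT_def fun_eq_iff)
  have sym: "dX (dT \<phi>1) x T = dT a x T" for x T
    using fun_cong[OF fun_cong[OF fun_cong[OF pX_pT_commute[OF o(3)]]], of undefined x T]
    unfolding pa pt1 paX .
  have da: "((\<lambda>x. a x T) has_real_derivative dX a x T) (at x)" "((\<lambda>T. a x T) has_real_derivative dT a x T) (at T)"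
    "((\<lambda>x. dT \<phi>1 x T) has_real_derivative dT a x T) (at x)" "((\<lambda>T. dT \<phi>1 x T) has_real_derivative dT (dT \<phi>1) x T) (at T)" for x T
    using pX_deriv[OF sa] pT_deriv[OF sa] pX_deriv[OF st] pT_deriv[OF st] unfolding paX sym by blast+
  define e where "e x T = - (dT \<phi>1 x T + (c + 2 * ct) * a x T + 6 * k * m x T) / (k * ctp)" for x T
  define eX where "eX x T = - (dT a x T + (c + 2 * ct) * dX a x T + 6 * k * avg (\<lambda>\<theta>. pX A \<theta> x T)) / (k * ctp)" for x T
  define eT where "eT x T = - (dT (dT \<phi>1) x T + (c + 2 * ct) * dT a x T + 6 * k * avg (\<lambda>\<theta>. pT A \<theta> x T)) / (k * ctp)" for x T
  have de: "((\<lambda>x. e x T) has_real_derivative eX x T) (at x)" "((\<lambda>T. e x T) has_real_derivative eT x T) (at T)" for x T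
    unfolding e_def eX_def eT_def
    by (intro DERIV_cdivide DERIV_minus DERIV_add DERIV_cmult da mX mT)+
  have slow: "continuous_on UNIV (\<lambda>z. f (fst z) (snd z))" if "smooth_twoscale (\<lambda>\<theta> x T. f x T)" for f :: "real \<Rightarrow> real \<Rightarrow> real"
    by (rule smooth_twoscale_continuous[OF that, of UNIV "\<lambda>_. 0"]) (intro continuous_intros)+
  note cslow = slow[OF sa] slow[OF smooth_twoscale_pX[OF sa, unfolded paX]] slow[OF smooth_twoscale_pT[OF sa, unfolded paX]] slow[OF smooth_twoscale_pT[OF st, unfolded paX]]
    cont_avg[OF sX(1), unfolded split_beta'] cont_avg[OF smooth_twoscale_pT[OF sA(1)], unfolded split_beta']
  have Cke: "Ck 1 (\<lambda>(x, T). e x T)"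
    by (rule Ck1_from_partials[OF de]) (unfold eX_def eT_def split_beta', use k_nz ctp_nz in \<open>auto intro!: continuous_intros cslow\<close>)
  have tau: "dT \<phi>1 x T + dpar (\<lambda>k M p. k * kdv_c k M p) k M p (a x T) (m x T) (e x T) = 0" for x T
    unfolding dpar_kc dpar_c e_def using k_nz ctp_nz by (simp add: field_simps)
  have "\<exists>\<beta>. \<forall>\<theta>. A \<theta> x T = dU0 (a x T) (m x T) (e x T) \<theta> + \<delta> * X \<theta> + \<beta> * V1 \<theta>" for x T
    unfolding m_def
    by (rule first_order_profile[OF pt_deriv[OF sA(1)] pt_deriv[OF sA(2)] pt_deriv[OF sA(3)] perA o(4) tau[unfolded m_def]])
  then obtain \<beta> where A: "\<And>\<theta> x T. A \<theta> x T = dU0 (a x T) (m x T) (e x T) \<theta> + \<delta> * X \<theta> + \<beta> x T * V1 \<theta>"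
    by metis
  \<comment> \<open>only the even part of the corrector contributes to averages against even weights\<close>
  have weight: "avg (\<lambda>\<theta>. g \<theta> * pX A \<theta> x T) = avg (\<lambda>\<theta>. g \<theta> * dU0 (dX a x T) (avg (\<lambda>\<theta>. pX A \<theta> x T)) (eX x T) \<theta>)"
    "avg (\<lambda>\<theta>. g \<theta> * pT A \<theta> x T) = avg (\<lambda>\<theta>. g \<theta> * dU0 (dT a x T) (avg (\<lambda>\<theta>. pT A \<theta> x T)) (eT x T) \<theta>)"
    if g: "continuous_on UNIV g" "one_periodic g" "\<And>\<theta>. g (- \<theta>) = g \<theta>" for g x T
  proof -
    define g1 g2 g3 where "g1 = avg (\<lambda>\<theta>. g \<theta> * (2 * V \<theta> / k))" and "g2 = avg g" and "g3 = avg (\<lambda>\<theta>. g \<theta> * W \<theta>)"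
    have lin: "avg (\<lambda>\<theta>. g \<theta> * dU0 r s t \<theta>) = g1 * r + g2 * s + g3 * t" for r s t
      unfolding g1_def g2_def g3_def
      using avg_lin3[of "\<lambda>\<theta>. g \<theta> * (2 * V \<theta> / k)" g "\<lambda>\<theta>. g \<theta> * W \<theta>" "\<lambda>\<theta>. g \<theta> * dU0 r s t \<theta>" r s t] k_nz g(1)
      by (force intro!: continuous_intros cont simp: dU0_def algebra_simps)
    have oX: "avg (\<lambda>\<theta>. g \<theta> * X \<theta>) = 0"
      by (rule avg_odd) (use g gks_X(2) in \<open>auto simp: one_periodic_def gks_X(3) intro!: continuous_intros contX\<close>)
    have oV: "avg (\<lambda>\<theta>. g \<theta> * V1 \<theta>) = 0"
      by (rule avg_odd) (use g periodic in \<open>auto simp: one_periodic_def odd_V1 intro!: continuous_intros cont\<close>)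
    have "avg (\<lambda>\<theta>. g \<theta> * A \<theta> x T) = avg (\<lambda>\<theta>. g \<theta> * dU0 (a x T) (m x T) (e x T) \<theta>) + \<delta> * avg (\<lambda>\<theta>. g \<theta> * X \<theta>)
        + \<beta> x T * avg (\<lambda>\<theta>. g \<theta> * V1 \<theta>)" for x T
    proof -
      have "((\<lambda>\<theta>. g \<theta> * dU0 (a x T) (m x T) (e x T) \<theta> + \<delta> * (g \<theta> * X \<theta>) + \<beta> x T * (g \<theta> * V1 \<theta>)) has_integral
        avg (\<lambda>\<theta>. g \<theta> * dU0 (a x T) (m x T) (e x T) \<theta>) + \<delta> * avg (\<lambda>\<theta>. g \<theta> * X \<theta>) + \<beta> x T * avg (\<lambda>\<theta>. g \<theta> * V1 \<theta>)) {0..1}"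
        by (intro has_integral_add has_integral_mult_right has_integral_avg continuous_intros g(1) cont_dU contX cont)
      then show ?thesis by (intro avg_eqI) (simp add: A algebra_simps)
    qed
    then have avgA: "avg (\<lambda>\<theta>. g \<theta> * A \<theta> x T) = g1 * a x T + g2 * m x T + g3 * e x T" for x T
      by (simp add: lin oX oV)
    have "((\<lambda>x. g1 * a x T + g2 * m x T + g3 * e x T) has_real_derivative
       g1 * dX a x T + g2 * avg (\<lambda>\<theta>. pX A \<theta> x T) + g3 * eX x T) (at x)"
      by (intro DERIV_add DERIV_cmult da mX de)
    from DERIV_unique[OF avg_dX[OF g(1), of T x, unfolded avgA] this]
    show "avg (\<lambda>\<theta>. g \<theta> * pX A \<theta> x T) = avg (\<lambda>\<theta>. g \<theta> * dU0 (dX a x T) (avg (\<lambda>\<theta>. pX A \<theta> x T)) (eX x T) \<theta>)"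
      unfolding lin .
    have "((\<lambda>T. g1 * a x T + g2 * m x T + g3 * e x T) has_real_derivative
       g1 * dT a x T + g2 * avg (\<lambda>\<theta>. pT A \<theta> x T) + g3 * eT x T) (at T)"
      by (intro DERIV_add DERIV_cmult da mT de)
    from DERIV_unique[OF avg_dT[OF g(1), of x T, unfolded avgA] this]
    show "avg (\<lambda>\<theta>. g \<theta> * pT A \<theta> x T) = avg (\<lambda>\<theta>. g \<theta> * dU0 (dT a x T) (avg (\<lambda>\<theta>. pT A \<theta> x T)) (eT x T) \<theta>)"
      unfolding lin .
  qed
  have perU: "one_periodic U" "one_periodic (\<lambda>y. 6 * U y)" "one_periodic (\<lambda>y. 6 * (U y)\<^sup>2 + 3 * k\<^sup>2 * V2 y)"
    using periodic by (simp_all add: one_periodic_def U_eq)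
  have evU: "U (- y) = U y" for y by (simp add: U_eq even_V)
  have at1: "A 1 x T = A 0 x T" "pt A 1 x T = pt A 0 x T" "pt (pt A) 1 x T = pt (pt A) 0 x T" "pt (pt (pt A)) 1 x T = pt (pt (pt A)) 0 x T"
    "B 1 x T = B 0 x T" "pt B 1 x T = pt B 0 x T" "pt (pt B) 1 x T = pt (pt B) 0 x T"
    "pX A 1 x T = pX A 0 x T" "pt (pX A) 1 x T = pt (pX A) 0 x T" for x T
  proof -
    have pp: "pt F (\<theta> + 1) x T = pt F \<theta> x T" if "smooth_twoscale F" "\<And>\<theta> x T. F (\<theta> + 1) x T = F \<theta> x T" for F \<theta> x T
      by (rule periodic_deriv[of "\<lambda>\<theta>. F \<theta> x T" "\<lambda>\<theta>. pt F \<theta> x T"])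
        (use that pt_deriv[OF that(1)] in \<open>auto simp: has_real_derivative_iff_has_vector_derivative\<close>)
    have 0: "A (\<theta> + 1) x T = A \<theta> x T" "B (\<theta> + 1) x T = B \<theta> x T" for \<theta> x T
      using perA[of x T] perB[of x T] by (auto simp: one_periodic_def)
    have 1: "pX A (\<theta> + 1) x T = pX A \<theta> x T" for \<theta> x T
      by (simp add: pX_def dX_def 0)
    note q = 0 1 pp[OF sA(1) 0(1)] pp[OF sA(2) pp[OF sA(1) 0(1)]] pp[OF sA(3) pp[OF sA(2) pp[OF sA(1) 0(1)]]]
      pp[OF sB(1) 0(2)] pp[OF sB(2) pp[OF sB(1) 0(2)]] pp[OF sX(1) 1]
    show "A 1 x T = A 0 x T" "pt A 1 x T = pt A 0 x T" "pt (pt A) 1 x T = pt (pt A) 0 x T" "pt (pt (pt A)) 1 x T = pt (pt (pt A)) 0 x T"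
      "B 1 x T = B 0 x T" "pt B 1 x T = pt B 0 x T" "pt (pt B) 1 x T = pt (pt B) 0 x T"
      "pX A 1 x T = pX A 0 x T" "pt (pX A) 1 x T = pt (pX A) 0 x T"
      using q[of 0 x T] by simp_all
  qed
  note sol = modulation_solvability[OF pt_deriv[OF sA(1)] pt_deriv[OF sA(2)] pt_deriv[OF sA(3)] pt_deriv[OF sA(4)]
      pt_deriv[OF sX(1)] pt_deriv[OF sX(2)] contF[OF smooth_twoscale_pT[OF sA(1)]]
      pt_deriv[OF sB(1)] pt_deriv[OF sB(2)] pt_deriv[OF sB(3)] at1(1-4) at1(8,9) at1(5-7) o(5) A tau]
  have dXs: "dX a x T = dX a x T" "dX m x T = avg (\<lambda>\<theta>. pX A \<theta> x T)" "dT m x T = avg (\<lambda>\<theta>. pT A \<theta> x T)"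
     "dX e x T = eX x T" "dT e x T = eT x T" for x T
    unfolding dX_def[of m] dT_def[of m] dX_def[of e] dT_def[of e] by (rule refl D_eqI_real mX mT de)+
  have "modulation_system k M p \<delta> X a m e"
    unfolding modulation_system_def Let_def
  proof (intro allI conjI)
    fix x T
    show "dT a x T + dpar (\<lambda>k M p. k * kdv_c k M p) k M p (dX a x T) (dX m x T) (dX e x T) = 0"
      unfolding dpar_kc dpar_c dXs(2-) eX_def using k_nz ctp_nz by (simp add: field_simps)
    show "dT m x T + dpar av_3U2 k M p (dX a x T) (dX m x T) (dX e x T) = 0"
      using sol(1)[of x T] weight(1)[of "\<lambda>y. 6 * U y" x T] unfolding dpar_3U2 dXs(2-)
      by (simp add: perU evU continuous_on_mult cont_U)
    have half: "dpar av_half_U2 k M p (dT a x T) (dT m x T) (dT e x T) = avg (\<lambda>y. U y * pT A y x T)"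
      using weight(2)[of U x T] unfolding dpar_half_U2 dXs(2-) by (simp add: perU evU cont_U)
    have flux: "dpar av_flux k M p (dX a x T) (dX m x T) (dX e x T)
       = avg (\<lambda>y. (6 * (U y)\<^sup>2 + 3 * k\<^sup>2 * V2 y) * pX A y x T) - 3 * k * dX a x T * avg (\<lambda>y. (V1 y)\<^sup>2)"
    proof -
      define r s t where "r = dX a x T" and "s = avg (\<lambda>\<theta>. pX A \<theta> x T)" and "t = eX x T"
      have "dpar av_flux k M p r s t = avg (\<lambda>y. 6 * (U y)\<^sup>2 * dU0 r s t y - 3 * k * (V1 y)\<^sup>2 * r - 3 * k\<^sup>2 * V1 y * dU1 r s t y)"
        unfolding dpar_flux by simp
      also have "\<dots> = avg (\<lambda>y. (6 * (U y)\<^sup>2 + 3 * k\<^sup>2 * V2 y) * dU0 r s t y - 3 * k * r * (V1 y)\<^sup>2)"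
      proof (rule avg_mod_exact[where Z = "\<lambda>y. - 3 * k\<^sup>2 * (V1 y * dU0 r s t y)" and Z' = "\<lambda>y. - 3 * k\<^sup>2 * (V1 y * dU1 r s t y + V2 y * dU0 r s t y)"])
        show "((\<lambda>y. - 3 * k\<^sup>2 * (V1 y * dU0 r s t y)) has_vector_derivative - 3 * k\<^sup>2 * (V1 y * dU1 r s t y + V2 y * dU0 r s t y)) (at y)" for y
          by (intro has_vector_derivative_mult_right has_vector_derivative_mult real_vd dV1 dU_real)
      qed (auto simp: at_1 dU_at_1 algebra_simps intro!: continuous_intros cont_U cont cont_dU)
      also have "\<dots> = avg (\<lambda>y. (6 * (U y)\<^sup>2 + 3 * k\<^sup>2 * V2 y) * dU0 r s t y) - 3 * k * r * avg (\<lambda>y. (V1 y)\<^sup>2)"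
        by (intro avg_eqI has_integral_diff has_integral_mult_right has_integral_avg continuous_intros cont_U cont cont_dU)
      finally show ?thesis
        using weight(1)[of "\<lambda>y. 6 * (U y)\<^sup>2 + 3 * k\<^sup>2 * V2 y" x T]
        unfolding dXs(2-) r_def s_def t_def by (simp add: perU evU even_V2 cont_U cont continuous_intros)
    qed
    show "dpar av_half_U2 k M p (dT a x T) (dT m x T) (dT e x T) + dpar av_flux k M p (dX a x T) (dX m x T) (dX e x T)
        - \<delta> *\<^sub>R dpar (av_dissip U) k M p (a x T) (m x T) (e x T)
        - (6 * \<delta>) *\<^sub>R avg (\<lambda>y. (X y * D U y) *\<^sub>R dpar (\<lambda>k M p. k * kdv_U k M p y) k M p (a x T) (m x T) (e x T))
        - (3 * \<delta> * k\<^sup>2 * avg (\<lambda>y. (D ^^ 2) X y * D U y)) *\<^sub>R a x T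
        - (\<delta> * avg (\<lambda>y. D X y * U y)) *\<^sub>R dpar (\<lambda>k M p. k * kdv_c k M p) k M p (a x T) (m x T) (e x T) = 0"
      unfolding third_modulation_equation unfolding half flux using sol(2)[of x T] unfolding of_real_eq_id id_apply by linarith
  qed
  then show ?thesis using Cke A by blast
qed

end

theorem mainTheorem8:
  fixes k M p \<delta>b c2 :: real
    and \<nu>b :: complex
    and Ud :: "real \<Rightarrow> real \<Rightarrow> real"
    and cd U1 U2 :: "real \<Rightarrow> real"
  assumes "\<delta>b > 0"
    and "Re \<nu>b = 0" and "\<nu>b \<noteq> 0"
    and "k > 0" and "0 < p" and "p < 1"
    and "avg (\<lambda>y. (D (kdv_U k M p) y)\<^sup>2) = k\<^sup>2 * avg (\<lambda>y. ((D ^^ 2) (kdv_U k M p) y)\<^sup>2)"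
    and "gks_profiles k M p Ud cd U1 U2 c2"
  shows
    "(\<forall>lam0 lam1 u0 u1 u2. bloch_expansion k \<delta>b Ud cd \<nu>b lam0 lam1 u0 u1 u2 \<longrightarrow>
        (\<exists>k1. (\<forall>y. u0 y = k1 * of_real (D (kdv_U k M p) y)) \<and>
          (let l = lam0 / of_real k; M1 = avg u1 / (\<nu>b * of_real k) in
           \<exists>p1 k2.
             (\<forall>y. u1 y = \<nu>b * of_real k * dpar (\<lambda>k M p. kdv_U k M p y) k M p k1 M1 p1
                        + k1 * of_real \<delta>b * of_real (D U1 y) + k2 * of_real (D (kdv_U k M p) y)) \<and>
             spectral_k k M p l k1 M1 p1 = 0 \<and>
             spectral_M k M p l k1 M1 p1 = 0 \<and>
             spectral_p k M p \<delta>b \<nu>b U1 l k1 M1 p1 = 0)))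
     \<and>
     (\<exists>E :: complex poly. degree E = 3 \<and>
        (\<forall>l. poly E l = det (matrix (spectral_map k M p \<delta>b \<nu>b U1 l))) \<and>
        (\<forall>l. poly E l = 0 \<longleftrightarrow> (\<exists>v. v \<noteq> 0 \<and> spectral_map k M p \<delta>b \<nu>b U1 l v = 0)) \<and>
        (\<forall>lam0 lam1 u0 u1 u2. bloch_expansion k \<delta>b Ud cd \<nu>b lam0 lam1 u0 u1 u2 \<longrightarrow>
           (\<exists>x. u0 x \<noteq> 0) \<longrightarrow> poly E (lam0 / of_real k) = 0))
     \<and>
     (\<forall>l k1 M1 p1 :: complex.
        let w = (\<lambda>X T. exp (\<nu>b * of_real k * (of_real (X - kdv_c k M p * T) + l * of_real T))) in
        modulation_system k M p \<delta>b U1 (\<lambda>X T. w X T * k1) (\<lambda>X T. w X T * M1) (\<lambda>X T. w X T * p1)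
        \<longleftrightarrow> spectral_map k M p \<delta>b \<nu>b U1 l (vector [k1, M1, p1]) = 0)
     \<and>
     (\<forall>\<phi>1 \<phi>2 W1 W2. modulation_expansion k M p \<delta>b \<phi>1 \<phi>2 W1 W2 \<longrightarrow>
        (let k1 = dX \<phi>1; M1 = (\<lambda>X T. avg (\<lambda>\<theta>. W1 \<theta> X T)) in
         \<exists>p1 k2. Ck 1 (\<lambda>(X, T). p1 X T) \<and>
           (\<forall>\<theta> X T. W1 \<theta> X T = dpar (\<lambda>k M p. kdv_U k M p \<theta>) k M p (k1 X T) (M1 X T) (p1 X T)
                        + \<delta>b * U1 \<theta> + k2 X T * D (kdv_U k M p) \<theta>) \<and>
           modulation_system k M p \<delta>b U1 k1 M1 p1))"
proof -
  interpret gks_wave k p M \<delta>b c2 Ud cd U1 U2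
    by unfold_locales (use assms in auto)
  have main: "\<exists>k1. (\<forall>y. u0 y = k1 * of_real (D (kdv_U k M p) y)) \<and>
          (let l = lam0 / of_real k; M1 = avg u1 / (\<nu>b * of_real k) in
           \<exists>p1 k2.
             (\<forall>y. u1 y = \<nu>b * of_real k * dpar (\<lambda>k M p. kdv_U k M p y) k M p k1 M1 p1
                        + k1 * of_real \<delta>b * of_real (D U1 y) + k2 * of_real (D (kdv_U k M p) y)) \<and>
             spectral_k k M p l k1 M1 p1 = 0 \<and>
             spectral_M k M p l k1 M1 p1 = 0 \<and>
             spectral_p k M p \<delta>b \<nu>b U1 l k1 M1 p1 = 0)"
    if be: "bloch_expansion k \<delta>b Ud cd \<nu>b lam0 lam1 u0 u1 u2" for lam0 lam1 u0 u1 u2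
  proof -
    obtain k1 where u0: "\<And>y. u0 y = k1 * of_real (V1 y)"
      using bloch_leading[OF assms(2,3) be] by blast
    from bloch_relations[OF assms(2,3) be u0] show ?thesis
      unfolding Let_def dpar_U D_U using u0 by (intro exI[of _ k1]) simp
  qed
  obtain E :: "complex poly" where E: "degree E = 3"
      "\<And>l. poly E l = det (matrix (spectral_map k M p \<delta>b \<nu>b U1 l))"
      "\<And>l. poly E l = 0 \<longleftrightarrow> (\<exists>v. v \<noteq> 0 \<and> spectral_map k M p \<delta>b \<nu>b U1 l v = 0)"
    using dispersion_polynomial[OF assms(3)] by blast
  have root: "poly E (lam0 / of_real k) = 0"
    if be: "bloch_expansion k \<delta>b Ud cd \<nu>b lam0 lam1 u0 u1 u2" and nz: "\<exists>x. u0 x \<noteq> 0" for lam0 lam1 u0 u1 u2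
  proof -
    obtain k1 M1 p1 where k1: "\<And>y. u0 y = k1 * of_real (D (kdv_U k M p) y)"
      and s: "spectral_k k M p (lam0 / of_real k) k1 M1 p1 = 0" "spectral_M k M p (lam0 / of_real k) k1 M1 p1 = 0"
        "spectral_p k M p \<delta>b \<nu>b U1 (lam0 / of_real k) k1 M1 p1 = 0"
      using main[OF be] unfolding Let_def by blast
    have "k1 \<noteq> 0" using nz k1 by auto
    then have "vector [k1, M1, p1] \<noteq> (0 :: complex ^ 3)"
      by (auto simp: vec_eq_iff forall_3)
    moreover have "spectral_map k M p \<delta>b \<nu>b U1 (lam0 / of_real k) (vector [k1, M1, p1]) = 0"
      using s by (simp add: spectral_map_def vec_eq_iff forall_3)
    ultimately show ?thesis using E(3) by blast
  qed
  have modulation: "let k1 = dX \<phi>1; M1 = (\<lambda>X T. avg (\<lambda>\<theta>. W1 \<theta> X T)) in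
         \<exists>p1 k2. Ck 1 (\<lambda>(X, T). p1 X T) \<and>
           (\<forall>\<theta> X T. W1 \<theta> X T = dpar (\<lambda>k M p. kdv_U k M p \<theta>) k M p (k1 X T) (M1 X T) (p1 X T)
                        + \<delta>b * U1 \<theta> + k2 X T * D (kdv_U k M p) \<theta>) \<and>
           modulation_system k M p \<delta>b U1 k1 M1 p1"
    if "modulation_expansion k M p \<delta>b \<phi>1 \<phi>2 W1 W2" for \<phi>1 \<phi>2 W1 W2
    using modulation_equations[OF that] unfolding Let_def dpar_U D_U by blast
  show ?thesis
    using main E root plane_waves[OF assms(3)] modulation unfolding Let_def by blast
qed

end
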